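(* Let $m\ge 2$ and $n\ge m-1$ be integers. For each $T\in\mathbb{N}$ let $$K_T(m,n):=\max_{A_1}\min_{\bar\varepsilon_1}\cdots\max_{A_T}\min_{\bar\varepsilon_T}\|A_1\bar\varepsilon_1+\cdots+A_T\bar\varepsilon_T\|_\infty,$$ where each $A_t$ ranges over all real $m\times n$ matrices whose columns have Euclidean length at most $1$ and each $\bar\varepsilon_t$ ranges over $\{-1,1\}^n$. Then $$\lim_{T\to\infty}\frac{K_T(m,n)}{\sqrt T}=\frac{1}{\sqrt{2\tau}},$$ where $\tau$ is the extinction time of the cube $[-1,1]^m$ under mean curvature flow.
   Context: The max/min are nested: $A_t$ may depend on all earlier matrices and signs, and $\bar\varepsilon_t$ may depend on $A_1,\dots,A_t$ and the earlier signs. Extinction time under mean curvature flow. The mean curvature flow starting from a centrally symmetric convex body $E\subset\mathbb{R}^m$ is the family $(E_t)_{t\ge 0}$ with $E_0=E$ whose boundary $\partial E_t$ moves with inner normal velocity equal to the sum of the principal curvatures of $\partial E_t$. The $E_t$ are centrally symmetric convex bodies that shrink to $\{0\}$ at a finite time. The extinction time of $E$ is the supremum of the $t>0$ such that the flow from $E$ exists and is non-vanishing on $(0,t)$. For non-smooth $E$ (such as the cube) the flow is understood in the level set sense, as follows. Let $\|\cdot\|_E$ be the norm with closed unit ball $E$ (so $\|\cdot\|_E=\|\cdot\|_\infty$ for $E=[-1,1]^m$). For symmetric $M\in\mathbb{R}^{m\times m}$ and $p\in\mathbb{R}^m\setminus\{0\}$ put $F(M,p)=\mathrm{tr}(M)-|p|^{-2}(Mp,p)$,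 with upper and lower semicontinuous envelopes $F^*(M,p)=\limsup_{(M',p')\to(M,p),\,p'\neq0}F(M',p')$ and $F_*(M,p)=\liminf_{(M',p')\to(M,p),\,p'\neq 0}F(M',p')$. Let $u:\mathbb{R}^m\times(-\infty,0]\to\mathbb{R}$ be the unique viscosity solution, of at most linear growth in $x$ uniformly on each $[-S,0]$, of $\partial_tu+F(D^2u,\nabla u)=0$ in $\mathbb{R}^m\times(-\infty,0)$, $u(x,0)=\|x\|_E$. Then $E_t=\{x:u(x,-t)\le 1\}$, and the extinction time is $\sup\{t>0: E_t\text{ has nonempty interior}\}$. Viscosity solution: an upper semicontinuous $u$ is a subsolution if, whenever $\phi$ is a test function (with $\partial_t\phi,\nabla\phi,D^2\phi$ continuous) and $u-\phi$ has a local maximum at $(x_0,t_0)$, $t_0<0$, one has $\partial_t\phi+F^*(D^2\phi,\nabla\phi)\ge0$ at $(x_0,t_0)$. A lower semicontinuous $u$ is a supersolution if, whenever $u-\phi$ has a local minimum at $(x_0,t_0)$, $t_0<0$, one has $\partial_t\phi+F_*(D^2\phi,\nabla\phi)\le0$ at $(x_0,t_0)$. A solution is both. *)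

theory Defs
  imports "HOL-Analysis.Analysis"
begin

section \<open>The game\<close>

definition admissible_matrices :: "(real^'n^'m) set" where
  "admissible_matrices = {A. \<forall>j. norm (column j A) \<le> 1}"

definition sign_vectors :: "(real^'n) set" where
  "sign_vectors = {e. \<forall>j. e $ j \<in> {-1, 1}}"

text \<open>
  \<open>game_value \<A> k x\<close> is the expression
  \<open>max min \<dots> max min \<parallel>x + A\<^sub>1 e\<^sub>1 + \<dots> + A\<^sub>k e\<^sub>k\<parallel>\<close> with \<open>k\<close> remaining rounds, where \<open>x\<close>
  is the sum accumulated in the rounds already played. The argument \<open>\<A>\<close> is the set of matrices
  allowed in each round. The supremum is a maximum for
  \<open>\<A> = admissible_matrices\<close>, see \<open>game_value_Suc_attained\<close> below.
\<close>

fun game_value :: "(real^'n^'m) set \<Rightarrow> nat \<Rightarrow> real^'m \<Rightarrow> real" where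
  "game_value \<A> 0 x = infnorm x"
| "game_value \<A> (Suc k) x = (SUP A\<in>\<A>. Min ((\<lambda>e. game_value \<A> k (x + A *v e)) ` sign_vectors))"

definition K_game :: "'m::finite itself \<Rightarrow> 'n::finite itself \<Rightarrow> nat \<Rightarrow> real" where
  "K_game _ _ T = game_value (admissible_matrices :: (real^'n^'m) set) T 0"

lemma finite_sign_vectors: "finite (sign_vectors :: (real^'n) set)"
proof -
  have "(sign_vectors :: (real^'n) set) \<subseteq> vec_lambda ` (UNIV \<rightarrow>\<^sub>E {-1, 1})"
  proof
    fix e :: "real^'n"
    assume "e \<in> sign_vectors"
    then have "vec_nth e \<in> UNIV \<rightarrow>\<^sub>E {-1, 1}"
      unfolding sign_vectors_def by (simp add: PiE_UNIV_domain)
    then show "e \<in> vec_lambda ` (UNIV \<rightarrow>\<^sub>E {-1, 1})"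
      by (metis image_eqI vec_nth_inverse)
  qed
  moreover have "finite ((UNIV :: 'n set) \<rightarrow>\<^sub>E {-1, 1 :: real})"
    by (intro finite_PiE) auto
  ultimately show ?thesis
    by (meson finite_imageI finite_subset)
qed

lemma sign_vectors_nonempty: "(sign_vectors :: (real^'n) set) \<noteq> {}"
proof -
  have "(1 :: real^'n) \<in> sign_vectors"
    by (simp add: sign_vectors_def)
  then show ?thesis by blast
qed

lemma compact_admissible_matrices: "compact (admissible_matrices :: (real^'n^'m) set)"
proof -
  have "closed (admissible_matrices :: (real^'n^'m) set)"
    unfolding admissible_matrices_def column_def
    by (intro closed_Collect_all closed_Collect_le continuous_intros)
  moreover have "bounded (admissible_matrices :: (real^'n^'m) set)"
  proof (rule boundedI)
    fix A :: "real^'n^'m"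
    assume A: "A \<in> admissible_matrices"
    have entry: "\<bar>A $ i $ j\<bar> \<le> 1" for i j
      using component_le_norm_cart[of "column j A" i] A
      by (fastforce simp: admissible_matrices_def column_def intro: order_trans)
    have row: "norm (A $ i) \<le> real CARD('n)" for i
    proof -
      have "norm (A $ i) \<le> (\<Sum>j\<in>UNIV. \<bar>A $ i $ j\<bar>)"
        by (rule norm_le_l1_cart)
      also have "\<dots> \<le> (\<Sum>j\<in>(UNIV :: 'n set). 1)"
        by (intro sum_mono entry)
      finally show ?thesis by simp
    qed
    have "norm A \<le> (\<Sum>i\<in>UNIV. norm (A $ i))"
      unfolding norm_vec_def by (intro L2_set_le_sum) simp
    also have "\<dots> \<le> (\<Sum>i\<in>(UNIV :: 'm set). real CARD('n))"
      by (intro sum_mono row)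
    finally show "norm A \<le> real CARD('m) * real CARD('n)"
      by simp
  qed
  ultimately show ?thesis
    by (simp add: compact_eq_bounded_closed)
qed

lemma continuous_on_Min_finite:
  fixes f :: "'i \<Rightarrow> 'a::topological_space \<Rightarrow> real"
  assumes "finite I" "I \<noteq> {}" "\<And>i. i \<in> I \<Longrightarrow> continuous_on S (f i)"
  shows "continuous_on S (\<lambda>x. Min ((\<lambda>i. f i x) ` I))"
  using assms by (induction rule: finite_ne_induct) (auto intro!: continuous_on_min)

lemma game_value_attained_aux:
  fixes \<A> :: "(real^'n^'m) set"
  assumes "compact \<A>" "\<A> \<noteq> {}"
    and cont: "continuous_on UNIV (game_value \<A> k)"
  shows "\<exists>A\<in>\<A>. game_value \<A> (Suc k) x
             = Min ((\<lambda>e. game_value \<A> k (x + A *v e)) ` sign_vectors) \<and>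
           (\<forall>B\<in>\<A>. Min ((\<lambda>e. game_value \<A> k (x + B *v e)) ` sign_vectors)
             \<le> game_value \<A> (Suc k) x)"
proof -
  let ?g = "\<lambda>A. Min ((\<lambda>e. game_value \<A> k (x + A *v e)) ` sign_vectors)"
  have "continuous_on \<A> ?g"
  proof (rule continuous_on_Min_finite)
    fix e :: "real^'n"
    have "continuous_on \<A> (\<lambda>A. x + A *v e)"
      unfolding matrix_vector_mult_def
      by (intro continuous_intros)
    then show "continuous_on \<A> (\<lambda>A. game_value \<A> k (x + A *v e))"
      by (rule continuous_on_compose2[OF cont]) auto
  qed (auto simp: finite_sign_vectors sign_vectors_nonempty)
  then have "\<exists>A\<in>\<A>. \<forall>B\<in>\<A>. ?g B \<le> ?g A"
    by (rule continuous_attains_sup[OF assms(1,2)])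
  then obtain A where A: "A \<in> \<A>" "\<And>B. B \<in> \<A> \<Longrightarrow> ?g B \<le> ?g A"
    by blast
  have "(SUP A\<in>\<A>. ?g A) = ?g A"
  proof (rule cSup_eq_maximum)
    show "?g A \<in> ?g ` \<A>"
      using A(1) by (rule imageI)
  qed (use A(2) in blast)
  then have "game_value \<A> (Suc k) x = ?g A"
    by (simp only: game_value.simps)
  with A show ?thesis
    by (intro bexI[of _ A] conjI ballI) (simp_all only:)
qed

lemma continuous_if_le_infnorm:
  fixes f :: "real^'m \<Rightarrow> real"
  assumes "\<And>x y. f x \<le> f y + infnorm (x - y)"
  shows "continuous_on UNIV f"
proof -
  have "\<bar>f x - f y\<bar> \<le> norm (x - y)" for x y
    using assms[of x y] assms[of y x] infnorm_le_norm[of "x - y"] infnorm_sub[of x y]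
    by linarith
  then show ?thesis
    by (intro lipschitz_on_continuous_on[of 1] lipschitz_onI) (auto simp: dist_norm)
qed

lemma game_value_le:
  fixes \<A> :: "(real^'n^'m) set"
  assumes "compact \<A>" "\<A> \<noteq> {}"
  shows "game_value \<A> k x \<le> game_value \<A> k y + infnorm (x - y)"
proof (induction k arbitrary: x y)
  case 0
  show ?case
    using infnorm_triangle[of y "x - y"] by simp
next
  case (Suc k)
  note att = game_value_attained_aux[OF assms continuous_if_le_infnorm[OF Suc]]
  let ?g = "\<lambda>x A. Min ((\<lambda>e. game_value \<A> k (x + A *v e)) ` sign_vectors)"
  obtain A where A: "A \<in> \<A>" "game_value \<A> (Suc k) x = ?g x A"
    using att by blast
  have "?g y A \<in> (\<lambda>e. game_value \<A> k (y + A *v e)) ` sign_vectors"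
    by (intro Min_in) (auto simp: finite_sign_vectors sign_vectors_nonempty)
  then obtain e where e: "e \<in> sign_vectors" "?g y A = game_value \<A> k (y + A *v e)"
    by blast
  have "?g x A \<le> game_value \<A> k (x + A *v e)"
    using e(1) by (intro Min_le) (auto simp: finite_sign_vectors)
  also have "\<dots> \<le> game_value \<A> k (y + A *v e) + infnorm (x - y)"
    using Suc[of "x + A *v e" "y + A *v e"] by simp
  finally have "?g x A \<le> ?g y A + infnorm (x - y)"
    using e(2) by simp
  moreover have "?g y A \<le> game_value \<A> (Suc k) y"
    using att A(1) by blast
  ultimately show ?case
    using A(2) by linarith
qed

lemma game_value_Suc_attained:
  fixes x :: "real^'m"
  defines "\<A> \<equiv> (admissible_matrices :: (real^'n^'m) set)"
  shows "\<exists>A\<in>\<A>. game_value \<A> (Suc k) x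
             = Min ((\<lambda>e. game_value \<A> k (x + A *v e)) ` sign_vectors) \<and>
           (\<forall>B\<in>\<A>. Min ((\<lambda>e. game_value \<A> k (x + B *v e)) ` sign_vectors)
             \<le> game_value \<A> (Suc k) x)"
proof -
  have "0 \<in> \<A>"
    unfolding \<A>_def admissible_matrices_def column_def
    by (simp add: zero_vec_def[symmetric])
  then have ne: "\<A> \<noteq> {}" by blast
  have "compact \<A>"
    unfolding \<A>_def by (rule compact_admissible_matrices)
  from game_value_attained_aux[OF this ne continuous_if_le_infnorm[OF game_value_le[OF this ne]]]
  show ?thesis .
qed


section \<open>The level set operator\<close>

definition mcf_F :: "real^'m^'m \<Rightarrow> real^'m \<Rightarrow> real" where
  "mcf_F M p = trace M - ((M *v p) \<bullet> p) / (norm p)\<^sup>2"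

text \<open>\<open>(M', p') \<rightarrow> (M, p)\<close> through symmetric \<open>M'\<close> and \<open>p' \<noteq> 0\<close>, the point
  \<open>(M, p)\<close> itself not being excluded.\<close>

definition mcf_filter :: "real^'m^'m \<Rightarrow> real^'m \<Rightarrow> ((real^'m^'m) \<times> (real^'m)) filter" where
  "mcf_filter M p = inf (nhds (M, p)) (principal {(M', p'). transpose M' = M' \<and> p' \<noteq> 0})"

definition mcf_F_upper :: "real^'m^'m \<Rightarrow> real^'m \<Rightarrow> ereal" where
  "mcf_F_upper M p = Limsup (mcf_filter M p) (\<lambda>(M', p'). ereal (mcf_F M' p'))"

definition mcf_F_lower :: "real^'m^'m \<Rightarrow> real^'m \<Rightarrow> ereal" where
  "mcf_F_lower M p = Liminf (mcf_filter M p) (\<lambda>(M', p'). ereal (mcf_F M' p'))"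


section \<open>Viscosity solutions on \<open>\<real>\<^sup>m \<times> (-\<infinity>, 0]\<close>\<close>

text \<open>Functions on space-time take pairs \<open>(x, t)\<close>; only the values at \<open>t \<le> 0\<close> matter.\<close>

definition usc_on :: "'a::topological_space set \<Rightarrow> ('a \<Rightarrow> real) \<Rightarrow> bool" where
  "usc_on S u \<longleftrightarrow> (\<forall>z\<in>S. \<forall>a. u z < a \<longrightarrow> (\<forall>\<^sub>F w in at z within S. u w < a))"

definition lsc_on :: "'a::topological_space set \<Rightarrow> ('a \<Rightarrow> real) \<Rightarrow> bool" where
  "lsc_on S u \<longleftrightarrow> (\<forall>z\<in>S. \<forall>a. a < u z \<longrightarrow> (\<forall>\<^sub>F w in at z within S. a < u w))"

text \<open>\<open>\<phi>\<close> is a test function with time derivative \<open>\<phi>t\<close>, spatial gradient \<open>G\<close> and spatial Hessian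
  \<open>H\<close>, all continuous.\<close>

definition test_function ::
  "((real^'m) \<times> real \<Rightarrow> real) \<Rightarrow> ((real^'m) \<times> real \<Rightarrow> real) \<Rightarrow> ((real^'m) \<times> real \<Rightarrow> real^'m)
    \<Rightarrow> ((real^'m) \<times> real \<Rightarrow> real^'m^'m) \<Rightarrow> bool" where
  "test_function \<phi> \<phi>t G H \<longleftrightarrow>
     (\<forall>x. \<forall>t<0.
        ((\<lambda>s. \<phi> (x, s)) has_real_derivative \<phi>t (x, t)) (at t) \<and>
        ((\<lambda>y. \<phi> (y, t)) has_derivative (\<lambda>h. G (x, t) \<bullet> h)) (at x) \<and>
        ((\<lambda>y. G (y, t)) has_derivative (\<lambda>h. H (x, t) *v h)) (at x)) \<and>
     continuous_on (UNIV \<times> {..<0}) \<phi>t \<and>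
     continuous_on (UNIV \<times> {..<0}) G \<and>
     continuous_on (UNIV \<times> {..<0}) H"

definition local_max_at :: "('a::topological_space \<Rightarrow> real) \<Rightarrow> 'a \<Rightarrow> bool" where
  "local_max_at f z \<longleftrightarrow> (\<forall>\<^sub>F w in nhds z. f w \<le> f z)"

definition local_min_at :: "('a::topological_space \<Rightarrow> real) \<Rightarrow> 'a \<Rightarrow> bool" where
  "local_min_at f z \<longleftrightarrow> (\<forall>\<^sub>F w in nhds z. f z \<le> f w)"

definition mcf_subsolution :: "((real^'m) \<times> real \<Rightarrow> real) \<Rightarrow> bool" where
  "mcf_subsolution u \<longleftrightarrow> usc_on (UNIV \<times> {..0}) u \<and>
     (\<forall>\<phi> \<phi>t G H z. test_function \<phi> \<phi>t G H \<longrightarrow> snd z < 0 \<longrightarrow>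
        local_max_at (\<lambda>w. u w - \<phi> w) z \<longrightarrow>
        ereal (\<phi>t z) + mcf_F_upper (H z) (G z) \<ge> 0)"

definition mcf_supersolution :: "((real^'m) \<times> real \<Rightarrow> real) \<Rightarrow> bool" where
  "mcf_supersolution u \<longleftrightarrow> lsc_on (UNIV \<times> {..0}) u \<and>
     (\<forall>\<phi> \<phi>t G H z. test_function \<phi> \<phi>t G H \<longrightarrow> snd z < 0 \<longrightarrow>
        local_min_at (\<lambda>w. u w - \<phi> w) z \<longrightarrow>
        ereal (\<phi>t z) + mcf_F_lower (H z) (G z) \<le> 0)"

definition linear_growth :: "((real^'m) \<times> real \<Rightarrow> real) \<Rightarrow> bool" where
  "linear_growth u \<longleftrightarrow>
     (\<forall>S>0. \<exists>C. \<forall>x. \<forall>t\<in>{-S..0}. \<bar>u (x, t)\<bar> \<le> C * (1 + norm x))"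


section \<open>Mean curvature flow of a centrally symmetric convex body\<close>

text \<open>The norm with closed unit ball \<open>E\<close>, as the Minkowski functional of \<open>E\<close>.\<close>

definition body_norm :: "(real^'m) set \<Rightarrow> real^'m \<Rightarrow> real" where
  "body_norm E x = Inf {r. r > 0 \<and> x \<in> (\<lambda>y. r *\<^sub>R y) ` E}"

definition mcf_level_solution :: "(real^'m) set \<Rightarrow> ((real^'m) \<times> real \<Rightarrow> real) \<Rightarrow> bool" where
  "mcf_level_solution E u \<longleftrightarrow>
     mcf_subsolution u \<and> mcf_supersolution u \<and> linear_growth u \<and>
     (\<forall>x. u (x, 0) = body_norm E x)"

text \<open>The unique solution; as \<open>u\<close> is total, its irrelevant values at \<open>t > 0\<close> are pinned to \<open>0\<close>.\<close>

definition mcf_level_function :: "(real^'m) set \<Rightarrow> (real^'m) \<times> real \<Rightarrow> real" where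
  "mcf_level_function E = (THE u. mcf_level_solution E u \<and> (\<forall>x. \<forall>t>0. u (x, t) = 0))"

definition mcf :: "(real^'m) set \<Rightarrow> real \<Rightarrow> (real^'m) set" where
  "mcf E t = {x. mcf_level_function E (x, -t) \<le> 1}"

definition extinction_time :: "(real^'m) set \<Rightarrow> real" where
  "extinction_time E = Sup {t. t > 0 \<and> interior (mcf E t) \<noteq> {}}"

definition cube :: "(real^'m) set" where
  "cube = {x. \<forall>i. x $ i \<in> {-1..1}}"

lemma body_norm_cube: "body_norm cube x = infnorm (x :: real^'m)"
proof -
  have *: "x \<in> (\<lambda>y. r *\<^sub>R y) ` cube \<longleftrightarrow> infnorm x \<le> r" if "r > 0" for r
  proof
    assume "x \<in> (\<lambda>y. r *\<^sub>R y) ` cube"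
    then obtain y where y: "y \<in> cube" "x = r *\<^sub>R y" by blast
    then have "infnorm y \<le> 1"
      unfolding infnorm_cart cube_def by (intro cSup_least) (auto simp: abs_le_iff)
    then show "infnorm x \<le> r"
      using that y(2) by (simp add: infnorm_mul mult_left_le)
  next
    assume le: "infnorm x \<le> r"
    have "(1 / r) *\<^sub>R x \<in> cube"
    proof -
      have "\<bar>x $ i\<bar> \<le> r" for i
        using component_le_infnorm_cart[of x i] le by linarith
      then have "- r \<le> x $ i \<and> x $ i \<le> r" for i
        by (simp add: abs_le_iff minus_le_iff)
      then show ?thesis
        using that by (simp add: cube_def field_simps)
    qed
    then show "x \<in> (\<lambda>y. r *\<^sub>R y) ` cube"
      using that by (intro image_eqI[of _ _ "(1 / r) *\<^sub>R x"]) auto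
  qed
  have "body_norm cube x = Inf {r. r > 0 \<and> infnorm x \<le> r}"
    unfolding body_norm_def by (intro arg_cong[where f=Inf] Collect_cong conj_cong refl *)
  also have "\<dots> = infnorm x"
  proof (cases "infnorm x = 0")
    case True
    then have "{r. r > 0 \<and> infnorm x \<le> r} = {0<..}" by auto
    with True show ?thesis by simp
  next
    case False
    then have "infnorm x > 0"
      using infnorm_pos_le[of x] by linarith
    then have "{r. r > 0 \<and> infnorm x \<le> r} = {infnorm x..}" by auto
    then show ?thesis by simp
  qed
  finally show ?thesis .
qed

end

theory Submission
  imports Defs
begin

text \<open>
  Let \<open>u\<^sub>T (x, t)\<close> be the value of the game with \<open>\<lfloor>- 2 t T\<rfloor>\<close> rounds started at \<open>\<surd>T x\<close>, divided by
  \<open>\<surd>T\<close>. Let \<open>M\<close> and \<open>p\<close> be the Hessian and the gradient of a test function. Whatever the matrix \<open>A\<close>,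
  a Gram--Schmidt walk yields signs with \<open>(A e) \<bullet> M (A e)\<close> at most the sum of the positive
  eigenvalues of \<open>M\<close>, and the penalty \<open>- \<Lambda> (p \<bullet> A e)\<^sup>2\<close> confines this sum to a plane orthogonal to
  \<open>p\<close>. Conversely, if the columns of \<open>A\<close> are an orthonormal eigenbasis of \<open>M\<close> on the hyperplane
  orthogonal to \<open>p\<close>, then all signs give the trace of \<open>M\<close> on that hyperplane. So the upper relaxed
  limit of \<open>u\<^sub>T\<close> is a subsolution for the family of all planes and the lower one a supersolution for
  the family of all hyperplanes.

  These two notions are compared without any theorem on sums: \<open>exp (- l v)\<close> and \<open>exp (l v)\<close> are
  controlled by monotone schemes that average over the unit ball of the best plane, and the noises of
  the schemes can be coupled. The comparison holds between \<open>v\<^sub>1\<close> at a midpoint and the mean of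
  \<open>v\<^sub>2\<close>, and thereby yields the uniqueness of the limit \<open>u\<close> together with its convexity in space.
  Convexity makes the Hessian of a touching test function positive semidefinite, so that the traces
  on smaller planes are dominated and \<open>u\<close> solves the level set equation. Finally
  \<open>u (0, - s) = c \<surd>(2 s)\<close> by scaling, where \<open>c\<close> is the limit in the theorem, and as \<open>u\<close> is even and
  convex the flow vanishes exactly when \<open>u (0, - s)\<close> reaches \<open>1\<close>.
\<close>

section \<open>Orthonormal sets as planes, their projections, and diagonalisation of a form on a
  subspace\<close>

section \<open>Orthonormal sets\<close>

text \<open>The obstacle is that the two sides of the game see different operators: balancing gives
  traces over planes of every dimension, the eigenbasis strategy only traces over hyperplanes, and
  the two are reconciled only by a positive semidefinite Hessian. So convexity is needed before the
  equation is known and must come out of the comparison itself. This is why a midpoint appears: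
  noise in a proper subspace of a hyperplane has too small a covariance to be a noise of the
  hyperplane, but the projection onto the subspace is the mean of the identity and a reflection,
  hence the noise is the mean of two hyperplane noises. The penalty of the doubling is quartic
  because its Hessian vanishes on the diagonal, where no direction is available to align the planes
  with. Away from the diagonal a misaligned plane produces noise along the displacement, and for
  large \<open>l\<close> the second-order gain of the exponential then outweighs the loss. One round
  lasts 1/(2T), since the second-order Taylor term carries a factor 1/2 that the equation lacks;
  this is the 2 under the root in the limit.\<close>

definition oset :: "'a::euclidean_space set \<Rightarrow> bool" where
  "oset B \<longleftrightarrow> pairwise orthogonal B \<and> (\<forall>b\<in>B. norm b = 1)"

text \<open>Planes through the origin are represented by orthonormal bases. For
  \<open>oset B\<close> this is the orthogonal projection onto the span; for the empty set it is the
  zero map.\<close>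

definition prj :: "'a::euclidean_space set \<Rightarrow> 'a \<Rightarrow> 'a" where
  "prj B x = (\<Sum>b\<in>B. (b \<bullet> x) *\<^sub>R b)"

lemma oset_independent: "oset B \<Longrightarrow> independent B"
  unfolding oset_def by (rule pairwise_orthogonal_independent) auto

lemma oset_finite: "oset B \<Longrightarrow> finite B"
  by (rule independent_imp_finite[OF oset_independent])

lemma oset_subset: "oset B \<Longrightarrow> A \<subseteq> B \<Longrightarrow> oset A"
  unfolding oset_def by (auto intro: pairwise_subset)

lemma oset_empty [simp]: "oset {}"
  by (simp add: oset_def)

lemma oset_inner: "oset B \<Longrightarrow> b \<in> B \<Longrightarrow> b' \<in> B \<Longrightarrow> b \<bullet> b' = (if b = b' then 1 else 0)"
  unfolding oset_def pairwise_def orthogonal_def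
  by (auto simp: norm_eq_1)

lemma oset_insert:
  assumes "oset B" "norm x = 1" "\<And>b. b \<in> B \<Longrightarrow> b \<bullet> x = 0"
  shows "oset (insert x B)"
  using assms unfolding oset_def by (auto simp: pairwise_insert orthogonal_def inner_commute)

lemma linear_prj: "linear (prj B)"
  unfolding prj_def
  by (intro linear_compose_sum ballI) (auto intro!: linearI simp: inner_add_right scaleR_add_left)

lemma prj_scaleR: "prj B (r *\<^sub>R x) = r *\<^sub>R prj B x"
  by (rule linear_scale[OF linear_prj])

lemma prj_add: "prj B (x + y) = prj B x + prj B y"
  by (rule linear_add[OF linear_prj])

lemma prj_diff: "prj B (x - y) = prj B x - prj B y"
  by (rule linear_diff[OF linear_prj])

lemma prj_minus: "prj B (- x) = - prj B x"
  by (rule linear_neg[OF linear_prj])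

lemma inner_prj: "oset B \<Longrightarrow> b \<in> B \<Longrightarrow> b \<bullet> prj B x = b \<bullet> x"
proof -
  assume B: "oset B" "b \<in> B"
  have "b \<bullet> prj B x = (\<Sum>c\<in>B. (c \<bullet> x) * (if c = b then 1 else 0))"
    unfolding prj_def inner_sum_right by (rule sum.cong) (auto simp: oset_inner[OF B(1)] B(2))
  also have "\<dots> = (\<Sum>c\<in>B. if c = b then c \<bullet> x else 0)"
    by (rule sum.cong) auto
  finally show ?thesis using B by (simp add: oset_finite)
qed

lemma prj_idem: "oset B \<Longrightarrow> prj B (prj B x) = prj B x"
proof -
  assume B: "oset B"
  have "prj B (prj B x) = (\<Sum>b\<in>B. (b \<bullet> prj B x) *\<^sub>R b)" by (rule prj_def)
  also have "\<dots> = (\<Sum>b\<in>B. (b \<bullet> x) *\<^sub>R b)"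
    by (intro sum.cong refl) (simp add: inner_prj[OF B])
  finally show ?thesis by (simp add: prj_def)
qed

lemma prj_inner: "prj B x \<bullet> y = (\<Sum>b\<in>B. (b \<bullet> x) * (b \<bullet> y))"
  unfolding prj_def inner_sum_left by simp

lemma prj_adjoint: "prj B x \<bullet> y = x \<bullet> prj B y"
proof -
  have "prj B x \<bullet> y = prj B y \<bullet> x"
    unfolding prj_inner by (rule sum.cong) auto
  then show ?thesis by (simp add: inner_commute)
qed

lemma prj_norm_sq: "oset B \<Longrightarrow> (norm (prj B x))\<^sup>2 = (\<Sum>b\<in>B. (b \<bullet> x)\<^sup>2)"
  unfolding power2_norm_eq_inner prj_inner[of B x "prj B x"]
  by (rule sum.cong) (auto simp: inner_prj power2_eq_square)

lemma prj_inner_self: "oset B \<Longrightarrow> prj B x \<bullet> x = (norm (prj B x))\<^sup>2"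
proof -
  assume B: "oset B"
  have "prj B x \<bullet> prj B x = x \<bullet> prj B (prj B x)" by (rule prj_adjoint)
  then show ?thesis
    unfolding power2_norm_eq_inner prj_idem[OF B] by (simp add: inner_commute)
qed

lemma norm_diff_prj: "oset B \<Longrightarrow> (norm (x - prj B x))\<^sup>2 = (norm x)\<^sup>2 - (norm (prj B x))\<^sup>2"
  using prj_inner_self[of B x]
  by (simp add: power2_norm_eq_inner inner_diff inner_commute)

lemma norm_prj_le: "oset B \<Longrightarrow> norm (prj B x) \<le> norm x"
proof -
  assume "oset B"
  then have "0 \<le> (norm x)\<^sup>2 - (norm (prj B x))\<^sup>2"
    by (metis norm_diff_prj zero_le_power2)
  then show ?thesis by (auto intro: power2_le_imp_le)
qed

text \<open>The reflection in the span of \<open>B\<close>. Hence \<open>prj B\<close> is the mean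
  of the identity and an isometry, and a reflected noise has the law of the original one.\<close>

lemma orthogonal_transformation_reflect:
  assumes "oset B"
  shows "orthogonal_transformation (\<lambda>x. 2 *\<^sub>R prj B x - x)"
  unfolding orthogonal_transformation_def
proof (intro conjI allI)
  show "linear (\<lambda>x. 2 *\<^sub>R prj B x - x)"
    by (rule linearI) (auto simp: prj_add prj_scaleR algebra_simps)
  fix v w
  have "prj B v \<bullet> prj B w = prj B v \<bullet> w"
    by (metis prj_adjoint prj_idem[OF assms])
  moreover have "prj B v \<bullet> w = v \<bullet> prj B w" by (rule prj_adjoint)
  ultimately show "(2 *\<^sub>R prj B v - v) \<bullet> (2 *\<^sub>R prj B w - w) = v \<bullet> w"
    by (simp add: inner_diff)
qed

lemma prj_basis:
  assumes "oset B" "span B = UNIV"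
  shows "prj B x = x"
proof -
  have "(\<Sum>i\<in>B. (x \<bullet> i) *\<^sub>R i) = x"
    using assms by (intro orthonormal_basis_expand oset_finite) (auto simp: oset_def)
  then show ?thesis by (simp add: prj_def inner_commute)
qed

lemma oset_card_le: "oset B \<Longrightarrow> card B \<le> DIM('a)" for B :: "'a::euclidean_space set"
  by (simp add: independent_bound oset_independent)

lemma oset_span_UNIV: "oset B \<Longrightarrow> card B = DIM('a) \<Longrightarrow> span B = UNIV" for B :: "'a::euclidean_space set"
  using dim_eq_full[of B] dim_eq_card_independent[OF oset_independent, of B] by simp

lemma oset_complement_vector:
  fixes B :: "'a::euclidean_space set"
  assumes "oset B" "card B + 1 = DIM('a)"
  obtains \<nu> where "norm \<nu> = 1" "oset (insert \<nu> B)" "\<nu> \<notin> B" "\<And>x. prj B x = x - (\<nu> \<bullet> x) *\<^sub>R \<nu>"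
proof -
  have "dim B < DIM('a)"
    using assms by (simp add: dim_eq_card_independent oset_independent)
  then have "span B \<noteq> UNIV" by (metis dim_UNIV dim_span less_irrefl)
  then have "span B \<subset> span (UNIV::'a set)" by auto
  from orthogonal_to_subspace_exists_gen[OF this]
  obtain v where v: "v \<noteq> 0" "\<And>y. y \<in> span B \<Longrightarrow> orthogonal v y" by blast
  define \<nu> where "\<nu> = v /\<^sub>R norm v"
  have n: "norm \<nu> = 1" using v by (simp add: \<nu>_def)
  have ob: "b \<bullet> \<nu> = 0" if "b \<in> B" for b
    using v(2)[OF span_base[OF that]] by (simp add: \<nu>_def orthogonal_def inner_commute)
  have os: "oset (insert \<nu> B)" by (rule oset_insert[OF assms(1) n ob])
  have ni: "\<nu> \<notin> B" using ob n by (force simp: norm_eq_1)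
  have "card (insert \<nu> B) = DIM('a)"
    using assms(2) ni oset_finite[OF assms(1)] by simp
  then have "prj (insert \<nu> B) x = x" for x
    by (intro prj_basis os oset_span_UNIV)
  then have "prj B x = x - (\<nu> \<bullet> x) *\<^sub>R \<nu>" for x
    using ni oset_finite[OF assms(1)] by (simp add: prj_def eq_diff_eq add.commute)
  with n os ni that show ?thesis by blast
qed

lemma oset_basis_extend:
  fixes \<nu> :: "'a::euclidean_space"
  assumes "norm \<nu> = 1"
  obtains B where "oset (insert \<nu> B)" "\<nu> \<notin> B" "card B + 1 = DIM('a)"
proof -
  obtain S where S: "\<nu> \<in> S" "pairwise orthogonal S" "\<And>x. x \<in> S \<Longrightarrow> norm x = 1" "card S = DIM('a)"
    using vector_in_orthonormal_basis[OF assms] by metis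
  have "oset S" using S by (simp add: oset_def)
  then have "finite S" by (rule oset_finite)
  then have "card (S - {\<nu>}) + 1 = DIM('a)" using S
    by (metis Suc_eq_plus1 card_Suc_Diff1)
  moreover have "insert \<nu> (S - {\<nu>}) = S" using S(1) by auto
  ultimately show ?thesis using that[of "S - {\<nu>}"] \<open>oset S\<close> by auto
qed

text \<open>\<open>f\<close> need not map \<open>S\<close> into itself: what is diagonalised is the
  quadratic form of \<open>f\<close> on \<open>S\<close>, and this is what a restriction to a
  hyperplane requires. A maximiser of the form on the unit sphere of \<open>S\<close> is split off
  and the induction continues in its orthogonal complement.\<close>

lemma orthonormal_eigenbasis:
  fixes S :: "'a::euclidean_space set"
  assumes "subspace S" and f: "linear f" and sym: "\<And>x y. x \<bullet> f y = f x \<bullet> y"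
  shows "\<exists>B. oset B \<and> span B = S \<and> (\<forall>b\<in>B. \<forall>c\<in>B. b \<noteq> c \<longrightarrow> b \<bullet> f c = 0)"
  using assms(1)
proof (induction "dim S" arbitrary: S rule: less_induct)
  case less
  show ?case
  proof (cases "S = {0}")
    case True
    then show ?thesis by (intro exI[of _ "{}"]) auto
  next
    case False
    have S0: "0 \<in> S" using less.prems by (rule subspace_0)
    obtain s where s: "s \<in> S" "s \<noteq> 0" using False S0 by auto
    let ?K = "S \<inter> sphere 0 1"
    have "compact ?K" by (intro closed_Int_compact closed_subspace less.prems) auto
    moreover have "s /\<^sub>R norm s \<in> ?K" using s less.prems by (simp add: subspace_scale)
    moreover have "continuous_on ?K (\<lambda>x. x \<bullet> f x)"
      by (intro continuous_intros linear_continuous_on f linear_linear[THEN iffD1] linear_conv_bounded_linear[THEN iffD1])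
    ultimately obtain x where x: "x \<in> ?K" "\<And>y. y \<in> ?K \<Longrightarrow> y \<bullet> f y \<le> x \<bullet> f x"
      using continuous_attains_sup[of ?K "\<lambda>x. x \<bullet> f x"] by blast
    define \<mu> where "\<mu> = x \<bullet> f x"
    have le: "y \<bullet> f y \<le> \<mu> * (norm y)\<^sup>2" if "y \<in> S" for y
    proof (cases "y = 0")
      case False
      have "y /\<^sub>R norm y \<in> ?K" using that False less.prems by (simp add: subspace_scale)
      from x(2)[OF this] have "(y \<bullet> f y) / (norm y)\<^sup>2 \<le> \<mu>"
        by (simp add: \<mu>_def linear_scale[OF f] power2_eq_square divide_simps)
      then show ?thesis using False by (simp add: divide_simps mult.commute)
    qed (simp add: linear_0[OF f])
    have xn: "norm x = 1" and xS: "x \<in> S" using x by auto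
    have orth: "y \<bullet> f x = 0" if y: "y \<in> S" "x \<bullet> y = 0" for y
    proof (rule ccontr)
      assume ne: "y \<bullet> f x \<noteq> 0"
      define a where "a = y \<bullet> f x"
      \<comment> \<open>Moving from \<open>x\<close> by \<open>t *\<^sub>R y\<close> gains
        \<open>2 * t * a\<close> to first order, and the maximality of \<open>x\<close> bounds this
        by \<open>t\<^sup>2 * K\<close>; the choice \<open>t = a / K\<close> then forces
        \<open>a = 0\<close>. The summand 1 keeps \<open>K\<close> positive.\<close>
      define K where "K = \<bar>\<mu> * (norm y)\<^sup>2 - y \<bullet> f y\<bar> + 1"
      have K: "K > 0" unfolding K_def by linarith
      have ineq: "2 * t * a \<le> t\<^sup>2 * K" for t
      proof -
        have "x + t *\<^sub>R y \<in> S" using xS y less.prems by (simp add: subspace_add subspace_scale)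
        from le[OF this]
        have "(x + t *\<^sub>R y) \<bullet> f (x + t *\<^sub>R y) \<le> \<mu> * (1 + t\<^sup>2 * (norm y)\<^sup>2)"
          using xn y(2) unfolding power2_norm_eq_inner
          by (simp add: norm_eq_1 inner_add inner_commute[of y x] power2_eq_square mult.assoc)
        moreover have "(x + t *\<^sub>R y) \<bullet> f (x + t *\<^sub>R y) = \<mu> + 2 * t * a + t\<^sup>2 * (y \<bullet> f y)"
        proof -
          have "x \<bullet> f y = a" using sym[of x y] by (simp add: a_def inner_commute)
          then show ?thesis
            by (simp add: \<mu>_def linear_add[OF f] linear_scale[OF f] inner_add_left inner_add_right
              power2_eq_square distrib_left a_def[symmetric])
        qed
        ultimately have "2 * t * a \<le> t\<^sup>2 * (\<mu> * (norm y)\<^sup>2 - y \<bullet> f y)" by (simp add: algebra_simps)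
        also have "\<dots> \<le> t\<^sup>2 * K" by (intro mult_left_mono) (auto simp: K_def)
        finally show ?thesis .
      qed
      have "2 * (a / K) * a \<le> (a / K)\<^sup>2 * K" by (rule ineq)
      then have "2 * a\<^sup>2 \<le> a\<^sup>2" using K by (simp add: power2_eq_square divide_simps)
      then show False using ne by (simp add: a_def)
    qed
    define T where "T = {y \<in> S. x \<bullet> y = 0}"
    have sT: "subspace T" unfolding T_def subspace_def using less.prems
      by (auto simp: subspace_add subspace_scale subspace_0 inner_add_right)
    have "dim T < dim S"
    proof (rule ccontr)
      assume "\<not> dim T < dim S"
      then have "T = S" by (intro subspace_dim_equal sT less.prems) (auto simp: T_def)
      then have "x \<in> T" using xS by simp
      then show False using xn by (simp add: T_def norm_eq_1)
    qed
    from less.hyps[OF this sT] obtain B where B: "oset B" "span B = T"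
      "\<And>b c. b \<in> B \<Longrightarrow> c \<in> B \<Longrightarrow> b \<noteq> c \<Longrightarrow> b \<bullet> f c = 0" by blast
    have BT: "b \<in> T" if "b \<in> B" for b using B(2) that span_base by blast
    have os: "oset (insert x B)" using BT by (intro oset_insert B xn) (auto simp: T_def inner_commute)
    have "span (insert x B) = S"
    proof
      show "span (insert x B) \<subseteq> S" using BT xS
        by (intro span_minimal less.prems) (auto simp: T_def)
      show "S \<subseteq> span (insert x B)"
      proof
        fix s assume s: "s \<in> S"
        have "s - (x \<bullet> s) *\<^sub>R x \<in> T"
          unfolding T_def using s xS less.prems xn
          by (auto simp: subspace_diff subspace_scale inner_diff_right norm_eq_1)
        then have "s - (x \<bullet> s) *\<^sub>R x \<in> span (insert x B)"
          using B(2) span_mono[of B "insert x B"] by auto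
        moreover have "(x \<bullet> s) *\<^sub>R x \<in> span (insert x B)" by (intro span_scale span_base) simp
        ultimately show "s \<in> span (insert x B)" using span_add by fastforce
      qed
    qed
    moreover have "\<forall>b\<in>insert x B. \<forall>c\<in>insert x B. b \<noteq> c \<longrightarrow> b \<bullet> f c = 0"
    proof (intro ballI impI)
      fix b c assume bc: "b \<in> insert x B" "c \<in> insert x B" "b \<noteq> c"
      have 1: "d \<bullet> f x = 0" if "d \<in> B" for d
        using orth[of d] BT[OF that] by (auto simp: T_def)
      have 2: "x \<bullet> f d = 0" if "d \<in> B" for d
        using 1[OF that] sym[of x d] by (simp add: inner_commute)
      show "b \<bullet> f c = 0" using bc 1 2 B(3) by auto
    qed
    ultimately show ?thesis using os by blast
  qed
qed


section \<open>Choice of signs for vectors of length at most 1: a derandomised Gram--Schmidt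
  walk\<close>

section \<open>Balancing vectors against a quadratic form\<close>

text \<open>The trace enters only through an upper bound \<open>K\<close> of all its partial sums
  over orthonormal sets, so an instance need not compute it. In the application \<open>f\<close> is
  the positive part of a symmetric matrix.\<close>

locale psd_form =
  fixes f :: "'a::euclidean_space \<Rightarrow> 'a" and K :: real
  assumes lin: "linear f"
    and sym: "x \<bullet> f y = f x \<bullet> y"
    and psd: "0 \<le> x \<bullet> f x"
    and bound: "oset B \<Longrightarrow> (\<Sum>b\<in>B. b \<bullet> f b) \<le> K"
begin

definition qf :: "'a \<Rightarrow> real" where "qf x = x \<bullet> f x"

text \<open>For a subspace \<open>E\<close> the supremum is the trace of the form restricted to \<open>E\<close>.\<close>

definition tau :: "'a set \<Rightarrow> real" where
  "tau E = (SUP B\<in>{B. oset B \<and> B \<subseteq> E}. \<Sum>b\<in>B. qf b)"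

lemma bdd: "bdd_above ((\<lambda>B. \<Sum>b\<in>B. qf b) ` {B. oset B \<and> B \<subseteq> E})"
  using bound by (intro bdd_aboveI2[of _ _ K]) (auto simp: qf_def)

lemma tau_upper: "oset B \<Longrightarrow> B \<subseteq> E \<Longrightarrow> (\<Sum>b\<in>B. qf b) \<le> tau E"
  unfolding tau_def by (intro cSUP_upper bdd) auto

lemma tau_le: "tau E \<le> K"
  unfolding tau_def using bound by (intro cSUP_least) (auto intro: exI[of _ "{}"] simp: qf_def)

lemma tau_mono: "E \<subseteq> F \<Longrightarrow> tau E \<le> tau F"
  unfolding tau_def[of E] by (intro cSUP_least tau_upper) (auto intro: exI[of _ "{}"])

lemma tau_nonneg: "0 \<le> tau E"
  using tau_upper[of "{}" E] by simp

lemma qf_scaleR: "qf (r *\<^sub>R x) = r\<^sup>2 * qf x"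
  by (simp add: qf_def linear_scale[OF lin] power2_eq_square)

lemma qf_add: "qf (x + t *\<^sub>R y) = qf x + 2 * t * (y \<bullet> f x) + t\<^sup>2 * qf y"
  using sym[of x y]
  by (simp add: qf_def linear_add[OF lin] linear_scale[OF lin] inner_add_left inner_add_right
      power2_eq_square distrib_left inner_commute)

lemma qf_nonneg: "0 \<le> qf x" by (simp add: qf_def psd)

text \<open>An orthonormal set in \<open>F\<close> extends by the direction of \<open>b\<close> to
  one in \<open>E\<close>, and since \<open>b\<close> has length at most 1, its energy is at most
  that of its direction. Thus the drop of \<open>tau\<close> from \<open>E\<close> to
  \<open>F\<close> pays for a move along \<open>b\<close>; this is where the bound on the column
  lengths enters.\<close>

lemma tau_add:
  assumes "subspace E" "F \<subseteq> E" "b \<in> E" "norm b \<le> 1" "\<And>x. x \<in> F \<Longrightarrow> x \<bullet> b = 0"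
  shows "tau F + qf b \<le> tau E"
proof (cases "b = 0")
  case True
  then show ?thesis using tau_mono[OF assms(2)] by (simp add: qf_def)
next
  case False
  define c where "c = b /\<^sub>R norm b"
  have c: "norm c = 1" "c \<in> E" using False assms by (auto simp: c_def subspace_scale)
  have "b = norm b *\<^sub>R c" using False by (simp add: c_def)
  then have "qf b = (norm b)\<^sup>2 * qf c" by (metis qf_scaleR)
  also have "\<dots> \<le> 1 * qf c"
    using assms(4) by (intro mult_right_mono qf_nonneg) (simp add: power_le_one)
  finally have bc: "qf b \<le> qf c" by simp
  have "tau F \<le> tau E - qf c"
    unfolding tau_def[of F]
  proof (intro cSUP_least)
    show "{B. oset B \<and> B \<subseteq> F} \<noteq> {}" by (auto intro: exI[of _ "{}"])
    fix B assume "B \<in> {B. oset B \<and> B \<subseteq> F}"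
    then have B: "oset B" "B \<subseteq> F" by auto
    have "x \<bullet> c = 0" if "x \<in> B" for x
      using assms(5)[of x] that B by (auto simp: c_def)
    then have o: "oset (insert c B)" using B c by (intro oset_insert) auto
    have "c \<notin> B" using \<open>\<And>x. x \<in> B \<Longrightarrow> x \<bullet> c = 0\<close> c by (force simp: norm_eq_1)
    moreover have "(\<Sum>b\<in>insert c B. qf b) \<le> tau E"
      using B c assms(2) by (intro tau_upper o) auto
    ultimately show "(\<Sum>b\<in>B. qf b) \<le> tau E - qf c"
      using oset_finite[OF B(1)] by simp
  qed
  with bc show ?thesis by simp
qed

end

lemma span_image_sum:
  assumes "finite S" "z \<in> span (a ` S)"
  shows "\<exists>c. z = (\<Sum>j\<in>S. c j *\<^sub>R a j)"
  using assms(2)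
proof (induction rule: span_induct_alt)
  case base
  show ?case by (intro exI[of _ "\<lambda>_. 0"]) simp
next
  case (step r x y)
  then obtain c i where c: "y = (\<Sum>j\<in>S. c j *\<^sub>R a j)" and i: "i \<in> S" "x = a i" by blast
  have "(\<Sum>j\<in>S. (c j + (if j = i then r else 0)) *\<^sub>R a j)
      = y + (\<Sum>j\<in>S. if j = i then r *\<^sub>R a j else 0)"
    unfolding c sum.distrib[symmetric] by (intro sum.cong) (auto simp: scaleR_add_left)
  also have "\<dots> = r *\<^sub>R x + y" using i assms(1) by simp
  finally show ?case by metis
qed

lemma cube_exit:
  fixes x u :: "'i \<Rightarrow> real"
  assumes "finite S" "p \<in> S" "u p \<noteq> 0" "\<And>j. j \<in> S \<Longrightarrow> \<bar>x j\<bar> \<le> 1"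
  shows "\<exists>t\<ge>0. (\<forall>j\<in>S. \<bar>x j + t * u j\<bar> \<le> 1) \<and> (\<exists>j\<in>S. \<bar>x j + t * u j\<bar> = 1)"
proof -
  define J where "J = {j\<in>S. u j \<noteq> 0}"
  \<comment> \<open>The time at which coordinate \<open>j\<close> reaches the face of the cube
    towards which it moves; the walk stops at the least of these times.\<close>
  define T where "T j = (1 - sgn (u j) * x j) / \<bar>u j\<bar>" for j
  have J: "finite J" "J \<noteq> {}" using assms by (auto simp: J_def)
  have sx: "\<bar>sgn (u j) * x j\<bar> \<le> 1" if "j \<in> S" for j
    using assms(4)[OF that] by (auto simp: abs_mult sgn_real_def)
  define t where "t = Min (T ` J)"
  have "t \<in> T ` J" unfolding t_def using J by (intro Min_in) auto
  then obtain i where i: "i \<in> J" "t = T i" by blast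
  have tle: "t \<le> T j" if "j \<in> J" for j unfolding t_def using J that by (intro Min_le) auto
  have t0: "0 \<le> t" using sx[of i] i by (auto simp: T_def J_def intro!: divide_nonneg_nonneg)
  have key: "sgn (u j) * (x j + s * u j) = sgn (u j) * x j + s * \<bar>u j\<bar>" for j s
    by (simp add: sgn_real_def algebra_simps)
  have abseq: "\<bar>x j + s * u j\<bar> = \<bar>sgn (u j) * x j + s * \<bar>u j\<bar>\<bar>" if "u j \<noteq> 0" for j s
    unfolding key[symmetric] using that by (simp add: abs_mult)
  have "\<bar>x j + t * u j\<bar> \<le> 1" if j: "j \<in> S" for j
  proof (cases "u j = 0")
    case False
    then have "t * \<bar>u j\<bar> \<le> 1 - sgn (u j) * x j"
      using tle[of j] j by (simp add: J_def T_def field_simps)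
    moreover have "0 \<le> t * \<bar>u j\<bar>" using t0 by simp
    ultimately show ?thesis unfolding abseq[OF False] using sx[OF j] by linarith
  qed (use assms(4) j in simp)
  moreover have "\<bar>x i + t * u i\<bar> = 1"
    using i by (subst abseq) (auto simp: J_def T_def)
  ultimately show ?thesis using t0 i by (auto simp: J_def)
qed

context psd_form begin

text \<open>The random walk with a pivot \<open>p\<close> that leads to the Gram--Schmidt walk, derandomised: along
  a direction that changes the signed sum orthogonally to the other vectors, the potential is a
  concave quadratic function, so one can move to a face of the cube without increasing it.\<close>

lemma balancing_pivot:
  fixes a :: "'i \<Rightarrow> 'a"
  assumes "finite S" "\<And>j. j \<in> S \<Longrightarrow> norm (a j) \<le> 1" "p \<in> S"
    "subspace E" "a ` S \<subseteq> E" "\<And>j. j \<in> S \<Longrightarrow> \<bar>x j\<bar> \<le> 1"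
  shows "\<exists>e. (\<forall>j\<in>S. e j \<in> {-1,1}) \<and>
    qf (y + (\<Sum>j\<in>S. e j *\<^sub>R a j)) \<le> qf (y + (\<Sum>j\<in>S. x j *\<^sub>R a j)) + tau E
       - (x p)\<^sup>2 * (tau E - tau (span (a ` (S - {p}))))"
  using assms
proof (induction "card S" arbitrary: S p E x y)
  case 0
  then show ?case by auto
next
  case (Suc n)
  note fin = \<open>finite S\<close> and p = \<open>p \<in> S\<close> and E = \<open>subspace E\<close> \<open>a ` S \<subseteq> E\<close>
  define F where "F = span (a ` (S - {p}))"
  have FE: "F \<subseteq> E" unfolding F_def using E by (intro span_minimal) auto
  \<comment> \<open>\<open>b\<close> is the Gram--Schmidt remainder of the pivot vector with respect
    to the other vectors that are still free.\<close>
  obtain z b where zb: "z \<in> F" "\<And>w. w \<in> F \<Longrightarrow> orthogonal b w" "a p = z + b"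
    using orthogonal_subspace_decomp_exists[of "a ` (S - {p})" "a p"] unfolding F_def by metis
  obtain c where c: "z = (\<Sum>j\<in>S - {p}. c j *\<^sub>R a j)"
    using span_image_sum[of "S - {p}" z a] fin zb(1) by (auto simp: F_def)
  \<comment> \<open>A move of the fractional signs in this direction changes the signed sum by a
    multiple of \<open>b\<close> only.\<close>
  define u where "u j = (if j = p then 1 else - c j)" for j
  have b: "(\<Sum>j\<in>S. u j *\<^sub>R a j) = b"
  proof -
    have "(\<Sum>j\<in>S. u j *\<^sub>R a j) = a p + (\<Sum>j\<in>S - {p}. u j *\<^sub>R a j)"
      using fin p by (subst sum.remove[of S p]) (auto simp: u_def)
    also have "(\<Sum>j\<in>S - {p}. u j *\<^sub>R a j) = - z"
      unfolding c sum_negf[symmetric] by (rule sum.cong) (auto simp: u_def)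
    finally show ?thesis using zb(3) by simp
  qed
  have bn: "norm b \<le> 1"
  proof -
    have "orthogonal b z" using zb by blast
    then have "(norm (a p))\<^sup>2 = (norm z)\<^sup>2 + (norm b)\<^sup>2"
      unfolding zb(3) by (subst norm_add_Pythagorean) (auto simp: orthogonal_commute)
    then have "(norm b)\<^sup>2 \<le> (norm (a p))\<^sup>2" by simp
    then have "norm b \<le> norm (a p)" by (auto intro: power2_le_imp_le)
    then show ?thesis using Suc.prems(2)[OF p] by linarith
  qed
  have bE: "b \<in> E"
  proof -
    have "a p \<in> E" "z \<in> E" using zb(1) FE E(2) p by auto
    then have "a p - z \<in> E" by (rule subspace_diff[OF E(1)])
    then show ?thesis by (simp add: zb(3))
  qed
  define D where "D = tau E - tau F"
  have D: "qf b \<le> D"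
    using tau_add[OF E(1) FE bE bn] zb(2) by (fastforce simp: D_def orthogonal_def inner_commute)
  define v where "v = y + (\<Sum>j\<in>S. x j *\<^sub>R a j)"
  \<comment> \<open>The potential is \<open>qf\<close> of the signed sum minus \<open>D\<close>
    times the square of the pivot coordinate. Its second-order coefficient along the direction is
    \<open>qf b - D\<close>, which is not positive, so it suffices to choose \<open>s\<close> such
    that the slope is not positive.\<close>
  define s :: real where "s = (if b \<bullet> f v - x p * D \<le> 0 then 1 else -1)"
  obtain t where t: "t \<ge> 0" "\<And>j. j \<in> S \<Longrightarrow> \<bar>x j + t * (s * u j)\<bar> \<le> 1"
      "\<exists>j\<in>S. \<bar>x j + t * (s * u j)\<bar> = 1"
  proof -
    have "s * u p \<noteq> 0" by (simp add: s_def u_def)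
    then show thesis using cube_exit[OF fin p, of "\<lambda>j. s * u j" x] Suc.prems(6) that by blast
  qed
  define x' where "x' j = x j + t * (s * u j)" for j
  have v': "y + (\<Sum>j\<in>S. x' j *\<^sub>R a j) = v + (t * s) *\<^sub>R b"
  proof -
    have "(\<Sum>j\<in>S. x' j *\<^sub>R a j) = (\<Sum>j\<in>S. x j *\<^sub>R a j) + (\<Sum>j\<in>S. (t * s) *\<^sub>R (u j *\<^sub>R a j))"
      unfolding sum.distrib[symmetric] x'_def by (rule sum.cong) (auto simp: scaleR_add_left mult.assoc)
    also have "(\<Sum>j\<in>S. (t * s) *\<^sub>R (u j *\<^sub>R a j)) = (t * s) *\<^sub>R b"
      unfolding scaleR_sum_right[symmetric] b ..
    finally show ?thesis by (simp add: v_def)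
  qed
  have decr: "qf (v + (t * s) *\<^sub>R b) - (x' p)\<^sup>2 * D \<le> qf v - (x p)\<^sup>2 * D"
  proof -
    have "x' p = x p + t * s" by (simp add: x'_def u_def)
    moreover have "qf (v + (t * s) *\<^sub>R b) = qf v + 2 * (t * s) * (b \<bullet> f v) + (t * s)\<^sup>2 * qf b"
      by (rule qf_add)
    ultimately have "qf (v + (t * s) *\<^sub>R b) - (x' p)\<^sup>2 * D - (qf v - (x p)\<^sup>2 * D)
      = 2 * t * (s * (b \<bullet> f v - x p * D)) + (t * s)\<^sup>2 * (qf b - D)"
      by (simp add: power2_eq_square algebra_simps)
    moreover have "s * (b \<bullet> f v - x p * D) \<le> 0" by (auto simp: s_def)
    then have "2 * t * (s * (b \<bullet> f v - x p * D)) \<le> 0" using t(1) by (simp add: mult_nonneg_nonpos)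
    moreover have "(t * s)\<^sup>2 * (qf b - D) \<le> 0" using D by (intro mult_nonneg_nonpos) auto
    ultimately show ?thesis by linarith
  qed
  obtain i where i: "i \<in> S" "\<bar>x' i\<bar> = 1" using t(3) by (auto simp: x'_def)
  define S' where "S' = S - {i}"
  have S': "finite S'" "card S' = n" "i \<notin> S'" "S = insert i S'"
    using fin i \<open>Suc n = card S\<close> by (auto simp: S'_def)
  define y' where "y' = y + x' i *\<^sub>R a i"
  have split: "y + (\<Sum>j\<in>S. e j *\<^sub>R a j) = y + e i *\<^sub>R a i + (\<Sum>j\<in>S'. e j *\<^sub>R a j)" for e
    using S' by (simp add: add.assoc)
  have x'1: "x' j \<in> {-1, 1}" if "\<bar>x' j\<bar> = 1" for j using that by auto
  have vy: "y' + (\<Sum>j\<in>S'. x' j *\<^sub>R a j) = v + (t * s) *\<^sub>R b"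
    unfolding v'[symmetric] split by (simp add: y'_def)
  have lift: ?case
    if ex: "\<exists>e. (\<forall>j\<in>S'. e j \<in> {-1,1}) \<and> qf (y' + (\<Sum>j\<in>S'. e j *\<^sub>R a j)) \<le> qf v + tau E - (x p)\<^sup>2 * D"
  proof -
    obtain e where e: "\<forall>j\<in>S'. e j \<in> {-1,1}"
      "qf (y' + (\<Sum>j\<in>S'. e j *\<^sub>R a j)) \<le> qf v + tau E - (x p)\<^sup>2 * D" using ex by blast
    have eq: "(\<Sum>j\<in>S'. (e(i := x' i)) j *\<^sub>R a j) = (\<Sum>j\<in>S'. e j *\<^sub>R a j)"
      using S' by (intro sum.cong) auto
    show ?thesis
    proof (intro exI[of _ "e(i := x' i)"] conjI)
      show "\<forall>j\<in>S. (e(i := x' i)) j \<in> {-1,1}" using e(1) S'(4) x'1[OF i(2)] by auto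
      have "qf (y + (\<Sum>j\<in>S. (e(i := x' i)) j *\<^sub>R a j)) \<le> qf v + tau E - (x p)\<^sup>2 * D"
        using e(2) unfolding split eq by (simp add: y'_def)
      then show "qf (y + (\<Sum>j\<in>S. (e(i := x' i)) j *\<^sub>R a j)) \<le> qf (y + (\<Sum>j\<in>S. x j *\<^sub>R a j)) + tau E
         - (x p)\<^sup>2 * (tau E - tau (span (a ` (S - {p}))))"
        by (simp only: v_def D_def F_def)
    qed
  qed
  show ?case
  proof (cases "i = p")
    \<comment> \<open>The pivot survives and another vector is frozen: the span of the remaining
      vectors can only shrink, which makes the credit of the pivot larger.\<close>
    case False
    have "\<exists>e. (\<forall>j\<in>S'. e j \<in> {-1,1}) \<and>
      qf (y' + (\<Sum>j\<in>S'. e j *\<^sub>R a j)) \<le> qf (y' + (\<Sum>j\<in>S'. x' j *\<^sub>R a j)) + tau E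
       - (x' p)\<^sup>2 * (tau E - tau (span (a ` (S' - {p}))))"
    proof (rule Suc.hyps(1))
      show "n = card S'" "finite S'" using S' by auto
      show "norm (a j) \<le> 1" if "j \<in> S'" for j using Suc.prems(2) that by (simp add: S'_def)
      show "p \<in> S'" using False p by (simp add: S'_def)
      show "subspace E" "a ` S' \<subseteq> E" using E by (auto simp: S'_def)
      show "\<bar>x' j\<bar> \<le> 1" if "j \<in> S'" for j using t(2)[of j] that by (simp add: S'_def x'_def)
    qed
    moreover have "tau (span (a ` (S' - {p}))) \<le> tau F"
      unfolding F_def by (intro tau_mono span_mono) (auto simp: S'_def)
    then have "(x' p)\<^sup>2 * (tau E - tau (span (a ` (S' - {p})))) \<ge> (x' p)\<^sup>2 * D"
      unfolding D_def by (intro mult_left_mono) auto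
    ultimately obtain e where "\<forall>j\<in>S'. e j \<in> {-1,1}"
      "qf (y' + (\<Sum>j\<in>S'. e j *\<^sub>R a j)) \<le> qf (v + (t * s) *\<^sub>R b) + tau E - (x' p)\<^sup>2 * D"
      unfolding vy by force
    then show ?thesis using decr by (intro lift exI[of _ e] conjI) auto
  next
    case True
    \<comment> \<open>A frozen pivot has a coordinate of square 1 and has therefore paid the whole
      difference \<open>tau E - tau F\<close>; the next pivot starts within
      \<open>F\<close>.\<close>
    have le: "qf (v + (t * s) *\<^sub>R b) + tau F \<le> qf v + tau E - (x p)\<^sup>2 * D"
    proof -
      have "(x' p)\<^sup>2 = 1" using i True by (metis abs_square_eq_1)
      then show ?thesis using decr by (simp add: D_def)
    qed
    show ?thesis
    proof (cases "S' = {}")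
      case True
      then show ?thesis using le vy tau_nonneg[of F] by (intro lift) auto
    next
      case False
      then obtain p' where p': "p' \<in> S'" by blast
      have sub: "a ` S' \<subseteq> F" unfolding F_def S'_def True by (rule span_superset)
      have "\<exists>e. (\<forall>j\<in>S'. e j \<in> {-1,1}) \<and>
        qf (y' + (\<Sum>j\<in>S'. e j *\<^sub>R a j)) \<le> qf (y' + (\<Sum>j\<in>S'. x' j *\<^sub>R a j)) + tau F
         - (x' p')\<^sup>2 * (tau F - tau (span (a ` (S' - {p'}))))"
      proof (rule Suc.hyps(1))
        show "n = card S'" "finite S'" using S' by auto
        show "norm (a j) \<le> 1" if "j \<in> S'" for j using Suc.prems(2) that by (simp add: S'_def)
        show "p' \<in> S'" by (rule p')
        show "subspace F" by (simp add: F_def)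
        show "a ` S' \<subseteq> F" by (rule sub)
        show "\<bar>x' j\<bar> \<le> 1" if "j \<in> S'" for j using t(2)[of j] that by (simp add: S'_def x'_def)
      qed
      moreover have "span (a ` (S' - {p'})) \<subseteq> F"
        using sub by (intro span_minimal) (auto simp: F_def)
      then have "0 \<le> (x' p')\<^sup>2 * (tau F - tau (span (a ` (S' - {p'}))))"
        using tau_mono by (intro mult_nonneg_nonneg) auto
      ultimately obtain e where "\<forall>j\<in>S'. e j \<in> {-1,1}"
        "qf (y' + (\<Sum>j\<in>S'. e j *\<^sub>R a j)) \<le> qf (v + (t * s) *\<^sub>R b) + tau F"
        unfolding vy by force
      then show ?thesis using le by (intro lift exI[of _ e] conjI) auto
    qed
  qed
qed

text \<open>The walk starts at the centre of the cube, where the signed sum and the pivot term both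
  vanish.\<close>

lemma balancing:
  fixes a :: "'i \<Rightarrow> 'a"
  assumes "finite S" "\<And>j. j \<in> S \<Longrightarrow> norm (a j) \<le> 1"
  shows "\<exists>e. (\<forall>j\<in>S. e j \<in> {-1,1}) \<and> qf (\<Sum>j\<in>S. e j *\<^sub>R a j) \<le> K"
proof (cases "S = {}")
  case True
  then show ?thesis using tau_nonneg[of UNIV] tau_le[of UNIV] by (simp add: qf_def linear_0[OF lin])
next
  case False
  then obtain p where "p \<in> S" by blast
  have "\<exists>e. (\<forall>j\<in>S. e j \<in> {-1,1}) \<and>
    qf (0 + (\<Sum>j\<in>S. e j *\<^sub>R a j)) \<le> qf (0 + (\<Sum>j\<in>S. 0 *\<^sub>R a j)) + tau UNIV
       - (0::real)\<^sup>2 * (tau UNIV - tau (span (a ` (S - {p}))))"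
    using assms \<open>p \<in> S\<close> by (intro balancing_pivot) auto
  then obtain e where "\<forall>j\<in>S. e j \<in> {-1,1}" "qf (\<Sum>j\<in>S. e j *\<^sub>R a j) \<le> tau UNIV"
    by (auto simp: qf_def)
  then show ?thesis using tau_le[of UNIV] by (intro exI[of _ e]) auto
qed

end

section \<open>Integrals against compactly supported weights, and rotation invariance of Lebesgue
  measure\<close>

section \<open>Weighted averages\<close>

text \<open>Continuity is required only on the closed ball, so that the normalised indicator of the
  unit ball is a weight as well as a smooth kernel.\<close>

definition weight :: "real \<Rightarrow> ('a::euclidean_space \<Rightarrow> real) \<Rightarrow> bool" where
  "weight R J \<longleftrightarrow> continuous_on (cball 0 R) J \<and> (\<forall>z. R < norm z \<longrightarrow> J z = 0)"

definition wint :: "('a::euclidean_space \<Rightarrow> real) \<Rightarrow> ('a \<Rightarrow> real) \<Rightarrow> real" where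
  "wint J f = (LINT z|lborel. J z * f z)"

lemma weight_integrable:
  assumes "weight R J" "continuous_on (cball 0 R) f"
  shows "integrable lborel (\<lambda>z. J z * f z)"
proof -
  have "integrable lborel (\<lambda>x. indicator (cball 0 R) x *\<^sub>R (J x * f x))"
    using assms by (intro borel_integrable_compact continuous_intros) (auto simp: weight_def)
  moreover have "(\<lambda>x. indicator (cball 0 R) x *\<^sub>R (J x * f x)) = (\<lambda>x. J x * f x)"
    using assms by (auto simp: weight_def indicator_def fun_eq_iff)
  ultimately show ?thesis by simp
qed

lemma wint_add:
  assumes "weight R J" "continuous_on (cball 0 R) f" "continuous_on (cball 0 R) g"
  shows "wint J (\<lambda>z. f z + g z) = wint J f + wint J g"
  using weight_integrable[OF assms(1,2)] weight_integrable[OF assms(1,3)]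
  by (simp add: wint_def distrib_left)

lemma wint_cmult: "wint J (\<lambda>z. c * f z) = c * wint J f"
  unfolding wint_def by (subst integral_mult_right_zero[symmetric]) (simp add: mult.left_commute)

lemma wint_diff:
  assumes "weight R J" "continuous_on (cball 0 R) f" "continuous_on (cball 0 R) g"
  shows "wint J (\<lambda>z. f z - g z) = wint J f - wint J g"
  using weight_integrable[OF assms(1,2)] weight_integrable[OF assms(1,3)]
  by (simp add: wint_def right_diff_distrib)

lemma wint_mono:
  assumes "weight R J" "\<And>z. 0 \<le> J z" "continuous_on (cball 0 R) f" "continuous_on (cball 0 R) g"
    "\<And>z. norm z \<le> R \<Longrightarrow> f z \<le> g z"
  shows "wint J f \<le> wint J g"
  unfolding wint_def
proof (rule integral_mono[OF weight_integrable[OF assms(1,3)] weight_integrable[OF assms(1,4)]])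
  fix z show "J z * f z \<le> J z * g z"
    using assms by (cases "norm z \<le> R") (auto simp: weight_def intro: mult_left_mono)
qed


lemma wint_fubini:
  fixes F :: "'a::euclidean_space \<Rightarrow> 'b::euclidean_space \<Rightarrow> real"
  assumes J: "weight R J" and J': "weight R' J'"
    and F: "continuous_on UNIV (\<lambda>(x, y). F x y)"
  shows "wint J (\<lambda>x. wint J' (F x)) = wint J' (\<lambda>y. wint J (\<lambda>x. F x y))"
proof -
  let ?G = "\<lambda>(x, y). J x * (J' y * F x y)"
  have "integrable lborel (\<lambda>p. indicator (cball 0 R \<times> cball 0 R') p *\<^sub>R ?G p)"
  proof (rule borel_integrable_compact)
    show "compact (cball 0 R \<times> cball 0 R' :: ('a \<times> 'b) set)" by (intro compact_Times compact_cball)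
    have 1: "continuous_on (cball 0 R \<times> cball 0 R') (\<lambda>p::'a\<times>'b. J (fst p))"
      by (rule continuous_on_compose2[of "cball 0 R" J]) (use J in \<open>auto simp: weight_def intro: continuous_on_fst continuous_on_id\<close>)
    have 2: "continuous_on (cball 0 R \<times> cball 0 R') (\<lambda>p::'a\<times>'b. J' (snd p))"
      by (rule continuous_on_compose2[of "cball 0 R'" J']) (use J' in \<open>auto simp: weight_def intro: continuous_on_snd continuous_on_id\<close>)
    show "continuous_on (cball 0 R \<times> cball 0 R') ?G"
      using continuous_on_mult[OF 1 continuous_on_mult[OF 2 continuous_on_subset[OF F subset_UNIV]]]
      by (simp add: case_prod_unfold)
  qed
  moreover have "(\<lambda>p. indicator (cball 0 R \<times> cball 0 R') p *\<^sub>R ?G p) = ?G"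
  proof
    fix p :: "'a \<times> 'b"
    show "indicator (cball 0 R \<times> cball 0 R') p *\<^sub>R ?G p = ?G p"
      using J J' by (cases p, cases "norm (fst p) \<le> R"; cases "norm (snd p) \<le> R'")
        (auto simp: weight_def indicator_def)
  qed
  ultimately have int: "integrable (lborel \<Otimes>\<^sub>M lborel) ?G"
    by (simp add: lborel_prod)
  have "(LINT y|lborel. LINT x|lborel. J x * (J' y * F x y)) = (LINT x|lborel. LINT y|lborel. J x * (J' y * F x y))"
    by (rule lborel_pair.Fubini_integral[OF int])
  moreover have "(LINT x|lborel. J x * (J' y * F x y)) = J' y * wint J (\<lambda>x. F x y)" for y
    unfolding wint_def by (subst integral_mult_right_zero[symmetric]) (simp add: mult.left_commute)
  moreover have "(LINT y|lborel. J x * (J' y * F x y)) = J x * wint J' (F x)" for x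
    unfolding wint_def by (subst integral_mult_right_zero[symmetric]) simp
  ultimately show ?thesis unfolding wint_def by simp
qed

lemma nn_integral_lborel_plus:
  assumes [measurable]: "F \<in> borel_measurable borel"
  shows "(\<integral>\<^sup>+x. F (c + x) \<partial>lborel) = (\<integral>\<^sup>+x. F x \<partial>lborel)"
proof -
  have "(\<integral>\<^sup>+x. F x \<partial>lborel) = (\<integral>\<^sup>+x. F x \<partial>distr lborel borel ((+) c))"
    by (simp add: lborel_distr_plus)
  also have "\<dots> = (\<integral>\<^sup>+x. F (c + x) \<partial>lborel)"
    by (subst nn_integral_distr) auto
  finally show ?thesis ..
qed

lemma nn_integral_lborel_minus:
  fixes c :: "'a::euclidean_space"
  assumes [measurable]: "F \<in> borel_measurable borel"
  shows "(\<integral>\<^sup>+x. F (c - x) \<partial>lborel) = (\<integral>\<^sup>+x. F x \<partial>lborel)"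
proof -
  have "lborel = density (distr lborel borel (\<lambda>x. c + (-1) *\<^sub>R x)) (\<lambda>_. \<bar>-1::real\<bar>^DIM('a))"
    by (rule lborel_affine) simp
  then have "lborel = distr lborel borel (\<lambda>x. c - x)" by (simp add: density_1)
  then have "(\<integral>\<^sup>+x. F x \<partial>lborel) = (\<integral>\<^sup>+x. F x \<partial>distr lborel borel (\<lambda>x. c - x))" by simp
  also have "\<dots> = (\<integral>\<^sup>+x. F (c - x) \<partial>lborel)"
    by (subst nn_integral_distr) auto
  finally show ?thesis ..
qed

text \<open>The image of Lebesgue measure under an orthogonal map is translation invariant, and both
  measures give the same mass to the unit ball: this is the usual uniqueness argument for Haar
  measure.\<close>

lemma lborel_distr_orthogonal:
  fixes T :: "'a::euclidean_space \<Rightarrow> 'a"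
  assumes T: "orthogonal_transformation T"
  shows "distr lborel borel T = lborel"
proof -
  have lin: "linear T" by (rule orthogonal_transformation_linear[OF T])
  have meas[measurable]: "T \<in> borel_measurable borel"
    by (intro borel_measurable_continuous_onI linear_continuous_on
        linear_conv_bounded_linear[THEN iffD1] lin)
  have shift: "(\<integral>\<^sup>+x. F (T x + y) \<partial>lborel) = (\<integral>\<^sup>+x. F (T x) \<partial>lborel)"
    if [measurable]: "F \<in> borel_measurable borel" for F :: "'a \<Rightarrow> ennreal" and y
  proof -
    obtain c where c: "y = T c" using orthogonal_transformation_surj[OF T] by (metis surjD)
    have "(\<integral>\<^sup>+x. F (T x + y) \<partial>lborel) = (\<integral>\<^sup>+x. F (T (c + x)) \<partial>lborel)"
      by (simp add: c linear_add[OF lin] add.commute)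
    also have "\<dots> = (\<integral>\<^sup>+x. F (T x) \<partial>lborel)" by (rule nn_integral_lborel_plus) measurable
    finally show ?thesis .
  qed
  \<comment> \<open>Both sides result from integrating \<open>f (T x) * g (T x + y)\<close> in the
    two orders, with \<open>shift\<close> moving the translation from one factor to the other. With
    the indicators of a set and of the unit ball this identifies the two measures.\<close>
  have key: "(\<integral>\<^sup>+x. f (T x) \<partial>lborel) * (\<integral>\<^sup>+y. g y \<partial>lborel) = (\<integral>\<^sup>+x. g (T x) \<partial>lborel) * (\<integral>\<^sup>+y. f y \<partial>lborel)"
    if [measurable]: "f \<in> borel_measurable borel" "g \<in> borel_measurable borel" for f g :: "'a \<Rightarrow> ennreal"
  proof -
    have "(\<integral>\<^sup>+x. f (T x) \<partial>lborel) * (\<integral>\<^sup>+y. g y \<partial>lborel)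
        = (\<integral>\<^sup>+x. f (T x) * (\<integral>\<^sup>+y. g (T x + y) \<partial>lborel) \<partial>lborel)"
      by (simp add: nn_integral_lborel_plus nn_integral_multc)
    also have "\<dots> = (\<integral>\<^sup>+x. (\<integral>\<^sup>+y. f (T x) * g (T x + y) \<partial>lborel) \<partial>lborel)"
      by (intro nn_integral_cong nn_integral_cmult[symmetric]) measurable
    also have "\<dots> = (\<integral>\<^sup>+y. (\<integral>\<^sup>+x. f (T x) * g (T x + y) \<partial>lborel) \<partial>lborel)"
      by (rule lborel_pair.Fubini') measurable
    also have "\<dots> = (\<integral>\<^sup>+y. (\<integral>\<^sup>+x. f (T x - y) * g (T x) \<partial>lborel) \<partial>lborel)"
    proof (rule nn_integral_cong)
      fix y
      show "(\<integral>\<^sup>+x. f (T x) * g (T x + y) \<partial>lborel) = (\<integral>\<^sup>+x. f (T x - y) * g (T x) \<partial>lborel)"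
        using shift[of "\<lambda>z. f (z - y) * g z" y] by simp
    qed
    also have "\<dots> = (\<integral>\<^sup>+x. (\<integral>\<^sup>+y. f (T x - y) * g (T x) \<partial>lborel) \<partial>lborel)"
      by (rule lborel_pair.Fubini'[symmetric]) measurable
    also have "\<dots> = (\<integral>\<^sup>+x. (\<integral>\<^sup>+y. f (T x - y) \<partial>lborel) * g (T x) \<partial>lborel)"
      by (intro nn_integral_cong nn_integral_multc) measurable
    also have "\<dots> = (\<integral>\<^sup>+x. g (T x) \<partial>lborel) * (\<integral>\<^sup>+y. f y \<partial>lborel)"
      by (simp add: nn_integral_lborel_minus nn_integral_cmult mult.commute)
    finally show ?thesis .
  qed
  show ?thesis
  proof (rule measure_eqI)
    fix A assume "A \<in> sets (distr lborel borel T)"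
    then have A[measurable]: "A \<in> sets borel" by simp
    let ?b = "emeasure lborel (cball 0 1 :: 'a set)"
    have b: "?b \<noteq> 0" "?b \<noteq> \<infinity>"
      using content_cball_pos[of 1 "0::'a"] emeasure_lborel_cball_finite[of "0::'a" 1]
      by (auto simp: measure_def)
    have 1: "(\<integral>\<^sup>+x. indicator (cball 0 1) (T x) \<partial>lborel) = ?b"
    proof -
      have "(\<integral>\<^sup>+x. indicator (cball 0 1) (T x) \<partial>lborel) = (\<integral>\<^sup>+x. indicator (cball 0 1 :: 'a set) x \<partial>lborel)"
        by (intro nn_integral_cong) (simp add: indicator_def orthogonal_transformation_norm[OF T])
      then show ?thesis by simp
    qed
    have 2: "emeasure (distr lborel borel T) A = (\<integral>\<^sup>+x. indicator A (T x) \<partial>lborel)"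
    proof -
      have "emeasure (distr lborel borel T) A = (\<integral>\<^sup>+x. indicator A x \<partial>distr lborel borel T)"
        by simp
      also have "\<dots> = (\<integral>\<^sup>+x. indicator A (T x) \<partial>lborel)" by (rule nn_integral_distr) auto
      finally show ?thesis .
    qed
    have "emeasure (distr lborel borel T) A * ?b = ?b * emeasure lborel A"
      using key[of "indicator A" "indicator (cball 0 1)"] A unfolding 1 2 by (simp add: borel_measurable_indicator)
    then show "emeasure (distr lborel borel T) A = emeasure lborel A"
      using b by (simp add: mult.commute[of _ ?b] ennreal_mult_cancel_left)
  qed simp
qed

section \<open>Uniform noise on the unit ball and its second moments\<close>

section \<open>The average over the unit ball\<close>

definition ballw :: "real^'m \<Rightarrow> real" where
  "ballw z = indicator (cball 0 1) z / measure lborel (cball 0 1 :: (real^'m) set)"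

definition bavg :: "(real^'m \<Rightarrow> real) \<Rightarrow> real" where
  "bavg f = wint ballw f"

lemma measure_unit_ball_pos: "0 < measure lborel (cball 0 1 :: (real^'m) set)"
  using content_cball_pos[of 1 "0::real^'m"] by simp

lemma weight_ballw: "weight 1 ballw"
  unfolding weight_def ballw_def
proof (intro conjI allI impI)
  show "continuous_on (cball 0 1) (\<lambda>z. indicator (cball 0 1) z / measure lborel (cball 0 1 :: (real^'m) set))"
    by (subst continuous_on_cong[OF refl, where g="\<lambda>_. 1 / measure lborel (cball 0 1 :: (real^'m) set)"])
      auto
qed auto

lemma ballw_nonneg: "0 \<le> ballw z"
  by (simp add: ballw_def)

lemma bavg_const [simp]: "bavg (\<lambda>_. c) = (c::real)"
proof -
  have "bavg (\<lambda>_::real^'m. c) = (LINT z|lborel. indicator (cball 0 1) (z::real^'m)) / measure lborel (cball 0 1 :: (real^'m) set) * c"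
    unfolding bavg_def wint_def ballw_def by simp
  also have "(LINT z|lborel. indicator (cball 0 1) (z::real^'m)) = measure lborel (cball 0 1 :: (real^'m) set)"
    by (simp add: emeasure_lborel_cball_finite)
  finally have "bavg (\<lambda>_::real^'m. c) = measure lborel (cball 0 1 :: (real^'m) set) / measure lborel (cball 0 1 :: (real^'m) set) * c" .
  also have "measure lborel (cball 0 1 :: (real^'m) set) / measure lborel (cball 0 1 :: (real^'m) set) * c = c" using measure_unit_ball_pos[where 'm='m] by (simp only: divide_self less_imp_neq[symmetric] mult_1 simp_thms)
  finally show ?thesis .
qed

lemma bavg_mono:
  assumes "continuous_on UNIV f" "continuous_on UNIV g" "\<And>z. norm z \<le> 1 \<Longrightarrow> f z \<le> g z"
  shows "bavg f \<le> bavg g"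
  unfolding bavg_def using assms
  by (intro wint_mono[OF weight_ballw ballw_nonneg]) (auto intro: continuous_on_subset)

lemma bavg_add:
  assumes "continuous_on UNIV f" "continuous_on UNIV g"
  shows "bavg (\<lambda>z. f z + g z) = bavg f + bavg g"
  unfolding bavg_def using assms by (intro wint_add[OF weight_ballw]) (auto intro: continuous_on_subset)

lemma bavg_diff:
  assumes "continuous_on UNIV f" "continuous_on UNIV g"
  shows "bavg (\<lambda>z. f z - g z) = bavg f - bavg g"
  unfolding bavg_def using assms by (intro wint_diff[OF weight_ballw]) (auto intro: continuous_on_subset)

lemma bavg_cmult: "bavg (\<lambda>z. c * f z) = c * bavg f"
  unfolding bavg_def by (rule wint_cmult)

lemma bavg_orthogonal:
  fixes f :: "real^'m \<Rightarrow> real" and T :: "real^'m \<Rightarrow> real^'m"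
  assumes T: "orthogonal_transformation T" and f: "continuous_on UNIV f"
  shows "bavg (\<lambda>z. f (T z)) = bavg f"
proof -
  have meas: "T \<in> borel_measurable borel"
    by (intro borel_measurable_continuous_onI linear_continuous_on
        linear_conv_bounded_linear[THEN iffD1] orthogonal_transformation_linear[OF T])
  have "bavg f = (LINT z|distr lborel borel T. ballw z * f z)"
    unfolding bavg_def wint_def lborel_distr_orthogonal[OF T] ..
  also have "\<dots> = (LINT z|lborel. ballw (T z) * f (T z))"
  proof (intro integral_distr)
    have "f \<in> borel_measurable borel" by (rule borel_measurable_continuous_onI[OF f])
    then show "(\<lambda>z. ballw z * f z) \<in> borel_measurable borel" unfolding ballw_def
      by (intro borel_measurable_times borel_measurable_divide borel_measurable_indicator borel_measurable_const) auto
  qed (use meas in simp)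
  also have "\<dots> = bavg (\<lambda>z. f (T z))"
    unfolding bavg_def wint_def ballw_def
    by (simp add: indicator_def orthogonal_transformation_norm[OF T])
  finally show ?thesis ..
qed

lemma bavg_odd:
  assumes "continuous_on UNIV f" "\<And>z. f (- z) = - f z"
  shows "bavg f = 0"
proof -
  have "orthogonal_transformation (\<lambda>z::real^'m. - z)" by (simp add: orthogonal_transformation_neg)
  from bavg_orthogonal[OF this assms(1)] have "bavg (\<lambda>z. - 1 * f z) = bavg f" by (simp add: assms(2))
  then show ?thesis unfolding bavg_cmult by simp
qed

text \<open>The variance of one coordinate under the uniform distribution on the unit ball; by
  rotation invariance the choice of the coordinate is immaterial. Its value is never computed, only
  its positivity matters.\<close>

definition bvar :: "'m::finite itself \<Rightarrow> real" where
  "bvar _ = bavg (\<lambda>z::real^'m. (z $ (SOME i. True))\<^sup>2)"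

lemma bavg_inner_sq:
  fixes a :: "real^'m"
  shows "bavg (\<lambda>z. (a \<bullet> z)\<^sup>2) = bvar TYPE('m) * (norm a)\<^sup>2"
proof -
  define e :: "real^'m" where "e = axis (SOME i. True) 1"
  have "norm a = norm (norm a *\<^sub>R e)" by (simp add: e_def)
  then obtain T where T: "orthogonal_transformation T" "T a = norm a *\<^sub>R e"
    using orthogonal_transformation_exists by blast
  have "a \<bullet> z = norm a *\<^sub>R e \<bullet> T z" for z
    using T unfolding orthogonal_transformation_def by metis
  then have "bavg (\<lambda>z. (a \<bullet> z)\<^sup>2) = bavg (\<lambda>z. (norm a *\<^sub>R e \<bullet> T z)\<^sup>2)" by simp
  also have "\<dots> = bavg (\<lambda>z. (norm a *\<^sub>R e \<bullet> z)\<^sup>2)"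
    by (rule bavg_orthogonal[OF T(1)]) (intro continuous_intros)
  also have "\<dots> = bavg (\<lambda>z::real^'m. (norm a)\<^sup>2 * (z $ (SOME i. True))\<^sup>2)"
    unfolding e_def inner_scaleR_left power_mult_distrib inner_axis' by (simp add: mult.assoc)
  finally show ?thesis by (simp add: bavg_cmult bvar_def mult.commute)
qed

lemma bvar_pos: "0 < bvar TYPE('m::finite)"
proof -
  define e :: "real^'m" where "e = axis (SOME i. True) 1"
  have c: "continuous_on UNIV (\<lambda>z::real^'m. (e \<bullet> z)\<^sup>2)" by (intro continuous_intros)
  have n: "norm e = 1" by (simp add: e_def)
  have bv: "bvar TYPE('m) = bavg (\<lambda>z. (e \<bullet> z)\<^sup>2)" by (simp add: bavg_inner_sq n)
  have ge: "0 \<le> bvar TYPE('m)"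
    unfolding bv using bavg_mono[OF _ c, of "\<lambda>_. 0"] by simp
  moreover have "bvar TYPE('m) \<noteq> 0"
  proof
    assume "bvar TYPE('m) = 0"
    then have "(LINT z|lborel. ballw z * (e \<bullet> z)\<^sup>2) = 0" by (simp add: bv bavg_def wint_def)
    moreover have "integrable lborel (\<lambda>z. ballw z * (e \<bullet> z)\<^sup>2)"
      by (intro weight_integrable[OF weight_ballw] continuous_intros)
    ultimately have "AE z in lborel. ballw z * (e \<bullet> z)\<^sup>2 = 0"
      by (subst (asm) integral_nonneg_eq_0_iff_AE) (auto simp: ballw_nonneg)
    then have "AE z in lborel. z \<notin> ball ((1/2) *\<^sub>R e) (1/2)"
    proof eventually_elim
      case (elim z)
      show ?case
      proof
        assume z: "z \<in> ball ((1/2) *\<^sub>R e) (1/2)"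
        then have d: "norm (z - (1/2) *\<^sub>R e) < 1/2" by (simp add: dist_norm norm_minus_commute)
        have "norm z \<le> norm (z - (1/2) *\<^sub>R e) + norm ((1/2) *\<^sub>R e)"
          by (metis add.commute diff_add_cancel norm_triangle_ineq)
        then have "norm z \<le> 1" using d n by simp
        then have "ballw z \<noteq> 0" using measure_unit_ball_pos[where 'm='m] by (simp add: ballw_def)
        then have "e \<bullet> z = 0" using elim by simp
        then have "\<bar>e \<bullet> (z - (1/2) *\<^sub>R e)\<bar> = 1/2" using n by (simp add: inner_diff_right norm_eq_1)
        moreover have "\<bar>e \<bullet> (z - (1/2) *\<^sub>R e)\<bar> \<le> norm e * norm (z - (1/2) *\<^sub>R e)" by (rule Cauchy_Schwarz_ineq2)
        ultimately show False using d n by simp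
      qed
    qed
    then have "emeasure lborel (ball ((1/2) *\<^sub>R e) (1/2)) = 0"
      by (subst (asm) AE_iff_measurable[of "ball ((1/2) *\<^sub>R e) (1/2)"]) (auto simp del: mem_ball)
    then have "measure lborel (ball ((1/2) *\<^sub>R e) (1/2)) = 0" by (simp add: measure_def)
    then show False using content_ball_pos[of "1/2" "(1/2) *\<^sub>R e"] by simp
  qed
  ultimately show ?thesis by linarith
qed

lemma bavg_inner_orthogonal:
  fixes a b :: "real^'m"
  assumes "a \<bullet> b = 0"
  shows "bavg (\<lambda>z. (a \<bullet> z) * (b \<bullet> z)) = 0"
proof -
  have "(a \<bullet> z) * (b \<bullet> z) = (1/4) * (((a + b) \<bullet> z)\<^sup>2 - ((a - b) \<bullet> z)\<^sup>2)" for z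
    by (simp add: inner_add_left inner_diff_left power2_eq_square algebra_simps)
  then have "bavg (\<lambda>z. (a \<bullet> z) * (b \<bullet> z)) = (1/4) * (bavg (\<lambda>z. ((a + b) \<bullet> z)\<^sup>2) - bavg (\<lambda>z. ((a - b) \<bullet> z)\<^sup>2))"
    by (simp only: bavg_cmult) (subst bavg_diff, auto intro!: continuous_intros)
  also have "norm (a + b) = norm (a - b)"
    using assms by (simp add: norm_eq_sqrt_inner inner_add inner_diff inner_commute)
  then have "bavg (\<lambda>z. ((a + b) \<bullet> z)\<^sup>2) - bavg (\<lambda>z. ((a - b) \<bullet> z)\<^sup>2) = 0"
    by (simp add: bavg_inner_sq)
  finally show ?thesis by simp
qed

section \<open>Monotone schemes for the least trace over a family of planes\<close>

section \<open>Two monotone schemes\<close>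

text \<open>The empty set counts as the zero plane, over which the trace is 0 and the noise
  vanishes; bases of the whole space are included too.\<close>

definition all_planes :: "(real^'m) set set" where
  "all_planes = {B. oset B}"

definition hyperplanes :: "(real^'m) set set" where
  "hyperplanes = {B. oset B \<and> card B + 1 = CARD('m)}"

text \<open>A discretisation of the flow driven by the least trace of the Hessian over the planes of
  the family. By the variance of the noise, a step of size \<open>h\<close> corresponds to the time
  \<open>h\<^sup>2 * bvar / 2\<close>.\<close>

fun scheme :: "(real^'m) set set \<Rightarrow> real \<Rightarrow> (real^'m \<Rightarrow> real) \<Rightarrow> nat \<Rightarrow> real^'m \<Rightarrow> real" where
  "scheme \<B> h f 0 x = f x"
| "scheme \<B> h f (Suc k) x = (INF B\<in>\<B>. bavg (\<lambda>\<xi>. scheme \<B> h f k (x + h *\<^sub>R prj B \<xi>)))"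

text \<open>The logarithm is Lipschitz with constant \<open>l\<close>. The class is stable under
  averages and infima, and it turns the estimates below into ones relative to the function itself,
  which may grow exponentially.\<close>

definition loglip :: "real \<Rightarrow> ('a::real_normed_vector \<Rightarrow> real) \<Rightarrow> bool" where
  "loglip l f \<longleftrightarrow> (\<forall>x. 0 < f x) \<and> (\<forall>x y. f x \<le> exp (l * norm (x - y)) * f y)"

lemma loglip_pos: "loglip l f \<Longrightarrow> 0 < f x"
  by (simp add: loglip_def)

lemma loglip_le: "loglip l f \<Longrightarrow> f x \<le> exp (l * norm (x - y)) * f y"
  by (simp add: loglip_def)

lemma loglip_continuous:
  assumes "loglip l f"
  shows "continuous_on UNIV f"
proof -
  have "ln (f x) - ln (f y) \<le> \<bar>l\<bar> * norm (x - y)" for x y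
  proof -
    have "ln (f x) \<le> ln (exp (l * norm (x - y)) * f y)"
      using loglip_le[OF assms] loglip_pos[OF assms] by (subst ln_le_cancel_iff) auto
    also have "\<dots> = l * norm (x - y) + ln (f y)"
      using loglip_pos[OF assms, of y] by (subst ln_mult) auto
    also have "l * norm (x - y) \<le> \<bar>l\<bar> * norm (x - y)" by (intro mult_right_mono) auto
    finally show ?thesis by simp
  qed
  from this[of x y for x y] this[of y x for x y]
  have "dist (ln (f x)) (ln (f y)) \<le> \<bar>l\<bar> * dist x y" for x y
    by (fastforce simp: dist_norm norm_minus_commute abs_le_iff)
  then have "continuous_on UNIV (\<lambda>x. ln (f x))"
    by (intro lipschitz_on_continuous_on[of "\<bar>l\<bar>"] lipschitz_onI) auto
  then have "continuous_on UNIV (\<lambda>x. exp (ln (f x)))" by (rule continuous_on_exp)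
  then show ?thesis using loglip_pos[OF assms] by simp
qed

lemma continuous_on_prj [continuous_intros]:
  "continuous_on S f \<Longrightarrow> continuous_on S (\<lambda>x. prj B (f x))"
  by (rule continuous_on_compose2[of UNIV "prj B"])
    (auto intro!: linear_continuous_on linear_conv_bounded_linear[THEN iffD1] linear_prj)

lemma norm_step_le:
  assumes "oset B" "norm \<xi> \<le> 1" "0 \<le> h"
  shows "norm (h *\<^sub>R prj B \<xi>) \<le> h"
  using norm_prj_le[OF assms(1), of \<xi>] assms by (simp add: mult_left_le)

lemma continuous_step:
  assumes "continuous_on UNIV (f :: real^'m \<Rightarrow> real)"
  shows "continuous_on UNIV (\<lambda>\<xi>. f (x + h *\<^sub>R prj B \<xi>))"
  by (rule continuous_on_compose2[OF assms]) (auto intro!: continuous_intros)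

lemma bavg_step_bounds:
  fixes f :: "real^'m \<Rightarrow> real"
  assumes f: "loglip l f" and "0 \<le> l" "0 \<le> h" "oset B"
  shows "exp (- (l * h)) * f x \<le> bavg (\<lambda>\<xi>. f (x + h *\<^sub>R prj B \<xi>))"
    and "bavg (\<lambda>\<xi>. f (x + h *\<^sub>R prj B \<xi>)) \<le> exp (l * h) * f x"
proof -
  note c = continuous_step[OF loglip_continuous[OF f], of x h B]
  have 1: "exp (- (l * h)) * f x \<le> f (x + h *\<^sub>R prj B \<xi>)" and 2: "f (x + h *\<^sub>R prj B \<xi>) \<le> exp (l * h) * f x"
    if "norm \<xi> \<le> 1" for \<xi>
  proof -
    have n: "norm (h *\<^sub>R prj B \<xi>) \<le> h" using norm_step_le assms that by blast
    then have e: "exp (l * norm (h *\<^sub>R prj B \<xi>)) \<le> exp (l * h)" using assms(2) by (simp add: mult_left_mono)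
    have "f x \<le> exp (l * norm (h *\<^sub>R prj B \<xi>)) * f (x + h *\<^sub>R prj B \<xi>)"
      using loglip_le[OF f, of x "x + h *\<^sub>R prj B \<xi>"] by simp
    also have "\<dots> \<le> exp (l * h) * f (x + h *\<^sub>R prj B \<xi>)"
      using e loglip_pos[OF f] by (intro mult_right_mono) (auto simp: less_imp_le)
    finally show "exp (- (l * h)) * f x \<le> f (x + h *\<^sub>R prj B \<xi>)"
      by (simp add: exp_minus field_simps)
    have "f (x + h *\<^sub>R prj B \<xi>) \<le> exp (l * norm (h *\<^sub>R prj B \<xi>)) * f x"
      using loglip_le[OF f, of "x + h *\<^sub>R prj B \<xi>" x] by simp
    also have "\<dots> \<le> exp (l * h) * f x"
      using e loglip_pos[OF f] by (intro mult_right_mono) (auto simp: less_imp_le)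
    finally show "f (x + h *\<^sub>R prj B \<xi>) \<le> exp (l * h) * f x" .
  qed
  show "exp (- (l * h)) * f x \<le> bavg (\<lambda>\<xi>. f (x + h *\<^sub>R prj B \<xi>))"
    using bavg_mono[OF continuous_on_const c 1] by simp
  show "bavg (\<lambda>\<xi>. f (x + h *\<^sub>R prj B \<xi>)) \<le> exp (l * h) * f x"
    using bavg_mono[OF c continuous_on_const 2] by simp
qed

text \<open>One step multiplies by a factor between \<open>exp (- (l * h))\<close> and
  \<open>exp (l * h)\<close>; hence the infimum is over a set that is bounded below, and it remains
  positive. The step commutes with translations, so the Lipschitz constant of the logarithm does not
  deteriorate.\<close>

lemma
  fixes f :: "real^'m \<Rightarrow> real"
  assumes f: "loglip l f" and l: "0 \<le> l" and h: "0 \<le> h" and B: "\<B> \<noteq> {}" "\<B> \<subseteq> all_planes"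
  shows loglip_scheme: "loglip l (scheme \<B> h f k)"
    and scheme_le: "A \<in> \<B> \<Longrightarrow> scheme \<B> h f (Suc k) x \<le> bavg (\<lambda>\<xi>. scheme \<B> h f k (x + h *\<^sub>R prj A \<xi>))"
    and scheme_ge_exp: "exp (- (l * h)) * scheme \<B> h f k x \<le> scheme \<B> h f (Suc k) x"
    and scheme_le_exp: "scheme \<B> h f (Suc k) x \<le> exp (l * h) * scheme \<B> h f k x"
proof -
  have os: "oset A" if "A \<in> \<B>" for A using B(2) that by (auto simp: all_planes_def)
  have step: "(\<forall>A\<in>\<B>. scheme \<B> h f (Suc k) x \<le> bavg (\<lambda>\<xi>. scheme \<B> h f k (x + h *\<^sub>R prj A \<xi>))) \<and>
      exp (- (l * h)) * scheme \<B> h f k x \<le> scheme \<B> h f (Suc k) x"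
    if L: "loglip l (scheme \<B> h f k)" for k x
  proof -
    note lb = bavg_step_bounds(1)[OF L l h os, of _ x]
    have "bdd_below ((\<lambda>A. bavg (\<lambda>\<xi>. scheme \<B> h f k (x + h *\<^sub>R prj A \<xi>))) ` \<B>)"
      using lb by (intro bdd_belowI2) auto
    then show ?thesis
      using lb B(1) by (auto intro!: cINF_lower cINF_greatest)
  qed
  show L: "loglip l (scheme \<B> h f k)" for k
  proof (induction k)
    case 0
    then show ?case using f by (simp add: loglip_def)
  next
    case (Suc k)
    note c = loglip_continuous[OF Suc]
    have pos: "0 < scheme \<B> h f (Suc k) x" for x
    proof -
      have "0 < exp (- (l * h)) * scheme \<B> h f k x" using loglip_pos[OF Suc] by simp
      also have "\<dots> \<le> scheme \<B> h f (Suc k) x" using step[OF Suc] by blast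
      finally show ?thesis .
    qed
    have "scheme \<B> h f (Suc k) x \<le> exp (l * norm (x - y)) * scheme \<B> h f (Suc k) y" for x y
    proof -
      have "exp (- (l * norm (x - y))) * scheme \<B> h f (Suc k) x \<le> bavg (\<lambda>\<xi>. scheme \<B> h f k (y + h *\<^sub>R prj A \<xi>))"
        if A: "A \<in> \<B>" for A
      proof -
        have "scheme \<B> h f (Suc k) x \<le> bavg (\<lambda>\<xi>. scheme \<B> h f k (x + h *\<^sub>R prj A \<xi>))"
          using step[OF Suc] A by blast
        also have "\<dots> \<le> bavg (\<lambda>\<xi>. exp (l * norm (x - y)) * scheme \<B> h f k (y + h *\<^sub>R prj A \<xi>))"
        proof (rule bavg_mono)
          fix z show "scheme \<B> h f k (x + h *\<^sub>R prj A z) \<le> exp (l * norm (x - y)) * scheme \<B> h f k (y + h *\<^sub>R prj A z)"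
            using loglip_le[OF Suc, of "x + h *\<^sub>R prj A z" "y + h *\<^sub>R prj A z"] by simp
        qed (auto intro!: continuous_intros continuous_step c)
        finally show ?thesis unfolding bavg_cmult by (simp add: exp_minus field_simps)
      qed
      then have "exp (- (l * norm (x - y))) * scheme \<B> h f (Suc k) x \<le> scheme \<B> h f (Suc k) y"
        using B(1) by (simp only: scheme.simps(2)) (rule cINF_greatest, auto)
      then show ?thesis by (simp add: exp_minus field_simps)
    qed
    with pos show ?case by (simp only: loglip_def)  blast
  qed
  show "A \<in> \<B> \<Longrightarrow> scheme \<B> h f (Suc k) x \<le> bavg (\<lambda>\<xi>. scheme \<B> h f k (x + h *\<^sub>R prj A \<xi>))"
    using step[OF L] by blast
  show "exp (- (l * h)) * scheme \<B> h f k x \<le> scheme \<B> h f (Suc k) x"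
    using step[OF L] by blast
  obtain A where A: "A \<in> \<B>" using B(1) by blast
  show "scheme \<B> h f (Suc k) x \<le> exp (l * h) * scheme \<B> h f k x"
    using step[OF L, of k x] A bavg_step_bounds(2)[OF L l h os[OF A], of k x] by force
qed

section \<open>Coupling the noises of three planes\<close>

section \<open>Coupling\<close>

text \<open>The square of Hoelder's inequality with exponents 2, 4 and 4. After division by the
  averages it is the integrated inequality of arithmetic and geometric means; \<open>N\<close>
  restores the normalisation.\<close>

lemma bavg_holder:
  fixes f g1 g2 :: "real^'m \<Rightarrow> real"
  assumes c: "continuous_on UNIV f" "continuous_on UNIV g1" "continuous_on UNIV g2"
    and pos: "\<And>x. 0 < f x" "\<And>x. 0 < g1 x" "\<And>x. 0 < g2 x"
    and b: "0 < bavg f" "0 < bavg g1" "0 < bavg g2"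
  shows "(bavg (\<lambda>\<xi>. sqrt (f \<xi> * sqrt (g1 \<xi> * g2 \<xi>))))\<^sup>2 \<le> bavg f * sqrt (bavg g1 * bavg g2)"
proof -
  define N where "N = sqrt (bavg f * sqrt (bavg g1 * bavg g2))"
  have N: "0 < N" "N\<^sup>2 = bavg f * sqrt (bavg g1 * bavg g2)" using b by (auto simp: N_def)
  let ?r = "\<lambda>\<xi>. N * ((1/2) * (1 / bavg f * f \<xi>) + ((1/4) * (1 / bavg g1 * g1 \<xi>) + (1/4) * (1 / bavg g2 * g2 \<xi>)))"
  have "bavg (\<lambda>\<xi>. sqrt (f \<xi> * sqrt (g1 \<xi> * g2 \<xi>))) \<le> bavg ?r"
  proof (rule bavg_mono)
    fix x
    let ?s = "sqrt ((1 / bavg g1 * g1 x) * (1 / bavg g2 * g2 x))"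
    have "sqrt (f x * sqrt (g1 x * g2 x)) = N * sqrt ((1 / bavg f * f x) * ?s)"
      unfolding N_def real_sqrt_mult[symmetric] using b by (simp add: real_sqrt_mult real_sqrt_divide field_simps)
    also have "sqrt ((1 / bavg f * f x) * ?s) \<le> ((1 / bavg f * f x) + ?s) / 2"
      using b pos by (intro arith_geo_mean_sqrt) (auto simp: less_imp_le)
    also have "?s \<le> ((1 / bavg g1 * g1 x) + (1 / bavg g2 * g2 x)) / 2"
      using b pos by (intro arith_geo_mean_sqrt) (auto simp: less_imp_le)
    finally have "sqrt (f x * sqrt (g1 x * g2 x)) \<le> N * ((1 / bavg f * f x + (1 / bavg g1 * g1 x + 1 / bavg g2 * g2 x) / 2) / 2)"
      using N by (simp add: mult_left_mono)
    moreover have "N * ((p + (q + s) / 2) / 2) = N * ((1/2) * p + ((1/4) * q + (1/4) * s))" for p q s :: real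
      by (simp add: algebra_simps)
    ultimately show "sqrt (f x * sqrt (g1 x * g2 x)) \<le> ?r x" by metis
  qed (use b in \<open>auto intro!: continuous_intros c\<close>)
  also have "bavg ?r = N"
  proof -
    have "bavg f \<noteq> 0" "bavg g1 \<noteq> 0" "bavg g2 \<noteq> 0" using b by auto
    then show ?thesis
      unfolding bavg_cmult
      by (subst bavg_add, (intro continuous_intros c)+, subst bavg_add, (intro continuous_intros c)+)
         (simp only: bavg_cmult divide_inverse mult_1 left_inverse, simp)
  qed
  finally have "bavg (\<lambda>\<xi>. sqrt (f \<xi> * sqrt (g1 \<xi> * g2 \<xi>))) \<le> N" .
  moreover have "0 \<le> bavg (\<lambda>\<xi>. sqrt (f \<xi> * sqrt (g1 \<xi> * g2 \<xi>)))"
  proof -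
    have "continuous_on UNIV (\<lambda>\<xi>. sqrt (f \<xi> * sqrt (g1 \<xi> * g2 \<xi>)))" by (intro continuous_intros c)
    from bavg_mono[OF continuous_on_const[of _ 0] this] show ?thesis using pos by (simp add: less_imp_le)
  qed
  ultimately show ?thesis unfolding N(2)[symmetric] by (intro power_mono)
qed

text \<open>Only the first-order term is kept exactly; it is odd in \<open>k\<close> and will
  disappear under an average. The 10 is the 2 of the cross term plus the 8 from the square of
  \<open>2 * (z \<bullet> k) + (norm k)\<^sup>2\<close>.\<close>

lemma quartic_expand:
  fixes z k :: "'a::real_inner"
  shows "norm (z + k) ^ 4 \<le> norm z ^ 4 + 4 * (norm z)\<^sup>2 * (z \<bullet> k) + 10 * (norm z)\<^sup>2 * (norm k)\<^sup>2 + 2 * norm k ^ 4"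
proof -
  have e: "(norm (z + k))\<^sup>2 = (norm z)\<^sup>2 + (2 * (z \<bullet> k) + (norm k)\<^sup>2)"
    by (simp add: power2_norm_eq_inner inner_add inner_commute)
  have "norm (z + k) ^ 4 = ((norm (z + k))\<^sup>2)\<^sup>2" by (simp flip: power_mult)
  also have "\<dots> = norm z ^ 4 + 2 * (norm z)\<^sup>2 * (2 * (z \<bullet> k) + (norm k)\<^sup>2) + (2 * (z \<bullet> k) + (norm k)\<^sup>2)\<^sup>2"
    unfolding e power2_sum by (simp flip: power_mult)
  also have "(2 * (z \<bullet> k) + (norm k)\<^sup>2)\<^sup>2 \<le> 8 * (z \<bullet> k)\<^sup>2 + 2 * norm k ^ 4"
    using sum_squares_ge_zero[of "2 * (z \<bullet> k) - (norm k)\<^sup>2" 0]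
    by (simp add: power2_eq_square power4_eq_xxxx algebra_simps)
  also have "(z \<bullet> k)\<^sup>2 \<le> (norm z)\<^sup>2 * (norm k)\<^sup>2"
    using Cauchy_Schwarz_ineq[of z k] by (simp add: power2_norm_eq_inner)
  finally show ?thesis by (simp add: algebra_simps)
qed

text \<open>The bound \<open>exp x \<ge> 1 + x\<close> leaves a linear term that is odd in the noise
  and averages to zero. Two bounds on the noise are kept apart because only \<open>s\<close>, which
  a good coupling makes small, is multiplied by \<open>(norm z)\<^sup>2\<close>; the crude bound 2
  produces the constant 32.\<close>

lemma bavg_exp_quartic_jensen:
  fixes \<eta> :: "real^'m \<Rightarrow> real^'m"
  assumes lin: "linear \<eta>" and b: "\<And>\<xi>. norm \<xi> \<le> 1 \<Longrightarrow> norm (\<eta> \<xi>) \<le> s" "\<And>\<xi>. norm \<xi> \<le> 1 \<Longrightarrow> norm (\<eta> \<xi>) \<le> 2"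
    and r: "0 \<le> r" and h: "0 \<le> h"
  shows "exp (- r * (norm z ^ 4 + h\<^sup>2 * (10 * (norm z)\<^sup>2 * s\<^sup>2 + 32 * h\<^sup>2)))
    \<le> bavg (\<lambda>\<xi>. exp (- r * norm (z + h *\<^sub>R \<eta> \<xi>) ^ 4))" (is "exp (- r * ?D) \<le> _")
proof -
  have c: "continuous_on UNIV \<eta>" by (intro linear_continuous_on linear_conv_bounded_linear[THEN iffD1] lin)
  define q where "q \<xi> = 4 * (norm z)\<^sup>2 * (z \<bullet> (h *\<^sub>R \<eta> \<xi>))" for \<xi>
  have cq: "continuous_on UNIV q" unfolding q_def by (intro continuous_intros c)
  have "bavg q = 0"
    by (rule bavg_odd[OF cq]) (simp add: q_def linear_neg[OF lin])
  then have "exp (- r * ?D) = bavg (\<lambda>\<xi>. exp (- r * ?D) * (1 + (- r) * q \<xi>))"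
    unfolding bavg_cmult by (subst bavg_add) (auto intro!: continuous_intros cq simp: bavg_cmult[of "- r" q, simplified])
  also have "\<dots> \<le> bavg (\<lambda>\<xi>. exp (- r * norm (z + h *\<^sub>R \<eta> \<xi>) ^ 4))"
  proof (rule bavg_mono)
    fix \<xi> :: "real^'m" assume \<xi>: "norm \<xi> \<le> 1"
    have n: "norm (h *\<^sub>R \<eta> \<xi>) \<le> h * s" "norm (h *\<^sub>R \<eta> \<xi>) \<le> h * 2" using b[OF \<xi>] h by (auto simp: mult_left_mono)
    have n1: "(norm (h *\<^sub>R \<eta> \<xi>))\<^sup>2 \<le> (h * s)\<^sup>2" by (intro power_mono n) auto
    have n2: "norm (h *\<^sub>R \<eta> \<xi>) ^ 4 \<le> (h * 2) ^ 4" by (intro power_mono n) auto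
    have "norm (z + h *\<^sub>R \<eta> \<xi>) ^ 4 \<le> norm z ^ 4 + q \<xi> + 10 * (norm z)\<^sup>2 * (norm (h *\<^sub>R \<eta> \<xi>))\<^sup>2 + 2 * norm (h *\<^sub>R \<eta> \<xi>) ^ 4"
      unfolding q_def by (rule quartic_expand)
    also have "\<dots> \<le> norm z ^ 4 + q \<xi> + 10 * (norm z)\<^sup>2 * (h * s)\<^sup>2 + 2 * (h * 2) ^ 4"
      using n1 n2 by (intro add_mono mult_left_mono order_refl) auto
    also have "\<dots> = ?D + q \<xi>" by (simp add: power_mult_distrib power2_eq_square power4_eq_xxxx algebra_simps)
    finally have "- r * (?D + q \<xi>) \<le> - r * norm (z + h *\<^sub>R \<eta> \<xi>) ^ 4"
      using r by (simp add: mult_left_mono)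
    then have "exp (- r * ?D) * exp (- r * q \<xi>) \<le> exp (- r * norm (z + h *\<^sub>R \<eta> \<xi>) ^ 4)"
      by (simp add: exp_add[symmetric] algebra_simps)
    moreover have "exp (- r * ?D) * (1 + (- r) * q \<xi>) \<le> exp (- r * ?D) * exp (- r * q \<xi>)"
      by (intro mult_left_mono exp_ge_add_one_self) auto
    ultimately show "exp (- r * ?D) * (1 + (- r) * q \<xi>) \<le> exp (- r * norm (z + h *\<^sub>R \<eta> \<xi>) ^ 4)" by linarith
  qed (auto intro!: continuous_intros c cq)
  finally show ?thesis .
qed

lemma exp_add_exp_minus_ge: "2 + x\<^sup>2 \<le> exp x + exp (- x)" for x :: real
proof -
  have pos: "2 + x\<^sup>2 \<le> exp x + exp (- x)" if x: "0 \<le> x" for x :: real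
  proof -
    let ?f = "\<lambda>x::real. exp x + exp (- x) - (2 + x\<^sup>2)"
    let ?g = "\<lambda>x::real. exp x - exp (- x) - 2 * x"
    have g: "0 \<le> ?g y" if "0 \<le> y" for y
    proof -
      have "?g 0 \<le> ?g y"
      proof (rule DERIV_nonneg_imp_nondecreasing[OF that])
        fix t :: real
        have "(?g has_real_derivative exp t + exp (- t) - 2) (at t)"
          by (auto intro!: derivative_eq_intros)
        moreover have "0 \<le> exp t + exp (- t) - 2"
          using exp_ge_add_one_self[of t] exp_ge_add_one_self[of "- t"] by linarith
        ultimately show "\<exists>y. (?g has_real_derivative y) (at t) \<and> 0 \<le> y" by blast
      qed
      then show ?thesis by simp
    qed
    have "?f 0 \<le> ?f x"
    proof (rule DERIV_nonneg_imp_nondecreasing[OF x])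
      fix t :: real assume t: "0 \<le> t"
      have "(?f has_real_derivative ?g t) (at t)"
        by (auto intro!: derivative_eq_intros)
      with g[OF t] show "\<exists>y. (?f has_real_derivative y) (at t) \<and> 0 \<le> y" by blast
    qed
    then show ?thesis by simp
  qed
  show ?thesis using pos[of x] pos[of "- x"] by (cases "0 \<le> x") auto
qed

text \<open>Here the noise does move along \<open>z\<close>, and the strict convexity of the
  exponential gives a gain: pairing \<xi> with its negative replaces \<open>1 + x\<close> by half of
  \<open>exp x + exp (- x)\<close>, which is at least \<open>1 + x\<^sup>2 / 2\<close>. The gain is
  quadratic in \<open>r\<close>, whereas the loss in the exponent is linear in
  \<open>r\<close>.\<close>

lemma bavg_exp_quartic_gain:
  fixes \<eta> :: "real^'m \<Rightarrow> real^'m"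
  assumes lin: "linear \<eta>" and b: "\<And>\<xi>. norm \<xi> \<le> 1 \<Longrightarrow> norm (\<eta> \<xi>) \<le> 2"
    and e: "\<And>\<xi>. z \<bullet> \<eta> \<xi> = t * (e \<bullet> \<xi>)" "norm e = 1"
    and r: "0 \<le> r" and h: "0 \<le> h"
  shows "exp (- r * (norm z ^ 4 + h\<^sup>2 * (40 * (norm z)\<^sup>2 + 32 * h\<^sup>2))) * (1 + (r * (4 * (norm z)\<^sup>2 * h * t))\<^sup>2 * bvar TYPE('m) / 2)
    \<le> bavg (\<lambda>\<xi>. exp (- r * norm (z + h *\<^sub>R \<eta> \<xi>) ^ 4))" (is "exp (- r * ?D) * _ \<le> _")
proof -
  have c: "continuous_on UNIV \<eta>" by (intro linear_continuous_on linear_conv_bounded_linear[THEN iffD1] lin)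
  let ?F = "\<lambda>\<xi>. exp (- r * norm (z + h *\<^sub>R \<eta> \<xi>) ^ 4)"
  define y where "y = r * (4 * (norm z)\<^sup>2 * h * t)"
  have low: "exp (- r * ?D) * exp (- (y * (e \<bullet> \<xi>))) \<le> ?F \<xi>" if \<xi>: "norm \<xi> \<le> 1" for \<xi>
  proof -
    have n: "norm (h *\<^sub>R \<eta> \<xi>) \<le> h * 2" using b[OF \<xi>] h by (auto simp: mult_left_mono)
    have n1: "(norm (h *\<^sub>R \<eta> \<xi>))\<^sup>2 \<le> (h * 2)\<^sup>2" by (intro power_mono n) auto
    have n2: "norm (h *\<^sub>R \<eta> \<xi>) ^ 4 \<le> (h * 2) ^ 4" by (intro power_mono n) auto
    have "norm (z + h *\<^sub>R \<eta> \<xi>) ^ 4 \<le> norm z ^ 4 + 4 * (norm z)\<^sup>2 * (z \<bullet> (h *\<^sub>R \<eta> \<xi>)) + 10 * (norm z)\<^sup>2 * (norm (h *\<^sub>R \<eta> \<xi>))\<^sup>2 + 2 * norm (h *\<^sub>R \<eta> \<xi>) ^ 4"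
      by (rule quartic_expand)
    also have "\<dots> \<le> norm z ^ 4 + 4 * (norm z)\<^sup>2 * (z \<bullet> (h *\<^sub>R \<eta> \<xi>)) + 10 * (norm z)\<^sup>2 * (h * 2)\<^sup>2 + 2 * (h * 2) ^ 4"
      using n1 n2 by (intro add_mono mult_left_mono order_refl) auto
    also have "\<dots> = ?D + 4 * (norm z)\<^sup>2 * h * t * (e \<bullet> \<xi>)"
      by (simp add: e power2_eq_square power4_eq_xxxx algebra_simps)
    finally have "- r * (?D + 4 * (norm z)\<^sup>2 * h * t * (e \<bullet> \<xi>)) \<le> - r * norm (z + h *\<^sub>R \<eta> \<xi>) ^ 4"
      using r by (simp add: mult_left_mono)
    then show ?thesis
      by (simp add: exp_add[symmetric] y_def algebra_simps)
  qed
  have neg: "orthogonal_transformation (\<lambda>z::real^'m. - z)" by (simp add: orthogonal_transformation_neg)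
  have cF: "continuous_on UNIV ?F" by (intro continuous_intros c)
  have "exp (- r * ?D) * (2 + y\<^sup>2 * bvar TYPE('m)) = bavg (\<lambda>\<xi>. exp (- r * ?D) * (2 + y\<^sup>2 * (e \<bullet> \<xi>)\<^sup>2))"
    unfolding bavg_cmult
    by (subst bavg_add) (auto intro!: continuous_intros simp: bavg_cmult bavg_inner_sq e(2))
  also have "\<dots> \<le> bavg (\<lambda>\<xi>. ?F \<xi> + ?F (- \<xi>))"
  proof (rule bavg_mono)
    fix \<xi> :: "real^'m" assume \<xi>: "norm \<xi> \<le> 1"
    have "exp (- r * ?D) * (2 + y\<^sup>2 * (e \<bullet> \<xi>)\<^sup>2) \<le> exp (- r * ?D) * (exp (y * (e \<bullet> \<xi>)) + exp (- (y * (e \<bullet> \<xi>))))"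
      using exp_add_exp_minus_ge[of "y * (e \<bullet> \<xi>)"] by (intro mult_left_mono) (auto simp: power_mult_distrib)
    also have "\<dots> = exp (- r * ?D) * exp (- (y * (e \<bullet> (- \<xi>)))) + exp (- r * ?D) * exp (- (y * (e \<bullet> \<xi>)))"
      unfolding distrib_left by (simp only: inner_minus_right mult_minus_right minus_minus)
    also have "\<dots> \<le> ?F (- \<xi>) + ?F \<xi>"
      using low[OF \<xi>] low[of "- \<xi>"] \<xi> by (intro add_mono) (auto simp only: norm_minus_cancel)
    finally show "exp (- r * ?D) * (2 + y\<^sup>2 * (e \<bullet> \<xi>)\<^sup>2) \<le> ?F \<xi> + ?F (- \<xi>)" by simp
  next
    show "continuous_on UNIV (\<lambda>\<xi>. ?F \<xi> + ?F (- \<xi>))"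
      by (intro continuous_intros c continuous_on_compose2[OF c]) auto
  qed (auto intro!: continuous_intros)
  also have "\<dots> = 2 * bavg ?F"
    using bavg_orthogonal[OF neg cF]
    by (subst bavg_add) (auto intro!: continuous_intros c continuous_on_compose2[OF c])
  finally show ?thesis unfolding y_def by (simp add: algebra_simps)
qed

text \<open>A unit vector that is almost orthogonal to the hyperplane with normal \<nu> is close to
  \<nu> or to its negative. The sign is irrelevant for the rank-one projections, and these are all
  that distinguishes two hyperplane projections.\<close>

lemma rank_one_close:
  fixes u \<nu> :: "'a::real_inner"
  assumes "norm u = 1" "norm \<nu> = 1" "norm (u - (\<nu> \<bullet> u) *\<^sub>R \<nu>) \<le> \<epsilon>"
  obtains \<nu>' where "norm (\<nu>' - u) \<le> 2 * \<epsilon>" "\<nu>' = \<nu> \<or> \<nu>' = - \<nu>"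
    "\<And>\<xi>. norm ((\<nu> \<bullet> \<xi>) *\<^sub>R \<nu> - (u \<bullet> \<xi>) *\<^sub>R u) \<le> 4 * \<epsilon> * norm \<xi>"
proof -
  define \<nu>' where "\<nu>' = (if \<nu> \<bullet> u \<ge> 0 then \<nu> else - \<nu>)"
  define d where "d = \<nu>' \<bullet> u"
  have d: "0 \<le> d" "d\<^sup>2 = (\<nu> \<bullet> u)\<^sup>2" by (auto simp: d_def \<nu>'_def power2_eq_square)
  have n': "norm \<nu>' = 1" using assms by (simp add: \<nu>'_def)
  have d1: "d \<le> 1" using norm_cauchy_schwarz[of \<nu>' u] n' assms by (simp add: d_def)
  have "(norm (u - (\<nu> \<bullet> u) *\<^sub>R \<nu>))\<^sup>2 = 1 - d\<^sup>2"
    using assms(1,2) d(2) unfolding power2_norm_eq_inner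
    by (simp add: inner_diff inner_commute power2_eq_square norm_eq_1)
  then have 1: "1 - d\<^sup>2 \<le> \<epsilon>\<^sup>2" using power_mono[OF assms(3), of 2] by simp
  have "(norm (\<nu>' - u))\<^sup>2 = 2 - 2 * d"
    using assms(1) n' unfolding power2_norm_eq_inner d_def
    by (simp add: inner_diff inner_commute norm_eq_1)
  also have "\<dots> \<le> 2 * (1 - d\<^sup>2)" using mult_left_le[OF d1 d(1)] by (simp add: power2_eq_square)
  also have "\<dots> \<le> (2 * \<epsilon>)\<^sup>2" using 1 by (simp add: power_mult_distrib) (smt (verit) zero_le_power2)
  finally have close: "norm (\<nu>' - u) \<le> 2 * \<epsilon>"
    using order_trans[OF norm_ge_zero assms(3)] by (intro power2_le_imp_le[of "norm (\<nu>' - u)"]) auto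
  have "norm ((\<nu> \<bullet> \<xi>) *\<^sub>R \<nu> - (u \<bullet> \<xi>) *\<^sub>R u) \<le> 4 * \<epsilon> * norm \<xi>" for \<xi>
  proof -
    have "(\<nu> \<bullet> \<xi>) *\<^sub>R \<nu> - (u \<bullet> \<xi>) *\<^sub>R u = (\<nu>' \<bullet> \<xi>) *\<^sub>R (\<nu>' - u) + ((\<nu>' - u) \<bullet> \<xi>) *\<^sub>R u"
      by (auto simp: \<nu>'_def algebra_simps inner_diff_left inner_add_left)
    also have "norm \<dots> \<le> norm ((\<nu>' \<bullet> \<xi>) *\<^sub>R (\<nu>' - u)) + norm (((\<nu>' - u) \<bullet> \<xi>) *\<^sub>R u)" by (rule norm_triangle_ineq)
    also have "\<dots> = \<bar>\<nu>' \<bullet> \<xi>\<bar> * norm (\<nu>' - u) + \<bar>(\<nu>' - u) \<bullet> \<xi>\<bar>" using assms by simp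
    also have "\<dots> \<le> (norm \<nu>' * norm \<xi>) * norm (\<nu>' - u) + norm (\<nu>' - u) * norm \<xi>"
      by (intro add_mono mult_right_mono Cauchy_Schwarz_ineq2) auto
    also have "\<dots> = 2 * norm (\<nu>' - u) * norm \<xi>" using n' by simp
    also have "\<dots> \<le> 2 * (2 * \<epsilon>) * norm \<xi>" by (intro mult_right_mono mult_left_mono close) auto
    finally show ?thesis by simp
  qed
  with close that show ?thesis by (auto simp: \<nu>'_def split: if_splits)
qed

text \<open>If all three planes are nearly orthogonal to \<open>u\<close>, then reflecting the second noise in the
  first plane makes the average of the two hyperplane noises nearly equal to the noise in the
  plane.\<close>

lemma coupling_reflection:
  fixes B B1 B2 :: "(real^'m) set"
  assumes B: "oset B" "B1 \<in> hyperplanes" "B2 \<in> hyperplanes" and u: "norm u = 1"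
    and e: "norm (prj B u) \<le> \<epsilon>" "norm (prj B1 u) \<le> \<epsilon>" "norm (prj B2 u) \<le> \<epsilon>" and \<xi>: "norm \<xi> \<le> 1"
  shows "norm (prj B \<xi> - (1/2) *\<^sub>R prj B1 \<xi> - (1/2) *\<^sub>R prj B2 (2 *\<^sub>R prj B \<xi> - \<xi>)) \<le> 7 * \<epsilon>"
proof -
  obtain \<nu>1 where n1: "norm \<nu>1 = 1" "\<And>x. prj B1 x = x - (\<nu>1 \<bullet> x) *\<^sub>R \<nu>1"
    using oset_complement_vector[of B1] B by (auto simp: hyperplanes_def)
  obtain \<nu>2 where n2: "norm \<nu>2 = 1" "\<And>x. prj B2 x = x - (\<nu>2 \<bullet> x) *\<^sub>R \<nu>2"
    using oset_complement_vector[of B2] B by (auto simp: hyperplanes_def)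
  have e0: "0 \<le> \<epsilon>" using e(1) norm_ge_zero order_trans by blast
  obtain \<nu>1' where c1: "\<And>\<xi>. norm ((\<nu>1 \<bullet> \<xi>) *\<^sub>R \<nu>1 - (u \<bullet> \<xi>) *\<^sub>R u) \<le> 4 * \<epsilon> * norm \<xi>"
    using rank_one_close[OF u n1(1)] e(2) by (metis n1(2))
  obtain \<nu>2' where c2: "\<And>\<xi>. norm ((\<nu>2 \<bullet> \<xi>) *\<^sub>R \<nu>2 - (u \<bullet> \<xi>) *\<^sub>R u) \<le> 4 * \<epsilon> * norm \<xi>"
    and c2': "norm (\<nu>2' - u) \<le> 2 * \<epsilon>" "\<nu>2' = \<nu>2 \<or> \<nu>2' = - \<nu>2"
    using rank_one_close[OF u n2(1)] e(3) by (metis n2(2))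
  have "norm (prj B \<nu>2) = norm (prj B \<nu>2')" using c2'(2) by (auto simp: prj_minus)
  also have "\<dots> = norm (prj B u + prj B (\<nu>2' - u))" by (simp add: prj_add[symmetric])
  also have "\<dots> \<le> norm (prj B u) + norm (prj B (\<nu>2' - u))" by (rule norm_triangle_ineq)
  also have "\<dots> \<le> \<epsilon> + 2 * \<epsilon>" using e(1) norm_prj_le[OF B(1), of "\<nu>2' - u"] c2'(1) by linarith
  finally have pn: "norm (prj B \<nu>2) \<le> 3 * \<epsilon>" by simp
  \<comment> \<open>If both hyperplanes were orthogonal to \<open>u\<close> and contained the plane
    of \<open>B\<close>, everything would cancel. What remains are two differences of rank-one
    projections, each at most \<open>2 * \<epsilon>\<close>, and the component of
    \<open>prj B \<xi>\<close> along \<open>\<nu>2\<close>, at most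
    \<open>3 * \<epsilon>\<close>.\<close>
  have eq: "prj B \<xi> - (1/2) *\<^sub>R prj B1 \<xi> - (1/2) *\<^sub>R prj B2 (2 *\<^sub>R prj B \<xi> - \<xi>)
     = (1/2) *\<^sub>R ((\<nu>1 \<bullet> \<xi>) *\<^sub>R \<nu>1 - (u \<bullet> \<xi>) *\<^sub>R u) - (1/2) *\<^sub>R ((\<nu>2 \<bullet> \<xi>) *\<^sub>R \<nu>2 - (u \<bullet> \<xi>) *\<^sub>R u)
       + (\<nu>2 \<bullet> prj B \<xi>) *\<^sub>R \<nu>2"
    unfolding n1(2) n2(2)
    by (simp add: inner_diff_right scaleR_diff_left scaleR_diff_right scaleR_add_left algebra_simps)
  have "norm (prj B \<xi> - (1/2) *\<^sub>R prj B1 \<xi> - (1/2) *\<^sub>R prj B2 (2 *\<^sub>R prj B \<xi> - \<xi>))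
      \<le> norm ((1/2) *\<^sub>R ((\<nu>1 \<bullet> \<xi>) *\<^sub>R \<nu>1 - (u \<bullet> \<xi>) *\<^sub>R u)) + norm ((1/2) *\<^sub>R ((\<nu>2 \<bullet> \<xi>) *\<^sub>R \<nu>2 - (u \<bullet> \<xi>) *\<^sub>R u))
       + norm ((\<nu>2 \<bullet> prj B \<xi>) *\<^sub>R \<nu>2)"
    unfolding eq by (rule order_trans[OF norm_triangle_ineq add_right_mono[OF norm_triangle_ineq4]])
  also have "norm ((\<nu>2 \<bullet> prj B \<xi>) *\<^sub>R \<nu>2) = \<bar>prj B \<nu>2 \<bullet> \<xi>\<bar>" using n2(1) by (simp add: prj_adjoint)
  also have "\<dots> \<le> norm (prj B \<nu>2) * norm \<xi>" by (rule Cauchy_Schwarz_ineq2)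
  also have "\<dots> \<le> 3 * \<epsilon> * 1" using pn \<xi> e0 by (intro mult_mono) auto
  also have "norm ((1/2) *\<^sub>R ((\<nu>1 \<bullet> \<xi>) *\<^sub>R \<nu>1 - (u \<bullet> \<xi>) *\<^sub>R u)) \<le> 2 * \<epsilon>"
  proof -
    have "4 * \<epsilon> * norm \<xi> \<le> 4 * \<epsilon> * 1" using \<xi> e0 by (intro mult_left_mono) auto
    then show ?thesis using c1[of \<xi>] by simp
  qed
  also have "norm ((1/2) *\<^sub>R ((\<nu>2 \<bullet> \<xi>) *\<^sub>R \<nu>2 - (u \<bullet> \<xi>) *\<^sub>R u)) \<le> 2 * \<epsilon>"
  proof -
    have "4 * \<epsilon> * norm \<xi> \<le> 4 * \<epsilon> * 1" using \<xi> e0 by (intro mult_left_mono) auto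
    then show ?thesis using c2[of \<xi>] by simp
  qed
  finally show ?thesis by simp
qed


lemma hyperplane_oset: "B \<in> hyperplanes \<Longrightarrow> oset B"
  by (simp add: hyperplanes_def)

lemma hyperplanes_subset: "hyperplanes \<subseteq> all_planes"
  by (auto simp: hyperplanes_def all_planes_def)

lemma hyperplanes_nonempty: "hyperplanes \<noteq> ({} :: (real^'m) set set)"
proof -
  have "norm (axis undefined 1 :: real^'m) = 1" by simp
  then obtain B :: "(real^'m) set" where "oset (insert (axis undefined 1) B)" "card B + 1 = DIM(real^'m)"
    using oset_basis_extend by metis
  then have "B \<in> hyperplanes" using oset_subset[of "insert (axis undefined 1) B" B] by (auto simp: hyperplanes_def)
  then show ?thesis by blast
qed

lemma all_planes_nonempty: "all_planes \<noteq> {}"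
  using hyperplanes_nonempty hyperplanes_subset by blast

text \<open>Rotating a noise does not change its law, so its component along any vector can be made
  to follow a prescribed direction \<open>e\<close>. The minus sign compensates for the subtraction
  of the hyperplane noises in the coupling.\<close>

lemma align_exists:
  fixes a e :: "real^'m"
  assumes "norm e = 1"
  obtains T where "orthogonal_transformation T" "\<And>\<xi>. a \<bullet> T \<xi> = - norm a * (e \<bullet> \<xi>)"
proof -
  have "norm (- norm a *\<^sub>R e) = norm a" using assms by simp
  then obtain T where T: "orthogonal_transformation T" "T (- norm a *\<^sub>R e) = a"
    using orthogonal_transformation_exists by blast
  have "a \<bullet> T \<xi> = - norm a *\<^sub>R e \<bullet> \<xi>" for \<xi>
    using T unfolding orthogonal_transformation_def by metis
  with T(1) that show ?thesis by auto
qed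

text \<open>There are three regimes. For \<open>norm z < \<rho>\<close> the Hessian of the quartic
  is small and any coupling will do. If one of the planes is noticeably tilted towards
  \<open>z\<close>, the noises are rotated so that their components along \<open>z\<close> add up,
  and the gain of the exponential outweighs the loss. Otherwise all three planes are nearly
  orthogonal to \<open>z\<close>, and the reflection coupling nearly cancels the noises.
  \<open>D\<close> collects the losses of the first and the last regime.\<close>

lemma coupling_step:
  fixes B B1 B2 :: "(real^'m) set" and z :: "real^'m"
  assumes B: "oset B" "B1 \<in> hyperplanes" "B2 \<in> hyperplanes"
    and r: "0 < r" and h: "0 < h" "h \<le> \<rho>" and \<rho>: "0 < \<rho>" "\<rho> \<le> 1" and small: "144 * r * h\<^sup>2 \<le> 1"
    and z: "norm z \<le> 1"
    and D: "D = 40 * \<rho>\<^sup>2 + 32 * h\<^sup>2 + 35280 / (r * bvar TYPE('m) * \<rho>\<^sup>2)"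
  shows "\<exists>T1 T2. orthogonal_transformation T1 \<and> orthogonal_transformation T2 \<and>
     exp (- r * (norm z ^ 4 + h\<^sup>2 * D))
       \<le> bavg (\<lambda>\<xi>. exp (- r * norm (z + h *\<^sub>R (prj B \<xi> - (1/2) *\<^sub>R prj B1 (T1 \<xi>) - (1/2) *\<^sub>R prj B2 (T2 \<xi>))) ^ 4))"
proof -
  define \<eta> where "\<eta> T1 T2 \<xi> = prj B \<xi> - (1/2) *\<^sub>R prj B1 (T1 \<xi>) - (1/2) *\<^sub>R prj B2 (T2 \<xi>)" for T1 T2 and \<xi> :: "real^'m"
  have os: "oset B1" "oset B2" using B hyperplane_oset by auto
  define c where "c = bvar TYPE('m)"
  have c: "0 < c" unfolding c_def by (rule bvar_pos)
  have lin: "linear (\<eta> T1 T2)" if "orthogonal_transformation T1" "orthogonal_transformation T2" for T1 T2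
    using that[THEN orthogonal_transformation_linear] unfolding \<eta>_def
    by (auto intro!: linearI simp: linear_add linear_scale prj_add prj_scaleR scaleR_add_right scaleR_diff_right)
  have le2: "norm (\<eta> T1 T2 \<xi>) \<le> 2" if T: "orthogonal_transformation T1" "orthogonal_transformation T2" and "norm \<xi> \<le> 1" for T1 T2 \<xi>
  proof -
    have "norm (\<eta> T1 T2 \<xi>) \<le> norm (prj B \<xi>) + norm ((1/2) *\<^sub>R prj B1 (T1 \<xi>)) + norm ((1/2) *\<^sub>R prj B2 (T2 \<xi>))"
      unfolding \<eta>_def by (rule order_trans[OF norm_triangle_ineq4 add_right_mono[OF norm_triangle_ineq4]])
    moreover have "norm (prj B \<xi>) \<le> 1" "norm (prj B1 (T1 \<xi>)) \<le> 1" "norm (prj B2 (T2 \<xi>)) \<le> 1"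
      using norm_prj_le[OF B(1), of \<xi>] norm_prj_le[OF os(1), of "T1 \<xi>"] norm_prj_le[OF os(2), of "T2 \<xi>"] that
        orthogonal_transformation_norm[OF T(1)] orthogonal_transformation_norm[OF T(2)] by auto
    ultimately show ?thesis by simp
  qed
  have "\<exists>T1 T2. orthogonal_transformation T1 \<and> orthogonal_transformation T2 \<and>
     exp (- r * (norm z ^ 4 + h\<^sup>2 * D)) \<le> bavg (\<lambda>\<xi>. exp (- r * norm (z + h *\<^sub>R \<eta> T1 T2 \<xi>) ^ 4))"
  proof (cases "norm z < \<rho>")
    case True
    have id: "orthogonal_transformation (\<lambda>x::real^'m. x)" by simp
    have "(norm z)\<^sup>2 \<le> \<rho>\<^sup>2" using True by (intro power_mono) auto
    then have "10 * (norm z)\<^sup>2 * 2\<^sup>2 + 32 * h\<^sup>2 \<le> D"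
    proof -
      have "0 \<le> 35280 / (r * bvar TYPE('m) * \<rho>\<^sup>2)" using r bvar_pos[where 'm='m] by simp
      moreover have "10 * (norm z)\<^sup>2 * 2\<^sup>2 \<le> 40 * \<rho>\<^sup>2" using \<open>(norm z)\<^sup>2 \<le> \<rho>\<^sup>2\<close> by simp
      ultimately show ?thesis unfolding D by linarith
    qed
    then have "h\<^sup>2 * (10 * (norm z)\<^sup>2 * 2\<^sup>2 + 32 * h\<^sup>2) \<le> h\<^sup>2 * D" by (rule mult_left_mono) simp
    then have "- r * (norm z ^ 4 + h\<^sup>2 * D) \<le> - r * (norm z ^ 4 + h\<^sup>2 * (10 * (norm z)\<^sup>2 * 2\<^sup>2 + 32 * h\<^sup>2))"
      using r by (simp only: mult_minus_left neg_le_iff_le) (intro mult_left_mono, auto)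
    then have "exp (- r * (norm z ^ 4 + h\<^sup>2 * D)) \<le> exp (- r * (norm z ^ 4 + h\<^sup>2 * (10 * (norm z)\<^sup>2 * 2\<^sup>2 + 32 * h\<^sup>2)))"
      by simp
    also have "\<dots> \<le> bavg (\<lambda>\<xi>. exp (- r * norm (z + h *\<^sub>R \<eta> (\<lambda>x. x) (\<lambda>x. x) \<xi>) ^ 4))"
      using r h by (intro bavg_exp_quartic_jensen lin id le2) auto
    finally show ?thesis using id by blast
  next
    case False
    then have zr: "\<rho> \<le> norm z" and z0: "0 < norm z" using \<rho> by auto
    \<comment> \<open>\<open>t\<close> is the size of the noise along \<open>z\<close> when the
      three components are aligned. The threshold \<open>th\<close> for \<open>t\<^sup>2\<close> is
      such that above it the gain \<open>Y\<close> is at least twice the loss \<open>r * E\<close>: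
      8 * 18 = 144, which is twice 72 = 40 + 32, the two constants being merged by
      \<open>h \<le> norm z\<close>.\<close>
    define t where "t = norm (prj B z) + norm (prj B1 z) / 2 + norm (prj B2 z) / 2"
    have t0: "0 \<le> t" by (simp add: t_def)
    define th where "th = 18 / (r * c * (norm z)\<^sup>2)"
    have th0: "0 < th" using r c z0 by (simp add: th_def)
    show ?thesis
    proof (cases "th \<le> t\<^sup>2")
      case True
      define e where "e = (if prj B z = 0 then axis undefined 1 else prj B z /\<^sub>R norm (prj B z))"
      have e1: "norm e = 1" by (auto simp: e_def)
      have pe: "prj B z = norm (prj B z) *\<^sub>R e" by (auto simp: e_def)
      obtain T1 where T1: "orthogonal_transformation T1" "\<And>\<xi>. prj B1 z \<bullet> T1 \<xi> = - norm (prj B1 z) * (e \<bullet> \<xi>)"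
        using align_exists[OF e1] by blast
      obtain T2 where T2: "orthogonal_transformation T2" "\<And>\<xi>. prj B2 z \<bullet> T2 \<xi> = - norm (prj B2 z) * (e \<bullet> \<xi>)"
        using align_exists[OF e1] by blast
      have ze: "z \<bullet> \<eta> T1 T2 \<xi> = t * (e \<bullet> \<xi>)" for \<xi>
      proof -
        have "z \<bullet> \<eta> T1 T2 \<xi> = prj B z \<bullet> \<xi> - (1/2) * (prj B1 z \<bullet> T1 \<xi>) - (1/2) * (prj B2 z \<bullet> T2 \<xi>)"
          by (simp add: \<eta>_def inner_diff_right prj_adjoint)
        also have "prj B z \<bullet> \<xi> = norm (prj B z) * (e \<bullet> \<xi>)" by (subst pe) simp
        finally show ?thesis by (simp add: T1 T2 t_def algebra_simps)
      qed
      define E where "E = h\<^sup>2 * (40 * (norm z)\<^sup>2 + 32 * h\<^sup>2)"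
      define Y where "Y = (r * (4 * (norm z)\<^sup>2 * h * t))\<^sup>2 * bvar TYPE('m) / 2"
      have n1: "(norm z)\<^sup>2 \<le> 1" using z by (simp add: power_le_one)
      have hz: "h\<^sup>2 \<le> (norm z)\<^sup>2" using h zr by (intro power_mono) auto
      have E: "0 \<le> E" "E \<le> 72 * h\<^sup>2 * (norm z)\<^sup>2"
      proof -
        show "0 \<le> E" by (simp add: E_def)
        have "h\<^sup>2 * (40 * (norm z)\<^sup>2 + 32 * h\<^sup>2) \<le> h\<^sup>2 * (72 * (norm z)\<^sup>2)"
          using hz by (intro mult_left_mono) auto
        then show "E \<le> 72 * h\<^sup>2 * (norm z)\<^sup>2" by (simp add: E_def)
      qed
      have "2 * (r * E) \<le> Y"
      proof -
        have "2 * (r * E) \<le> 144 * r * h\<^sup>2 * (norm z)\<^sup>2" using E(2) r by simp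
        also have "\<dots> = 8 * r\<^sup>2 * (norm z)^4 * h\<^sup>2 * c * th"
          unfolding th_def using r c z0 by (simp add: field_simps power2_eq_square power4_eq_xxxx)
        also have "\<dots> \<le> 8 * r\<^sup>2 * (norm z)^4 * h\<^sup>2 * c * t\<^sup>2"
          using True c by (intro mult_left_mono) auto
        also have "\<dots> = Y" by (simp add: Y_def c_def power_mult_distrib power2_eq_square power4_eq_xxxx)
        finally show ?thesis .
      qed
      have rE1: "2 * (r * E) \<le> 1"
      proof -
        have "2 * (r * E) \<le> 144 * r * h\<^sup>2 * (norm z)\<^sup>2" using E(2) r by simp
        also have "\<dots> \<le> 144 * r * h\<^sup>2 * 1" using n1 r by (intro mult_left_mono) auto
        also have "144 * r * h\<^sup>2 * 1 \<le> 1" using small by simp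
        finally show ?thesis .
      qed
      have "exp (r * E) \<le> 1 + 2 * (r * E)"
      proof -
        have q: "0 \<le> r * E" "r * E \<le> 1" using rE1 r E(1) by auto
        have "exp (r * E) \<le> 1 + r * E + (r * E)\<^sup>2" using q by (rule exp_bound)
        also have "(r * E)\<^sup>2 \<le> r * E" using mult_left_le[OF q(2) q(1)] by (simp add: power2_eq_square)
        finally show ?thesis by linarith
      qed
      then have "1 \<le> exp (- (r * E)) * (1 + Y)"
        using \<open>2 * (r * E) \<le> Y\<close> by (simp add: exp_minus field_simps)
      then have "exp (- r * norm z ^ 4) * 1 \<le> exp (- r * norm z ^ 4) * (exp (- (r * E)) * (1 + Y))"
        by (rule mult_left_mono) simp
      also have "\<dots> = exp (- r * (norm z ^ 4 + E)) * (1 + Y)"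
        by (simp add: exp_add[symmetric] mult.assoc[symmetric] algebra_simps del: mult.assoc)
      also have "\<dots> \<le> bavg (\<lambda>\<xi>. exp (- r * norm (z + h *\<^sub>R \<eta> T1 T2 \<xi>) ^ 4))"
        unfolding E_def Y_def using r h by (intro bavg_exp_quartic_gain[OF lin _ ze e1] T1 T2 le2) auto
      finally have "exp (- r * norm z ^ 4) \<le> bavg (\<lambda>\<xi>. exp (- r * norm (z + h *\<^sub>R \<eta> T1 T2 \<xi>) ^ 4))" by simp
      moreover have "exp (- r * (norm z ^ 4 + h\<^sup>2 * D)) \<le> exp (- r * norm z ^ 4)"
        unfolding D using r c by (simp add: c_def)
      ultimately show ?thesis using T1(1) T2(1) by (meson order_trans)
    next
      case False
      define \<theta> where "\<theta> = sqrt th"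
      have \<theta>: "t \<le> \<theta>" using False real_le_rsqrt[of t th] by (simp add: \<theta>_def)
      define u where "u = z /\<^sub>R norm z"
      have u: "norm u = 1" using z0 by (simp add: u_def)
      \<comment> \<open>Each projection of \<open>z\<close> occurs in \<open>t\<close> with weight
        at least 1/2, hence is at most \<open>2 * \<theta>\<close>. With this \<epsilon> the loss
        \<open>10 * (norm z)\<^sup>2 * (7 * \<epsilon>)\<^sup>2\<close> equals
        \<open>1960 * th\<close>, which is the origin of 35280 = 1960 * 18.\<close>
      define \<epsilon> where "\<epsilon> = 2 * \<theta> / norm z"
      have pr: "norm (prj A u) = norm (prj A z) / norm z" for A by (simp add: u_def prj_scaleR divide_inverse mult.commute)
      have \<theta>0: "0 \<le> \<theta>" using \<theta> t0 by linarith
      have tt: "norm (prj B z) \<le> 2 * \<theta>" "norm (prj B1 z) \<le> 2 * \<theta>" "norm (prj B2 z) \<le> 2 * \<theta>"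
        using \<theta> \<theta>0 norm_ge_zero[of "prj B z"] norm_ge_zero[of "prj B1 z"] norm_ge_zero[of "prj B2 z"]
        unfolding t_def by linarith+
      then have ee: "norm (prj B u) \<le> \<epsilon>" "norm (prj B1 u) \<le> \<epsilon>" "norm (prj B2 u) \<le> \<epsilon>"
        unfolding pr \<epsilon>_def using z0 by (auto intro: divide_right_mono)
      let ?T2 = "\<lambda>x. 2 *\<^sub>R prj B x - x"
      have T: "orthogonal_transformation (\<lambda>x::real^'m. x)" "orthogonal_transformation ?T2"
        by (simp_all add: orthogonal_transformation_reflect B)
      have s: "norm (\<eta> (\<lambda>x. x) ?T2 \<xi>) \<le> 7 * \<epsilon>" if "norm \<xi> \<le> 1" for \<xi>
        unfolding \<eta>_def by (rule coupling_reflection[OF B u ee that])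
      have e2: "10 * (norm z)\<^sup>2 * (7 * \<epsilon>)\<^sup>2 = 35280 / (r * c * (norm z)\<^sup>2)"
      proof -
        have "\<theta>\<^sup>2 = th" using th0 by (simp add: \<theta>_def)
        then have "10 * (norm z)\<^sup>2 * (7 * \<epsilon>)\<^sup>2 = 1960 * th"
          using z0 by (simp add: \<epsilon>_def power_mult_distrib power_divide)
        then show ?thesis by (simp add: th_def)
      qed
      also have "\<dots> \<le> 35280 / (r * c * \<rho>\<^sup>2)"
        using r c \<rho> z0 power_mono[OF zr, of 2] by (intro divide_left_mono mult_left_mono mult_pos_pos) auto
      finally have "10 * (norm z)\<^sup>2 * (7 * \<epsilon>)\<^sup>2 + 32 * h\<^sup>2 \<le> D" unfolding D c_def
        using zero_le_power2[of \<rho>] by linarith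
      then have "h\<^sup>2 * (10 * (norm z)\<^sup>2 * (7 * \<epsilon>)\<^sup>2 + 32 * h\<^sup>2) \<le> h\<^sup>2 * D" by (rule mult_left_mono) simp
      then have "- r * (norm z ^ 4 + h\<^sup>2 * D) \<le> - r * (norm z ^ 4 + h\<^sup>2 * (10 * (norm z)\<^sup>2 * (7 * \<epsilon>)\<^sup>2 + 32 * h\<^sup>2))"
        using r by (simp only: mult_minus_left neg_le_iff_le) (intro mult_left_mono, auto)
      then have "exp (- r * (norm z ^ 4 + h\<^sup>2 * D)) \<le> exp (- r * (norm z ^ 4 + h\<^sup>2 * (10 * (norm z)\<^sup>2 * (7 * \<epsilon>)\<^sup>2 + 32 * h\<^sup>2)))"
        by simp
      also have "\<dots> \<le> bavg (\<lambda>\<xi>. exp (- r * norm (z + h *\<^sub>R \<eta> (\<lambda>x. x) ?T2 \<xi>) ^ 4))"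
        using r h by (intro bavg_exp_quartic_jensen lin T le2 s) auto
      finally show ?thesis using T by blast
    qed
  qed
  then show ?thesis unfolding \<eta>_def .
qed

lemma le_INF_mult:
  fixes f :: "'i \<Rightarrow> real"
  assumes "I \<noteq> {}" "0 < q" "\<And>i. i \<in> I \<Longrightarrow> r \<le> f i * q"
  shows "r \<le> (INF i\<in>I. f i) * q"
proof -
  have "r / q \<le> (INF i\<in>I. f i)"
    using assms by (intro cINF_greatest) (auto simp: field_simps)
  then show ?thesis using assms(2) by (simp add: field_simps)
qed

text \<open>The comparison of the two schemes: in terms of \<open>- ln Z / l\<close> and \<open>ln W / l\<close> this is the
  doubling of variables with penalty \<open>a |x - (y1 + y2) / 2|^4\<close>. Taking the average of the second
  function at two points makes every noise in a subspace of a hyperplane the average of two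
  noises in the hyperplane.\<close>

lemma scheme_coupling:
  fixes f g :: "real^'m \<Rightarrow> real"
  assumes f: "loglip l f" and g: "loglip l g" and l: "0 < l" and a: "1 \<le> a"
    and h: "0 < h" "h \<le> \<rho>" and \<rho>: "0 < \<rho>" "\<rho> \<le> 1" and small: "72 * l * a * h\<^sup>2 \<le> 1"
    and D: "D = 40 * \<rho>\<^sup>2 + 32 * h\<^sup>2 + 35280 / (l * a / 2 * bvar TYPE('m) * \<rho>\<^sup>2)"
    and init: "\<And>x y1 y2. exp (- l * (m + a * norm (x - (1/2) *\<^sub>R (y1 + y2)) ^ 4)) \<le> f x * sqrt (g y1 * g y2)"
  shows "exp (- l * (m + a * (real k * h\<^sup>2 * D) + a * norm (x - (1/2) *\<^sub>R (y1 + y2)) ^ 4))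
     \<le> scheme all_planes h f k x * sqrt (scheme hyperplanes h g k y1 * scheme hyperplanes h g k y2)"
proof (induction k arbitrary: x y1 y2)
  case 0
  then show ?case using init by simp
next
  case (Suc k)
  let ?Z = "scheme all_planes h f" and ?W = "scheme hyperplanes h g"
  have l0: "0 \<le> l" and h0: "0 \<le> h" using l h by auto
  note LZ = loglip_scheme[OF f l0 h0 all_planes_nonempty order_refl]
  note LW = loglip_scheme[OF g l0 h0 hyperplanes_nonempty hyperplanes_subset]
  define mk where "mk = m + a * (real k * h\<^sup>2 * D)"
  have mS: "m + a * (real (Suc k) * h\<^sup>2 * D) = mk + a * (h\<^sup>2 * D)" by (simp add: mk_def algebra_simps)
  have near: "exp (- l * (mk + a * (h\<^sup>2 * D) + a * norm (x - (1/2) *\<^sub>R (y1 + y2)) ^ 4))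
     \<le> ?Z (Suc k) x * sqrt (?W (Suc k) y1 * ?W (Suc k) y2)"
    if z1: "norm (x - (1/2) *\<^sub>R (y1 + y2)) \<le> 1" for x y1 y2
  proof -
    define z where "z = x - (1/2) *\<^sub>R (y1 + y2)"
    define R where "R = exp (- l * (mk + a * (h\<^sup>2 * D) + a * norm z ^ 4))"
    \<comment> \<open>Half of \<open>l * a\<close>, because Hoelder's inequality is applied to the
      square root of the product that the induction hypothesis bounds.\<close>
    define r where "r = l * a / 2"
    have r: "0 < r" using l a by (simp add: r_def)
    have prod: "R \<le> bavg (\<lambda>\<xi>. ?Z k (x + h *\<^sub>R prj B \<xi>)) * sqrt (bavg (\<lambda>\<xi>. ?W k (y1 + h *\<^sub>R prj B1 \<xi>)) * bavg (\<lambda>\<xi>. ?W k (y2 + h *\<^sub>R prj B2 \<xi>)))"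
      if B: "B \<in> all_planes" "B1 \<in> hyperplanes" "B2 \<in> hyperplanes" for B B1 B2
    proof -
      have os: "oset B" "oset B1" "oset B2" using B by (auto simp: all_planes_def hyperplanes_def)
      obtain T1 T2 where T: "orthogonal_transformation T1" "orthogonal_transformation T2"
        and T12: "exp (- r * (norm z ^ 4 + h\<^sup>2 * D))
         \<le> bavg (\<lambda>\<xi>. exp (- r * norm (z + h *\<^sub>R (prj B \<xi> - (1/2) *\<^sub>R prj B1 (T1 \<xi>) - (1/2) *\<^sub>R prj B2 (T2 \<xi>))) ^ 4))"
      proof -
        have "144 * r * h\<^sup>2 \<le> 1" using small by (simp add: r_def mult_ac)
        from coupling_step[OF os(1) B(2,3) r h \<rho> this z1[folded z_def] D[folded r_def]] that
        show thesis by blast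
      qed
      let ?f = "\<lambda>\<xi>. ?Z k (x + h *\<^sub>R prj B \<xi>)"
      let ?g1 = "\<lambda>\<xi>. ?W k (y1 + h *\<^sub>R prj B1 (T1 \<xi>))"
      let ?g2 = "\<lambda>\<xi>. ?W k (y2 + h *\<^sub>R prj B2 (T2 \<xi>))"
      have cT: "continuous_on UNIV T1" "continuous_on UNIV T2"
        using T by (auto intro!: linear_continuous_on linear_conv_bounded_linear[THEN iffD1] orthogonal_transformation_linear)
      have cf: "continuous_on UNIV ?f" by (intro continuous_step loglip_continuous[OF LZ])
      have cg: "continuous_on UNIV (\<lambda>\<xi>. ?W k (y1 + h *\<^sub>R prj B1 \<xi>))" "continuous_on UNIV (\<lambda>\<xi>. ?W k (y2 + h *\<^sub>R prj B2 \<xi>))"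
        by (intro continuous_step loglip_continuous[OF LW])+
      have cg': "continuous_on UNIV ?g1" "continuous_on UNIV ?g2"
        by (rule continuous_on_compose2[OF cg(1) cT(1)] continuous_on_compose2[OF cg(2) cT(2)]; simp)+
      have eq: "bavg ?g1 = bavg (\<lambda>\<xi>. ?W k (y1 + h *\<^sub>R prj B1 \<xi>))" "bavg ?g2 = bavg (\<lambda>\<xi>. ?W k (y2 + h *\<^sub>R prj B2 \<xi>))"
        using bavg_orthogonal[OF T(1) cg(1)] bavg_orthogonal[OF T(2) cg(2)] by auto
      have pos: "0 < bavg ?f" "0 < bavg ?g1" "0 < bavg ?g2"
      proof -
        show "0 < bavg ?f"
          by (rule less_le_trans[OF _ bavg_step_bounds(1)[OF LZ l0 h0 os(1)]]) (simp add: loglip_pos[OF LZ])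
        show "0 < bavg ?g1" unfolding eq
          by (rule less_le_trans[OF _ bavg_step_bounds(1)[OF LW l0 h0 os(2)]]) (simp add: loglip_pos[OF LW])
        show "0 < bavg ?g2" unfolding eq
          by (rule less_le_trans[OF _ bavg_step_bounds(1)[OF LW l0 h0 os(3)]]) (simp add: loglip_pos[OF LW])
      qed
      let ?E = "\<lambda>\<xi>. exp (- r * norm (z + h *\<^sub>R (prj B \<xi> - (1/2) *\<^sub>R prj B1 (T1 \<xi>) - (1/2) *\<^sub>R prj B2 (T2 \<xi>))) ^ 4)"
      have "exp (- (l * mk / 2)) * exp (- r * (norm z ^ 4 + h\<^sup>2 * D)) \<le> exp (- (l * mk / 2)) * bavg ?E"
        using T12 by (rule mult_left_mono) simp
      also have "\<dots> = bavg (\<lambda>\<xi>. exp (- (l * mk / 2)) * ?E \<xi>)" by (rule bavg_cmult[symmetric])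
      also have "\<dots> \<le> bavg (\<lambda>\<xi>. sqrt (?f \<xi> * sqrt (?g1 \<xi> * ?g2 \<xi>)))"
      proof (rule bavg_mono)
        fix \<xi>
        let ?n = "norm (z + h *\<^sub>R (prj B \<xi> - (1/2) *\<^sub>R prj B1 (T1 \<xi>) - (1/2) *\<^sub>R prj B2 (T2 \<xi>))) ^ 4"
        have "x + h *\<^sub>R prj B \<xi> - (1/2) *\<^sub>R ((y1 + h *\<^sub>R prj B1 (T1 \<xi>)) + (y2 + h *\<^sub>R prj B2 (T2 \<xi>)))
          = z + h *\<^sub>R (prj B \<xi> - (1/2) *\<^sub>R prj B1 (T1 \<xi>) - (1/2) *\<^sub>R prj B2 (T2 \<xi>))"
          by (simp add: z_def algebra_simps)
        then have "exp (- l * (mk + a * ?n)) \<le> ?f \<xi> * sqrt (?g1 \<xi> * ?g2 \<xi>)"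
          using Suc[of "x + h *\<^sub>R prj B \<xi>" "y1 + h *\<^sub>R prj B1 (T1 \<xi>)" "y2 + h *\<^sub>R prj B2 (T2 \<xi>)"]
          unfolding mk_def by metis
        moreover have "exp (- l * (mk + a * ?n)) = (exp (- (l * mk / 2)) * exp (- r * ?n))\<^sup>2"
          unfolding power_mult_distrib exp_double[symmetric] exp_add[symmetric]
          by (simp add: r_def algebra_simps)
        ultimately show "exp (- (l * mk / 2)) * ?E \<xi> \<le> sqrt (?f \<xi> * sqrt (?g1 \<xi> * ?g2 \<xi>))"
          by (intro real_le_rsqrt) simp
      qed (auto intro!: continuous_intros cf cg' cT)
      finally have le: "exp (- (l * mk / 2)) * exp (- r * (norm z ^ 4 + h\<^sup>2 * D)) \<le> bavg (\<lambda>\<xi>. sqrt (?f \<xi> * sqrt (?g1 \<xi> * ?g2 \<xi>)))" .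
      have "R = (exp (- (l * mk / 2)) * exp (- r * (norm z ^ 4 + h\<^sup>2 * D)))\<^sup>2"
        unfolding R_def power_mult_distrib exp_double[symmetric] exp_add[symmetric]
        by (simp add: r_def algebra_simps)
      also have "\<dots> \<le> (bavg (\<lambda>\<xi>. sqrt (?f \<xi> * sqrt (?g1 \<xi> * ?g2 \<xi>))))\<^sup>2" using le by (rule power_mono) simp
      also have "\<dots> \<le> bavg ?f * sqrt (bavg ?g1 * bavg ?g2)"
        by (intro bavg_holder cf cg' pos loglip_pos[OF LZ] loglip_pos[OF LW])
      finally show ?thesis unfolding eq .
    qed
    have R0: "0 < R" by (simp add: R_def)
    have posb: "0 < bavg (\<lambda>\<xi>. ?W k (y + h *\<^sub>R prj A \<xi>))" if "A \<in> hyperplanes" for y A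
      by (rule less_le_trans[OF _ bavg_step_bounds(1)[OF LW l0 h0 hyperplane_oset[OF that]]]) (simp add: loglip_pos[OF LW])
    note posW = loglip_pos[OF LW, of "Suc k"] and posZ = loglip_pos[OF LZ, of "Suc k"]
    \<comment> \<open>The three infima in the next step of the schemes are taken one at a time with
      the other factors fixed; in between the inequality is squared to free the hyperplane factors
      from the root.\<close>
    have s1: "R \<le> ?Z (Suc k) x * sqrt (bavg (\<lambda>\<xi>. ?W k (y1 + h *\<^sub>R prj B1 \<xi>)) * bavg (\<lambda>\<xi>. ?W k (y2 + h *\<^sub>R prj B2 \<xi>)))"
      if B: "B1 \<in> hyperplanes" "B2 \<in> hyperplanes" for B1 B2
      unfolding scheme.simps using prod[OF _ B] posb[OF B(1)] posb[OF B(2)]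
      by (intro le_INF_mult all_planes_nonempty) auto
    have s1': "R\<^sup>2 \<le> bavg (\<lambda>\<xi>. ?W k (y1 + h *\<^sub>R prj B1 \<xi>)) * (bavg (\<lambda>\<xi>. ?W k (y2 + h *\<^sub>R prj B2 \<xi>)) * (?Z (Suc k) x)\<^sup>2)"
      if B: "B1 \<in> hyperplanes" "B2 \<in> hyperplanes" for B1 B2
      using power_mono[OF s1[OF B], of 2] R0 posb[OF B(1), of y1] posb[OF B(2), of y2]
      by (simp add: power_mult_distrib mult_ac)
    have s2: "R\<^sup>2 \<le> ?W (Suc k) y1 * (bavg (\<lambda>\<xi>. ?W k (y2 + h *\<^sub>R prj B2 \<xi>)) * (?Z (Suc k) x)\<^sup>2)"
      if B: "B2 \<in> hyperplanes" for B2
    proof -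
      have "0 < bavg (\<lambda>\<xi>. ?W k (y2 + h *\<^sub>R prj B2 \<xi>)) * (?Z (Suc k) x)\<^sup>2"
        by (intro mult_pos_pos zero_less_power posb[OF B] posZ)
      then show ?thesis
        unfolding scheme.simps(2)[of hyperplanes h g k y1]
        by (intro le_INF_mult hyperplanes_nonempty s1'[OF _ B])
    qed
    have "R\<^sup>2 \<le> ?W (Suc k) y2 * (?W (Suc k) y1 * (?Z (Suc k) x)\<^sup>2)"
    proof -
      have "0 < ?W (Suc k) y1 * (?Z (Suc k) x)\<^sup>2"
        by (intro mult_pos_pos zero_less_power posW posZ)
      then show ?thesis
        unfolding scheme.simps(2)[of hyperplanes h g k y2]
        by (intro le_INF_mult hyperplanes_nonempty) (use s2 in \<open>simp_all add: mult_ac del: scheme.simps\<close>)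
    qed
    then have "R\<^sup>2 \<le> (?Z (Suc k) x * sqrt (?W (Suc k) y1 * ?W (Suc k) y2))\<^sup>2"
      using posW[of y1] posW[of y2] by (simp add: power_mult_distrib mult_ac less_imp_le del: scheme.simps)
    then have "R \<le> ?Z (Suc k) x * sqrt (?W (Suc k) y1 * ?W (Suc k) y2)"
      using posW[of y1] posW[of y2] posZ[of x]
      by (intro power2_le_imp_le[of R]) (auto intro!: mult_nonneg_nonneg simp: less_imp_le simp del: scheme.simps)
    then show ?thesis by (simp only: R_def z_def)
  qed
  show ?case
  proof (cases "norm (x - (1/2) *\<^sub>R (y1 + y2)) \<le> 1")
    case True
    then show ?thesis using near unfolding mS by blast
  next
    case False
    define y where "y = (1/2) *\<^sub>R (y1 + y2)"
    define n where "n = norm (x - y)"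
    have n1: "1 \<le> n" using False by (simp add: n_def y_def)
    have "n \<le> n ^ 4" using n1 by (simp add: self_le_power)
    also have "\<dots> \<le> a * n ^ 4" using a n1 by simp
    finally have "exp (- l * (mk + a * (h\<^sup>2 * D) + a * n ^ 4)) \<le> exp (- (l * n)) * exp (- l * (mk + a * (h\<^sup>2 * D)))"
      unfolding exp_add[symmetric] using l by (simp add: algebra_simps)
    also have "\<dots> \<le> exp (- (l * n)) * (?Z (Suc k) y * sqrt (?W (Suc k) y1 * ?W (Suc k) y2))"
      using near[of y y1 y2] by (intro mult_left_mono) (auto simp: y_def simp del: scheme.simps)
    also have "\<dots> \<le> ?Z (Suc k) x * sqrt (?W (Suc k) y1 * ?W (Suc k) y2)"
    proof -
      have "?Z (Suc k) y \<le> exp (l * n) * ?Z (Suc k) x"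
        using loglip_le[OF LZ, of "Suc k" y x] by (simp add: n_def norm_minus_commute del: scheme.simps)
      then have "exp (- (l * n)) * ?Z (Suc k) y \<le> ?Z (Suc k) x" by (simp add: exp_minus field_simps del: scheme.simps)
      then show ?thesis using loglip_pos[OF LW]
        unfolding mult.assoc[symmetric] by (intro mult_right_mono) (auto simp: less_imp_le simp del: scheme.simps)
    qed
    finally show ?thesis unfolding mS n_def y_def .
  qed
qed

section \<open>Taylor expansion, and traces over planes as averages over noise\<close>

section \<open>Second order calculus\<close>

definition trc :: "(real^'m) set \<Rightarrow> real^'m^'m \<Rightarrow> real" where
  "trc B M = (\<Sum>b\<in>B. b \<bullet> (M *v b))"

lemma taylor_second_order:
  fixes f :: "real^'m \<Rightarrow> real"
  assumes f: "\<And>t. 0 \<le> t \<Longrightarrow> t \<le> 1 \<Longrightarrow> (f has_derivative (\<lambda>v. G (x + t *\<^sub>R k) \<bullet> v)) (at (x + t *\<^sub>R k))"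
    and G: "\<And>t. 0 \<le> t \<Longrightarrow> t \<le> 1 \<Longrightarrow> (G has_derivative (\<lambda>v. H (x + t *\<^sub>R k) *v v)) (at (x + t *\<^sub>R k))"
  shows "\<exists>t\<in>{0<..<1}. f (x + k) = f x + G x \<bullet> k + (1/2) * (k \<bullet> (H (x + t *\<^sub>R k) *v k))"
proof -
  define diff where "diff n t = (if n = 0 then f (x + t *\<^sub>R k) else if n = 1 then G (x + t *\<^sub>R k) \<bullet> k
    else k \<bullet> (H (x + t *\<^sub>R k) *v k))" for n :: nat and t
  have line: "((\<lambda>t. x + t *\<^sub>R k) has_derivative (\<lambda>s. s *\<^sub>R k)) (at t)" for t
    by (auto intro!: derivative_eq_intros)
  have d0: "DERIV (diff 0) t :> diff (Suc 0) t" if "0 \<le> t" "t \<le> 1" for t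
  proof -
    have "((\<lambda>t. f (x + t *\<^sub>R k)) has_derivative (\<lambda>s. G (x + t *\<^sub>R k) \<bullet> (s *\<^sub>R k))) (at t)"
      using diff_chain_at[OF line f[OF that]] by (simp add: o_def)
    then show ?thesis unfolding has_field_derivative_def diff_def by (simp add: mult_commute_abs)
  qed
  have d1: "DERIV (diff (Suc 0)) t :> diff (Suc (Suc 0)) t" if "0 \<le> t" "t \<le> 1" for t
  proof -
    have "((\<lambda>t. G (x + t *\<^sub>R k)) has_derivative (\<lambda>s. H (x + t *\<^sub>R k) *v (s *\<^sub>R k))) (at t)"
      using diff_chain_at[OF line G[OF that]] by (simp add: o_def)
    then have "((\<lambda>t. G (x + t *\<^sub>R k) \<bullet> k) has_derivative (\<lambda>s. (H (x + t *\<^sub>R k) *v (s *\<^sub>R k)) \<bullet> k)) (at t)"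
      by (rule has_derivative_inner_left)
    then show ?thesis unfolding has_field_derivative_def diff_def
      by (simp add: mult_commute_abs matrix_vector_mult_scaleR inner_commute)
  qed
  have "\<exists>t>0. t < 1 \<and> f (x + 1 *\<^sub>R k) = (\<Sum>m<2. diff m 0 / fact m * 1 ^ m) + diff 2 t / fact 2 * 1 ^ 2"
  proof (rule Maclaurin)
    show "diff 0 = (\<lambda>t. f (x + t *\<^sub>R k))" by (rule ext) (simp add: diff_def)
    show "\<forall>m t. m < 2 \<and> 0 \<le> t \<and> t \<le> 1 \<longrightarrow> DERIV (diff m) t :> diff (Suc m) t"
      using d0 d1 by (auto simp: less_2_cases_iff)
  qed auto
  then obtain t where "0 < t" "t < 1" "f (x + k) = (\<Sum>m<2. diff m 0 / fact m) + diff 2 t / fact 2" by auto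
  then show ?thesis
    by (intro bexI[of _ t]) (auto simp: diff_def numeral_2_eq_2)
qed

definition C2 :: "(real^'m \<Rightarrow> real) \<Rightarrow> (real^'m \<Rightarrow> real^'m) \<Rightarrow> (real^'m \<Rightarrow> real^'m^'m) \<Rightarrow> bool" where
  "C2 f G H \<longleftrightarrow> (\<forall>x. (f has_derivative (\<lambda>k. G x \<bullet> k)) (at x)) \<and>
     (\<forall>x. (G has_derivative (\<lambda>k. H x *v k)) (at x)) \<and> continuous_on UNIV H"

lemma C2_continuous:
  assumes "C2 f G H"
  shows "continuous_on UNIV f" "continuous_on UNIV G" "continuous_on UNIV H"
  using assms unfolding C2_def
  by (auto intro!: continuous_at_imp_continuous_on has_derivative_continuous)

lemma C2_linear_combination:
  assumes "C2 f G H" "C2 f' G' H'"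
  shows "C2 (\<lambda>x. a * f x + b * f' x) (\<lambda>x. a *\<^sub>R G x + b *\<^sub>R G' x) (\<lambda>x. a *\<^sub>R H x + b *\<^sub>R H' x)"
  using assms unfolding C2_def
proof (intro conjI allI)
  fix x
  assume *: "(\<forall>x. (f has_derivative (\<bullet>) (G x)) (at x)) \<and> (\<forall>x. (G has_derivative (*v) (H x)) (at x)) \<and> continuous_on UNIV H"
    "(\<forall>x. (f' has_derivative (\<bullet>) (G' x)) (at x)) \<and> (\<forall>x. (G' has_derivative (*v) (H' x)) (at x)) \<and> continuous_on UNIV H'"
  show "((\<lambda>x. a * f x + b * f' x) has_derivative (\<bullet>) (a *\<^sub>R G x + b *\<^sub>R G' x)) (at x)"
    by (rule has_derivative_eq_rhs[OF has_derivative_add[OF has_derivative_mult_right[of f] has_derivative_mult_right[of f']]])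
      (use * in \<open>auto simp: inner_add_left fun_eq_iff\<close>)
  show "((\<lambda>x. a *\<^sub>R G x + b *\<^sub>R G' x) has_derivative (*v) (a *\<^sub>R H x + b *\<^sub>R H' x)) (at x)"
    by (rule has_derivative_eq_rhs[OF has_derivative_add[OF has_derivative_scaleR_right[of G] has_derivative_scaleR_right[of G']]])
      (use * in \<open>auto simp: matrix_vector_mult_add_rdistrib scaleR_matrix_vector_assoc fun_eq_iff\<close>)
  show "continuous_on UNIV (\<lambda>x. a *\<^sub>R H x + b *\<^sub>R H' x)"
    using * by (intro continuous_intros) auto
qed

lemma trc_add: "trc B (M + N) = trc B M + trc B N"
  by (simp add: trc_def matrix_vector_mult_add_rdistrib inner_add_right sum.distrib)

lemma trc_scaleR: "trc B (a *\<^sub>R M) = a * trc B M"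
  by (simp add: trc_def scaleR_matrix_vector_assoc[symmetric] sum_distrib_left)

lemma trc_diff: "trc B (M - N) = trc B M - trc B N"
  using trc_add[of B M "- 1 *\<^sub>R N"] trc_scaleR[of B "-1" N] by simp

lemma quadratic_form_bound:
  fixes M :: "real^'m^'m"
  assumes "\<And>i j. \<bar>M $ i $ j\<bar> \<le> C"
  shows "\<bar>k \<bullet> (M *v k)\<bar> \<le> real CARD('m) ^ 2 * C * (norm k)\<^sup>2"
proof -
  have "\<bar>k \<bullet> (M *v k)\<bar> = \<bar>\<Sum>i\<in>UNIV. \<Sum>j\<in>UNIV. k $ i * (M $ i $ j * k $ j)\<bar>"
    by (simp add: inner_vec_def matrix_vector_mult_def sum_distrib_left)
  also have "\<dots> \<le> (\<Sum>i\<in>UNIV. \<Sum>j\<in>UNIV. \<bar>k $ i * (M $ i $ j * k $ j)\<bar>)"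
    by (rule order_trans[OF sum_abs sum_mono[OF sum_abs]])
  also have "\<dots> \<le> (\<Sum>i\<in>(UNIV::'m set). \<Sum>j\<in>(UNIV::'m set). C * (norm k)\<^sup>2)"
  proof (intro sum_mono)
    fix i j
    have "\<bar>k $ i * (M $ i $ j * k $ j)\<bar> = \<bar>M $ i $ j\<bar> * (\<bar>k $ i\<bar> * \<bar>k $ j\<bar>)" by (simp add: abs_mult)
    also have "\<dots> \<le> C * (norm k * norm k)"
      using assms[of i j] order_trans[OF abs_ge_zero assms[of i j]]
      by (intro mult_mono component_le_norm_cart) auto
    finally show "\<bar>k $ i * (M $ i $ j * k $ j)\<bar> \<le> C * (norm k)\<^sup>2" by (simp add: power2_eq_square)
  qed
  finally show ?thesis by (simp add: power2_eq_square)
qed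

lemma trc_bound:
  fixes M :: "real^'m^'m"
  assumes "\<And>i j. \<bar>M $ i $ j\<bar> \<le> C" "oset B"
  shows "\<bar>trc B M\<bar> \<le> real CARD('m) ^ 3 * C"
proof -
  have C: "0 \<le> C" using order_trans[OF abs_ge_zero assms(1)[of undefined undefined]] .
  have "\<bar>trc B M\<bar> \<le> (\<Sum>b\<in>B. \<bar>b \<bullet> (M *v b)\<bar>)" unfolding trc_def by (rule sum_abs)
  also have "\<dots> \<le> (\<Sum>b\<in>B. real CARD('m) ^ 2 * C)"
  proof (rule sum_mono)
    fix b assume "b \<in> B"
    then have "norm b = 1" using assms(2) by (simp add: oset_def)
    then show "\<bar>b \<bullet> (M *v b)\<bar> \<le> real CARD('m) ^ 2 * C"
      using quadratic_form_bound[of M C b] assms(1) by simp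
  qed
  also have "\<dots> = real (card B) * (real CARD('m) ^ 2 * C)" by simp
  also have "\<dots> \<le> real CARD('m) * (real CARD('m) ^ 2 * C)"
    using oset_card_le[OF assms(2)] C by (intro mult_right_mono) auto
  finally show ?thesis by (simp add: power3_eq_cube power2_eq_square mult.assoc)
qed

lemma bavg_sum:
  assumes "finite I" "\<And>i. i \<in> I \<Longrightarrow> continuous_on UNIV (f i)"
  shows "bavg (\<lambda>\<xi>. \<Sum>i\<in>I. f i \<xi>) = (\<Sum>i\<in>I. bavg (f i))"
  using assms
proof (induction rule: finite_induct)
  case (insert i I)
  then show ?case by (simp add: bavg_add continuous_on_sum)
qed simp

text \<open>The covariance of the noise is \<open>bvar\<close> times the identity, and projecting
  the noise restricts the trace to the plane.\<close>

lemma bavg_quadratic: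
  fixes M :: "real^'m^'m"
  assumes "oset B"
  shows "bavg (\<lambda>\<xi>. prj B \<xi> \<bullet> (M *v prj B \<xi>)) = bvar TYPE('m) * trc B M"
proof -
  have fin: "finite B" by (rule oset_finite[OF assms])
  have "prj B \<xi> \<bullet> (M *v prj B \<xi>) = (\<Sum>b\<in>B. \<Sum>b'\<in>B. (b \<bullet> (M *v b')) * ((b \<bullet> \<xi>) * (b' \<bullet> \<xi>)))" for \<xi>
  proof -
    have "M *v prj B \<xi> = (\<Sum>b'\<in>B. (b' \<bullet> \<xi>) *\<^sub>R (M *v b'))"
      unfolding prj_def by (simp add: linear_sum[OF matrix_vector_mul_linear] matrix_vector_mult_scaleR)
    then show ?thesis
      unfolding prj_def[of B \<xi>] inner_sum_left by (simp add: inner_sum_right sum_distrib_left mult_ac)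
  qed
  then have "bavg (\<lambda>\<xi>. prj B \<xi> \<bullet> (M *v prj B \<xi>))
      = (\<Sum>b\<in>B. \<Sum>b'\<in>B. (b \<bullet> (M *v b')) * bavg (\<lambda>\<xi>. (b \<bullet> \<xi>) * (b' \<bullet> \<xi>)))"
    by (simp only:) (simp add: bavg_sum fin bavg_cmult continuous_intros)
  also have "\<dots> = (\<Sum>b\<in>B. \<Sum>b'\<in>B. if b' = b then (b \<bullet> (M *v b)) * bvar TYPE('m) else 0)"
  proof (intro sum.cong refl)
    fix b b' assume b: "b \<in> B" "b' \<in> B"
    show "(b \<bullet> (M *v b')) * bavg (\<lambda>\<xi>. (b \<bullet> \<xi>) * (b' \<bullet> \<xi>)) = (if b' = b then (b \<bullet> (M *v b)) * bvar TYPE('m) else 0)"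
    proof (cases "b' = b")
      case True
      have "norm b = 1" using assms b by (simp add: oset_def)
      then show ?thesis using True bavg_inner_sq[of b] by (simp add: power2_eq_square)
    next
      case False
      then show ?thesis using bavg_inner_orthogonal[of b b'] oset_inner[OF assms b] by auto
    qed
  qed
  also have "\<dots> = (\<Sum>b\<in>B. (b \<bullet> (M *v b)) * bvar TYPE('m))" using fin by (simp add: sum.delta)
  finally show ?thesis by (simp add: trc_def sum_distrib_left mult.commute)
qed

section \<open>Smoothing of functions with Lipschitz logarithm\<close>

section \<open>Mollification\<close>

definition moll :: "('a::euclidean_space \<Rightarrow> real) \<Rightarrow> ('a \<Rightarrow> real) \<Rightarrow> 'a \<Rightarrow> real" where
  "moll J w x = wint J (\<lambda>z. w (x + z))"

lemma continuous_translate: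
  "continuous_on UNIV w \<Longrightarrow> continuous_on S (\<lambda>z. w (x + z))" for w :: "'a::real_normed_vector \<Rightarrow> real"
  by (rule continuous_on_compose2[of UNIV w]) (auto intro!: continuous_intros)

lemma wint_abs_le:
  fixes J f :: "'a::euclidean_space \<Rightarrow> real"
  assumes J: "weight R J" and f: "continuous_on (cball 0 R) f"
    and b: "\<And>z. \<bar>J z\<bar> \<le> C" "\<And>z. norm z \<le> R \<Longrightarrow> \<bar>f z\<bar> \<le> D"
  shows "\<bar>wint J f\<bar> \<le> C * D * measure lborel (cball 0 R :: 'a set)" (is "_ \<le> _ * ?V")
proof -
  have C: "0 \<le> C" using order_trans[OF abs_ge_zero b(1)] .
  have int: "integrable lborel (\<lambda>z. J z * f z)" by (rule weight_integrable[OF J f])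
  have "\<bar>wint J f\<bar> \<le> (LINT z|lborel. norm (J z * f z))"
    unfolding wint_def using integral_norm_bound[of lborel "\<lambda>z. J z * f z"] by simp
  also have "\<dots> \<le> (LINT z|lborel. (C * D) * indicator (cball 0 R :: 'a set) z)"
  proof (rule Bochner_Integration.integral_mono)
    show "integrable lborel (\<lambda>z. norm (J z * f z))" using int by simp
    show "integrable lborel (\<lambda>z. (C * D) * indicator (cball 0 R :: 'a set) z)"
      using emeasure_lborel_cball_finite[of "0::'a" R]
      by (intro integrable_mult_right integrable_real_indicator) (auto simp: less_top)
    fix z :: 'a
    show "norm (J z * f z) \<le> (C * D) * indicator (cball 0 R) z"
    proof (cases "norm z \<le> R")
      case True
      then show ?thesis using b(1)[of z] b(2)[OF True] C
        by (auto simp: abs_mult intro!: mult_mono)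
    next
      case False
      then show ?thesis using J by (simp add: weight_def)
    qed
  qed
  also have "\<dots> = C * D * ?V" by simp
  finally show ?thesis .
qed

lemma wint_translate:
  fixes J w :: "'a::euclidean_space \<Rightarrow> real"
  assumes "J \<in> borel_measurable borel" "w \<in> borel_measurable borel"
  shows "wint J (\<lambda>z. w (x + k + z)) = (LINT z|lborel. J (z - k) * w (x + z))"
proof -
  have "(LINT z|lborel. J (z - k) * w (x + z)) = (LINT z|distr lborel borel ((+) k). J (z - k) * w (x + z))"
    by (simp only: lborel_distr_plus)
  also have "\<dots> = (LINT z|lborel. J (k + z - k) * w (x + (k + z)))"
    by (rule integral_distr) (use assms in measurable)
  finally show ?thesis by (simp add: wint_def add.assoc)
qed

text \<open>A translation of the integration variable puts the increment into the kernel, so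
  \<open>w\<close> only has to be continuous; the kernel is then seen at \<open>z - k\<close>, which
  is the origin of the minus sign. The quadratic remainder of the kernel replaces differentiation
  under the integral.\<close>

lemma moll_has_derivative:
  fixes J :: "real^'m \<Rightarrow> real" and g :: "real^'m \<Rightarrow> real^'m"
  assumes J: "continuous_on UNIV J" "\<And>z. R < norm z \<Longrightarrow> J z = 0"
    and g: "continuous_on UNIV g" "\<And>z. R < norm z \<Longrightarrow> g z = 0"
    and rem: "\<And>z k. \<bar>J (z + k) - J z - g z \<bullet> k\<bar> \<le> L * (norm k)\<^sup>2"
    and w: "continuous_on UNIV w" and R: "0 \<le> R"
  shows "(moll J w has_derivative (\<lambda>k. (\<chi> i. - moll (\<lambda>z. g z $ i) w x) \<bullet> k)) (at x)"
proof -
  \<comment> \<open>The radius \<open>R + 1\<close> covers the supports of all kernels translated by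
    a vector of length at most 1.\<close>
  let ?V = "measure lborel (cball 0 (R + 1) :: (real^'m) set)"
  obtain D where D: "\<And>z. norm z \<le> R + 1 \<Longrightarrow> \<bar>w (x + z)\<bar> \<le> D"
  proof -
    have "compact ((\<lambda>z. w (x + z)) ` cball 0 (R + 1))"
      by (intro compact_continuous_image continuous_translate w) auto
    then have "bounded ((\<lambda>z. w (x + z)) ` cball 0 (R + 1))" by (rule compact_imp_bounded)
    then obtain D where "\<forall>y\<in>(\<lambda>z. w (x + z)) ` cball 0 (R + 1). norm y \<le> D" by (auto simp: bounded_iff)
    then show thesis by (intro that[of D]) auto
  qed
  have Jm: "J \<in> borel_measurable borel" and wm: "w \<in> borel_measurable borel"
    using J w by (auto intro: borel_measurable_continuous_onI)
  have L: "0 \<le> L" using order_trans[OF abs_ge_zero rem[of 0 "axis undefined 1"]] by simp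
  have est: "\<bar>moll J w (x + k) - moll J w x - (\<chi> i. - moll (\<lambda>z. g z $ i) w x) \<bullet> k\<bar> \<le> (L * D * ?V) * (norm k)\<^sup>2"
    if k: "norm k \<le> 1" for k
  proof -
    let ?J = "\<lambda>z. J (z - k) - J z + g z \<bullet> k"
    have J0: "J (z - k) = 0" "J z = 0" "g z = 0" if "R + 1 < norm z" for z
    proof -
      have "norm z \<le> norm (z - k) + norm k" by (metis add.commute diff_add_cancel norm_triangle_ineq)
      then have "R < norm (z - k)" using that k by linarith
      then show "J (z - k) = 0" by (rule J(2))
      show "J z = 0" "g z = 0" using that by (auto intro: J(2) g(2))
    qed
    have cJ: "continuous_on UNIV (\<lambda>z. J (z - k))" by (rule continuous_on_compose2[OF J(1)]) (auto intro!: continuous_intros)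
    have wJ: "weight (R + 1) ?J" unfolding weight_def using J0
      by (auto intro!: continuous_intros continuous_on_subset[OF cJ] continuous_on_subset[OF J(1)] continuous_on_subset[OF g(1)])
    have w1: "weight (R + 1) (\<lambda>z. J (z - k))" unfolding weight_def using J0 by (auto intro: continuous_on_subset[OF cJ])
    have w2: "weight (R + 1) J" unfolding weight_def using J0 by (auto intro: continuous_on_subset[OF J(1)])
    have w3: "weight (R + 1) (\<lambda>z. g z $ i)" for i unfolding weight_def using J0 by (auto intro!: continuous_intros continuous_on_subset[OF g(1)])
    note cw = continuous_translate[OF w, of "cball 0 (R + 1)" x]
    note ints = weight_integrable[OF w1 cw] weight_integrable[OF w2 cw] weight_integrable[OF w3 cw]
    have e1: "(\<chi> i. - moll (\<lambda>z. g z $ i) w x) \<bullet> k = - (LINT z|lborel. (g z \<bullet> k) * w (x + z))"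
    proof -
      have "(LINT z|lborel. (g z \<bullet> k) * w (x + z)) = (LINT z|lborel. (\<Sum>i\<in>UNIV. k $ i * (g z $ i * w (x + z))))"
        by (intro Bochner_Integration.integral_cong refl) (simp add: inner_vec_def sum_distrib_left sum_distrib_right mult_ac)
      also have "\<dots> = (\<Sum>i\<in>UNIV. LINT z|lborel. k $ i * (g z $ i * w (x + z)))"
        by (intro Bochner_Integration.integral_sum integrable_mult_right ints)
      also have "\<dots> = (\<Sum>i\<in>UNIV. k $ i * moll (\<lambda>z. g z $ i) w x)" by (simp add: moll_def wint_def)
      finally show ?thesis by (simp add: inner_vec_def sum_negf mult.commute)
    qed
    have i3: "integrable lborel (\<lambda>z. (g z \<bullet> k) * w (x + z))"
    proof -
      have "weight (R + 1) (\<lambda>z. g z \<bullet> k)" unfolding weight_def using J0 by (auto intro!: continuous_intros continuous_on_subset[OF g(1)])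
      then show ?thesis by (rule weight_integrable[OF _ cw])
    qed
    have "moll J w (x + k) - moll J w x - (\<chi> i. - moll (\<lambda>z. g z $ i) w x) \<bullet> k
      = (LINT z|lborel. J (z - k) * w (x + z)) - (LINT z|lborel. J z * w (x + z)) + (LINT z|lborel. (g z \<bullet> k) * w (x + z))"
    proof -
      have "moll J w (x + k) = (LINT z|lborel. J (z - k) * w (x + z))"
        by (simp only: moll_def wint_translate[OF Jm wm])
      moreover have "moll J w x = (LINT z|lborel. J z * w (x + z))" by (simp only: moll_def wint_def)
      ultimately show ?thesis unfolding e1 by simp
    qed
    also have "\<dots> = (LINT z|lborel. J (z - k) * w (x + z) - J z * w (x + z) + (g z \<bullet> k) * w (x + z))"
      using ints(1,2) i3 by simp
    also have "\<dots> = wint ?J (\<lambda>z. w (x + z))"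
      unfolding wint_def by (intro Bochner_Integration.integral_cong refl) (simp add: algebra_simps)
    finally have eq: "moll J w (x + k) - moll J w x - (\<chi> i. - moll (\<lambda>z. g z $ i) w x) \<bullet> k = wint ?J (\<lambda>z. w (x + z))" .
    have "\<bar>wint ?J (\<lambda>z. w (x + z))\<bar> \<le> (L * (norm k)\<^sup>2) * D * ?V"
    proof (rule wint_abs_le[OF wJ cw])
      fix z show "\<bar>?J z\<bar> \<le> L * (norm k)\<^sup>2" using rem[of z "- k"] by simp
    qed (use D in auto)
    then show ?thesis unfolding eq by (simp add: mult_ac)
  qed
  show ?thesis
    unfolding has_derivative_at
  proof (intro conjI)
    show "bounded_linear (\<lambda>k. (\<chi> i. - moll (\<lambda>z. g z $ i) w x) \<bullet> k)" by (rule bounded_linear_inner_right)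
    show "(\<lambda>k. norm (moll J w (x + k) - moll J w x - (\<chi> i. - moll (\<lambda>z. g z $ i) w x) \<bullet> k) / norm k) \<midarrow>0\<rightarrow> 0"
    proof (rule Lim_null_comparison)
      have "eventually (\<lambda>k::real^'m. norm k < 1) (at 0)"
        unfolding eventually_at by (intro exI[of _ 1]) (auto simp: dist_norm)
      then show "eventually (\<lambda>k. norm (norm (moll J w (x + k) - moll J w x - (\<chi> i. - moll (\<lambda>z. g z $ i) w x) \<bullet> k) / norm k)
          \<le> (L * D * ?V) * norm k) (at 0)"
      proof eventually_elim
        case (elim k)
        then show ?case using est[of k]
          by (cases "k = 0") (auto simp: field_simps power2_eq_square)
      qed
      show "(\<lambda>k::real^'m. (L * D * ?V) * norm k) \<midarrow>0\<rightarrow> 0" by (auto intro!: tendsto_eq_intros)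
    qed
  qed
qed

text \<open>On the support of the kernel \<open>w\<close> exceeds \<open>w x\<close> by at most the
  factor \<open>exp (l * R)\<close>. As the bound is relative to \<open>w x\<close>, its constant
  does not depend on \<open>w\<close>.\<close>

lemma moll_loglip_bound:
  fixes J w :: "'a::euclidean_space \<Rightarrow> real"
  assumes J: "weight R J" "\<And>z. \<bar>J z\<bar> \<le> C" and w: "loglip l w" "0 \<le> l" "0 \<le> R"
  shows "\<bar>moll J w x\<bar> \<le> (C * exp (l * R) * measure lborel (cball 0 R :: 'a set)) * w x"
proof -
  have "w (x + z) \<le> exp (l * R) * w x" if "norm z \<le> R" for z
  proof -
    have "w (x + z) \<le> exp (l * norm z) * w x" using loglip_le[OF w(1), of "x + z" x] by simp
    also have "\<dots> \<le> exp (l * R) * w x"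
      using that w loglip_pos[OF w(1), of x] by (intro mult_right_mono) (auto intro: mult_left_mono)
    finally show ?thesis .
  qed
  then have "\<bar>wint J (\<lambda>z. w (x + z))\<bar> \<le> C * (exp (l * R) * w x) * measure lborel (cball 0 R :: 'a set)"
    using loglip_pos[OF w(1)]
    by (intro wint_abs_le[OF J(1) continuous_translate[OF loglip_continuous[OF w(1)]] J(2)]) (auto simp: less_imp_le)
  then show ?thesis by (simp add: moll_def mult_ac)
qed

lemma moll_diff_bound:
  fixes J w v :: "'a::euclidean_space \<Rightarrow> real"
  assumes J: "weight R J" "\<And>z. \<bar>J z\<bar> \<le> C" and w: "loglip l w" "0 \<le> l" "0 \<le> R" and v: "continuous_on UNIV v"
    and d: "\<And>y. \<bar>v y - w y\<bar> \<le> d * w y" "0 \<le> d"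
  shows "\<bar>moll J v x - moll J w x\<bar> \<le> (C * exp (l * R) * measure lborel (cball 0 R :: 'a set)) * d * w x"
proof -
  have "\<bar>v (x + z) - w (x + z)\<bar> \<le> d * (exp (l * R) * w x)" if "norm z \<le> R" for z
  proof -
    have "w (x + z) \<le> exp (l * norm z) * w x" using loglip_le[OF w(1), of "x + z" x] by simp
    also have "\<dots> \<le> exp (l * R) * w x"
      using that w loglip_pos[OF w(1), of x] by (intro mult_right_mono) (auto intro: mult_left_mono)
    finally have "d * w (x + z) \<le> d * (exp (l * R) * w x)" using d(2) by (rule mult_left_mono)
    with d(1)[of "x + z"] show ?thesis by linarith
  qed
  moreover note c = continuous_translate[OF v, of "cball 0 R" x] continuous_translate[OF loglip_continuous[OF w(1)], of "cball 0 R" x]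
  ultimately have "\<bar>wint J (\<lambda>z. v (x + z) - w (x + z))\<bar> \<le> C * (d * (exp (l * R) * w x)) * measure lborel (cball 0 R :: 'a set)"
    by (intro wint_abs_le[OF J(1) _ J(2)] continuous_intros) auto
  then show ?thesis unfolding moll_def wint_diff[OF J(1) c] by (simp add: mult_ac)
qed

lemma loglip_translate_diff:
  assumes w: "loglip l w" "0 \<le> l"
  shows "\<bar>w (y + k) - w y\<bar> \<le> (exp (l * norm k) - 1) * w y"
proof -
  have 1: "w (y + k) \<le> exp (l * norm k) * w y" using loglip_le[OF w(1), of "y + k" y] by simp
  have 2: "w y \<le> exp (l * norm k) * w (y + k)" using loglip_le[OF w(1), of y "y + k"] by simp
  have e: "1 \<le> exp (l * norm k)" using w by simp
  have "w y - w (y + k) \<le> (exp (l * norm k) - 1) * w y"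
  proof (cases "w (y + k) \<le> w y")
    case True
    have "w y - w (y + k) \<le> (exp (l * norm k) - 1) * w (y + k)" using 2 by (simp add: algebra_simps)
    also have "\<dots> \<le> (exp (l * norm k) - 1) * w y" using True e by (intro mult_left_mono) auto
    finally show ?thesis .
  next
    case False
    then show ?thesis using e loglip_pos[OF w(1), of y] by (smt (verit) mult_nonneg_nonneg)
  qed
  with 1 show ?thesis by (simp add: algebra_simps)
qed

lemma moll_translate_bound:
  fixes J w :: "'a::euclidean_space \<Rightarrow> real"
  assumes J: "weight R J" "\<And>z. \<bar>J z\<bar> \<le> C" and w: "loglip l w" "0 \<le> l" "0 \<le> R"
  shows "\<bar>moll J w (x + k) - moll J w x\<bar> \<le> (C * exp (l * R) * measure lborel (cball 0 R :: 'a set)) * (exp (l * norm k) - 1) * w x"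
proof -
  have "moll J w (x + k) = moll J (\<lambda>y. w (y + k)) x" by (simp add: moll_def add_ac)
  moreover have "continuous_on UNIV (\<lambda>y. w (y + k))"
    using continuous_translate[OF loglip_continuous[OF w(1)], of UNIV k] by (simp add: add.commute)
  ultimately show ?thesis
    using moll_diff_bound[OF J w, of "\<lambda>y. w (y + k)" "exp (l * norm k) - 1" x] loglip_translate_diff[OF w(1,2)] w(2) by simp
qed

lemma moll_continuous:
  fixes J w :: "'a::euclidean_space \<Rightarrow> real"
  assumes J: "weight R J" "\<And>z. \<bar>J z\<bar> \<le> C" and w: "loglip l w" "0 \<le> l" "0 \<le> R"
  shows "continuous_on UNIV (moll J w)"
proof (rule continuous_at_imp_continuous_on, rule ballI)
  fix x :: 'a
  let ?c = "C * exp (l * R) * measure lborel (cball 0 R :: 'a set)"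
  have "((\<lambda>k. moll J w (x + k) - moll J w x) \<longlongrightarrow> 0) (at 0)"
  proof (rule Lim_null_comparison)
    show "\<forall>\<^sub>F k in at 0. norm (moll J w (x + k) - moll J w x) \<le> ?c * (exp (l * norm k) - 1) * w x"
      using moll_translate_bound[OF J w] by simp
    show "((\<lambda>k::'a. ?c * (exp (l * norm k) - 1) * w x) \<longlongrightarrow> 0) (at 0)"
      by (auto intro!: tendsto_eq_intros)
  qed
  then have "((\<lambda>k. moll J w (x + k)) \<longlongrightarrow> moll J w x) (at 0)" by (simp add: LIM_zero_iff)
  then show "isCont (moll J w) x" by (simp add: isCont_iff)
qed

section \<open>Construction of a compactly supported kernel with Lipschitz Hessian\<close>

section \<open>A mollifier\<close>

lemma DERIV_max0_square: "((\<lambda>r::real. (max 0 r)\<^sup>2) has_real_derivative 2 * max 0 r) (at r)"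
proof -
  have b: "\<bar>(max 0 (r + h))\<^sup>2 - (max 0 r)\<^sup>2 - 2 * max 0 r * h\<bar> \<le> h\<^sup>2" for h :: real
  proof (cases "0 \<le> r"; cases "0 \<le> r + h")
    assume "0 \<le> r" "0 \<le> r + h"
    then show ?thesis by (simp add: power2_eq_square algebra_simps)
  next
    assume a: "0 \<le> r" "\<not> 0 \<le> r + h"
    have "(max 0 (r + h))\<^sup>2 - (max 0 r)\<^sup>2 - 2 * max 0 r * h = h\<^sup>2 - (r + h)\<^sup>2"
      using a by (simp add: power2_eq_square algebra_simps)
    moreover have "(r + h)\<^sup>2 \<le> h\<^sup>2" using a by (simp add: abs_le_square_iff[symmetric])
    ultimately show ?thesis using zero_le_power2[of "r + h"] by linarith
  next
    assume a: "\<not> 0 \<le> r" "0 \<le> r + h"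
    then have "(r + h)\<^sup>2 \<le> h\<^sup>2" by (intro power_mono) auto
    then show ?thesis using a by simp
  next
    assume "\<not> 0 \<le> r" "\<not> 0 \<le> r + h"
    then show ?thesis by simp
  qed
  show ?thesis
    unfolding DERIV_def
  proof (rule LIM_zero_cancel, rule Lim_null_comparison)
    show "\<forall>\<^sub>F h in at 0. norm (((max 0 (r + h))\<^sup>2 - (max 0 r)\<^sup>2) / h - 2 * max 0 r) \<le> \<bar>h\<bar>"
      unfolding eventually_at
    proof (intro exI[of _ 1] conjI ballI impI)
      fix h :: real assume "h \<noteq> 0 \<and> dist h 0 < 1"
      then have h: "h \<noteq> 0" by simp
      have "((max 0 (r + h))\<^sup>2 - (max 0 r)\<^sup>2) / h - 2 * max 0 r = ((max 0 (r + h))\<^sup>2 - (max 0 r)\<^sup>2 - 2 * max 0 r * h) / h"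
        using h by (simp add: field_simps)
      then have "norm (((max 0 (r + h))\<^sup>2 - (max 0 r)\<^sup>2) / h - 2 * max 0 r) \<le> h\<^sup>2 / \<bar>h\<bar>"
        using b[of h] by (simp add: divide_right_mono)
      also have "h\<^sup>2 / \<bar>h\<bar> = \<bar>h\<bar>" using h by (simp add: divide_eq_eq power2_eq_square abs_mult[symmetric])
      finally show "norm (((max 0 (r + h))\<^sup>2 - (max 0 r)\<^sup>2) / h - 2 * max 0 r) \<le> \<bar>h\<bar>" .
    qed simp
    show "((\<lambda>h::real. \<bar>h\<bar>) \<longlongrightarrow> 0) (at 0)" by (auto intro!: tendsto_eq_intros)
  qed
qed

lemma DERIV_max0_power:
  "((\<lambda>r::real. (max 0 r) ^ (n + 2)) has_real_derivative real (n + 2) * (max 0 r) ^ (n + 1)) (at r)"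
proof (induction n)
  case 0
  then show ?case using DERIV_max0_square[of r] by (simp add: power2_eq_square)
next
  case (Suc n)
  have eq: "(\<lambda>r::real. (max 0 r) ^ (Suc n + 2)) = (\<lambda>r. r * (max 0 r) ^ (n + 2))"
    by (auto simp: max_def fun_eq_iff)
  have m: "r * (max 0 r) ^ (n + 1) = (max 0 r) ^ (n + 2)" by (auto simp: max_def)
  have "((\<lambda>r. r * (max 0 r) ^ (n + 2)) has_real_derivative
      1 * (max 0 r) ^ (n + 2) + (real (n + 2) * (max 0 r) ^ (n + 1)) * r) (at r)"
    by (rule DERIV_mult[OF DERIV_ident Suc])
  also have "1 * (max 0 r) ^ (n + 2) + (real (n + 2) * (max 0 r) ^ (n + 1)) * r = real (Suc n + 2) * (max 0 r) ^ (Suc n + 1)"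
  proof -
    have "1 * (max 0 r) ^ (n + 2) + (real (n + 2) * (max 0 r) ^ (n + 1)) * r
        = (max 0 r) ^ (n + 2) + real (n + 2) * (r * (max 0 r) ^ (n + 1))" by simp
    also have "\<dots> = real (Suc n + 2) * (max 0 r) ^ (n + 2)" unfolding m by (simp add: algebra_simps)
    finally show ?thesis by simp
  qed
  finally show ?case unfolding eq .
qed

text \<open>A truncated polynomial: each differentiation lowers the exponent by one, so the few
  derivatives that occur are explicit and bounded by elementary means.\<close>

definition bump :: "real \<Rightarrow> nat \<Rightarrow> 'a::euclidean_space \<Rightarrow> real" where
  "bump \<eta> n z = (max 0 (\<eta>\<^sup>2 - z \<bullet> z)) ^ n"

lemma bump_zero: "0 < n \<Longrightarrow> 0 \<le> \<eta> \<Longrightarrow> \<eta> \<le> norm z \<Longrightarrow> bump \<eta> n z = 0"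
proof -
  assume "0 < n" "0 \<le> \<eta>" "\<eta> \<le> norm z"
  then have "\<eta>\<^sup>2 \<le> z \<bullet> z" unfolding power2_norm_eq_inner[symmetric] by (intro power_mono)
  then show ?thesis using \<open>0 < n\<close> by (simp add: bump_def)
qed

lemma bump_bounds: "0 \<le> \<eta> \<Longrightarrow> \<eta> \<le> 1 \<Longrightarrow> 0 \<le> bump \<eta> n z \<and> bump \<eta> n z \<le> 1"
proof -
  assume "0 \<le> \<eta>" "\<eta> \<le> 1"
  then have "\<eta>\<^sup>2 \<le> 1" by (simp add: power_le_one)
  then have "max 0 (\<eta>\<^sup>2 - z \<bullet> z) \<le> 1" using inner_ge_zero[of z] by linarith
  then show ?thesis unfolding bump_def by (auto intro: power_le_one)
qed

lemma bump_continuous [continuous_intros]: "continuous_on S (bump \<eta> n)"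
  unfolding bump_def by (intro continuous_intros)

lemma bump_has_derivative:
  "(bump \<eta> (n + 2) has_derivative (\<lambda>k. - 2 * real (n + 2) * bump \<eta> (n + 1) z * (z \<bullet> k))) (at z)"
proof -
  have "((\<lambda>z. \<eta>\<^sup>2 - z \<bullet> z) has_derivative (\<lambda>k. - 2 * (z \<bullet> k))) (at z)"
    by (auto intro!: derivative_eq_intros simp: inner_commute)
  note d = has_derivative_compose[OF this DERIV_max0_power[of n "\<eta>\<^sup>2 - z \<bullet> z", unfolded has_field_derivative_def]]
  show ?thesis
    unfolding bump_def[abs_def] by (rule has_derivative_eq_rhs[OF d]) (simp add: fun_eq_iff algebra_simps)
qed

lemma mean_value_line:
  fixes J :: "'a::real_inner \<Rightarrow> real"
  assumes "\<And>z. (J has_derivative (\<lambda>k. g z \<bullet> k)) (at z)"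
  shows "\<exists>t\<in>{0<..<1}. J (z + k) - J z = g (z + t *\<^sub>R k) \<bullet> k"
proof -
  have line: "((\<lambda>t. z + t *\<^sub>R k) has_derivative (\<lambda>s. s *\<^sub>R k)) (at t)" for t
    by (auto intro!: derivative_eq_intros)
  have d: "((\<lambda>t. J (z + t *\<^sub>R k)) has_real_derivative g (z + t *\<^sub>R k) \<bullet> k) (at t)" for t
    using diff_chain_at[OF line assms] unfolding has_field_derivative_def
    by (simp add: o_def mult_commute_abs)
  obtain t where t: "0 < t" "t < 1" "J (z + 1 *\<^sub>R k) - J (z + 0 *\<^sub>R k) = (1 - 0) * (g (z + t *\<^sub>R k) \<bullet> k)"
    using MVT2[of 0 1 "\<lambda>t. J (z + t *\<^sub>R k)" "\<lambda>t. g (z + t *\<^sub>R k) \<bullet> k"] d by auto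
  then show ?thesis by (intro bexI[of _ t]) auto
qed

lemma gradient_lipschitz_remainder:
  fixes J :: "'a::real_inner \<Rightarrow> real"
  assumes "\<And>z. (J has_derivative (\<lambda>k. g z \<bullet> k)) (at z)" "\<And>z k. norm (g (z + k) - g z) \<le> L * norm k"
    "0 \<le> L"
  shows "\<bar>J (z + k) - J z - g z \<bullet> k\<bar> \<le> L * (norm k)\<^sup>2"
proof -
  obtain t where t: "t \<in> {0<..<1}" "J (z + k) - J z = g (z + t *\<^sub>R k) \<bullet> k"
    using mean_value_line[OF assms(1)] by blast
  have "\<bar>J (z + k) - J z - g z \<bullet> k\<bar> = \<bar>(g (z + t *\<^sub>R k) - g z) \<bullet> k\<bar>" using t by (simp add: inner_diff_left)
  also have "\<dots> \<le> norm (g (z + t *\<^sub>R k) - g z) * norm k" by (rule Cauchy_Schwarz_ineq2)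
  also have "\<dots> \<le> (L * norm (t *\<^sub>R k)) * norm k" by (intro mult_right_mono assms(2)) auto
  also have "\<dots> \<le> (L * (1 * norm k)) * norm k"
    using t assms(3) by (intro mult_right_mono mult_left_mono) (auto intro!: mult_left_le_one_le)
  finally show ?thesis by (simp add: power2_eq_square)
qed

lemma bounded_gradient_lipschitz:
  fixes J :: "'a::real_inner \<Rightarrow> real"
  assumes "\<And>z. (J has_derivative (\<lambda>k. g z \<bullet> k)) (at z)" "\<And>z k. \<bar>g z \<bullet> k\<bar> \<le> L * norm k"
  shows "\<bar>J (z + k) - J z\<bar> \<le> L * norm k"
  using mean_value_line[OF assms(1)] assms(2) by metis

text \<open>A normalised kernel with gradient \<open>G\<close> and Hessian \<open>H\<close>. The
  constant \<open>L\<close> may blow up as \<eta> tends to 0; it only restricts the step size of the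
  scheme, which is chosen after \<eta>.\<close>

locale mollifier =
  fixes K :: "real^'m \<Rightarrow> real" and G :: "real^'m \<Rightarrow> real^'m" and H :: "real^'m \<Rightarrow> real^'m^'m"
    and \<eta> L :: real
  assumes eta: "0 < \<eta>"
    and cont: "continuous_on UNIV K" "continuous_on UNIV G" "continuous_on UNIV H"
    and zero: "\<eta> < norm z \<Longrightarrow> K z = 0" "\<eta> < norm z \<Longrightarrow> G z = 0" "\<eta> < norm z \<Longrightarrow> H z = 0"
    and nonneg: "0 \<le> K z" and total: "wint K (\<lambda>_. 1) = 1"
    and rem: "\<bar>K (z + k) - K z - G z \<bullet> k\<bar> \<le> L * (norm k)\<^sup>2"
      "\<bar>G (z + k) $ i - G z $ i - H z $ i \<bullet> k\<bar> \<le> L * (norm k)\<^sup>2"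
    and hbound: "\<bar>H z $ i $ j\<bar> \<le> L" and kbound: "\<bar>K z\<bar> \<le> L"

lemma mollifier_exists:
  assumes "0 < \<eta>" "\<eta> \<le> 1"
  shows "\<exists>K G H L. mollifier (K :: real^'m \<Rightarrow> real) G H \<eta> L"
proof -
  define N where "N = wint (bump \<eta> 4 :: real^'m \<Rightarrow> real) (\<lambda>_. 1)"
  let ?b = "bump \<eta> :: nat \<Rightarrow> real^'m \<Rightarrow> real"
  have e0: "0 \<le> \<eta>" using assms by simp
  note bb = bump_bounds[OF e0 assms(2)]
  note bz = bump_zero[OF _ e0]
  have N: "0 < N"
  proof -
    have "weight \<eta> (?b 4)" unfolding weight_def by (auto intro!: continuous_intros bz)
    from weight_integrable[OF this, of "\<lambda>_. 1"] have int: "integrable lborel (?b 4)" by simp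
    have "0 < (3/4 * \<eta>\<^sup>2) ^ 4 * measure lborel (cball 0 (\<eta>/2) :: (real^'m) set)"
      using assms content_cball_pos[of "\<eta>/2" "0::real^'m"] by simp
    also have "\<dots> = (LINT z|lborel. (3/4 * \<eta>\<^sup>2) ^ 4 * indicator (cball 0 (\<eta>/2) :: (real^'m) set) z)" by simp
    also have "\<dots> \<le> (LINT z|lborel. ?b 4 z)"
    proof (rule Bochner_Integration.integral_mono[OF _ int])
      show "integrable lborel (\<lambda>z. (3/4 * \<eta>\<^sup>2) ^ 4 * indicator (cball 0 (\<eta>/2) :: (real^'m) set) z)"
        using emeasure_lborel_cball_finite[of "0::real^'m" "\<eta>/2"]
        by (intro integrable_mult_right integrable_real_indicator) (auto simp: less_top)
      fix z :: "real^'m"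
      show "(3/4 * \<eta>\<^sup>2) ^ 4 * indicator (cball 0 (\<eta>/2)) z \<le> ?b 4 z"
      proof (cases "norm z \<le> \<eta>/2")
        case True
        then have "(norm z)\<^sup>2 \<le> (\<eta>/2)\<^sup>2" by (intro power_mono) auto
        then have "3/4 * \<eta>\<^sup>2 \<le> \<eta>\<^sup>2 - z \<bullet> z" by (simp add: power2_norm_eq_inner power_divide)
        also have "\<dots> \<le> max 0 (\<eta>\<^sup>2 - z \<bullet> z)" by simp
        finally have "3/4 * \<eta>\<^sup>2 \<le> max 0 (\<eta>\<^sup>2 - z \<bullet> z)" .
        then have "(3/4 * \<eta>\<^sup>2) ^ 4 \<le> ?b 4 z" unfolding bump_def by (intro power_mono) auto
        then show ?thesis using True by simp
      qed (use bb[of 4 z] in simp)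
    qed
    finally show ?thesis by (simp add: N_def wint_def)
  qed
  \<comment> \<open>The exponent 4 becomes 3 in the gradient and 2 in the Hessian. The gradient
    \<open>T0\<close> of an entry of the Hessian still contains the exponent 1 and is bounded, so
    the Hessian is Lipschitz.\<close>
  define G0 where "G0 z = (- 8 * ?b 3 z) *\<^sub>R z" for z
  define H0 where "H0 z = (\<chi> i j. (if i = j then - 8 * ?b 3 z else 0) + 48 * ?b 2 z * (z $ i * z $ j))" for z :: "real^'m"
  have dK: "(?b 4 has_derivative (\<lambda>k. G0 z \<bullet> k)) (at z)" for z
    using bump_has_derivative[of \<eta> 2 z] by (simp add: G0_def)
  have d3: "(?b 3 has_derivative (\<lambda>k. - 6 * ?b 2 z * (z \<bullet> k))) (at z)" for z
    using bump_has_derivative[of \<eta> 1 z] by (simp add: numeral_3_eq_3 numeral_2_eq_2)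
  have d2: "(?b 2 has_derivative (\<lambda>k. - 4 * ?b 1 z * (z \<bullet> k))) (at z)" for z
    using bump_has_derivative[of \<eta> 0 z] by (simp add: numeral_2_eq_2)
  have comp: "((\<lambda>z::real^'m. z $ i) has_derivative (\<lambda>k. k $ i)) (at z)" for i z
    by (rule bounded_linear_imp_has_derivative[OF bounded_linear_vec_nth])
  have rowH: "H0 z $ i \<bullet> k = - 8 * ?b 3 z * k $ i + 48 * ?b 2 z * z $ i * (z \<bullet> k)" for z i k
  proof -
    have "H0 z $ i \<bullet> k = (\<Sum>j\<in>UNIV. (if j = i then - 8 * ?b 3 z * k $ i else 0) + 48 * ?b 2 z * z $ i * (z $ j * k $ j))"
      unfolding inner_vec_def H0_def by (intro sum.cong) (auto simp: algebra_simps)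
    then show ?thesis by (simp add: sum.distrib sum_distrib_left[symmetric] inner_vec_def)
  qed
  have dG: "((\<lambda>z. G0 z $ i) has_derivative (\<lambda>k. H0 z $ i \<bullet> k)) (at z)" for i z
  proof -
    have "((\<lambda>z. - 8 * (?b 3 z * z $ i)) has_derivative (\<lambda>k. - 8 * (?b 3 z * k $ i + (- 6 * ?b 2 z * (z \<bullet> k)) * z $ i))) (at z)"
      by (intro has_derivative_mult_right has_derivative_mult d3 comp)
    then show ?thesis unfolding rowH by (simp add: G0_def algebra_simps)
  qed
  define T0 where "T0 i j z = (if i = j then 48 * ?b 2 z else 0) *\<^sub>R z - (192 * ?b 1 z * (z $ i * z $ j)) *\<^sub>R z
    + (48 * ?b 2 z * z $ j) *\<^sub>R axis i 1 + (48 * ?b 2 z * z $ i) *\<^sub>R axis j 1" for i j and z :: "real^'m"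
  have dH: "((\<lambda>z. H0 z $ i $ j) has_derivative (\<lambda>k. T0 i j z \<bullet> k)) (at z)" for i j z
  proof -
    have 1: "((\<lambda>z. 48 * (?b 2 z * (z $ i * z $ j))) has_derivative
      (\<lambda>k. 48 * (?b 2 z * (z $ i * k $ j + k $ i * z $ j) + (- 4 * ?b 1 z * (z \<bullet> k)) * (z $ i * z $ j)))) (at z)"
      by (intro has_derivative_mult_right has_derivative_mult d2 comp)
    have 2: "((\<lambda>z. if i = j then - 8 * ?b 3 z else 0) has_derivative (\<lambda>k. (if i = j then - 8 * (- 6 * ?b 2 z * (z \<bullet> k)) else 0))) (at z)"
    proof (cases "i = j")
      case True
      have "((\<lambda>z. - 8 * ?b 3 z) has_derivative (\<lambda>k. - 8 * (- 6 * ?b 2 z * (z \<bullet> k)))) (at z)"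
        by (intro has_derivative_mult_right d3)
      then show ?thesis unfolding if_P[OF True] .
    qed simp
    show ?thesis
    proof -
      have eq: "(\<lambda>z. H0 z $ i $ j) = (\<lambda>z. (if i = j then - 8 * ?b 3 z else 0) + 48 * (?b 2 z * (z $ i * z $ j)))"
        by (simp add: H0_def fun_eq_iff)
      show ?thesis unfolding eq
        by (rule has_derivative_eq_rhs[OF has_derivative_add[OF 2 1]])
          (auto simp: T0_def fun_eq_iff inner_add_left inner_diff_left inner_axis' algebra_simps)
    qed
  qed
  have z1: "\<bar>?b n z * c\<bar> \<le> 1 * \<bar>c\<bar>" for n z c using bb[of n z] by (auto simp: abs_mult intro!: mult_left_le_one_le)
  have bza: "\<bar>?b n z * (p * q)\<bar> \<le> 1" if "0 < n" "\<bar>p\<bar> \<le> norm z" "\<bar>q\<bar> \<le> norm z" for n z p q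
  proof (cases "norm z \<le> 1")
    case True
    have "\<bar>?b n z * (p * q)\<bar> = ?b n z * (\<bar>p\<bar> * \<bar>q\<bar>)" using bb[of n z] by (simp add: abs_mult)
    also have "\<dots> \<le> 1 * (1 * 1)" using True that bb[of n z] by (intro mult_mono) auto
    finally show ?thesis by simp
  next
    case False
    then show ?thesis using bz[OF that(1), of z] assms by simp
  qed
  have bzb: "\<bar>?b n z * p\<bar> \<le> 1" if "0 < n" "\<bar>p\<bar> \<le> norm z" for n z p
  proof (cases "norm z \<le> 1")
    case True
    have "\<bar>?b n z * p\<bar> = ?b n z * \<bar>p\<bar>" using bb[of n z] by (simp add: abs_mult)
    also have "\<dots> \<le> 1 * 1" using True that bb[of n z] by (intro mult_mono) auto
    finally show ?thesis by simp
  next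
    case False
    then show ?thesis using bz[OF that(1), of z] assms by simp
  qed
  have nb: "norm (?b n z *\<^sub>R z) \<le> 1" if "0 < n" for n z using bzb[OF that, of "norm z" z] by (simp add: abs_mult)
  have nc: "norm ((?b n z * (z $ i * z $ j)) *\<^sub>R z) \<le> 1" if "0 < n" for n z i j
  proof (cases "norm z \<le> 1")
    case True
    have "norm ((?b n z * (z $ i * z $ j)) *\<^sub>R z) = \<bar>?b n z * (z $ i * z $ j)\<bar> * norm z" by simp
    also have "\<dots> \<le> 1 * 1" using True bza[OF that, of "z $ i" z "z $ j"] component_le_norm_cart[of z] by (intro mult_mono) auto
    finally show ?thesis by simp
  next
    case False
    then show ?thesis using bz[OF that(1), of z] assms by simp
  qed
  have Hb: "\<bar>H0 z $ i $ j\<bar> \<le> 56" for z i j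
  proof -
    have "H0 z $ i $ j = (if i = j then - 8 * ?b 3 z else 0) + 48 * (?b 2 z * (z $ i * z $ j))"
      by (simp add: H0_def)
    moreover have "\<bar>if i = j then - 8 * ?b 3 z else 0\<bar> \<le> 8" using bb[of 3 z] by auto
    moreover have "\<bar>?b 2 z * (z $ i * z $ j)\<bar> \<le> 1"
      by (intro bza component_le_norm_cart) simp
    ultimately show ?thesis by linarith
  qed
  have Tb: "\<bar>T0 i j z \<bullet> k\<bar> \<le> 336 * norm k" for i j z k
  proof -
    have "norm (T0 i j z) \<le> norm ((if i = j then 48 * ?b 2 z else 0) *\<^sub>R z) + norm ((192 * ?b 1 z * (z $ i * z $ j)) *\<^sub>R z)
      + norm ((48 * ?b 2 z * z $ j) *\<^sub>R (axis i 1 :: real^'m)) + norm ((48 * ?b 2 z * z $ i) *\<^sub>R (axis j 1 :: real^'m))"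
      unfolding T0_def by (intro norm_triangle_le norm_triangle_le_diff add_right_mono) auto
    also have "\<dots> \<le> 48 + 192 + 48 + 48"
    proof (intro add_mono)
      show "norm ((if i = j then 48 * ?b 2 z else 0) *\<^sub>R z) \<le> 48" using nb[of 2 z] by (simp add: abs_mult)
      show "norm ((192 * ?b 1 z * (z $ i * z $ j)) *\<^sub>R z) \<le> 192" using nc[of 1 z i j] by (simp add: abs_mult)
      show "norm ((48 * ?b 2 z * z $ j) *\<^sub>R (axis i 1 :: real^'m)) \<le> 48" "norm ((48 * ?b 2 z * z $ i) *\<^sub>R (axis j 1 :: real^'m)) \<le> 48"
        using bzb[of 2 "z $ j" z] bzb[of 2 "z $ i" z] component_le_norm_cart[of z] by (simp_all add: abs_mult)
    qed
    finally have "norm (T0 i j z) * norm k \<le> 336 * norm k" by (intro mult_right_mono) auto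
    then show ?thesis using Cauchy_Schwarz_ineq2[of "T0 i j z" k] by linarith
  qed
  have lipH: "\<bar>H0 (z + k) $ i $ j - H0 z $ i $ j\<bar> \<le> 336 * norm k" for z k i j
    by (rule bounded_gradient_lipschitz[where J="\<lambda>z. H0 z $ i $ j", OF dH Tb])
  have lipHrow: "norm (H0 (z + k) $ i - H0 z $ i) \<le> (336 * real CARD('m)) * norm k" for z k i
  proof -
    have "norm (H0 (z + k) $ i - H0 z $ i) \<le> (\<Sum>j\<in>UNIV. \<bar>(H0 (z + k) $ i - H0 z $ i) $ j\<bar>)" by (rule norm_le_l1_cart)
    also have "\<dots> \<le> (\<Sum>j\<in>(UNIV::'m set). 336 * norm k)" using lipH by (intro sum_mono) simp
    finally show ?thesis by (simp add: mult_ac)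
  qed
  have lipGi: "\<bar>G0 (z + k) $ i - G0 z $ i\<bar> \<le> 56 * norm k" for z k i
  proof (rule bounded_gradient_lipschitz[where J="\<lambda>z. G0 z $ i", OF dG])
    fix z k
    have "H0 z $ i \<bullet> k = - 8 * (?b 3 z * k $ i) + 48 * (?b 2 z * (z $ i * (z \<bullet> k)))" unfolding rowH by simp
    moreover have "\<bar>?b 3 z * k $ i\<bar> \<le> norm k" using z1[of 3 z "k $ i"] component_le_norm_cart[of k i] by linarith
    moreover have "\<bar>?b 2 z * (z $ i * (z \<bullet> k))\<bar> \<le> norm k"
    proof -
      have "\<bar>?b 2 z * (z $ i * (z \<bullet> k))\<bar> = \<bar>?b 2 z * z $ i\<bar> * \<bar>z \<bullet> k\<bar>" by (simp add: abs_mult)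
      also have "\<dots> \<le> \<bar>?b 2 z * z $ i\<bar> * (norm z * norm k)" by (intro mult_left_mono Cauchy_Schwarz_ineq2) auto
      also have "\<dots> = \<bar>?b 2 z * (z $ i * norm z)\<bar> * norm k" by (simp add: abs_mult)
      also have "\<dots> \<le> 1 * norm k" using component_le_norm_cart[of z i] by (intro mult_right_mono bza) auto
      finally show ?thesis by simp
    qed
    ultimately show "\<bar>H0 z $ i \<bullet> k\<bar> \<le> 56 * norm k" by linarith
  qed
  have lipG: "norm (G0 (z + k) - G0 z) \<le> (56 * real CARD('m)) * norm k" for z k
  proof -
    have "norm (G0 (z + k) - G0 z) \<le> (\<Sum>i\<in>UNIV. \<bar>(G0 (z + k) - G0 z) $ i\<bar>)" by (rule norm_le_l1_cart)
    also have "\<dots> \<le> (\<Sum>i\<in>(UNIV::'m set). 56 * norm k)" using lipGi by (intro sum_mono) simp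
    finally show ?thesis by (simp add: mult_ac)
  qed
  define L where "L = 336 * real CARD('m) / N"
  have m1: "1 \<le> real CARD('m)" by (simp add: Suc_leI)
  have remK: "\<bar>?b 4 (z + k) - ?b 4 z - G0 z \<bullet> k\<bar> \<le> 336 * real CARD('m) * (norm k)\<^sup>2" for z k
  proof -
    have "\<bar>?b 4 (z + k) - ?b 4 z - G0 z \<bullet> k\<bar> \<le> (56 * real CARD('m)) * (norm k)\<^sup>2"
      by (rule gradient_lipschitz_remainder[OF dK lipG]) simp
    also have "\<dots> \<le> 336 * real CARD('m) * (norm k)\<^sup>2" by (intro mult_right_mono) auto
    finally show ?thesis .
  qed
  have remG: "\<bar>G0 (z + k) $ i - G0 z $ i - H0 z $ i \<bullet> k\<bar> \<le> 336 * real CARD('m) * (norm k)\<^sup>2" for z k i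
    by (rule gradient_lipschitz_remainder[where J="\<lambda>z. G0 z $ i", OF dG lipHrow]) simp
  have "mollifier (\<lambda>z. ?b 4 z / N) (\<lambda>z. G0 z /\<^sub>R N) (\<lambda>z. H0 z /\<^sub>R N) \<eta> L"
  proof
    show "0 < \<eta>" by (rule assms)
    show "continuous_on UNIV (\<lambda>z. ?b 4 z / N)" using N by (intro continuous_intros) auto
    show "continuous_on UNIV (\<lambda>z. G0 z /\<^sub>R N)" unfolding G0_def by (intro continuous_intros)
    have cH: "continuous_on UNIV (\<lambda>z. H0 z $ i $ j)" for i j
      by (intro continuous_at_imp_continuous_on ballI has_derivative_continuous[OF dH])
    then have "continuous_on UNIV (\<lambda>z. \<chi> i j. H0 z $ i $ j)"
      by (intro continuous_on_vec_lambda)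
    then show "continuous_on UNIV (\<lambda>z. H0 z /\<^sub>R N)" by (intro continuous_intros) (simp add: vec_lambda_eta)
    show "?b 4 z / N = 0" "G0 z /\<^sub>R N = 0" "H0 z /\<^sub>R N = 0" if "\<eta> < norm z" for z
      using that bz[of _ z] by (auto simp: G0_def H0_def vec_eq_iff)
    show "0 \<le> ?b 4 z / N" for z using bb[of 4 z] N by simp
    show "wint (\<lambda>z. ?b 4 z / N) (\<lambda>_. 1) = 1" using N by (simp add: N_def wint_def)
    show "\<bar>?b 4 (z + k) / N - ?b 4 z / N - (G0 z /\<^sub>R N) \<bullet> k\<bar> \<le> L * (norm k)\<^sup>2" for z k
    proof -
      have "?b 4 (z + k) / N - ?b 4 z / N - (G0 z /\<^sub>R N) \<bullet> k = (?b 4 (z + k) - ?b 4 z - G0 z \<bullet> k) / N"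
        by (simp add: divide_inverse algebra_simps)
      then show ?thesis using divide_right_mono[OF remK[of z k], of N] N by (simp add: L_def)
    qed
    show "\<bar>(G0 (z + k) /\<^sub>R N) $ i - (G0 z /\<^sub>R N) $ i - (H0 z /\<^sub>R N) $ i \<bullet> k\<bar> \<le> L * (norm k)\<^sup>2" for z k i
    proof -
      have "(G0 (z + k) /\<^sub>R N) $ i - (G0 z /\<^sub>R N) $ i - (H0 z /\<^sub>R N) $ i \<bullet> k = (G0 (z + k) $ i - G0 z $ i - H0 z $ i \<bullet> k) / N"
        by (simp add: divide_inverse algebra_simps)
      then show ?thesis using divide_right_mono[OF remG[of z k i], of N] N by (simp add: L_def)
    qed
    show "\<bar>(H0 z /\<^sub>R N) $ i $ j\<bar> \<le> L" for z i j
    proof -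
      have "\<bar>H0 z $ i $ j\<bar> \<le> 336 * real CARD('m)" using Hb[of z i j] m1 by linarith
      then show ?thesis using N by (simp add: L_def abs_mult divide_inverse mult_left_mono mult.commute)
    qed
    show "\<bar>?b 4 z / N\<bar> \<le> L" for z
    proof -
      have "\<bar>?b 4 z\<bar> \<le> 336 * real CARD('m)" using bb[of 4 z] m1 by linarith
      then show ?thesis using N by (simp add: L_def divide_right_mono)
    qed
  qed
  then show ?thesis by blast
qed

lemma exp_minus_one_le: "0 \<le> x \<Longrightarrow> x \<le> 1 \<Longrightarrow> exp x - 1 \<le> 2 * x" for x :: real
proof -
  assume x: "0 \<le> x" "x \<le> 1"
  have "exp x \<le> 1 + x + x\<^sup>2" using x by (rule exp_bound)
  also have "x\<^sup>2 \<le> x" using mult_left_le[OF x(2) x(1)] by (simp add: power2_eq_square)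
  finally show ?thesis by simp
qed

lemma loglip_bavg_step:
  fixes w :: "real^'m \<Rightarrow> real"
  assumes w: "loglip l w" and l: "0 \<le> l" and h: "0 \<le> h" and B: "oset B"
  shows "loglip l (\<lambda>y. bavg (\<lambda>\<xi>. w (y + h *\<^sub>R prj B \<xi>)))"
  unfolding loglip_def
proof (intro conjI allI)
  fix x y
  show "0 < bavg (\<lambda>\<xi>. w (x + h *\<^sub>R prj B \<xi>))"
    by (rule less_le_trans[OF _ bavg_step_bounds(1)[OF w l h B]]) (simp add: loglip_pos[OF w])
  have "bavg (\<lambda>\<xi>. w (x + h *\<^sub>R prj B \<xi>)) \<le> bavg (\<lambda>\<xi>. exp (l * norm (x - y)) * w (y + h *\<^sub>R prj B \<xi>))"
  proof (rule bavg_mono)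
    fix z show "w (x + h *\<^sub>R prj B z) \<le> exp (l * norm (x - y)) * w (y + h *\<^sub>R prj B z)"
      using loglip_le[OF w, of "x + h *\<^sub>R prj B z" "y + h *\<^sub>R prj B z"] by simp
  qed (auto intro!: continuous_intros continuous_step loglip_continuous[OF w])
  then show "bavg (\<lambda>\<xi>. w (x + h *\<^sub>R prj B \<xi>)) \<le> exp (l * norm (x - y)) * bavg (\<lambda>\<xi>. w (y + h *\<^sub>R prj B \<xi>))"
    by (simp add: bavg_cmult)
qed

context mollifier
begin

definition sm :: "(real^'m \<Rightarrow> real) \<Rightarrow> real^'m \<Rightarrow> real" where
  "sm w = moll K w"

definition smG :: "(real^'m \<Rightarrow> real) \<Rightarrow> real^'m \<Rightarrow> real^'m" where
  "smG w x = (\<chi> i. - moll (\<lambda>z. G z $ i) w x)"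

definition smH :: "(real^'m \<Rightarrow> real) \<Rightarrow> real^'m \<Rightarrow> real^'m^'m" where
  "smH w x = (\<chi> i j. moll (\<lambda>z. H z $ i $ j) w x)"

lemma weights: "weight \<eta> K" "weight \<eta> (\<lambda>z. G z $ i)" "weight \<eta> (\<lambda>z. H z $ i $ j)"
  unfolding weight_def using zero
  by (auto intro!: continuous_intros continuous_on_subset[OF cont(1)] continuous_on_subset[OF cont(2)] continuous_on_subset[OF cont(3)])

lemma sm_bounds:
  assumes w: "loglip l w" and l: "0 \<le> l"
  shows "exp (- (l * \<eta>)) * w x \<le> sm w x" "sm w x \<le> exp (l * \<eta>) * w x"
proof -
  note c = continuous_translate[OF loglip_continuous[OF w], of "cball 0 \<eta>" x]
  have b: "exp (- (l * \<eta>)) * w x \<le> w (x + z) \<and> w (x + z) \<le> exp (l * \<eta>) * w x" if "norm z \<le> \<eta>" for z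
  proof
    have e: "exp (l * norm z) \<le> exp (l * \<eta>)" using that l by (simp add: mult_left_mono)
    have "w x \<le> exp (l * norm z) * w (x + z)" using loglip_le[OF w, of x "x + z"] by simp
    also have "\<dots> \<le> exp (l * \<eta>) * w (x + z)" using e loglip_pos[OF w, of "x + z"] by (intro mult_right_mono) auto
    finally show "exp (- (l * \<eta>)) * w x \<le> w (x + z)" by (simp add: exp_minus field_simps)
    have "w (x + z) \<le> exp (l * norm z) * w x" using loglip_le[OF w, of "x + z" x] by simp
    also have "\<dots> \<le> exp (l * \<eta>) * w x" using e loglip_pos[OF w, of x] by (intro mult_right_mono) auto
    finally show "w (x + z) \<le> exp (l * \<eta>) * w x" .
  qed
  have const: "wint K (\<lambda>_. a) = a" for a using wint_cmult[of K a "\<lambda>_. 1"] total by simp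
  show "exp (- (l * \<eta>)) * w x \<le> sm w x"
    using wint_mono[OF weights(1) nonneg continuous_on_const c, of "exp (- (l * \<eta>)) * w x"] b
    by (simp add: const sm_def moll_def)
  show "sm w x \<le> exp (l * \<eta>) * w x"
    using wint_mono[OF weights(1) nonneg c continuous_on_const, of "exp (l * \<eta>) * w x"] b
    by (simp add: const sm_def moll_def)
qed

lemma C2_sm:
  assumes w: "loglip l w" and l: "0 \<le> l"
  shows "C2 (sm w) (smG w) (smH w)"
  unfolding C2_def
proof (intro conjI allI)
  note cw = loglip_continuous[OF w]
  have e0: "0 \<le> \<eta>" using eta by simp
  fix x
  show "(sm w has_derivative (\<lambda>k. smG w x \<bullet> k)) (at x)"
    unfolding sm_def smG_def by (rule moll_has_derivative[OF cont(1) zero(1) cont(2) zero(2) rem(1) cw e0])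
  have d: "(moll (\<lambda>z. G z $ i) w has_derivative (\<lambda>k. (\<chi> j. - moll (\<lambda>z. H z $ i $ j) w x) \<bullet> k)) (at x)" for i
    by (rule moll_has_derivative[where J="\<lambda>z. G z $ i" and g="\<lambda>z. H z $ i", OF _ _ _ _ rem(2) cw e0])
       (auto intro!: continuous_intros cont simp: zero)
  have "((\<lambda>x. \<Sum>i\<in>UNIV. (- moll (\<lambda>z. G z $ i) w x) *\<^sub>R (axis i 1 :: real^'m)) has_derivative
      (\<lambda>k. \<Sum>i\<in>UNIV. (- ((\<chi> j. - moll (\<lambda>z. H z $ i $ j) w x) \<bullet> k)) *\<^sub>R (axis i 1 :: real^'m))) (at x)"
    by (intro has_derivative_sum has_derivative_scaleR_left has_derivative_minus d)
  moreover have "(\<lambda>x. \<Sum>i\<in>UNIV. (- moll (\<lambda>z. G z $ i) w x) *\<^sub>R (axis i 1 :: real^'m)) = smG w"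
    by (rule ext, simp add: smG_def vec_eq_iff axis_def sum_negf if_distrib[of "\<lambda>a. _ * a"] cong: if_cong)
  moreover have "(\<lambda>k. \<Sum>i\<in>UNIV. (- ((\<chi> j. - moll (\<lambda>z. H z $ i $ j) w x) \<bullet> k)) *\<^sub>R (axis i 1 :: real^'m)) = (*v) (smH w x)"
    by (rule ext, simp add: smH_def vec_eq_iff axis_def inner_vec_def matrix_vector_mult_def sum_negf if_distrib[of "\<lambda>a. _ * a"] cong: if_cong)
  ultimately show "(smG w has_derivative (\<lambda>k. smH w x *v k)) (at x)" by simp
next
  have "continuous_on UNIV (moll (\<lambda>z. H z $ i $ j) w)" for i j
    by (rule moll_continuous[OF weights(3) hbound w l]) (use eta in simp)
  then show "continuous_on UNIV (smH w)" unfolding smH_def by (intro continuous_on_vec_lambda)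
qed

text \<open>The constant depends on \<open>l\<close> and on the kernel only, because every bound is
  relative to \<open>sm w x\<close>. The last statement is the consistency of a step: mollifying
  commutes with averaging over the noise, and in the Taylor expansion of \<open>sm w\<close> the
  linear term averages to zero while the quadratic one gives the trace.\<close>

lemma sm_constants:
  assumes l: "0 < l"
  shows "\<exists>C\<ge>0.
    (\<forall>w B x. loglip l w \<longrightarrow> oset B \<longrightarrow> \<bar>trc B (smH w x)\<bar> \<le> C * sm w x) \<and>
    (\<forall>w w' B x d. loglip l w \<longrightarrow> loglip l w' \<longrightarrow> oset B \<longrightarrow> 0 \<le> d \<longrightarrow> (\<forall>y. \<bar>w' y - w y\<bar> \<le> d * w y) \<longrightarrow>
       \<bar>trc B (smH w' x) - trc B (smH w x)\<bar> \<le> C * d * sm w x) \<and>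
    (\<forall>w w' B x h. loglip l w \<longrightarrow> loglip l w' \<longrightarrow> oset B \<longrightarrow> 0 \<le> h \<longrightarrow> l * h \<le> 1 \<longrightarrow>
       (\<forall>y. w' y \<le> bavg (\<lambda>\<xi>. w (y + h *\<^sub>R prj B \<xi>))) \<longrightarrow>
       sm w' x \<le> sm w x + (h\<^sup>2 * bvar TYPE('m) / 2) * trc B (smH w x) + C * h ^ 3 * sm w x)"
proof -
  define C0 where "C0 = L * exp (l * \<eta>) * measure lborel (cball 0 \<eta> :: (real^'m) set)"
  define m where "m = real CARD('m)"
  have l0: "0 \<le> l" and e0: "0 \<le> \<eta>" using l eta by auto
  have L0: "0 \<le> L" using order_trans[OF abs_ge_zero kbound] .
  have C0: "0 \<le> C0" unfolding C0_def using L0 by simp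
  have m0: "1 \<le> m" by (simp add: m_def Suc_leI)
  have wle: "w x \<le> exp (l * \<eta>) * sm w x" if "loglip l w" for w x
    using sm_bounds(1)[OF that l0, of x] by (simp add: exp_minus field_simps)
  define C where "C = m ^ 3 * C0 * exp (l * \<eta>) * (1 + l)"
  have Cge: "m ^ 3 * C0 * exp (l * \<eta>) \<le> C" "m ^ 2 * C0 * l * exp (l * \<eta>) \<le> C" "0 \<le> C"
  proof -
    show "m ^ 3 * C0 * exp (l * \<eta>) \<le> C" "0 \<le> C" unfolding C_def using C0 l0 m0 by (auto simp: algebra_simps)
    have "m ^ 2 * (C0 * l * exp (l * \<eta>)) \<le> m ^ 3 * (C0 * l * exp (l * \<eta>))"
      using C0 l0 m0 by (intro mult_right_mono power_increasing) auto
    also have "\<dots> \<le> C" unfolding C_def using C0 l0 m0 by (auto simp: algebra_simps)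
    finally show "m ^ 2 * C0 * l * exp (l * \<eta>) \<le> C" by (simp add: mult.assoc)
  qed
  have Hb: "\<bar>smH w x $ i $ j\<bar> \<le> C0 * w x" if "loglip l w" for w x i j
    using moll_loglip_bound[OF weights(3) hbound that l0 e0] by (simp add: smH_def C0_def)
  have a: "\<bar>trc B (smH w x)\<bar> \<le> C * sm w x" if w: "loglip l w" and B: "oset B" for w B x
  proof -
    have "\<bar>trc B (smH w x)\<bar> \<le> m ^ 3 * (C0 * w x)" unfolding m_def by (rule trc_bound[OF Hb[OF w] B])
    also have "\<dots> \<le> m ^ 3 * (C0 * (exp (l * \<eta>) * sm w x))"
      using wle[OF w] C0 m0 by (intro mult_left_mono) auto
    also have "\<dots> = (m ^ 3 * C0 * exp (l * \<eta>)) * sm w x" by simp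
    also have "\<dots> \<le> C * sm w x"
      using sm_bounds(1)[OF w l0, of x] loglip_pos[OF w, of x]
      by (intro mult_right_mono Cge) (meson exp_gt_zero less_imp_le mult_pos_pos order_trans)
    finally show ?thesis .
  qed
  have smpos: "0 \<le> sm w x" if "loglip l w" for w x
    using sm_bounds(1)[OF that l0, of x] loglip_pos[OF that, of x] by (meson exp_gt_zero less_imp_le mult_pos_pos order_trans)
  have b: "\<bar>trc B (smH w' x) - trc B (smH w x)\<bar> \<le> C * d * sm w x"
    if w: "loglip l w" "loglip l w'" and B: "oset B" and d: "0 \<le> d" "\<forall>y. \<bar>w' y - w y\<bar> \<le> d * w y" for w w' B x d
  proof -
    have "\<bar>(smH w' x - smH w x) $ i $ j\<bar> \<le> C0 * d * w x" for i j
      using moll_diff_bound[OF weights(3) hbound w(1) l0 e0 loglip_continuous[OF w(2)], of d] d by (simp add: smH_def C0_def)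
    then have "\<bar>trc B (smH w' x - smH w x)\<bar> \<le> m ^ 3 * (C0 * d * w x)" unfolding m_def by (rule trc_bound[OF _ B])
    also have "\<dots> = (m ^ 3 * C0 * d) * w x" by simp
    also have "\<dots> \<le> (m ^ 3 * C0 * d) * (exp (l * \<eta>) * sm w x)"
      using wle[OF w(1)] C0 m0 d by (intro mult_left_mono) auto
    also have "\<dots> = (m ^ 3 * C0 * exp (l * \<eta>)) * (d * sm w x)" by simp
    also have "\<dots> \<le> C * (d * sm w x)" using smpos[OF w(1)] d by (intro mult_right_mono Cge) auto
    finally show ?thesis by (simp add: trc_diff)
  qed
  have c: "sm w' x \<le> sm w x + (h\<^sup>2 * bvar TYPE('m) / 2) * trc B (smH w x) + C * h ^ 3 * sm w x"
    if w: "loglip l w" "loglip l w'" and B: "oset B" and h: "0 \<le> h" "l * h \<le> 1"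
      and le: "\<forall>y. w' y \<le> bavg (\<lambda>\<xi>. w (y + h *\<^sub>R prj B \<xi>))" for w w' B x h
  proof -
    note cw = loglip_continuous[OF w(1)]
    have cF: "continuous_on UNIV (\<lambda>(z, \<xi>). w (x + z + h *\<^sub>R prj B \<xi>))"
      unfolding case_prod_unfold by (rule continuous_on_compose2[OF cw]) (auto intro!: continuous_intros)
    have "sm w' x \<le> moll K (\<lambda>y. bavg (\<lambda>\<xi>. w (y + h *\<^sub>R prj B \<xi>))) x"
      unfolding sm_def moll_def using le
      by (intro wint_mono[OF weights(1) nonneg] continuous_translate loglip_continuous[OF w(2)]
        loglip_continuous[OF loglip_bavg_step[OF w(1) l0 h(1) B]]) auto
    also have "\<dots> = bavg (\<lambda>\<xi>. sm w (x + h *\<^sub>R prj B \<xi>))"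
      unfolding moll_def bavg_def sm_def using wint_fubini[OF weights(1) weight_ballw cF] by (simp add: add_ac)
    also have "\<dots> \<le> bavg (\<lambda>\<xi>. (sm w x + (smG w x \<bullet> (h *\<^sub>R prj B \<xi>)) + (h\<^sup>2 / 2) * (prj B \<xi> \<bullet> (smH w x *v prj B \<xi>))) + C * h ^ 3 * sm w x)"
    proof (rule bavg_mono)
      note C2 = C2_sm[OF w(1) l0]
      show "continuous_on UNIV (\<lambda>\<xi>. sm w (x + h *\<^sub>R prj B \<xi>))" by (intro continuous_step C2_continuous(1)[OF C2])
      show "continuous_on UNIV (\<lambda>\<xi>. (sm w x + (smG w x \<bullet> (h *\<^sub>R prj B \<xi>)) + (h\<^sup>2 / 2) * (prj B \<xi> \<bullet> (smH w x *v prj B \<xi>))) + C * h ^ 3 * sm w x)"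
        by (intro continuous_intros linear_continuous_on_compose[OF _ matrix_vector_mul_linear])
      fix \<xi> :: "real^'m" assume \<xi>: "norm \<xi> \<le> 1"
      define k where "k = h *\<^sub>R prj B \<xi>"
      have k: "norm k \<le> h" unfolding k_def by (rule norm_step_le[OF B \<xi> h(1)])
      have d: "(sm w has_derivative (\<lambda>v. smG w y \<bullet> v)) (at y)" "(smG w has_derivative (\<lambda>v. smH w y *v v)) (at y)" for y
        using C2 by (auto simp: C2_def)
      obtain t where t: "t \<in> {0<..<1}" "sm w (x + k) = sm w x + smG w x \<bullet> k + (1/2) * (k \<bullet> (smH w (x + t *\<^sub>R k) *v k))"
        using taylor_second_order[of "sm w" "smG w" x k "smH w"] d by blast
      have tk: "norm (t *\<^sub>R k) \<le> h" using t(1) k by (auto intro: order_trans[OF mult_left_le_one_le])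
      have "\<bar>(smH w (x + t *\<^sub>R k) - smH w x) $ i $ j\<bar> \<le> C0 * (2 * (l * h)) * w x" for i j
      proof -
        have "\<bar>(smH w (x + t *\<^sub>R k) - smH w x) $ i $ j\<bar> \<le> C0 * (exp (l * norm (t *\<^sub>R k)) - 1) * w x"
          using moll_translate_bound[OF weights(3) hbound w(1) l0 e0, where x=x and k="t *\<^sub>R k"] by (simp add: smH_def C0_def)
        also have "exp (l * norm (t *\<^sub>R k)) - 1 \<le> exp (l * h) - 1" using tk l0 by (simp add: mult_left_mono)
        also have "\<dots> \<le> 2 * (l * h)" using h l0 by (intro exp_minus_one_le) auto
        finally show ?thesis using C0 loglip_pos[OF w(1), of x] by (simp add: mult_left_mono mult_right_mono)
      qed
      from quadratic_form_bound[OF this, of k]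
      have "\<bar>k \<bullet> ((smH w (x + t *\<^sub>R k) - smH w x) *v k)\<bar> \<le> m\<^sup>2 * (C0 * (2 * (l * h)) * w x) * (norm k)\<^sup>2" by (simp add: m_def)
      also have "\<dots> \<le> m\<^sup>2 * (C0 * (2 * (l * h)) * w x) * h\<^sup>2"
        using k C0 l0 h(1) loglip_pos[OF w(1), of x] by (intro mult_left_mono power_mono) auto
      also have "\<dots> = 2 * (m\<^sup>2 * C0 * l * h ^ 3 * w x)" by (simp add: power3_eq_cube power2_eq_square)
      also have "\<dots> \<le> 2 * (m\<^sup>2 * C0 * l * h ^ 3 * (exp (l * \<eta>) * sm w x))"
        using C0 l0 h(1) wle[OF w(1), of x] by (intro mult_left_mono) auto
      also have "\<dots> = 2 * ((m\<^sup>2 * C0 * l * exp (l * \<eta>)) * (h ^ 3 * sm w x))" by simp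
      also have "\<dots> \<le> 2 * (C * (h ^ 3 * sm w x))"
        using smpos[OF w(1), of x] h(1) Cge(2) by (intro mult_left_mono mult_right_mono) auto
      finally have "k \<bullet> (smH w (x + t *\<^sub>R k) *v k) \<le> k \<bullet> (smH w x *v k) + 2 * (C * (h ^ 3 * sm w x))"
        by (simp add: matrix_vector_mult_diff_rdistrib inner_diff_right)
      then have "sm w (x + k) \<le> sm w x + smG w x \<bullet> k + (1/2) * (k \<bullet> (smH w x *v k)) + C * h ^ 3 * sm w x"
        unfolding t(2) by simp
      then show "sm w (x + h *\<^sub>R prj B \<xi>) \<le> (sm w x + (smG w x \<bullet> (h *\<^sub>R prj B \<xi>)) + (h\<^sup>2 / 2) * (prj B \<xi> \<bullet> (smH w x *v prj B \<xi>))) + C * h ^ 3 * sm w x"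
        by (simp add: k_def matrix_vector_mult_scaleR power2_eq_square)
    qed
    also have "\<dots> = sm w x + (h\<^sup>2 * bvar TYPE('m) / 2) * trc B (smH w x) + C * h ^ 3 * sm w x"
    proof -
      have c1: "continuous_on UNIV (\<lambda>\<xi>. smG w x \<bullet> (h *\<^sub>R prj B \<xi>))" by (intro continuous_intros)
      have c2: "continuous_on UNIV (\<lambda>\<xi>. (h\<^sup>2 / 2) * (prj B \<xi> \<bullet> (smH w x *v prj B \<xi>)))"
        by (intro continuous_intros linear_continuous_on_compose[OF _ matrix_vector_mul_linear])
      have z: "bavg (\<lambda>\<xi>. smG w x \<bullet> (h *\<^sub>R prj B \<xi>)) = 0"
        by (rule bavg_odd[OF c1]) (simp add: prj_minus)
      show ?thesis
        by (simp only: bavg_add[OF continuous_on_add[OF continuous_on_add[OF continuous_on_const c1] c2] continuous_on_const]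
          bavg_add[OF continuous_on_add[OF continuous_on_const c1] c2] bavg_add[OF continuous_on_const c1] bavg_cmult
          z bavg_quadratic[OF B] bavg_const) simp
    qed
    finally show ?thesis .
  qed
  show ?thesis using a b c Cge(3) by (intro exI[of _ C]) blast
qed

end

section \<open>From viscosity subsolutions for planes to bounds by the schemes\<close>

section \<open>Viscosity subsolutions for families of planes\<close>

text \<open>For a subsolution of the level set equation one can take the hyperplane orthogonal to a
  direction near that of \<open>\<nabla>\<phi>\<close>; the term with \<open>\<Lambda>\<close> enforces this approximately and is meaningful
  also where \<open>\<nabla>\<phi> = 0\<close>.\<close>

definition plane_subsolution :: "(real^'m) set set \<Rightarrow> ((real^'m) \<times> real \<Rightarrow> real) \<Rightarrow> bool" where
  "plane_subsolution \<B> v \<longleftrightarrow>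
     (\<forall>\<phi> \<phi>t G H z \<Lambda> \<epsilon>. test_function \<phi> \<phi>t G H \<longrightarrow> snd z < 0 \<longrightarrow> local_max_at (\<lambda>w. v w - \<phi> w) z \<longrightarrow>
        0 < \<Lambda> \<longrightarrow> 0 < \<epsilon> \<longrightarrow>
        (\<exists>B\<in>\<B>. - \<epsilon> \<le> \<phi>t z + trc B (H z) - \<Lambda> * (norm (prj B (G z)))\<^sup>2))"

definition outer :: "real^'m \<Rightarrow> real^'m^'m" where
  "outer p = (\<chi> i j. p $ i * p $ j)"

lemma outer_mult: "outer p *v k = (p \<bullet> k) *\<^sub>R p"
  by (simp add: outer_def matrix_vector_mult_def vec_eq_iff inner_vec_def sum_distrib_left mult_ac)

lemma trc_outer: "oset B \<Longrightarrow> trc B (outer p) = (norm (prj B p))\<^sup>2"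
  unfolding prj_norm_sq by (simp add: trc_def outer_mult power2_eq_square inner_commute)

lemma test_function_quadratic:
  assumes R: "test_function R Rt G H" and cR: "continuous_on (UNIV \<times> {..<0}) R"
  shows "test_function (\<lambda>w. a + b * R w + c * (R w)\<^sup>2) (\<lambda>w. (b + 2 * c * R w) * Rt w)
    (\<lambda>w. (b + 2 * c * R w) *\<^sub>R G w) (\<lambda>w. (b + 2 * c * R w) *\<^sub>R H w + (2 * c) *\<^sub>R outer (G w))"
  unfolding test_function_def
proof (intro conjI allI impI)
  fix x :: "real^'a" and t :: real assume t: "t < 0"
  have d: "((\<lambda>s. R (x, s)) has_real_derivative Rt (x, t)) (at t)"
    "((\<lambda>y. R (y, t)) has_derivative (\<lambda>h. G (x, t) \<bullet> h)) (at x)"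
    "((\<lambda>y. G (y, t)) has_derivative (\<lambda>h. H (x, t) *v h)) (at x)"
    using R t by (auto simp: test_function_def)
  show "((\<lambda>s. a + b * R (x, s) + c * (R (x, s))\<^sup>2) has_real_derivative (b + 2 * c * R (x, t)) * Rt (x, t)) (at t)"
    using d(1) by (auto intro!: derivative_eq_intros simp: algebra_simps)
  show "((\<lambda>y. a + b * R (y, t) + c * (R (y, t))\<^sup>2) has_derivative (\<lambda>h. ((b + 2 * c * R (x, t)) *\<^sub>R G (x, t)) \<bullet> h)) (at x)"
    using d(2) by (auto intro!: derivative_eq_intros simp: algebra_simps)
  have "((\<lambda>y. (b + 2 * c * R (y, t)) *\<^sub>R G (y, t)) has_derivative
      (\<lambda>h. (b + 2 * c * R (x, t)) *\<^sub>R (H (x, t) *v h) + (0 + 2 * c * (G (x, t) \<bullet> h)) *\<^sub>R G (x, t))) (at x)"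
    by (intro has_derivative_scaleR has_derivative_add has_derivative_const has_derivative_mult_right d)
  then show "((\<lambda>y. (b + 2 * c * R (y, t)) *\<^sub>R G (y, t)) has_derivative
      (\<lambda>h. ((b + 2 * c * R (x, t)) *\<^sub>R H (x, t) + (2 * c) *\<^sub>R outer (G (x, t))) *v h)) (at x)"
    by (simp add: matrix_vector_mult_add_rdistrib scaleR_matrix_vector_assoc[symmetric] outer_mult)
next
  have c: "continuous_on (UNIV \<times> {..<0}) Rt" "continuous_on (UNIV \<times> {..<0}) G" "continuous_on (UNIV \<times> {..<0}) H"
    using R by (auto simp: test_function_def)
  show "continuous_on (UNIV \<times> {..<0}) (\<lambda>w. (b + 2 * c * R w) * Rt w)"
    "continuous_on (UNIV \<times> {..<0}) (\<lambda>w. (b + 2 * c * R w) *\<^sub>R G w)"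
    by (intro continuous_intros c cR)+
  have "continuous_on (UNIV \<times> {..<0}) (\<lambda>w. outer (G w))"
    unfolding outer_def by (intro continuous_on_vec_lambda continuous_intros c)
  then show "continuous_on (UNIV \<times> {..<0}) (\<lambda>w. (b + 2 * c * R w) *\<^sub>R H w + (2 * c) *\<^sub>R outer (G w))"
    by (intro continuous_intros c cR)
qed

text \<open>In terms of \<open>exp (- l v)\<close> the gradient term disappears if \<open>\<Lambda>\<close> is chosen suitably; a quadratic
  lower bound of the logarithm serves as its replacement in the test function.\<close>

lemma exp_touching:
  fixes v :: "(real^'m) \<times> real \<Rightarrow> real"
  assumes v: "plane_subsolution \<B> v" "\<B> \<subseteq> all_planes" and l: "0 < l"
    and \<Phi>: "test_function \<Phi> \<Phi>t G H" "continuous_on (UNIV \<times> {..<0}) \<Phi>"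
    and z: "snd z < 0" "local_min_at (\<lambda>w. exp (- l * v w) - \<Phi> w) z" and e: "0 < \<epsilon>"
  shows "\<exists>B\<in>\<B>. \<Phi>t z + trc B (H z) \<le> \<epsilon>"
proof -
  define y0 where "y0 = exp (- l * v z)"
  have y0: "0 < y0" by (simp add: y0_def)
  \<comment> \<open>The natural candidate \<open>- ln (y0 + \<Phi> w - \<Phi> z) / l\<close> is
    defined only near \<open>z\<close>. With \<open>r = (\<Phi> w - \<Phi> z) / y0\<close> the term
    \<open>ln (1 + r)\<close> is replaced by its minorant \<open>r - 2 * r\<^sup>2\<close>, valid
    for |r| at most 1/2, which yields a polynomial in \<Phi>.\<close>
  define \<phi> where "\<phi> = (\<lambda>w. - (ln y0 + (\<Phi> w - \<Phi> z) / y0 - 2 * ((\<Phi> w - \<Phi> z) / y0)\<^sup>2) / l)"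
  define b where "b = - (1 / y0 + 4 * \<Phi> z / y0\<^sup>2) / l"
  define c where "c = 2 / (l * y0\<^sup>2)"
  have \<phi>eq: "\<phi> = (\<lambda>w. (- (ln y0 - \<Phi> z / y0 - 2 * (\<Phi> z / y0)\<^sup>2) / l) + b * \<Phi> w + c * (\<Phi> w)\<^sup>2)"
    using l y0 by (simp add: \<phi>_def b_def c_def fun_eq_iff field_simps power2_eq_square)
  have bc: "b + 2 * c * \<Phi> z = - 1 / (l * y0)"
    using l y0 by (simp add: b_def c_def field_simps power2_eq_square)
  note tf = test_function_quadratic[OF \<Phi>, of "- (ln y0 - \<Phi> z / y0 - 2 * (\<Phi> z / y0)\<^sup>2) / l" b c, folded \<phi>eq]
  have "isCont \<Phi> z"
  proof -
    have "open (UNIV \<times> {..<0} :: ((real^'m) \<times> real) set)" by (intro open_Times) auto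
    moreover have "z \<in> UNIV \<times> {..<0}" using z(1) by (simp add: mem_Times_iff)
    ultimately show ?thesis using \<Phi>(2) continuous_on_eq_continuous_at by blast
  qed
  then have "(\<Phi> \<longlongrightarrow> \<Phi> z) (nhds z)" by (simp add: continuous_at tendsto_nhds_iff)
  then have ev: "\<forall>\<^sub>F w in nhds z. dist (\<Phi> w) (\<Phi> z) < y0 / 2"
    using y0 by (intro tendstoD) auto
  have lm: "local_max_at (\<lambda>w. v w - \<phi> w) z"
    unfolding local_max_at_def using ev z(2)[unfolded local_min_at_def]
  proof eventually_elim
    case (elim w)
    define r where "r = (\<Phi> w - \<Phi> z) / y0"
    have r: "\<bar>r\<bar> \<le> 1/2" using elim(1) y0 by (simp add: r_def dist_real_def field_simps abs_le_iff abs_less_iff)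
    have "y0 * (1 + r) \<le> exp (- l * v w)"
    proof -
      have "y0 * (1 + r) = y0 + (\<Phi> w - \<Phi> z)" using y0 by (simp add: r_def distrib_left)
      then show ?thesis using elim(2) by (simp add: y0_def)
    qed
    moreover have "0 < y0 * (1 + r)" using r y0 by (intro mult_pos_pos) auto
    ultimately have "ln (y0 * (1 + r)) \<le> ln (exp (- l * v w))" by (subst ln_le_cancel_iff) auto
    then have "ln y0 + ln (1 + r) \<le> - l * v w" using y0 r by (subst (asm) ln_mult_pos) auto
    moreover have "r - 2 * r\<^sup>2 \<le> ln (1 + r)"
      using abs_ln_one_plus_x_minus_x_bound[OF r] by linarith
    ultimately have "l * v w \<le> - (ln y0 + r - 2 * r\<^sup>2)" by linarith
    then have "v w \<le> \<phi> w" using l by (simp add: \<phi>_def r_def field_simps)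
    moreover have "v z = \<phi> z" using l by (simp add: \<phi>_def y0_def)
    ultimately show ?case by simp
  qed
  \<comment> \<open>With this value of \<Lambda> the penalty exactly cancels
    \<open>(2 * c) *\<^sub>R outer (G z)\<close>, the rank-one part of the Hessian of \<phi>. The
    factor \<open>1 / (l * y0)\<close> in the tolerance is, up to sign, the derivative of \<phi>
    with respect to \<Phi> at \<open>z\<close>.\<close>
  have "0 < 4 * l" "0 < \<epsilon> / (l * y0)" using l y0 e by auto
  then obtain B where B: "B \<in> \<B>" "- (\<epsilon> / (l * y0)) \<le> (b + 2 * c * \<Phi> z) * \<Phi>t z
      + trc B ((b + 2 * c * \<Phi> z) *\<^sub>R H z + (2 * c) *\<^sub>R outer (G z)) - (4 * l) * (norm (prj B ((b + 2 * c * \<Phi> z) *\<^sub>R G z)))\<^sup>2"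
    using v(1)[unfolded plane_subsolution_def] tf z(1) lm by blast
  have os: "oset B" using B(1) v(2) by (auto simp: all_planes_def)
  have "(4 * l) * (norm (prj B ((b + 2 * c * \<Phi> z) *\<^sub>R G z)))\<^sup>2 = 2 * c * (norm (prj B (G z)))\<^sup>2"
  proof -
    define q where "q = b + 2 * c * \<Phi> z"
    have "(4 * l) * q\<^sup>2 = 2 * c"
      unfolding q_def bc using l y0 by (simp add: c_def power_divide power2_eq_square)
    then show ?thesis unfolding q_def[symmetric] prj_scaleR norm_scaleR power_mult_distrib power2_abs
      by (metis mult.assoc)
  qed
  then have "- (\<epsilon> / (l * y0)) \<le> (- 1 / (l * y0)) * (\<Phi>t z + trc B (H z))"
    using B(2) unfolding bc trc_add trc_scaleR trc_outer[OF os] by (simp add: algebra_simps)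
  then have "(\<Phi>t z + trc B (H z)) / (l * y0) \<le> \<epsilon> / (l * y0)" by simp
  moreover have "0 < l * y0" using l y0 by simp
  ultimately have "\<Phi>t z + trc B (H z) \<le> \<epsilon>" by (simp only: divide_le_cancel)
  then show ?thesis using B(1) by blast
qed

lemma test_function_barrier:
  assumes f: "C2 f Gf Hf" and g: "C2 g Gg Hg"
  shows "test_function (\<lambda>(x, t). f x + (- t - s) * g x - \<beta> * (max 0 (- t - s'))\<^sup>2)
     (\<lambda>(x, t). - g x + 2 * \<beta> * max 0 (- t - s'))
     (\<lambda>(x, t). Gf x + (- t - s) *\<^sub>R Gg x) (\<lambda>(x, t). Hf x + (- t - s) *\<^sub>R Hg x)"
  unfolding test_function_def prod.case
proof (intro conjI allI impI)
  fix x and t :: real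
  have "((\<lambda>t. (max 0 (- t - s'))\<^sup>2) has_real_derivative (2 * max 0 (- t - s')) * (- 1)) (at t)"
    by (rule DERIV_chain2[of "\<lambda>r. (max 0 r)\<^sup>2", OF DERIV_max0_square]) (auto intro!: derivative_eq_intros)
  note d2 = DERIV_cmult[OF this, of \<beta>]
  have d1: "((\<lambda>t. (- t - s) * g x) has_real_derivative (- 1) * g x) (at t)"
    by (intro DERIV_cmult_right) (auto intro!: derivative_eq_intros)
  from DERIV_diff[OF DERIV_add[OF DERIV_const[of "f x"] d1] d2]
  show "((\<lambda>t. f x + (- t - s) * g x - \<beta> * (max 0 (- t - s'))\<^sup>2) has_real_derivative - g x + 2 * \<beta> * max 0 (- t - s')) (at t)"
    by (simp add: mult_ac)
  note C = C2_linear_combination[OF f g, of 1 "- t - s"]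
  from C show "((\<lambda>y. f y + (- t - s) * g y - \<beta> * (max 0 (- t - s'))\<^sup>2) has_derivative (\<bullet>) (Gf x + (- t - s) *\<^sub>R Gg x)) (at x)"
    unfolding C2_def using has_derivative_diff[OF _ has_derivative_const] by fastforce
  from C show "((\<lambda>y. Gf y + (- t - s) *\<^sub>R Gg y) has_derivative (*v) (Hf x + (- t - s) *\<^sub>R Hg x)) (at x)"
    unfolding C2_def by simp
next
  note c = C2_continuous[OF f] C2_continuous[OF g]
  have cc: "continuous_on A (\<lambda>p. q (fst p))" if "continuous_on UNIV q" for A :: "((real^'a) \<times> real) set" and q :: "real^'a \<Rightarrow> 'b::topological_space"
    by (rule continuous_on_compose2[OF that]) (auto intro!: continuous_intros)
  show "continuous_on (UNIV \<times> {..<0}) (\<lambda>(x, t). - g x + 2 * \<beta> * max 0 (- t - s'))"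
    "continuous_on (UNIV \<times> {..<0}) (\<lambda>(x, t). Gf x + (- t - s) *\<^sub>R Gg x)"
    "continuous_on (UNIV \<times> {..<0}) (\<lambda>(x, t). Hf x + (- t - s) *\<^sub>R Hg x)"
    unfolding case_prod_unfold by (intro continuous_intros cc c)+
qed

text \<open>If the inequality failed, \<open>exp (- l * v)\<close> minus the barrier would have a
  negative minimum over a compact box, and touching there contradicts the strict inequality
  \<open>sub\<close>. Viscosity tests are available at interior times only; therefore the hypotheses
  cover twice the time step, and a cut-off acting beyond \<sigma> keeps the minimum away from the
  far end.\<close>

lemma barrier_step:
  fixes v :: "(real^'m) \<times> real \<Rightarrow> real"
  assumes v: "plane_subsolution \<B> v" "\<B> \<subseteq> all_planes" "continuous_on (UNIV \<times> {..0}) v" and l: "0 < l"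
    and f: "C2 f Gf Hf" and g: "C2 g Gg Hg" and s: "0 \<le> s" and \<sigma>: "0 < \<sigma>"
    and init: "\<And>x. f x \<le> exp (- l * v (x, - s))"
    and sub: "\<And>x \<theta>. 0 \<le> \<theta> \<Longrightarrow> \<theta> \<le> 2 * \<sigma> \<Longrightarrow> \<exists>\<gamma>>0. \<forall>B\<in>\<B>. g x + \<gamma> \<le> trc B (Hf x + \<theta> *\<^sub>R Hg x)"
    and bd: "\<And>x \<theta>. 0 \<le> \<theta> \<Longrightarrow> \<theta> \<le> 2 * \<sigma> \<Longrightarrow> R \<le> norm x \<Longrightarrow> f x + \<theta> * g x \<le> 0"
    and \<theta>: "0 \<le> \<theta>" "\<theta> \<le> \<sigma>"
  shows "f x + \<theta> * g x \<le> exp (- l * v (x, - s - \<theta>))"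
proof (rule ccontr)
  assume neg: "\<not> f x + \<theta> * g x \<le> exp (- l * v (x, - s - \<theta>))"
  let ?K = "cball (0::real^'m) R \<times> {- s - 2 * \<sigma> .. - s}"
  note cfg = C2_continuous(1)[OF f] C2_continuous(1)[OF g]
  have cc: "continuous_on A (\<lambda>p. q (fst p))" if "continuous_on UNIV q" for A :: "((real^'m) \<times> real) set" and q :: "real^'m \<Rightarrow> real"
    by (rule continuous_on_compose2[OF that]) (auto intro!: continuous_intros)
  have K: "compact ?K" by (intro compact_Times compact_cball compact_Icc)
  have c0: "continuous_on ?K (\<lambda>p. f (fst p) + (- snd p - s) * g (fst p))"
    by (intro continuous_intros cc cfg)
  define F where "F = (\<lambda>p. f (fst p) + (- snd p - s) * g (fst p))"
  have "bounded (F ` ?K)"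
    unfolding F_def by (intro compact_imp_bounded compact_continuous_image c0 K)
  then obtain M where M0: "\<forall>y\<in>F ` ?K. norm y \<le> M" unfolding bounded_iff by blast
  have M: "\<bar>F p\<bar> \<le> M" if "p \<in> ?K" for p using bspec[OF M0 imageI[OF that]] by simp
  \<comment> \<open>At the far end, \<open>\<theta> = 2 * \<sigma>\<close>, the cut-off amounts to
    the absolute value of \<open>M\<close>, so the barrier is not positive there.\<close>
  define \<beta> where "\<beta> = \<bar>M\<bar> / \<sigma>\<^sup>2"
  have \<beta>: "0 \<le> \<beta>" "\<beta> * \<sigma>\<^sup>2 = \<bar>M\<bar>" using \<sigma> by (auto simp: \<beta>_def)
  define \<Phi> where "\<Phi> = (\<lambda>(x, t). f x + (- t - s) * g x - \<beta> * (max 0 (- t - (s + \<sigma>)))\<^sup>2)"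
  note tf = test_function_barrier[OF f g, of s \<beta> "s + \<sigma>", folded \<Phi>_def]
  have c\<Phi>: "continuous_on A \<Phi>" for A
    unfolding \<Phi>_def case_prod_unfold by (intro continuous_intros cc cfg)
  have cv: "continuous_on ?K (\<lambda>p. exp (- l * v p))"
    using v(3) s by (intro continuous_intros) (auto elim!: continuous_on_subset)
  have xR: "norm x < R"
  proof (rule ccontr)
    assume "\<not> norm x < R"
    then have "f x + \<theta> * g x \<le> 0" using bd[of \<theta> x] \<theta> \<sigma> by simp
    also have "0 \<le> exp (- l * v (x, - s - \<theta>))" by simp
    finally show False using neg by contradiction
  qed
  have xK: "(x, - s - \<theta>) \<in> ?K" using xR \<theta> \<sigma> by auto
  obtain z where z: "z \<in> ?K" "\<And>p. p \<in> ?K \<Longrightarrow> exp (- l * v z) - \<Phi> z \<le> exp (- l * v p) - \<Phi> p"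
  proof -
    have "continuous_on ?K (\<lambda>p. exp (- l * v p) - \<Phi> p)" by (intro continuous_on_diff cv c\<Phi>)
    moreover have "?K \<noteq> {}" using xK by blast
    ultimately have "\<exists>z\<in>?K. \<forall>p\<in>?K. exp (- l * v z) - \<Phi> z \<le> exp (- l * v p) - \<Phi> p"
      by (intro continuous_attains_inf K)
    then show thesis using that by blast
  qed
  have "\<Phi> (x, - s - \<theta>) = f x + \<theta> * g x" using \<theta> by (simp add: \<Phi>_def)
  then have zneg: "exp (- l * v z) < \<Phi> z" using z(2)[OF xK] neg by simp
  obtain x0 t0 where z0: "z = (x0, t0)" by fastforce
  define \<theta>0 where "\<theta>0 = - t0 - s"
  have \<theta>0: "0 \<le> \<theta>0" "\<theta>0 \<le> 2 * \<sigma>" "t0 = - s - \<theta>0" using z(1) by (auto simp: z0 \<theta>0_def)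
  have \<Phi>le: "\<Phi> z \<le> f x0 + \<theta>0 * g x0" using \<beta> by (simp add: \<Phi>_def z0 \<theta>0)
  have pos: "0 < f x0 + \<theta>0 * g x0" using zneg \<Phi>le exp_gt_zero[of "- l * v z"] by linarith
  have x0: "norm x0 < R" using bd[OF \<theta>0(1,2), of x0] pos by (cases "R \<le> norm x0") auto
  have ne0: "\<theta>0 \<noteq> 0"
  proof
    assume "\<theta>0 = 0"
    then show False using init[of x0] zneg \<Phi>le by (simp add: z0 \<theta>0)
  qed
  have ne2: "\<theta>0 \<noteq> 2 * \<sigma>"
  proof
    assume e: "\<theta>0 = 2 * \<sigma>"
    have "\<Phi> z = f x0 + \<theta>0 * g x0 - \<bar>M\<bar>" using \<sigma> \<beta>(2) by (simp add: \<Phi>_def z0 \<theta>0 e)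
    also have "\<dots> \<le> 0" using M[OF z(1)] by (simp add: z0 \<theta>0 F_def)
    finally show False using zneg exp_gt_zero[of "- l * v z"] by linarith
  qed
  have "local_min_at (\<lambda>w. exp (- l * v w) - \<Phi> w) z"
    unfolding local_min_at_def eventually_nhds
  proof (intro exI[of _ "ball 0 R \<times> {- s - 2 * \<sigma> <..< - s}"] conjI ballI)
    show "open (ball (0::real^'m) R \<times> {- s - 2 * \<sigma> <..< - s})" by (intro open_Times) auto
    show "z \<in> ball 0 R \<times> {- s - 2 * \<sigma> <..< - s}" using x0 \<theta>0 ne0 ne2 by (auto simp: z0)
    show "exp (- l * v z) - \<Phi> z \<le> exp (- l * v w) - \<Phi> w" if "w \<in> ball 0 R \<times> {- s - 2 * \<sigma> <..< - s}" for w
      by (rule z(2)) (use that in auto)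
  qed
  moreover have "snd z < 0" using s \<theta>0 ne0 by (simp add: z0)
  moreover obtain \<gamma> where \<gamma>: "0 < \<gamma>" "\<And>B. B \<in> \<B> \<Longrightarrow> g x0 + \<gamma> \<le> trc B (Hf x0 + \<theta>0 *\<^sub>R Hg x0)"
    using sub[OF \<theta>0(1,2)] by blast
  ultimately obtain B where B: "B \<in> \<B>" "(- g x0 + 2 * \<beta> * max 0 (- t0 - (s + \<sigma>))) + trc B (Hf x0 + (- t0 - s) *\<^sub>R Hg x0) \<le> \<gamma> / 2"
    using exp_touching[OF v(1,2) l tf c\<Phi>, of z "\<gamma> / 2"] by (auto simp: z0)
  \<comment> \<open>The time derivative of the cut-off has the favourable sign.\<close>
  have "0 \<le> 2 * \<beta> * max 0 (- t0 - (s + \<sigma>))" using \<beta> by simp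
  then show False using B(2) \<gamma>(2)[OF B(1)] \<gamma>(1) by (simp add: \<theta>0_def[symmetric])
qed

lemma loglip_exp_norm: "0 \<le> l \<Longrightarrow> loglip l (\<lambda>x. exp (l * norm x))"
  unfolding loglip_def
proof (intro conjI allI)
  fix x y :: 'a assume l: "0 \<le> l"
  have "norm x \<le> norm (x - y) + norm y" by (metis diff_add_cancel norm_triangle_ineq)
  then have "l * norm x \<le> l * norm (x - y) + l * norm y" using l by (metis distrib_left mult_left_mono)
  then show "exp (l * norm x) \<le> exp (l * norm (x - y)) * exp (l * norm y)" by (simp add: exp_add[symmetric])
qed simp

lemma mult_le_twice:
  fixes s :: real
  assumes "0 \<le> s" "s \<le> 2" "0 \<le> a" "\<bar>t\<bar> \<le> q"
  shows "s * (a * t) \<le> 2 * (a * q)"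
proof -
  have "s * (a * t) \<le> s * (a * q)" using assms by (intro mult_left_mono) auto
  also have "\<dots> \<le> 2 * (a * q)" using assms by (intro mult_right_mono mult_nonneg_nonneg) auto
  finally show ?thesis .
qed

text \<open>The mollified values of the scheme, interpolated linearly in time over each step, serve
  as barriers. The slowly decaying factor \<open>b k\<close> absorbs the consistency error; a small
  multiple of \<open>bet\<close> supplies strictness, makes the barrier negative far away, and is
  removed at the end. Of the loss in the exponent, \<open>2 * l * \<eta>\<close> is due to smoothing
  at the initial and the final time and \<eta> to the decay of \<open>b\<close>.\<close>

lemma scheme_barrier:
  fixes v :: "(real^'m) \<times> real \<Rightarrow> real"
  assumes v: "plane_subsolution \<B> v" "continuous_on (UNIV \<times> {..0}) v"
    and \<B>: "\<B> \<noteq> {}" "\<B> \<subseteq> all_planes" and l: "0 < l" and w0: "loglip l w0"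
    and init: "\<And>x. w0 x \<le> exp (- l * v (x, 0))"
    and S: "0 < S" and \<eta>: "0 < \<eta>" "\<eta> \<le> 1"
  shows "\<exists>h0>0. \<forall>h k x. 0 < h \<longrightarrow> h < h0 \<longrightarrow> real k * (h\<^sup>2 * bvar TYPE('m) / 2) \<le> S \<longrightarrow>
     exp (- (2 * l * \<eta> + \<eta>)) * scheme \<B> h w0 k x \<le> exp (- l * v (x, - (real k * (h\<^sup>2 * bvar TYPE('m) / 2))))"
proof -
  obtain K G H L where "mollifier (K :: real^'m \<Rightarrow> real) G H \<eta> L" using mollifier_exists[OF \<eta>] by blast
  then interpret mollifier K G H \<eta> L .
  define c where "c = bvar TYPE('m)"
  have c: "0 < c" unfolding c_def by (rule bvar_pos)
  have l0: "0 \<le> l" and l2: "0 < 2 * l" "0 \<le> 2 * l" using l by auto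
  obtain C1 where C1: "0 \<le> C1"
    "\<And>w B x. loglip l w \<Longrightarrow> oset B \<Longrightarrow> \<bar>trc B (smH w x)\<bar> \<le> C1 * sm w x"
    "\<And>w w' B x d. loglip l w \<Longrightarrow> loglip l w' \<Longrightarrow> oset B \<Longrightarrow> 0 \<le> d \<Longrightarrow> (\<And>y. \<bar>w' y - w y\<bar> \<le> d * w y) \<Longrightarrow>
       \<bar>trc B (smH w' x) - trc B (smH w x)\<bar> \<le> C1 * d * sm w x"
    "\<And>w w' B x h. loglip l w \<Longrightarrow> loglip l w' \<Longrightarrow> oset B \<Longrightarrow> 0 \<le> h \<Longrightarrow> l * h \<le> 1 \<Longrightarrow>
       (\<And>y. w' y \<le> bavg (\<lambda>\<xi>. w (y + h *\<^sub>R prj B \<xi>))) \<Longrightarrow>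
       sm w' x \<le> sm w x + (h\<^sup>2 * c / 2) * trc B (smH w x) + C1 * h ^ 3 * sm w x"
    using sm_constants[OF l] unfolding c_def by blast
  obtain C3 where C3: "0 \<le> C3" "\<And>w B x. loglip (2 * l) w \<Longrightarrow> oset B \<Longrightarrow> \<bar>trc B (smH w x)\<bar> \<le> C3 * sm w x"
    using sm_constants[OF l2(1)] by blast
  \<comment> \<open>Growth at the rate \<open>2 * l\<close> beats the scheme, which grows at most at
    the rate \<open>l\<close>.\<close>
  define bet where "bet = (\<lambda>x::real^'m. exp (2 * l * norm x))"
  have bet: "loglip (2 * l) bet" unfolding bet_def using loglip_exp_norm[OF l2(2)] by simp
  \<comment> \<open>\<open>X * h\<close> bounds the relative consistency error:
    \<open>2 * C1 / c\<close> comes from the Taylor remainder, as \<open>h ^ 3 / \<sigma>\<close> is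
    \<open>2 * h / c\<close>, and \<open>4 * C1 * l\<close> from the change of the trace during a
    step. Of \<open>A\<close>, three quarters cover \<open>3 * X\<close>, where 3 is the factor lost
    in \<open>smmono\<close>, and one quarter covers the decay of \<open>b\<close> inside the
    trace.\<close>
  define X where "X = 4 * C1 * l + 2 * C1 / c"
  define A where "A = 4 * X"
  define K1 where "K1 = 2 * C3 + 2"
  have X: "0 \<le> X" "0 \<le> A" using C1(1) l0 c by (auto simp: X_def A_def)
  \<comment> \<open>The entries ensure, in this order, that \<open>h\<close> and
    \<open>l * h\<close> are at most 1, that \<open>8 * (\<sigma> * C1)\<close> and
    \<open>8 * (\<sigma> * C3)\<close> are at most 1, that the decay factor
    \<open>1 - A * h * \<sigma>\<close> is nonnegative, and that its powers up to the time
    \<open>S\<close> stay above \<open>exp (- \<eta>)\<close>.\<close>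
  define Hs where "Hs = {1, 1 / l, 1 / (4 * c * C1 + 1), 1 / (4 * c * C3 + 1), 1 / (A * c + 1), (1 - exp (- \<eta>)) / (A * S + 1)}"
  define h0 where "h0 = Min Hs"
  have e1: "exp (- \<eta>) < 1" using \<eta> by simp
  have h0: "0 < h0" unfolding h0_def Hs_def using l c C1(1) C3(1) X S e1
    by (simp add: add_nonneg_pos)
  have main: "exp (- (2 * l * \<eta> + \<eta>)) * scheme \<B> h w0 k x \<le> exp (- l * v (x, - (real k * (h\<^sup>2 * c / 2))))"
    if h: "0 < h" "h < h0" and kS: "real k * (h\<^sup>2 * c / 2) \<le> S" for h k x
  proof -
    define \<sigma> where "\<sigma> = h\<^sup>2 * c / 2"
    have \<sigma>: "0 < \<sigma>" using h c by (simp add: \<sigma>_def)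
    have hb: "h \<le> 1" "h \<le> 1 / l" "h \<le> 1 / (4 * c * C1 + 1)" "h \<le> 1 / (4 * c * C3 + 1)" "h \<le> 1 / (A * c + 1)"
        "h \<le> (1 - exp (- \<eta>)) / (A * S + 1)"
    proof -
      have hh: "h \<le> a" if "a \<in> Hs" for a
        using Min_le[OF _ that] h(2) by (fastforce simp: h0_def Hs_def)
      show "h \<le> 1" "h \<le> 1 / l" "h \<le> 1 / (4 * c * C1 + 1)" "h \<le> 1 / (4 * c * C3 + 1)" "h \<le> 1 / (A * c + 1)"
        "h \<le> (1 - exp (- \<eta>)) / (A * S + 1)"
        by (rule hh, simp add: Hs_def)+
    qed
    have lh: "l * h \<le> 1" using hb(2) l by (simp add: field_simps)
    have h2: "h\<^sup>2 \<le> h" using hb(1) h by (simp add: power2_eq_square mult_left_le)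
    have \<sigma>h: "\<sigma> \<le> h * c / 2" using h2 c by (simp add: \<sigma>_def)
    have dv: "a * (q + 1) \<le> b" if "a \<le> b / (q + 1)" "0 \<le> q" for a b q :: real
      using that by (simp add: pos_le_divide_eq)
    have small: "8 * (\<sigma> * C) \<le> 1" if "h \<le> 1 / (4 * c * C + 1)" "0 \<le> C" for C
    proof -
      have "h * (4 * c * C + 1) \<le> 1" using dv[OF that(1)] that(2) c by simp
      then have "4 * (h * c * C) \<le> 1" using h by (simp add: algebra_simps)
      moreover have "\<sigma> * C \<le> (h * c / 2) * C" using \<sigma>h that(2) by (rule mult_right_mono)
      ultimately show ?thesis by (simp add: algebra_simps)
    qed
    note \<sigma>C1 = small[OF hb(3) C1(1)] and \<sigma>C3 = small[OF hb(4) C3(1)]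
    have A1: "A * h * \<sigma> \<le> 1"
    proof -
      have "h * (A * c + 1) \<le> 1" using dv[OF hb(5)] c X by simp
      then have "h * (A * c) \<le> 1" using h by (simp add: algebra_simps)
      moreover have "\<sigma> \<le> c" 
      proof -
        have "h * c \<le> 1 * c" using hb(1) c by (intro mult_right_mono) auto
        then show ?thesis using \<sigma>h c by linarith
      qed
      then have "A * h * \<sigma> \<le> A * h * c" using X h by (intro mult_left_mono) auto
      ultimately show ?thesis by (simp add: mult_ac)
    qed
    define w where "w = scheme \<B> h w0"
    have h0': "0 \<le> h" using h by simp
    have Lw: "loglip l (w k)" for k unfolding w_def by (rule loglip_scheme[OF w0 l0 h0' \<B>])
    have wstep: "w (Suc k) y \<le> bavg (\<lambda>\<xi>. w k (y + h *\<^sub>R prj B \<xi>))" if "B \<in> \<B>" for k B y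
      unfolding w_def by (rule scheme_le[OF w0 l0 h0' \<B> that])
    have wge: "w k y \<le> exp (l * h) * w (Suc k) y" for k y
      using scheme_ge_exp[OF w0 l0 h0' \<B>, of k y] by (simp add: w_def exp_minus field_simps del: scheme.simps)
    have wle: "w (Suc k) y \<le> exp (l * h) * w k y" for k y
      using scheme_le_exp[OF w0 l0 h0' \<B>, of k y] by (simp add: w_def del: scheme.simps)
    have elh: "exp (l * h) \<le> 3"
    proof -
      have "exp (l * h) \<le> exp 1" using lh by simp
      then show ?thesis using exp_le by linarith
    qed
    have wdiff: "\<bar>w (Suc k) y - w k y\<bar> \<le> (2 * (l * h)) * w k y" for k y
    proof -
      have e: "exp (l * h) - 1 \<le> 2 * (l * h)" using lh l0 h by (intro exp_minus_one_le) auto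
      have p: "0 < w k y" "0 < w (Suc k) y" using loglip_pos[OF Lw] by auto
      have 1: "w (Suc k) y - w k y \<le> (2 * (l * h)) * w k y"
        using wle[of k y] mult_right_mono[OF e, of "w k y"] p by (simp add: algebra_simps)
      have 2: "w k y - w (Suc k) y \<le> (2 * (l * h)) * w k y"
      proof (cases "w (Suc k) y \<le> w k y")
        case True
        have "w k y - w (Suc k) y \<le> (exp (l * h) - 1) * w (Suc k) y" using wge[of k y] by (simp add: algebra_simps)
        also have "\<dots> \<le> (2 * (l * h)) * w k y" using True e p l0 h by (intro mult_mono) auto
        finally show ?thesis .
      next
        case False
        then show ?thesis using p l0 h by (smt (verit) mult_nonneg_nonneg)
      qed
      show ?thesis using 1 2 by linarith
    qed
    have pos: "0 < sm (w k) y" for k y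
      using sm_bounds(1)[OF Lw l0, of k y] loglip_pos[OF Lw, of k y] by (meson exp_gt_zero less_le_trans mult_pos_pos)
    have posb: "0 < sm bet y" for y
      using sm_bounds(1)[OF bet l2(2), of y] loglip_pos[OF bet, of y] by (meson exp_gt_zero less_le_trans mult_pos_pos)
    have smmono: "sm (w k) y \<le> 3 * sm (w (Suc k)) y" for k y
    proof -
      have "w k y \<le> 3 * w (Suc k) y" for y
        using wge[of k y] mult_right_mono[OF elh, of "w (Suc k) y"] loglip_pos[OF Lw, of "Suc k" y] by linarith
      then have "wint K (\<lambda>z. w k (y + z)) \<le> wint K (\<lambda>z. 3 * w (Suc k) (y + z))"
        by (intro wint_mono[OF weights(1) nonneg] continuous_intros continuous_translate loglip_continuous[OF Lw])
      then show ?thesis by (simp add: sm_def moll_def wint_cmult)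
    qed
    define b where "b k = exp (- (l * \<eta>)) * (1 - A * h * \<sigma>) ^ k" for k :: nat
    define d where "d k = (1 + K1 * \<sigma>) ^ k" for k :: nat
    have b0: "0 \<le> b k" for k unfolding b_def using A1 by simp
    have K10: "0 \<le> K1" using C3(1) by (simp add: K1_def)
    have d0: "0 < d k" for k unfolding d_def using K10 \<sigma> by (intro zero_less_power add_pos_nonneg) auto
    have bS: "b (Suc k) = b k * (1 - A * h * \<sigma>)" and dS: "d (Suc k) = d k * (1 + K1 * \<sigma>)" for k
      by (auto simp: b_def d_def)
    have claim: "b k * sm (w k) x - \<epsilon> * d k * sm bet x \<le> exp (- l * v (x, - (real k * \<sigma>)))"
      if \<epsilon>: "0 < \<epsilon>" for \<epsilon> k x
    proof (induction k arbitrary: x)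
      case 0
      have "b 0 * sm (w 0) x \<le> exp (- (l * \<eta>)) * (exp (l * \<eta>) * w 0 x)"
        unfolding b_def using sm_bounds(2)[OF Lw l0, of 0 x] by simp
      also have "\<dots> = w0 x" by (simp add: exp_minus w_def)
      also have "\<dots> \<le> exp (- l * v (x, 0))" by (rule init)
      finally have "b 0 * sm (w 0) x \<le> exp (- l * v (x, 0))" .
      moreover have "0 \<le> \<epsilon> * d 0 * sm bet x" using \<epsilon> d0[of 0] posb[of x] by (simp add: less_imp_le)
      ultimately have "b 0 * sm (w 0) x - \<epsilon> * d 0 * sm bet x \<le> exp (- l * v (x, 0))" by linarith
      then show ?case by simp
    next
      case (Suc k)
      define f where "f = (\<lambda>x. b k * sm (w k) x + (- (\<epsilon> * d k)) * sm bet x)"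
      define f' where "f' = (\<lambda>x. b (Suc k) * sm (w (Suc k)) x + (- (\<epsilon> * d (Suc k))) * sm bet x)"
      define Hf where "Hf = (\<lambda>x. b k *\<^sub>R smH (w k) x + (- (\<epsilon> * d k)) *\<^sub>R smH bet x)"
      define Hf' where "Hf' = (\<lambda>x. b (Suc k) *\<^sub>R smH (w (Suc k)) x + (- (\<epsilon> * d (Suc k))) *\<^sub>R smH bet x)"
      define g where "g = (\<lambda>x. (1 / \<sigma>) * f' x + (- (1 / \<sigma>)) * f x)"
      define Hg where "Hg = (\<lambda>x. (1 / \<sigma>) *\<^sub>R Hf' x + (- (1 / \<sigma>)) *\<^sub>R Hf x)"
      note Cw = C2_sm[OF Lw l0] and Cb = C2_sm[OF bet l2(2)]
      have Cf: "C2 f (\<lambda>x. b k *\<^sub>R smG (w k) x + (- (\<epsilon> * d k)) *\<^sub>R smG bet x) Hf"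
        unfolding f_def Hf_def by (rule C2_linear_combination[OF Cw Cb])
      have Cf': "C2 f' (\<lambda>x. b (Suc k) *\<^sub>R smG (w (Suc k)) x + (- (\<epsilon> * d (Suc k))) *\<^sub>R smG bet x) Hf'"
        unfolding f'_def Hf'_def by (rule C2_linear_combination[OF Cw Cb])
      note Cg = C2_linear_combination[OF Cf' Cf, of "1 / \<sigma>" "- (1 / \<sigma>)", folded g_def Hg_def]
      have fg: "f x + \<sigma> * g x = f' x" for x using \<sigma> by (simp add: g_def algebra_simps)
      have "f x + \<sigma> * g x \<le> exp (- l * v (x, - (real k * \<sigma>) - \<sigma>))" for x
      proof (rule barrier_step[OF v(1) \<B>(2) v(2) l Cf Cg])
        show "0 \<le> real k * \<sigma>" using \<sigma> by simp
        show "f x \<le> exp (- l * v (x, - (real k * \<sigma>)))" for x using Suc[of x] by (simp add: f_def)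
        show "0 < \<sigma>" "0 \<le> \<sigma>" "\<sigma> \<le> \<sigma>" using \<sigma> by auto
        fix x \<theta> assume \<theta>: "0 \<le> \<theta>" "\<theta> \<le> 2 * \<sigma>"
        \<comment> \<open>The relative time within the step. It runs up to 2 because of the doubled
          interval in \<open>barrier_step\<close>, so beyond 1 the interpolation is an
          extrapolation.\<close>
        define s where "s = \<theta> / \<sigma>"
        have s: "0 \<le> s" "s \<le> 2" "\<theta> = s * \<sigma>" using \<theta> \<sigma> by (auto simp: s_def field_simps)
        let ?W = "sm (w k) x" and ?W' = "sm (w (Suc k)) x" and ?B = "sm bet x"
        have fgs: "f x + \<theta> * g x = (1 - s) * f x + s * f' x" using \<sigma> by (simp add: g_def s(3) algebra_simps)
        have Hgs: "Hf x + \<theta> *\<^sub>R Hg x = (1 - s) *\<^sub>R Hf x + s *\<^sub>R Hf' x" using \<sigma> by (simp add: Hg_def s(3) algebra_simps)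
        show "\<exists>\<gamma>>0. \<forall>B\<in>\<B>. g x + \<gamma> \<le> trc B (Hf x + \<theta> *\<^sub>R Hg x)"
        proof (intro exI[of _ "\<epsilon> * d k * ?B"] conjI ballI)
          show "0 < \<epsilon> * d k * ?B" using \<epsilon> d0 posb by simp
          fix B assume B: "B \<in> \<B>"
          have os: "oset B" using B \<B>(2) by (auto simp: all_planes_def)
          define T T' U where "T = trc B (smH (w k) x)" and "T' = trc B (smH (w (Suc k)) x)" and "U = trc B (smH bet x)"
          have U: "\<bar>U\<bar> \<le> C3 * ?B" unfolding U_def by (rule C3(2)[OF bet os])
          have T': "\<bar>T'\<bar> \<le> C1 * ?W'" unfolding T'_def by (rule C1(2)[OF Lw os])
          have TT: "\<bar>T' - T\<bar> \<le> C1 * (2 * (l * h)) * ?W"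
            unfolding T_def T'_def using wdiff l0 h by (intro C1(3)[OF Lw Lw os]) auto
          have W'le: "?W' \<le> ?W + \<sigma> * T + C1 * h ^ 3 * ?W"
            unfolding \<sigma>_def T_def using wstep[OF B] lh h by (intro C1(4)[OF Lw Lw os]) auto
          have WW: "?W \<le> 3 * ?W'" by (rule smmono)
          have h3: "h ^ 3 / \<sigma> = 2 * h / c" using h c by (simp add: \<sigma>_def field_simps power2_eq_square power3_eq_cube)
          have gle: "g x \<le> b k * T + b k * (2 * C1 / c * h * ?W) - b k * A * h * ?W' - \<epsilon> * d k * K1 * ?B"
          proof -
            have 1: "g x = b k * ((?W' - ?W) / \<sigma>) - b k * A * h * ?W' - \<epsilon> * d k * K1 * ?B"
              using \<sigma> by (simp add: g_def f_def f'_def bS dS field_simps)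
            have "(?W' - ?W) / \<sigma> \<le> (\<sigma> * T + C1 * h ^ 3 * ?W) / \<sigma>"
              using W'le \<sigma> by (intro divide_right_mono) auto
            also have "(\<sigma> * T + C1 * h ^ 3 * ?W) / \<sigma> = T + C1 * (h ^ 3 / \<sigma>) * ?W"
              using \<sigma> by (simp add: field_simps)
            finally have "b k * ((?W' - ?W) / \<sigma>) \<le> b k * (T + C1 * (h ^ 3 / \<sigma>) * ?W)"
              using b0[of k] by (rule mult_left_mono)
            then have "g x \<le> b k * (T + C1 * (h ^ 3 / \<sigma>) * ?W) - b k * A * h * ?W' - \<epsilon> * d k * K1 * ?B"
              unfolding 1 by linarith
            then show ?thesis unfolding h3 by (simp add: algebra_simps)
          qed
          have trceq: "trc B (Hf x + \<theta> *\<^sub>R Hg x)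
            = b k * T + s * (b k * (T' - T)) - s * (b k * (A * h * \<sigma>) * T') - \<epsilon> * d k * U - s * (\<epsilon> * d k * (K1 * \<sigma>) * U)"
          proof -
            have 1: "trc B (Hf x) = b k * T + (- (\<epsilon> * d k)) * U"
              by (simp only: Hf_def trc_add trc_scaleR T_def U_def)
            have 2: "trc B (Hf' x) = b (Suc k) * T' + (- (\<epsilon> * d (Suc k))) * U"
              by (simp only: Hf'_def trc_add trc_scaleR T'_def U_def)
            have "trc B (Hf x + \<theta> *\<^sub>R Hg x) = (1 - s) * trc B (Hf x) + s * trc B (Hf' x)"
              by (simp only: Hgs trc_add trc_scaleR)
            then show ?thesis unfolding 1 2 bS dS by (simp add: algebra_simps)
          qed
          have p: "0 \<le> ?W" "0 \<le> ?W'" "0 \<le> ?B" using pos posb by (auto simp: less_imp_le)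
          have e1: "- (s * (b k * (T' - T))) \<le> 2 * (b k * (C1 * (2 * (l * h)) * ?W))"
          proof -
            have "- (s * (b k * (T' - T))) \<le> \<bar>s * (b k * (T' - T))\<bar>" by linarith
            also have "\<dots> = s * (b k * \<bar>T' - T\<bar>)" using s b0[of k] by (simp add: abs_mult)
            also have "\<dots> \<le> 2 * (b k * (C1 * (2 * (l * h)) * ?W))"
              using TT s b0[of k] C1(1) l0 h p by (intro mult_mono) auto
            finally show ?thesis .
          qed
          have e2: "s * (b k * (A * h * \<sigma>) * T') \<le> 2 * (b k * (A * h * \<sigma>) * (C1 * ?W'))"
            using T' s b0[of k] X h \<sigma> by (intro mult_le_twice) auto
          have e3: "\<epsilon> * d k * U \<le> \<epsilon> * d k * (C3 * ?B)"
            using U \<epsilon> d0[of k] by (intro mult_left_mono) auto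
          have e4: "s * (\<epsilon> * d k * (K1 * \<sigma>) * U) \<le> 2 * (\<epsilon> * d k * (K1 * \<sigma>) * (C3 * ?B))"
            using U s \<epsilon> d0[of k] K10 \<sigma> by (intro mult_le_twice) auto
          have q1: "b k * h * (4 * C1 * l + 2 * C1 / c) * ?W + 2 * (b k * (A * h * \<sigma>) * (C1 * ?W')) \<le> b k * A * h * ?W'"
          proof -
            have "b k * h * X * ?W \<le> b k * h * X * (3 * ?W')" using WW b0[of k] h X by (intro mult_left_mono) auto
            moreover have "(b k * A * h * ?W') * (8 * (\<sigma> * C1)) \<le> (b k * A * h * ?W') * 1"
              using \<sigma>C1 b0[of k] X h p by (intro mult_left_mono mult_nonneg_nonneg) auto
            moreover have "b k * h * X * (3 * ?W') = (3/4) * (b k * A * h * ?W')" by (simp add: A_def)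
            moreover have "2 * (b k * (A * h * \<sigma>) * (C1 * ?W')) = (1/4) * ((b k * A * h * ?W') * (8 * (\<sigma> * C1)))" by simp
            ultimately show ?thesis unfolding X_def[symmetric] by linarith
          qed
          have q2: "\<epsilon> * d k * (C3 * ?B) + 2 * (\<epsilon> * d k * (K1 * \<sigma>) * (C3 * ?B)) + \<epsilon> * d k * ?B \<le> \<epsilon> * d k * K1 * ?B"
          proof -
            have "(\<epsilon> * d k * K1 * ?B) * (8 * (\<sigma> * C3)) \<le> (\<epsilon> * d k * K1 * ?B) * 1"
              using \<sigma>C3 \<epsilon> d0[of k] K10 p by (intro mult_left_mono mult_nonneg_nonneg) auto
            moreover have "2 * (\<epsilon> * d k * (K1 * \<sigma>) * (C3 * ?B)) = (1/4) * ((\<epsilon> * d k * K1 * ?B) * (8 * (\<sigma> * C3)))" by simp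
            ultimately have "2 * (\<epsilon> * d k * (K1 * \<sigma>) * (C3 * ?B)) \<le> (1/4) * (\<epsilon> * d k * K1 * ?B)" by linarith
            moreover have "\<epsilon> * d k * (C3 * ?B) + \<epsilon> * d k * ?B \<le> (3/4) * (\<epsilon> * d k * K1 * ?B)"
            proof -
              have "(\<epsilon> * d k * ?B) * (C3 + 1) \<le> (\<epsilon> * d k * ?B) * ((3/4) * K1)"
                using \<epsilon> d0[of k] p C3(1) by (intro mult_left_mono mult_nonneg_nonneg) (auto simp: K1_def)
              then show ?thesis by (simp add: algebra_simps)
            qed
            ultimately show ?thesis by linarith
          qed
          have "b k * (2 * C1 / c * h * ?W) + 2 * (b k * (C1 * (2 * (l * h)) * ?W)) = b k * h * (4 * C1 * l + 2 * C1 / c) * ?W"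
            by (simp add: algebra_simps)
          then show "g x + \<epsilon> * d k * ?B \<le> trc B (Hf x + \<theta> *\<^sub>R Hg x)"
            using gle e1 e2 e3 e4 q1 q2 unfolding trceq by linarith
        qed
        \<comment> \<open>\<open>D1\<close> bounds the contribution of the scheme and
          \<open>D2\<close> bounds that of \<open>bet\<close> from below, apart from the
          exponentials \<open>exp (l * norm x)\<close> and its square; beyond the radius
          \<open>D1 / (D2 * l)\<close> the latter wins.\<close>
        define D1 where "D1 = b k * (w k 0 + 2 * w (Suc k) 0) * exp (l * \<eta>)"
        define D2 where "D2 = \<epsilon> * d k * exp (- (2 * l * \<eta>))"
        have D: "0 \<le> D1" "0 < D2" unfolding D1_def D2_def using b0[of k] loglip_pos[OF Lw] \<epsilon> d0[of k]
          by (auto intro!: mult_nonneg_nonneg add_nonneg_nonneg simp: less_imp_le)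
        assume R: "D1 / (D2 * l) \<le> norm x"
        have wx: "sm (w j) x \<le> exp (l * \<eta>) * (exp (l * norm x) * w j 0)" for j
        proof -
          have "w j x \<le> exp (l * norm x) * w j 0" using loglip_le[OF Lw, of j x 0] by simp
          then have "exp (l * \<eta>) * w j x \<le> exp (l * \<eta>) * (exp (l * norm x) * w j 0)" by (rule mult_left_mono) simp
          then show ?thesis using sm_bounds(2)[OF Lw l0, of j x] by linarith
        qed
        have Bx: "exp (- (2 * l * \<eta>)) * (exp (l * norm x) * exp (l * norm x)) \<le> ?B"
        proof -
          have "exp (- (2 * l * \<eta>)) * bet x \<le> ?B" using sm_bounds(1)[OF bet l2(2), of x] by (simp add: mult.assoc)
          moreover have "bet x = exp (l * norm x) * exp (l * norm x)" by (simp add: bet_def exp_add[symmetric])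
          ultimately show ?thesis by simp
        qed
        have "D1 \<le> D2 * exp (l * norm x)"
        proof -
          have "D1 \<le> D2 * (l * norm x)" using R D l by (simp add: field_simps)
          also have "\<dots> \<le> D2 * exp (l * norm x)"
          proof (rule mult_left_mono)
            show "l * norm x \<le> exp (l * norm x)" using exp_ge_add_one_self[of "l * norm x"] by linarith
          qed (use D in simp)
          finally show ?thesis .
        qed
        then have "D1 * exp (l * norm x) \<le> D2 * exp (l * norm x) * exp (l * norm x)" by (rule mult_right_mono) simp
        also have "\<dots> = \<epsilon> * d k * (exp (- (2 * l * \<eta>)) * (exp (l * norm x) * exp (l * norm x)))" by (simp add: D2_def)
        also have "\<dots> \<le> \<epsilon> * d k * ?B" using Bx \<epsilon> d0[of k] by (intro mult_left_mono) auto
        finally have DB: "D1 * exp (l * norm x) \<le> \<epsilon> * d k * ?B" .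
        have p: "0 \<le> ?W" "0 \<le> ?W'" "0 \<le> ?B" using pos posb by (auto simp: less_imp_le)
        have "(1 - s) * f x + s * f' x = b k * ((1 - s) * ?W + s * ((1 - A * h * \<sigma>) * ?W')) - \<epsilon> * d k * ?B - s * (\<epsilon> * d k * (K1 * \<sigma>) * ?B)"
          unfolding f_def f'_def bS dS by (simp add: algebra_simps)
        also have "\<dots> \<le> b k * (1 * ?W + 2 * (1 * ?W')) - \<epsilon> * d k * ?B - 0"
          using b0[of k] s p A1 X h \<sigma> \<epsilon> d0[of k] K10
          by (intro diff_mono mult_left_mono add_mono mult_right_mono mult_mono) (auto intro!: mult_nonneg_nonneg simp: less_imp_le)
        also have "\<dots> \<le> b k * (exp (l * \<eta>) * (exp (l * norm x) * w k 0) + 2 * (exp (l * \<eta>) * (exp (l * norm x) * w (Suc k) 0))) - \<epsilon> * d k * ?B"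
          using wx[of k] wx[of "Suc k"] b0[of k] by (simp add: mult_left_mono)
        also have "\<dots> = D1 * exp (l * norm x) - \<epsilon> * d k * ?B" by (simp add: D1_def algebra_simps)
        also have "\<dots> \<le> 0" using DB by simp
        finally show "f x + \<theta> * g x \<le> 0" unfolding fgs .
      qed
      moreover have "- (real k * \<sigma>) - \<sigma> = - (real (Suc k) * \<sigma>)" by (simp add: algebra_simps)
      ultimately have "f' x \<le> exp (- l * v (x, - (real (Suc k) * \<sigma>)))" unfolding fg by metis
      then show ?case by (simp only: f'_def)  simp
    qed
    have "b k * sm (w k) x \<le> exp (- l * v (x, - (real k * \<sigma>)))"
    proof (rule field_le_epsilon)
      fix e :: real assume e: "0 < e"
      then have "0 < e / (d k * sm bet x)" using d0 posb by simp
      from claim[OF this, of k x] show "b k * sm (w k) x \<le> exp (- l * v (x, - (real k * \<sigma>))) + e"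
        using d0[of k] posb[of x] by simp
    qed
    moreover have "exp (- (2 * l * \<eta> + \<eta>)) * w k x \<le> b k * sm (w k) x"
    proof -
      have "1 + real k * (- (A * h * \<sigma>)) \<le> (1 + (- (A * h * \<sigma>))) ^ k"
        using A1 by (intro Bernoulli_inequality) simp
      moreover have "A * h * (real k * \<sigma>) \<le> A * h * S" using kS X h by (intro mult_left_mono) (auto simp: \<sigma>_def)
      moreover have "A * h * S \<le> 1 - exp (- \<eta>)"
      proof -
        have "h * (A * S + 1) \<le> 1 - exp (- \<eta>)" using dv[OF hb(6)] X S by simp
        then show ?thesis using h by (simp add: algebra_simps)
      qed
      ultimately have "exp (- \<eta>) \<le> (1 - A * h * \<sigma>) ^ k" by (simp add: algebra_simps)
      then have "exp (- (l * \<eta>)) * exp (- \<eta>) \<le> b k" unfolding b_def by (intro mult_left_mono) auto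
      moreover have "exp (- (l * \<eta>)) * w k x \<le> sm (w k) x" by (rule sm_bounds(1)[OF Lw l0])
      ultimately have "(exp (- (l * \<eta>)) * exp (- \<eta>)) * (exp (- (l * \<eta>)) * w k x) \<le> b k * sm (w k) x"
        using b0[of k] loglip_pos[OF Lw, of k x] by (intro mult_mono) auto
      moreover have "exp (- (2 * l * \<eta> + \<eta>)) = exp (- (l * \<eta>)) * exp (- \<eta>) * exp (- (l * \<eta>))"
        unfolding exp_add[symmetric] by (simp add: algebra_simps)
      ultimately show ?thesis by (simp add: mult.assoc)
    qed
    ultimately show ?thesis by (simp add: w_def \<sigma>_def)
  qed
  then show ?thesis using h0 unfolding c_def by blast
qed

section \<open>Comparison at midpoints\<close>

section \<open>Comparison\<close>

lemma loglip_exp_lipschitz: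
  assumes "\<And>x y. f x - f y \<le> norm (x - y)" "0 \<le> l"
  shows "loglip l (\<lambda>x. exp (l * f x))"
  unfolding loglip_def
proof (intro conjI allI)
  fix x y
  have "l * f x \<le> l * (norm (x - y) + f y)" using assms(1)[of x y] assms(2) by (intro mult_left_mono) auto
  then show "exp (l * f x) \<le> exp (l * norm (x - y)) * exp (l * f y)" by (simp add: exp_add[symmetric] distrib_left)
qed simp

lemma infnorm_diff_le_norm: "infnorm x - infnorm y \<le> norm (x - y)"
proof -
  have "infnorm (y + (x - y)) \<le> infnorm y + infnorm (x - y)" by (rule infnorm_triangle)
  then show ?thesis using infnorm_le_norm[of "x - y"] by simp
qed

text \<open>With equal functions this is midpoint convexity, with equal points the comparison
  principle. The parameters are fixed in the order \<epsilon>, \<open>a\<close>, \<rho>,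
  \<open>l\<close>, and last the step size: \<open>a\<close> makes the penalty dominate the initial
  modulus, \<rho> and \<open>l\<close> control the first and the last summand of the loss
  \<open>D\<close>, and the step size controls the rest and makes the schemes comparable with
  \<open>v1\<close> and \<open>v2\<close>.\<close>

theorem comparison:
  fixes v1 v2 :: "(real^'m) \<times> real \<Rightarrow> real"
  assumes v1: "plane_subsolution all_planes v1" "continuous_on (UNIV \<times> {..0}) v1" "\<And>x. v1 (x, 0) \<le> infnorm x"
    and v2: "plane_subsolution hyperplanes (\<lambda>p. - v2 p)" "continuous_on (UNIV \<times> {..0}) v2" "\<And>x. infnorm x \<le> v2 (x, 0)"
    and t: "t \<le> 0"
  shows "v1 ((1/2) *\<^sub>R (y1 + y2), t) \<le> (v2 (y1, t) + v2 (y2, t)) / 2"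
proof (cases "t = 0")
  case True
  have "v1 ((1/2) *\<^sub>R (y1 + y2), 0) \<le> infnorm ((1/2) *\<^sub>R (y1 + y2))" by (rule v1(3))
  also have "\<dots> = infnorm (y1 + y2) / 2" by (simp add: infnorm_mul)
  also have "\<dots> \<le> (infnorm y1 + infnorm y2) / 2" using infnorm_triangle[of y1 y2] by simp
  also have "\<dots> \<le> (v2 (y1, 0) + v2 (y2, 0)) / 2" using v2(3)[of y1] v2(3)[of y2] by simp
  finally show ?thesis using True by simp
next
  case False
  define s where "s = - t"
  have s: "0 < s" using False t by (simp add: s_def)
  define c where "c = bvar TYPE('m)"
  have c: "0 < c" unfolding c_def by (rule bvar_pos)
  define x where "x = (1/2) *\<^sub>R (y1 + y2)"
  have approx: "v1 (x, t) \<le> (v2 (y1, t) + v2 (y2, t)) / 2 + 8 * \<epsilon>" if e: "0 < \<epsilon>" "\<epsilon> \<le> 1" for \<epsilon>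
  proof -
    \<comment> \<open>The sum of the squared step sizes that corresponds to the time
      \<open>s\<close>.\<close>
    define T where "T = 2 * s / c"
    have T: "0 < T" using s c by (simp add: T_def)
    \<comment> \<open>With this \<open>a\<close>,
      \<open>norm z \<le> \<epsilon> + a * norm z ^ 4\<close> for every \<open>z\<close>: either
      \<open>norm z \<le> \<epsilon>\<close>, or the cube of \<open>norm z / \<epsilon>\<close>
      exceeds 1.\<close>
    define a where "a = 1 / \<epsilon> ^ 3"
    have a: "1 \<le> a" using e by (simp add: a_def power_le_one)
    define \<rho> where "\<rho> = min 1 (sqrt (\<epsilon> / (120 * a * T)))"
    have \<rho>: "0 < \<rho>" "\<rho> \<le> 1" using e a T by (auto simp: \<rho>_def)
    have \<rho>2: "a * T * (40 * \<rho>\<^sup>2) \<le> \<epsilon> / 3"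
    proof -
      have "\<rho>\<^sup>2 \<le> (sqrt (\<epsilon> / (120 * a * T)))\<^sup>2" using \<rho> by (intro power_mono) (auto simp: \<rho>_def)
      also have "\<dots> = \<epsilon> / (120 * a * T)" using e a T by simp
      finally show ?thesis using a T by (simp add: field_simps)
    qed
    \<comment> \<open>211680 is 6 * 35280: a factor 2 from \<open>l * a / 2\<close>, and a factor 3
      because each summand of the loss is granted a third of \<epsilon>.\<close>
    define l where "l = max 1 (211680 * T / (c * \<rho>\<^sup>2 * \<epsilon>))"
    have l: "1 \<le> l" "0 < l" by (auto simp: l_def)
    have l2: "a * T * (35280 / (l * a / 2 * c * \<rho>\<^sup>2)) \<le> \<epsilon> / 3"
    proof -
      have "211680 * T / (c * \<rho>\<^sup>2 * \<epsilon>) \<le> l" by (simp add: l_def)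
      then have "211680 * T \<le> l * (c * \<rho>\<^sup>2 * \<epsilon>)" using c \<rho> e by (simp add: pos_divide_le_eq)
      moreover have "a * T * (35280 / (l * a / 2 * c * \<rho>\<^sup>2)) = 70560 * T / (l * c * \<rho>\<^sup>2)"
        using a l c \<rho> by (simp add: field_simps)
      moreover have "70560 * T / (l * c * \<rho>\<^sup>2) \<le> \<epsilon> / 3"
        using \<open>211680 * T \<le> l * (c * \<rho>\<^sup>2 * \<epsilon>)\<close> l c \<rho> by (simp add: pos_divide_le_eq mult_ac)
      ultimately show ?thesis by simp
    qed
    define f where "f = (\<lambda>x::real^'m. exp (- l * infnorm x))"
    define g where "g = (\<lambda>x::real^'m. exp (l * infnorm x))"
    have Lf: "loglip l f"
    proof -
      have "- infnorm x - - infnorm y \<le> norm (x - y)" for x y :: "real^'m"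
        using infnorm_diff_le_norm[of y x] by (simp add: norm_minus_commute)
      from loglip_exp_lipschitz[OF this, of l] show ?thesis using l by (simp add: f_def)
    qed
    have Lg: "loglip l g"
      unfolding g_def using infnorm_diff_le_norm l by (intro loglip_exp_lipschitz) auto
    have if': "f x \<le> exp (- l * v1 (x, 0))" for x using v1(3)[of x] l by (simp add: f_def)
    have ig: "g x \<le> exp (- l * (- v2 (x, 0)))" for x using v2(3)[of x] l by (simp add: g_def)
    obtain h1 where h1: "0 < h1" "\<And>h k x. 0 < h \<Longrightarrow> h < h1 \<Longrightarrow> real k * (h\<^sup>2 * c / 2) \<le> s \<Longrightarrow>
      exp (- (2 * l * \<epsilon> + \<epsilon>)) * scheme all_planes h f k x \<le> exp (- l * v1 (x, - (real k * (h\<^sup>2 * c / 2))))"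
      using scheme_barrier[OF v1(1,2) all_planes_nonempty order_refl l(2) Lf if' s e] unfolding c_def by blast
    obtain h2 where h2: "0 < h2" "\<And>h k x. 0 < h \<Longrightarrow> h < h2 \<Longrightarrow> real k * (h\<^sup>2 * c / 2) \<le> s \<Longrightarrow>
      exp (- (2 * l * \<epsilon> + \<epsilon>)) * scheme hyperplanes h g k x \<le> exp (- l * (- v2 (x, - (real k * (h\<^sup>2 * c / 2)))))"
      using scheme_barrier[OF v2(1) continuous_on_minus[OF v2(2)] hyperplanes_nonempty hyperplanes_subset l(2) Lg ig s e]
      unfolding c_def by blast
    define h3 where "h3 = sqrt (\<epsilon> / (96 * a * T))"
    define h4 where "h4 = sqrt (1 / (72 * l * a))"
    have h34: "0 < h3" "0 < h4" using e a T l by (auto simp: h3_def h4_def)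
    define H where "H = Min {h1, h2, h3, h4, \<rho>}"
    have H: "0 < H" unfolding H_def using h1(1) h2(1) h34 \<rho> by simp
    \<comment> \<open>So many steps that \<open>h\<close>, determined by
      \<open>real k * h\<^sup>2 = T\<close>, lies below all thresholds; the schemes then stop
      exactly at the time \<open>s\<close>.\<close>
    obtain k :: nat where k: "T / H\<^sup>2 < real k" using reals_Archimedean2 by blast
    have k0: "0 < real k" using k H T by (meson divide_pos_pos less_trans zero_less_power)
    define h where "h = sqrt (T / real k)"
    have hk: "h\<^sup>2 = T / real k" using T k0 by (simp add: h_def)
    have h: "0 < h" using T k0 by (simp add: h_def)
    have hH: "h < H"
    proof -
      have "h\<^sup>2 < H\<^sup>2" unfolding hk using k k0 H by (simp add: field_simps)
      then show ?thesis using H by (intro power_less_imp_less_base[of h 2 H]) auto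
    qed
    have hs: "h < h1" "h < h2" "h \<le> h3" "h \<le> h4" "h \<le> \<rho>"
    proof -
      have "H \<le> q" if "q \<in> {h1, h2, h3, h4, \<rho>}" for q unfolding H_def using that by (intro Min_le) auto
      then have "H \<le> h1" "H \<le> h2" "H \<le> h3" "H \<le> h4" "H \<le> \<rho>" by auto
      then show "h < h1" "h < h2" "h \<le> h3" "h \<le> h4" "h \<le> \<rho>" using hH by linarith+
    qed
    have ks: "real k * (h\<^sup>2 * c / 2) = s" unfolding hk using k0 c by (simp add: T_def)
    have kh: "real k * h\<^sup>2 = T" unfolding hk using k0 by simp
    have small: "72 * l * a * h\<^sup>2 \<le> 1"
    proof -
      have "h\<^sup>2 \<le> h4\<^sup>2" using hs(4) h by (intro power_mono) auto
      also have "h4\<^sup>2 = 1 / (72 * l * a)" using l a by (simp add: h4_def)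
      finally show ?thesis using l a by (simp add: field_simps)
    qed
    have h3b: "a * T * (32 * h\<^sup>2) \<le> \<epsilon> / 3"
    proof -
      have "h\<^sup>2 \<le> h3\<^sup>2" using hs(3) h by (intro power_mono) auto
      also have "h3\<^sup>2 = \<epsilon> / (96 * a * T)" using e a T by (simp add: h3_def)
      finally show ?thesis using a T by (simp add: field_simps)
    qed
    define D where "D = 40 * \<rho>\<^sup>2 + 32 * h\<^sup>2 + 35280 / (l * a / 2 * bvar TYPE('m) * \<rho>\<^sup>2)"
    have loss: "a * (real k * h\<^sup>2 * D) \<le> \<epsilon>"
    proof -
      have "a * (real k * h\<^sup>2 * D) = a * T * (40 * \<rho>\<^sup>2) + a * T * (32 * h\<^sup>2) + a * T * (35280 / (l * a / 2 * c * \<rho>\<^sup>2))"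
        unfolding kh D_def c_def by (simp only: distrib_left mult.assoc)
      then show ?thesis using \<rho>2 h3b l2 by linarith
    qed
    have init: "exp (- l * (\<epsilon> + a * norm (x - (1/2) *\<^sub>R (y1 + y2)) ^ 4)) \<le> f x * sqrt (g y1 * g y2)" for x y1 y2
    proof -
      define z where "z = x - (1/2) *\<^sub>R (y1 + y2)"
      have "infnorm x \<le> infnorm ((1/2) *\<^sub>R (y1 + y2)) + norm z"
        using infnorm_diff_le_norm[of x "(1/2) *\<^sub>R (y1 + y2)"] by (simp add: z_def)
      also have "infnorm ((1/2) *\<^sub>R (y1 + y2)) \<le> (infnorm y1 + infnorm y2) / 2"
        using infnorm_triangle[of y1 y2] by (simp add: infnorm_mul)
      also have "norm z \<le> \<epsilon> + a * norm z ^ 4"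
      proof (cases "norm z \<le> \<epsilon>")
        case True
        then show ?thesis using a by (simp add: add_increasing2)
      next
        case False
        then have "1 \<le> (norm z / \<epsilon>) ^ 3" using e by (simp add: one_le_power)
        then have "norm z * 1 \<le> norm z * (norm z / \<epsilon>) ^ 3" by (rule mult_left_mono) simp
        also have "\<dots> = a * norm z ^ 4" by (simp add: a_def power_divide power4_eq_xxxx power3_eq_cube)
        finally show ?thesis using e by simp
      qed
      finally have "l * infnorm x \<le> l * ((infnorm y1 + infnorm y2) / 2 + (\<epsilon> + a * norm z ^ 4))"
        using l by (intro mult_left_mono) auto
      also have "\<dots> = (l * infnorm y1 + l * infnorm y2) / 2 + l * (\<epsilon> + a * norm z ^ 4)"
        unfolding distrib_left[of l "(infnorm y1 + infnorm y2) / 2"] by (simp add: distrib_left)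
      finally have "- l * (\<epsilon> + a * norm z ^ 4) \<le> - l * infnorm x + (l * infnorm y1 + l * infnorm y2) / 2"
        by linarith
      moreover have "sqrt (g y1 * g y2) = exp ((l * infnorm y1 + l * infnorm y2) / 2)"
      proof -
        have "g y1 * g y2 = (exp ((l * infnorm y1 + l * infnorm y2) / 2))\<^sup>2"
          by (simp add: g_def exp_add[symmetric] exp_double[symmetric])
        then show ?thesis by simp
      qed
      ultimately show ?thesis unfolding z_def f_def by (simp add: exp_add[symmetric])
    qed
    let ?Z = "scheme all_planes h f k" and ?W = "scheme hyperplanes h g k"
    have "exp (- l * (\<epsilon> + a * (real k * h\<^sup>2 * D) + a * norm (x - (1/2) *\<^sub>R (y1 + y2)) ^ 4)) \<le> ?Z x * sqrt (?W y1 * ?W y2)"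
      by (rule scheme_coupling[OF Lf Lg l(2) a h hs(5) \<rho> small D_def init])
    moreover have "exp (- l * (2 * \<epsilon>)) \<le> exp (- l * (\<epsilon> + a * (real k * h\<^sup>2 * D) + a * norm (x - (1/2) *\<^sub>R (y1 + y2)) ^ 4))"
      using loss l by (simp add: x_def)
    ultimately have ZW: "exp (- l * (2 * \<epsilon>)) \<le> ?Z x * sqrt (?W y1 * ?W y2)" by linarith
    define q where "q = exp (- (2 * l * \<epsilon> + \<epsilon>))"
    have q: "0 < q" by (simp add: q_def)
    have Zv: "q * ?Z x \<le> exp (- l * v1 (x, t))" using h1(2)[OF h hs(1), of k x] ks by (simp add: q_def s_def)
    have Wv: "q * ?W y \<le> exp (l * v2 (y, t))" for y using h2(2)[OF h hs(2), of k y] ks by (simp add: q_def s_def)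
    have h0: "0 \<le> h" and l0: "0 \<le> l" using h l by auto
    note pZ = loglip_pos[OF loglip_scheme[OF Lf l0 h0 all_planes_nonempty order_refl]]
    note pW = loglip_pos[OF loglip_scheme[OF Lg l0 h0 hyperplanes_nonempty hyperplanes_subset]]
    have "q * q * exp (- l * (2 * \<epsilon>)) \<le> q * q * (?Z x * sqrt (?W y1 * ?W y2))" using ZW q by (intro mult_left_mono) auto
    also have "\<dots> = (q * ?Z x) * sqrt ((q * ?W y1) * (q * ?W y2))"
    proof -
      have "(q * ?W y1) * (q * ?W y2) = q\<^sup>2 * (?W y1 * ?W y2)" by (simp add: power2_eq_square)
      then have "sqrt ((q * ?W y1) * (q * ?W y2)) = q * sqrt (?W y1 * ?W y2)" using q by (simp add: real_sqrt_mult)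
      then show ?thesis by simp
    qed
    also have "\<dots> \<le> exp (- l * v1 (x, t)) * sqrt (exp (l * v2 (y1, t)) * exp (l * v2 (y2, t)))"
      using pZ pW q by (intro mult_mono Zv real_sqrt_le_mono Wv) (auto intro!: mult_nonneg_nonneg simp: less_imp_le)
    also have "sqrt (exp (l * v2 (y1, t)) * exp (l * v2 (y2, t))) = exp ((l * v2 (y1, t) + l * v2 (y2, t)) / 2)"
    proof -
      have "exp (l * v2 (y1, t)) * exp (l * v2 (y2, t)) = (exp ((l * v2 (y1, t) + l * v2 (y2, t)) / 2))\<^sup>2"
        by (simp add: exp_add[symmetric] exp_double[symmetric])
      then show ?thesis by simp
    qed
    \<comment> \<open>The two hyperplane factors enter by their geometric mean, so \<open>q\<close>
      occurs only twice. The total loss is \<open>6 * (l * \<epsilon>) + 2 * \<epsilon>\<close>, at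
      most \<open>8 * (l * \<epsilon>)\<close> since \<open>1 \<le> l\<close>, and division by
      \<open>l\<close> leaves \<open>8 * \<epsilon>\<close>.\<close>
    finally have "exp (- 2 * (2 * l * \<epsilon> + \<epsilon>) - l * (2 * \<epsilon>)) \<le> exp (- l * v1 (x, t) + (l * v2 (y1, t) + l * v2 (y2, t)) / 2)"
      by (simp add: q_def exp_add[symmetric] exp_diff[symmetric] algebra_simps)
    then have "- 2 * (2 * l * \<epsilon> + \<epsilon>) - l * (2 * \<epsilon>) \<le> - l * v1 (x, t) + (l * v2 (y1, t) + l * v2 (y2, t)) / 2"
      by (simp only: exp_le_cancel_iff)
    moreover have "- 2 * (2 * l * \<epsilon> + \<epsilon>) - l * (2 * \<epsilon>) = - (6 * (l * \<epsilon>) + 2 * \<epsilon>)" by (simp add: algebra_simps)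
    ultimately have "l * v1 (x, t) \<le> (l * v2 (y1, t) + l * v2 (y2, t)) / 2 + 6 * (l * \<epsilon>) + 2 * \<epsilon>" by linarith
    moreover have "(l * v2 (y1, t) + l * v2 (y2, t)) / 2 = l * ((v2 (y1, t) + v2 (y2, t)) / 2)" by (simp add: distrib_left)
    ultimately have "l * v1 (x, t) \<le> l * ((v2 (y1, t) + v2 (y2, t)) / 2) + 6 * (l * \<epsilon>) + 2 * \<epsilon>" by (simp only:)
    also have "2 * \<epsilon> \<le> 2 * (l * \<epsilon>)" using l e by simp
    finally have "l * v1 (x, t) \<le> l * ((v2 (y1, t) + v2 (y2, t)) / 2 + 8 * \<epsilon>)" by (simp add: algebra_simps)
    then show ?thesis using l by simp
  qed
  have "v1 (x, t) \<le> (v2 (y1, t) + v2 (y2, t)) / 2"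
  proof (rule field_le_epsilon)
    fix e :: real assume e: "0 < e"
    then have "v1 (x, t) \<le> (v2 (y1, t) + v2 (y2, t)) / 2 + 8 * min 1 (e / 8)" by (intro approx) auto
    moreover have "8 * min 1 (e / 8) \<le> e" by linarith
    ultimately show "v1 (x, t) \<le> (v2 (y1, t) + v2 (y2, t)) / 2 + e" by linarith
  qed
  then show ?thesis by (simp add: x_def)
qed

section \<open>Calculus of test functions\<close>

section \<open>Test functions\<close>

lemma test_functionD:
  assumes "test_function \<phi> \<phi>t G H" "t < 0"
  shows "((\<lambda>s. \<phi> (x, s)) has_real_derivative \<phi>t (x, t)) (at t)"
    "((\<lambda>y. \<phi> (y, t)) has_derivative (\<lambda>h. G (x, t) \<bullet> h)) (at x)"
    "((\<lambda>y. G (y, t)) has_derivative (\<lambda>h. H (x, t) *v h)) (at x)"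
  using assms by (auto simp: test_function_def)

lemma test_function_isCont:
  assumes "test_function \<phi> \<phi>t G H" "snd z < 0"
  shows "isCont \<phi>t z" "isCont G z" "isCont H z"
proof -
  have o: "open (UNIV \<times> {..<0} :: ((real^'a) \<times> real) set)" by (intro open_Times) auto
  have z: "z \<in> UNIV \<times> {..<0}" using assms(2) by (simp add: mem_Times_iff)
  show "isCont \<phi>t z" "isCont G z" "isCont H z"
    using assms(1) continuous_on_eq_continuous_at[OF o] z unfolding test_function_def by blast+
qed

lemma isCont_near:
  fixes f :: "(real^'m) \<times> real \<Rightarrow> 'b::metric_space"
  assumes "isCont f (x0, t0)" "0 < e"
  obtains r where "0 < r" "\<And>x t. norm (x - x0) < r \<Longrightarrow> \<bar>t - t0\<bar> < r \<Longrightarrow> dist (f (x, t)) (f (x0, t0)) < e"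
proof -
  obtain d where d: "0 < d" "\<And>w. dist w (x0, t0) < d \<Longrightarrow> dist (f w) (f (x0, t0)) < e"
    using assms unfolding continuous_at_eps_delta by blast
  show thesis
  proof (rule that[of "d / 2"])
    fix x t assume a: "norm (x - x0) < d / 2" "\<bar>t - t0\<bar> < d / 2"
    have "dist (x, t) (x0, t0) \<le> norm (x - x0) + \<bar>t - t0\<bar>"
      unfolding dist_norm using norm_Pair_le[of "x - x0" "t - t0"] by simp
    then show "dist (f (x, t)) (f (x0, t0)) < e" using a by (intro d(2)) linarith
  qed (use d in simp)
qed

text \<open>A test function comes with a matrix \<open>H\<close> that represents the derivative of
  \<open>G\<close>; its symmetry has to be derived. The mixed second difference over a small
  parallelogram is symmetric in the two directions, and two mean value steps express it by
  \<open>H\<close> at a nearby point.\<close>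

lemma hessian_symmetric:
  assumes \<phi>: "test_function \<phi> \<phi>t G H" and t: "t < 0"
  shows "u \<bullet> (H (x, t) *v v) = v \<bullet> (H (x, t) *v u)"
proof (rule ccontr)
  assume ne: "u \<bullet> (H (x, t) *v v) \<noteq> v \<bullet> (H (x, t) *v u)"
  define e where "e = \<bar>u \<bullet> (H (x, t) *v v) - v \<bullet> (H (x, t) *v u)\<bar>"
  have e: "0 < e / 2" using ne by (simp add: e_def)
  define f where "f y = \<phi> (y, t)" for y
  define g where "g y = G (y, t)" for y
  have df: "(f has_derivative (\<lambda>h. g y \<bullet> h)) (at y)" for y
    unfolding f_def g_def by (rule test_functionD[OF \<phi> t])
  have dg: "(g has_derivative (\<lambda>h. H (y, t) *v h)) (at y)" for y
    unfolding g_def by (rule test_functionD[OF \<phi> t])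
  have mixed: "\<exists>y. norm (y - x) \<le> s * (norm a + norm b) \<and>
      f (x + s *\<^sub>R a + s *\<^sub>R b) - f (x + s *\<^sub>R a) - f (x + s *\<^sub>R b) + f x = s\<^sup>2 * (a \<bullet> (H (y, t) *v b))"
    if s: "0 \<le> s" for s a b
  proof -
    define J where "J y = f (y + s *\<^sub>R b) - f y" for y
    have sh: "((\<lambda>y. y + s *\<^sub>R b) has_derivative (\<lambda>h. h)) (at y)" for y by (auto intro!: derivative_eq_intros)
    have dJ: "(J has_derivative (\<lambda>h. (g (y + s *\<^sub>R b) - g y) \<bullet> h)) (at y)" for y
    proof -
      have "((\<lambda>y. f (y + s *\<^sub>R b)) has_derivative (\<lambda>h. g (y + s *\<^sub>R b) \<bullet> h)) (at y)"
        using diff_chain_at[OF sh df] by (simp add: o_def)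
      then show ?thesis unfolding J_def[abs_def] using has_derivative_diff[OF _ df] by (simp add: inner_diff_left)
    qed
    obtain r where r: "r \<in> {0<..<1}" "J (x + s *\<^sub>R a) - J x = (g (x + r *\<^sub>R s *\<^sub>R a + s *\<^sub>R b) - g (x + r *\<^sub>R s *\<^sub>R a)) \<bullet> (s *\<^sub>R a)"
      using mean_value_line[of J "\<lambda>y. g (y + s *\<^sub>R b) - g y" x "s *\<^sub>R a", OF dJ] by blast
    define y0 where "y0 = x + r *\<^sub>R s *\<^sub>R a"
    define L where "L y = g y \<bullet> a" for y
    have dL: "(L has_derivative (\<lambda>h. (a v* H (y, t)) \<bullet> h)) (at y)" for y
    proof -
      have "(L has_derivative (\<lambda>h. (H (y, t) *v h) \<bullet> a)) (at y)"
        unfolding L_def[abs_def] by (rule has_derivative_inner_left[OF dg])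
      moreover have "(H (y, t) *v h) \<bullet> a = (a v* H (y, t)) \<bullet> h" for h
        using dot_lmul_matrix[of a "H (y, t)" h] by (simp add: inner_commute)
      ultimately show ?thesis by simp
    qed
    obtain q where q: "q \<in> {0<..<1}" "L (y0 + s *\<^sub>R b) - L y0 = (a v* H (y0 + q *\<^sub>R s *\<^sub>R b, t)) \<bullet> (s *\<^sub>R b)"
      using mean_value_line[of L "\<lambda>y. a v* H (y, t)" y0 "s *\<^sub>R b", OF dL] by blast
    define y where "y = y0 + q *\<^sub>R s *\<^sub>R b"
    have "norm (y - x) \<le> norm (r *\<^sub>R s *\<^sub>R a) + norm (q *\<^sub>R s *\<^sub>R b)"
    proof -
      have "y - x = r *\<^sub>R s *\<^sub>R a + q *\<^sub>R s *\<^sub>R b" by (simp add: y_def y0_def)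
      then show ?thesis by (simp only: norm_triangle_ineq)
    qed
    also have "\<dots> \<le> s * norm a + s * norm b"
      using mult_left_le_one_le[of "s * norm a" r] mult_left_le_one_le[of "s * norm b" q] r(1) q(1) s
      by (intro add_mono) (auto simp: mult.assoc)
    finally have "norm (y - x) \<le> s * (norm a + norm b)" by (simp add: distrib_left)
    moreover have "f (x + s *\<^sub>R a + s *\<^sub>R b) - f (x + s *\<^sub>R a) - f (x + s *\<^sub>R b) + f x = J (x + s *\<^sub>R a) - J x"
      by (simp add: J_def)
    moreover have "J (x + s *\<^sub>R a) - J x = s * (L (y0 + s *\<^sub>R b) - L y0)"
      unfolding r(2) by (simp add: L_def y0_def inner_diff_left)
    moreover have "L (y0 + s *\<^sub>R b) - L y0 = s * (a \<bullet> (H (y, t) *v b))"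
      unfolding q(2) y_def[symmetric] dot_lmul_matrix by (simp add: matrix_vector_mult_scaleR)
    ultimately show ?thesis by (intro exI[of _ y]) (simp add: power2_eq_square)
  qed
  have cH: "isCont H (x, t)" using test_function_isCont(3)[OF \<phi>, of "(x, t)"] t by simp
  have c: "isCont (\<lambda>w. a \<bullet> (H w *v b)) (x, t)" for a b
    unfolding inner_vec_def matrix_vector_mult_def vec_lambda_beta by (intro continuous_intros cH)
  obtain r1 where r1: "0 < r1" "\<And>y s. norm (y - x) < r1 \<Longrightarrow> \<bar>s - t\<bar> < r1 \<Longrightarrow> dist (u \<bullet> (H (y, s) *v v)) (u \<bullet> (H (x, t) *v v)) < e / 2"
    using isCont_near[OF c e] by blast
  obtain r2 where r2: "0 < r2" "\<And>y s. norm (y - x) < r2 \<Longrightarrow> \<bar>s - t\<bar> < r2 \<Longrightarrow> dist (v \<bullet> (H (y, s) *v u)) (v \<bullet> (H (x, t) *v u)) < e / 2"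
    using isCont_near[OF c e] by blast
  define s where "s = min r1 r2 / (norm u + norm v + 1)"
  have nn: "0 < norm u + norm v + 1" by (simp add: add_nonneg_pos)
  have s: "0 < s" using r1 r2 nn by (simp add: s_def)
  have sn: "s * (norm u + norm v) < min r1 r2"
  proof -
    have "s * (norm u + norm v) < s * (norm u + norm v + 1)" using s by (intro mult_strict_left_mono) auto
    also have "\<dots> = min r1 r2" using nn by (simp add: s_def)
    finally show ?thesis .
  qed
  obtain y1 where y1: "norm (y1 - x) \<le> s * (norm u + norm v)"
    "f (x + s *\<^sub>R u + s *\<^sub>R v) - f (x + s *\<^sub>R u) - f (x + s *\<^sub>R v) + f x = s\<^sup>2 * (u \<bullet> (H (y1, t) *v v))"
    using mixed[of s u v] s by auto
  obtain y2 where y2: "norm (y2 - x) \<le> s * (norm v + norm u)"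
    "f (x + s *\<^sub>R v + s *\<^sub>R u) - f (x + s *\<^sub>R v) - f (x + s *\<^sub>R u) + f x = s\<^sup>2 * (v \<bullet> (H (y2, t) *v u))"
    using mixed[of s v u] s by auto
  have "f (x + s *\<^sub>R v + s *\<^sub>R u) = f (x + s *\<^sub>R u + s *\<^sub>R v)" by (simp add: add_ac)
  then have "s\<^sup>2 * (u \<bullet> (H (y1, t) *v v)) = s\<^sup>2 * (v \<bullet> (H (y2, t) *v u))"
    using y1(2) y2(2) by linarith
  then have "u \<bullet> (H (y1, t) *v v) = v \<bullet> (H (y2, t) *v u)" using s by simp
  moreover have "dist (u \<bullet> (H (y1, t) *v v)) (u \<bullet> (H (x, t) *v v)) < e / 2"
    using y1(1) sn r1(1) by (intro r1(2)) auto
  moreover have "dist (v \<bullet> (H (y2, t) *v u)) (v \<bullet> (H (x, t) *v u)) < e / 2"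
    using y2(1) sn r2(1) by (intro r2(2)) (auto simp: add.commute)
  ultimately have "e \<le> dist (v \<bullet> (H (y2, t) *v u)) (u \<bullet> (H (x, t) *v v)) + dist (v \<bullet> (H (y2, t) *v u)) (v \<bullet> (H (x, t) *v u))"
    "dist (v \<bullet> (H (y2, t) *v u)) (u \<bullet> (H (x, t) *v v)) < e / 2" "dist (v \<bullet> (H (y2, t) *v u)) (v \<bullet> (H (x, t) *v u)) < e / 2"
    unfolding e_def dist_real_def by (linarith, simp_all)
  then show False by linarith
qed

text \<open>The gradient is kept at the moving base point, since replacing it by its value at the
  centre would cost a term of first order in \<open>k\<close>, which the error bound does not
  permit.\<close>

lemma test_function_taylor:
  fixes x0 :: "real^'m"
  assumes \<phi>: "test_function \<phi> \<phi>t G H" and t0: "t0 < 0" and e: "0 < e"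
  obtains r where "0 < r" "\<And>x t k \<tau>. norm (x - x0) < r \<Longrightarrow> norm (x + k - x0) < r \<Longrightarrow> \<bar>t - t0\<bar> < r \<Longrightarrow> \<bar>t + \<tau> - t0\<bar> < r \<Longrightarrow> 0 < \<tau> \<Longrightarrow>
    \<bar>\<phi> (x + k, t + \<tau>) - \<phi> (x, t) - \<tau> * \<phi>t (x0, t0) - G (x, t) \<bullet> k - (1/2) * (k \<bullet> (H (x0, t0) *v k))\<bar> \<le> e * (\<tau> + (norm k)\<^sup>2)"
proof -
  define m where "m = real CARD('m) ^ 2"
  have m: "0 < m" by (simp add: m_def)
  have z: "snd (x0, t0) < 0" using t0 by simp
  obtain r1 where r1: "0 < r1" "\<And>x t. norm (x - x0) < r1 \<Longrightarrow> \<bar>t - t0\<bar> < r1 \<Longrightarrow> dist (\<phi>t (x, t)) (\<phi>t (x0, t0)) < e"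
    using isCont_near[OF test_function_isCont(1)[OF \<phi> z] e] by blast
  have em: "0 < e / m" using e m by simp
  obtain r2 where r2: "0 < r2" "\<And>x t. norm (x - x0) < r2 \<Longrightarrow> \<bar>t - t0\<bar> < r2 \<Longrightarrow> dist (H (x, t)) (H (x0, t0)) < e / m"
    using isCont_near[OF test_function_isCont(3)[OF \<phi> z] em] by blast
  show thesis
  proof (rule that[of "Min {r1, r2, - t0}"])
    show "0 < Min {r1, r2, - t0}" using r1 r2 t0 by simp
    fix x k :: "real^'m" and t \<tau>
    assume a: "norm (x - x0) < Min {r1, r2, - t0}" "norm (x + k - x0) < Min {r1, r2, - t0}"
      "\<bar>t - t0\<bar> < Min {r1, r2, - t0}" "\<bar>t + \<tau> - t0\<bar> < Min {r1, r2, - t0}" and \<tau>: "0 < \<tau>"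
    have tneg: "t < 0" "t + \<tau> < 0" using a(3,4) by auto
    have d: "((\<lambda>s. \<phi> (x + k, s)) has_real_derivative \<phi>t (x + k, s)) (at s)" if "t \<le> s" "s \<le> t + \<tau>" for s
      using test_functionD(1)[OF \<phi>, of s] that tneg by auto
    obtain s where s: "t < s" "s < t + \<tau>" "\<phi> (x + k, t + \<tau>) - \<phi> (x + k, t) = (t + \<tau> - t) * \<phi>t (x + k, s)"
      using MVT2[of t "t + \<tau>" "\<lambda>s. \<phi> (x + k, s)" "\<lambda>s. \<phi>t (x + k, s)"] d \<tau> by auto
    have "\<bar>s - t0\<bar> < r1" using a(3,4) s by auto
    then have 1: "\<bar>\<phi>t (x + k, s) - \<phi>t (x0, t0)\<bar> < e" using r1(2)[of "x + k" s] a(2) by (simp add: dist_real_def)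
    obtain \<theta> where \<theta>: "\<theta> \<in> {0<..<1}" "\<phi> (x + k, t) = \<phi> (x, t) + G (x, t) \<bullet> k + (1/2) * (k \<bullet> (H (x + \<theta> *\<^sub>R k, t) *v k))"
      using taylor_second_order[of "\<lambda>y. \<phi> (y, t)" "\<lambda>y. G (y, t)" x k "\<lambda>y. H (y, t)"] test_functionD(2,3)[OF \<phi> tneg(1)] by blast
    have "x + \<theta> *\<^sub>R k - x0 = (1 - \<theta>) *\<^sub>R (x - x0) + \<theta> *\<^sub>R (x + k - x0)" by (simp add: algebra_simps)
    then have "norm (x + \<theta> *\<^sub>R k - x0) \<le> (1 - \<theta>) * norm (x - x0) + \<theta> * norm (x + k - x0)"
      using \<theta>(1) norm_triangle_ineq[of "(1 - \<theta>) *\<^sub>R (x - x0)" "\<theta> *\<^sub>R (x + k - x0)"] by simp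
    also have "\<dots> < r2"
      using convex_bound_lt[of "norm (x - x0)" r2 "norm (x + k - x0)" "1 - \<theta>" \<theta>] a(1,2) \<theta>(1) by simp
    finally have "dist (H (x + \<theta> *\<^sub>R k, t)) (H (x0, t0)) < e / m" using a(3) by (intro r2(2)) auto
    then have "\<bar>(H (x + \<theta> *\<^sub>R k, t) - H (x0, t0)) $ i $ j\<bar> \<le> e / m" for i j
    proof -
      let ?X = "H (x + \<theta> *\<^sub>R k, t) - H (x0, t0)"
      have "\<bar>?X $ i $ j\<bar> \<le> norm (?X $ i)" by (rule component_le_norm_cart)
      also have "\<dots> \<le> norm ?X" by (rule Finite_Cartesian_Product.norm_nth_le)
      finally show ?thesis using \<open>dist (H (x + \<theta> *\<^sub>R k, t)) (H (x0, t0)) < e / m\<close> by (simp add: dist_norm)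
    qed
    from quadratic_form_bound[OF this, of k]
    have 2: "\<bar>k \<bullet> ((H (x + \<theta> *\<^sub>R k, t) - H (x0, t0)) *v k)\<bar> \<le> e * (norm k)\<^sup>2" using m by (simp add: m_def)
    have "\<phi> (x + k, t + \<tau>) - \<phi> (x, t) - \<tau> * \<phi>t (x0, t0) - G (x, t) \<bullet> k - (1/2) * (k \<bullet> (H (x0, t0) *v k))
      = \<tau> * (\<phi>t (x + k, s) - \<phi>t (x0, t0)) + (1/2) * (k \<bullet> ((H (x + \<theta> *\<^sub>R k, t) - H (x0, t0)) *v k))"
      using s(3) \<theta>(2) by (simp add: matrix_vector_mult_diff_rdistrib inner_diff_right algebra_simps)
    also have "\<bar>\<dots>\<bar> \<le> \<tau> * e + (1/2) * (e * (norm k)\<^sup>2)"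
      using 1 2 \<tau> by (intro order_trans[OF abs_triangle_ineq] add_mono) (auto simp: abs_mult intro!: mult_left_mono)
    also have "\<dots> \<le> e * (\<tau> + (norm k)\<^sup>2)" using e by (simp add: distrib_left mult.commute)
    finally show "\<bar>\<phi> (x + k, t + \<tau>) - \<phi> (x, t) - \<tau> * \<phi>t (x0, t0) - G (x, t) \<bullet> k - (1/2) * (k \<bullet> (H (x0, t0) *v k))\<bar> \<le> e * (\<tau> + (norm k)\<^sup>2)" .
  qed
qed

text \<open>This perturbation makes a maximum at \<open>(x0, t0)\<close> strict without changing the derivatives there.\<close>

lemma test_function_strict:
  assumes \<phi>: "test_function \<phi> \<phi>t G H"
  shows "test_function (\<lambda>(x, t). \<phi> (x, t) + ((x - x0) \<bullet> (x - x0))\<^sup>2 + (t - t0)\<^sup>2)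
    (\<lambda>(x, t). \<phi>t (x, t) + 2 * (t - t0))
    (\<lambda>(x, t). G (x, t) + (4 * ((x - x0) \<bullet> (x - x0))) *\<^sub>R (x - x0))
    (\<lambda>(x, t). H (x, t) + (4 * ((x - x0) \<bullet> (x - x0))) *\<^sub>R mat 1 + 8 *\<^sub>R outer (x - x0))"
  unfolding test_function_def prod.case
proof (intro conjI allI impI)
  fix x and t :: real assume t: "t < 0"
  note d = test_functionD[OF \<phi> t, of x]
  show "((\<lambda>s. \<phi> (x, s) + ((x - x0) \<bullet> (x - x0))\<^sup>2 + (s - t0)\<^sup>2) has_real_derivative \<phi>t (x, t) + 2 * (t - t0)) (at t)"
    using d(1) by (auto intro!: derivative_eq_intros)
  have i: "((\<lambda>y. (y - x0) \<bullet> (y - x0)) has_derivative (\<lambda>h. 2 * ((x - x0) \<bullet> h))) (at x)"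
    by (auto intro!: derivative_eq_intros simp: inner_commute)
  have "((\<lambda>y. \<phi> (y, t) + ((y - x0) \<bullet> (y - x0))\<^sup>2 + (t - t0)\<^sup>2) has_derivative
     (\<lambda>h. G (x, t) \<bullet> h + 2 * (2 * ((x - x0) \<bullet> h)) * ((x - x0) \<bullet> (x - x0)) + 0)) (at x)"
    using has_derivative_power[OF i, of 2]
    by (intro has_derivative_add d(2) has_derivative_const) (simp add: algebra_simps)
  then show "((\<lambda>y. \<phi> (y, t) + ((y - x0) \<bullet> (y - x0))\<^sup>2 + (t - t0)\<^sup>2) has_derivative
     (\<lambda>h. (G (x, t) + (4 * ((x - x0) \<bullet> (x - x0))) *\<^sub>R (x - x0)) \<bullet> h)) (at x)"
    by (rule has_derivative_eq_rhs) (auto simp: inner_add_left algebra_simps)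
  have "((\<lambda>y. y - x0) has_derivative (\<lambda>h. h)) (at x)" by (auto intro!: derivative_eq_intros)
  then have "((\<lambda>y. G (y, t) + (4 * ((y - x0) \<bullet> (y - x0))) *\<^sub>R (y - x0)) has_derivative
     (\<lambda>h. H (x, t) *v h + ((4 * ((x - x0) \<bullet> (x - x0))) *\<^sub>R h + (4 * (2 * ((x - x0) \<bullet> h))) *\<^sub>R (x - x0)))) (at x)"
    by (intro has_derivative_add d(3) has_derivative_scaleR has_derivative_mult_right i)
  then show "((\<lambda>y. G (y, t) + (4 * ((y - x0) \<bullet> (y - x0))) *\<^sub>R (y - x0)) has_derivative
     (\<lambda>h. (H (x, t) + (4 * ((x - x0) \<bullet> (x - x0))) *\<^sub>R mat 1 + 8 *\<^sub>R outer (x - x0)) *v h)) (at x)"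
    by (rule has_derivative_eq_rhs)
      (auto simp: matrix_vector_mult_add_rdistrib scaleR_matrix_vector_assoc[symmetric] outer_mult fun_eq_iff)
next
  have c: "continuous_on (UNIV \<times> {..<0}) \<phi>t" "continuous_on (UNIV \<times> {..<0}) G" "continuous_on (UNIV \<times> {..<0}) H"
    using \<phi> by (auto simp: test_function_def)
  show "continuous_on (UNIV \<times> {..<0}) (\<lambda>(x, t). \<phi>t (x, t) + 2 * (t - t0))"
    "continuous_on (UNIV \<times> {..<0}) (\<lambda>(x, t). G (x, t) + (4 * ((x - x0) \<bullet> (x - x0))) *\<^sub>R (x - x0))"
    using c unfolding case_prod_unfold by (auto intro!: continuous_intros)
  have "continuous_on (UNIV \<times> {..<0}) (\<lambda>w::(real^'a) \<times> real. outer (fst w - x0))"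
    unfolding outer_def by (intro continuous_on_vec_lambda continuous_intros)
  then show "continuous_on (UNIV \<times> {..<0}) (\<lambda>(x, t). H (x, t) + (4 * ((x - x0) \<bullet> (x - x0))) *\<^sub>R mat 1 + 8 *\<^sub>R outer (x - x0))"
    using c unfolding case_prod_unfold by (auto intro!: continuous_intros)
qed

section \<open>Upper limits of equicontinuous families, and almost maximal points\<close>

section \<open>Upper relaxed limits\<close>

lemma limsup_exists:
  fixes X :: "nat \<Rightarrow> real"
  assumes "\<And>n. \<bar>X n\<bar> \<le> C"
  shows "\<exists>L. (\<forall>e>0. \<forall>\<^sub>F n in sequentially. X n \<le> L + e) \<and> (\<forall>e>0. \<exists>\<^sub>F n in sequentially. L - e \<le> X n)"
proof -
  define A where "A = {a. \<forall>\<^sub>F n in sequentially. X n \<le> a}"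
  have "C \<in> A" using assms by (auto simp: A_def abs_le_iff)
  then have ne: "A \<noteq> {}" by blast
  have bd: "bdd_below A"
  proof (rule bdd_belowI[of _ "- C"])
    fix a assume "a \<in> A"
    then obtain n where "X n \<le> a" unfolding A_def by (auto simp: eventually_sequentially)
    then show "- C \<le> a" using assms[of n] by linarith
  qed
  show ?thesis
  proof (intro exI[of _ "Inf A"] conjI allI impI)
    fix e :: real assume e: "0 < e"
    obtain a where "a \<in> A" "a < Inf A + e" using cInf_lessD[OF ne, of "Inf A + e"] e by auto
    then show "\<forall>\<^sub>F n in sequentially. X n \<le> Inf A + e" unfolding A_def by (auto elim: eventually_mono)
    show "\<exists>\<^sub>F n in sequentially. Inf A - e \<le> X n"
    proof (rule ccontr)
      assume "\<not> ?thesis"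
      then have "\<forall>\<^sub>F n in sequentially. X n \<le> Inf A - e" by (auto simp: not_frequently elim: eventually_mono)
      then have "Inf A - e \<in> A" by (simp add: A_def)
      then show False using cInf_lower[OF _ bd] e by fastforce
    qed
  qed
qed

text \<open>The pointwise upper limit suffices: for an equicontinuous family it agrees with the
  relaxed one, in which the point may vary as well.\<close>

definition is_limsup :: "(nat \<Rightarrow> (real^'m) \<times> real \<Rightarrow> real) \<Rightarrow> ((real^'m) \<times> real \<Rightarrow> real) \<Rightarrow> bool" where
  "is_limsup f u \<longleftrightarrow> (\<forall>x. \<forall>t\<le>0. (\<forall>e>0. \<forall>\<^sub>F n in sequentially. f n (x, t) \<le> u (x, t) + e) \<and>
     (\<forall>e>0. \<exists>\<^sub>F n in sequentially. u (x, t) - e \<le> f n (x, t)))"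

text \<open>The summand \<open>1 / real n\<close> allows for the jumps of a family that is piecewise
  constant in time, as the value of a game with an integer number of rounds is.\<close>

definition equicont :: "real \<Rightarrow> (nat \<Rightarrow> (real^'m) \<times> real \<Rightarrow> real) \<Rightarrow> bool" where
  "equicont C f \<longleftrightarrow> (\<forall>n>0. \<forall>x x' t t'. t \<le> 0 \<longrightarrow> t' \<le> 0 \<longrightarrow>
     \<bar>f n (x, t) - f n (x', t')\<bar> \<le> norm (x - x') + sqrt (C * (2 * \<bar>t - t'\<bar> + 1 / real n)))"

lemma limsup_modulus:
  assumes f: "equicont C f" and u: "is_limsup f u" and t: "t \<le> 0" "t' \<le> 0"
  shows "u (x, t) \<le> u (x', t') + norm (x - x') + sqrt (C * (2 * \<bar>t - t'\<bar>))"
proof -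
  have "(\<lambda>n. norm (x - x') + sqrt (C * (2 * \<bar>t - t'\<bar> + 1 / real n))) \<longlonglongrightarrow> norm (x - x') + sqrt (C * (2 * \<bar>t - t'\<bar> + 0))"
    by (intro tendsto_intros lim_1_over_n)
  then have lim: "(\<lambda>n. norm (x - x') + sqrt (C * (2 * \<bar>t - t'\<bar> + 1 / real n))) \<longlonglongrightarrow> norm (x - x') + sqrt (C * (2 * \<bar>t - t'\<bar>))" by simp
  show ?thesis
  proof (rule field_le_epsilon)
    fix e :: real assume e: "0 < e"
    have e3: "0 < e / 3" using e by simp
    have "\<exists>\<^sub>F n in sequentially. u (x, t) - e / 3 \<le> f n (x, t)" using u t e3 unfolding is_limsup_def by blast
    moreover have "\<forall>\<^sub>F n in sequentially. f n (x', t') \<le> u (x', t') + e / 3" using u t e3 unfolding is_limsup_def by blast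
    moreover have "\<forall>\<^sub>F n in sequentially. norm (x - x') + sqrt (C * (2 * \<bar>t - t'\<bar> + 1 / real n)) < norm (x - x') + sqrt (C * (2 * \<bar>t - t'\<bar>)) + e / 3"
      using lim e3 by (intro order_tendstoD) auto
    moreover have "\<forall>\<^sub>F n in sequentially. 0 < n" by (rule eventually_gt_at_top)
    ultimately have "\<exists>\<^sub>F n in sequentially. u (x, t) - e / 3 \<le> f n (x, t) \<and> f n (x', t') \<le> u (x', t') + e / 3 \<and>
      norm (x - x') + sqrt (C * (2 * \<bar>t - t'\<bar> + 1 / real n)) < norm (x - x') + sqrt (C * (2 * \<bar>t - t'\<bar>)) + e / 3 \<and> 0 < n"
      by (intro frequently_eventually_frequently eventually_conj)
    then obtain n where n: "u (x, t) - e / 3 \<le> f n (x, t)" "f n (x', t') \<le> u (x', t') + e / 3"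
      "norm (x - x') + sqrt (C * (2 * \<bar>t - t'\<bar> + 1 / real n)) < norm (x - x') + sqrt (C * (2 * \<bar>t - t'\<bar>)) + e / 3" "0 < n"
      using frequently_ex by fastforce
    have "\<bar>f n (x, t) - f n (x', t')\<bar> \<le> norm (x - x') + sqrt (C * (2 * \<bar>t - t'\<bar> + 1 / real n))"
      using f n(4) t unfolding equicont_def by blast
    then show "u (x, t) \<le> u (x', t') + norm (x - x') + sqrt (C * (2 * \<bar>t - t'\<bar>)) + e" using n by linarith
  qed
qed

lemma limsup_continuous:
  fixes u :: "(real^'m) \<times> real \<Rightarrow> real"
  assumes f: "equicont C f" and u: "is_limsup f u"
  shows "continuous_on (UNIV \<times> {..0}) u"
  unfolding continuous_on_def
proof (intro ballI)
  fix z :: "(real^'m) \<times> real" assume z: "z \<in> UNIV \<times> {..0}"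
  obtain x t where zt: "z = (x, t)" "t \<le> 0" using z by auto
  have "((\<lambda>w. u w - u z) \<longlongrightarrow> 0) (at z within UNIV \<times> {..0})"
  proof (rule Lim_null_comparison)
    show "\<forall>\<^sub>F w in at z within UNIV \<times> {..0}. norm (u w - u z) \<le> norm (fst w - x) + sqrt (C * (2 * \<bar>snd w - t\<bar>))"
      unfolding eventually_at
    proof (intro exI[of _ 1] conjI ballI impI)
      fix w :: "(real^'m) \<times> real" assume "w \<in> UNIV \<times> {..0}"
      then have "snd w \<le> 0" by auto
      then have "u (fst w, snd w) \<le> u (x, t) + norm (fst w - x) + sqrt (C * (2 * \<bar>snd w - t\<bar>))"
        "u (x, t) \<le> u (fst w, snd w) + norm (x - fst w) + sqrt (C * (2 * \<bar>t - snd w\<bar>))"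
        using limsup_modulus[OF f u] zt(2) by blast+
      then show "norm (u w - u z) \<le> norm (fst w - x) + sqrt (C * (2 * \<bar>snd w - t\<bar>))"
        by (simp add: zt(1) norm_minus_commute abs_minus_commute abs_le_iff)
    qed simp
    have "((\<lambda>w. norm (fst w - x) + sqrt (C * (2 * \<bar>snd w - t\<bar>))) \<longlongrightarrow> norm (fst z - x) + sqrt (C * (2 * \<bar>snd z - t\<bar>))) (at z within UNIV \<times> {..0})"
      by (intro tendsto_intros tendsto_fst tendsto_snd tendsto_ident_at)
    then show "((\<lambda>w. norm (fst w - x) + sqrt (C * (2 * \<bar>snd w - t\<bar>))) \<longlongrightarrow> 0) (at z within UNIV \<times> {..0})"
      by (simp add: zt(1))
  qed
  then show "(u \<longlongrightarrow> u z) (at z within UNIV \<times> {..0})" by (simp add: LIM_zero_iff)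
qed

lemma limsup_uniform:
  assumes f: "equicont C f" and u: "is_limsup f u" and K: "compact K" "K \<subseteq> UNIV \<times> {..0}" and e: "0 < e"
  shows "\<forall>\<^sub>F n in sequentially. \<forall>w\<in>K. f n w \<le> u w + e"
proof -
  define d where "d = (e/4)\<^sup>2 / (4 * (\<bar>C\<bar> + 1))"
  have d: "0 < d" using e by (simp add: d_def)
  define r where "r = min d (e / 8)"
  have r: "0 < r" using d e by (simp add: r_def)
  obtain F where F: "F \<subseteq> K" "finite F" "K \<subseteq> (\<Union>z\<in>F. ball z r)"
    using compactE_image[OF K(1), of K "\<lambda>z. ball z r"] r
    by (metis UN_I centre_in_ball open_ball subsetI)
  have Cd: "sqrt (C * (2 * a + b)) \<le> e / 4" if "0 \<le> a" "a \<le> d" "0 \<le> b" "b \<le> d" for a b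
  proof -
    have "C * (2 * a + b) \<le> \<bar>C\<bar> * (2 * a + b)" using that by (intro mult_right_mono) auto
    also have "\<dots> \<le> (\<bar>C\<bar> + 1) * (3 * d)" using that by (intro mult_mono) auto
    also have "\<dots> \<le> (e/4)\<^sup>2" unfolding d_def by (simp add: field_simps)
    finally have "sqrt (C * (2 * a + b)) \<le> sqrt ((e/4)\<^sup>2)" by (rule real_sqrt_le_mono)
    then show ?thesis using e by simp
  qed
  have "\<forall>\<^sub>F n in sequentially. \<forall>z\<in>F. f n z \<le> u z + e / 8"
  proof (rule eventually_ball_finite[OF F(2)], rule ballI)
    fix z assume "z \<in> F"
    then have "snd z \<le> 0" using F(1) K(2) by auto
    then have "\<forall>\<^sub>F n in sequentially. f n (fst z, snd z) \<le> u (fst z, snd z) + e / 8"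
      using u e unfolding is_limsup_def by (metis half_gt_zero divide_pos_pos zero_less_numeral)
    then show "\<forall>\<^sub>F n in sequentially. f n z \<le> u z + e / 8" by simp
  qed
  moreover have "\<forall>\<^sub>F n in sequentially. 1 / real n < d" using lim_1_over_n d by (rule order_tendstoD)
  moreover have "\<forall>\<^sub>F n in sequentially. 0 < n" by (rule eventually_gt_at_top)
  ultimately show ?thesis
  proof eventually_elim
    case (elim n)
    show ?case
    proof
      fix w assume w: "w \<in> K"
      then obtain z where z: "z \<in> F" "dist z w < r" using F(3) by auto
      obtain x t x' t' where eq: "w = (x, t)" "z = (x', t')" by (metis surj_pair)
      have tt: "t \<le> 0" "t' \<le> 0" using w z(1) F(1) K(2) by (auto simp: eq)
      have dx: "norm (x - x') < r" "\<bar>t - t'\<bar> < r"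
        using z(2) dist_fst_le[of z w] dist_snd_le[of z w] by (auto simp: eq dist_norm norm_minus_commute abs_minus_commute)
      have 1: "f n w \<le> f n z + norm (x - x') + sqrt (C * (2 * \<bar>t - t'\<bar> + 1 / real n))"
        using f elim(3) tt unfolding equicont_def eq by (smt (verit) abs_le_iff)
      have 2: "u z \<le> u w + norm (x' - x) + sqrt (C * (2 * \<bar>t' - t\<bar>))"
        unfolding eq by (rule limsup_modulus[OF f u tt(2,1)])
      have 3: "sqrt (C * (2 * \<bar>t - t'\<bar> + 1 / real n)) \<le> e / 4" using dx elim(2) by (intro Cd) (auto simp: r_def)
      have 4: "sqrt (C * (2 * \<bar>t' - t\<bar>)) \<le> e / 4" using Cd[of "\<bar>t' - t\<bar>" 0] dx d by (simp add: r_def abs_minus_commute)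
      have 5: "norm (x - x') \<le> e / 8" using dx by (simp add: r_def)
      show "f n w \<le> u w + e"
      proof -
        have "f n z \<le> u z + e / 8" using elim(1) z(1) by blast
        moreover have "norm (x' - x) = norm (x - x')" by (rule norm_minus_commute)
        ultimately show ?thesis using 1 2 3 4 5 e by linarith
      qed
    qed
  qed
qed

text \<open>The functions \<open>f n\<close> may jump in time, so \<open>f n - \<psi>\<close> need
  not attain a maximum. A point that is maximal up to \<open>1 / (real n)\<^sup>2\<close> is good
  enough, as this is of smaller order than a time step \<open>1 / (2 * real n)\<close>. Passing to a
  strict maximum is what makes these points converge.\<close>

lemma relaxed_maximum:
  fixes u :: "(real^'m) \<times> real \<Rightarrow> real"
  assumes f: "equicont C f" and u: "is_limsup f u" and \<phi>: "test_function \<phi> \<phi>t G H"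
    and t0: "t0 < 0" and max: "local_max_at (\<lambda>w. u w - \<phi> w) (x0, t0)"
  shows "\<exists>\<psi> \<psi>t G' H' r0. test_function \<psi> \<psi>t G' H' \<and> \<psi>t (x0, t0) = \<phi>t (x0, t0) \<and> G' (x0, t0) = G (x0, t0) \<and>
    H' (x0, t0) = H (x0, t0) \<and> 0 < r0 \<and>
    (\<forall>r>0. \<forall>N. \<exists>n>N. \<exists>x t. norm (x - x0) < r \<and> \<bar>t - t0\<bar> < r \<and>
      (\<forall>y s. norm (y - x0) < r0 \<longrightarrow> \<bar>s - t0\<bar> < r0 \<longrightarrow> f n (y, s) - \<psi> (y, s) \<le> f n (x, t) - \<psi> (x, t) + 1 / (real n)\<^sup>2))"
proof -
  define q where "q = (\<lambda>(x, t). ((x - x0) \<bullet> (x - x0))\<^sup>2 + (t - t0)\<^sup>2)"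
  define \<psi> where "\<psi> = (\<lambda>(x, t). \<phi> (x, t) + ((x - x0) \<bullet> (x - x0))\<^sup>2 + (t - t0)\<^sup>2)"
  have \<psi>q: "\<psi> w = \<phi> w + q w" for w by (simp add: \<psi>_def q_def case_prod_unfold)
  note tf = test_function_strict[OF \<phi>, of x0 t0, folded \<psi>_def]
  obtain d where d: "0 < d" "\<And>w. dist w (x0, t0) < d \<Longrightarrow> u w - \<phi> w \<le> u (x0, t0) - \<phi> (x0, t0)"
    using max unfolding local_max_at_def eventually_nhds_metric by blast
  define r1 where "r1 = min (d / 4) (- t0 / 2)"
  have r1: "0 < r1" using d t0 by (simp add: r1_def)
  let ?K = "cball x0 r1 \<times> cball t0 r1"
  have K: "compact ?K" by (intro compact_Times compact_cball)
  have K0: "?K \<subseteq> UNIV \<times> {..0}" using t0 by (auto simp: r1_def dist_real_def)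
  have Kd: "dist w (x0, t0) < d" if "w \<in> ?K" for w
  proof -
    obtain x t where w: "w = (x, t)" by fastforce
    have "dist w (x0, t0) \<le> norm (x - x0) + \<bar>t - t0\<bar>"
      unfolding w dist_norm using norm_Pair_le[of "x - x0" "t - t0"] by simp
    also have "\<dots> \<le> r1 + r1" using that by (intro add_mono) (auto simp: w dist_norm norm_minus_commute abs_minus_commute)
    also have "\<dots> < d" using d(1) by (simp add: r1_def)
    finally show ?thesis .
  qed
  have main: "\<exists>n>N. \<exists>x t. norm (x - x0) < r \<and> \<bar>t - t0\<bar> < r \<and>
      (\<forall>y s. norm (y - x0) < r1 \<longrightarrow> \<bar>s - t0\<bar> < r1 \<longrightarrow> f n (y, s) - \<psi> (y, s) \<le> f n (x, t) - \<psi> (x, t) + 1 / (real n)\<^sup>2)"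
    if r: "0 < r" for r N
  proof -
    define \<kappa> where "\<kappa> = min (r ^ 4) (r\<^sup>2)"
    have \<kappa>: "0 < \<kappa>" using r by (simp add: \<kappa>_def)
    have far: "\<kappa> \<le> q (x, t)" if "r \<le> norm (x - x0) \<or> r \<le> \<bar>t - t0\<bar>" for x t
    proof -
      have e: "((x - x0) \<bullet> (x - x0))\<^sup>2 = norm (x - x0) ^ 4" by (simp add: power2_norm_eq_inner[symmetric] flip: power_mult)
      show ?thesis using that
      proof
        assume "r \<le> norm (x - x0)"
        then have "r ^ 4 \<le> norm (x - x0) ^ 4" using r by (intro power_mono) auto
        moreover have "\<kappa> \<le> r ^ 4" by (simp add: \<kappa>_def)
        ultimately show ?thesis unfolding q_def prod.case e using zero_le_power2[of "t - t0"] by linarith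
      next
        assume "r \<le> \<bar>t - t0\<bar>"
        then have "r\<^sup>2 \<le> \<bar>t - t0\<bar>\<^sup>2" using r by (intro power_mono) auto
        moreover have "\<kappa> \<le> r\<^sup>2" by (simp add: \<kappa>_def)
        moreover have "0 \<le> norm (x - x0) ^ 4" by simp
        ultimately show ?thesis unfolding q_def prod.case e power2_abs by linarith
      qed
    qed
    have k4: "0 < \<kappa> / 4" using \<kappa> by simp
    have "\<exists>\<^sub>F n in sequentially. u (x0, t0) - \<kappa> / 4 \<le> f n (x0, t0)"
      using u t0 k4 unfolding is_limsup_def by (simp add: less_imp_le)
    moreover have "\<forall>\<^sub>F n in sequentially. \<forall>w\<in>?K. f n w \<le> u w + \<kappa> / 4"
      by (rule limsup_uniform[OF f u K K0 k4])
    moreover have "\<forall>\<^sub>F n in sequentially. N < n" by (rule eventually_gt_at_top)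
    moreover have "\<forall>\<^sub>F n in sequentially. 1 / (real n)\<^sup>2 < \<kappa> / 4"
    proof -
      have "(\<lambda>n. (1 / real n)\<^sup>2) \<longlonglongrightarrow> 0\<^sup>2" by (intro tendsto_power lim_1_over_n)
      then have "(\<lambda>n. 1 / (real n)\<^sup>2) \<longlonglongrightarrow> 0" by (simp add: power_divide)
      then show ?thesis using k4 by (rule order_tendstoD)
    qed
    ultimately have "\<exists>\<^sub>F n in sequentially. u (x0, t0) - \<kappa> / 4 \<le> f n (x0, t0) \<and> (\<forall>w\<in>?K. f n w \<le> u w + \<kappa> / 4) \<and> N < n \<and> 1 / (real n)\<^sup>2 < \<kappa> / 4"
      by (intro frequently_eventually_frequently eventually_conj)
    then obtain n where n: "u (x0, t0) - \<kappa> / 4 \<le> f n (x0, t0)" "\<And>w. w \<in> ?K \<Longrightarrow> f n w \<le> u w + \<kappa> / 4" "N < n" "1 / (real n)\<^sup>2 < \<kappa> / 4"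
      using frequently_ex by fastforce
    have bound: "f n w - \<psi> w \<le> u (x0, t0) - \<phi> (x0, t0) + \<kappa> / 4 - q w" if "w \<in> ?K" for w
      using n(2)[OF that] d(2)[OF Kd[OF that]] unfolding \<psi>q by linarith
    have q0: "0 \<le> q w" for w by (simp add: q_def case_prod_unfold)
    let ?S = "(\<lambda>w. f n w - \<psi> w) ` ?K"
    have z0K: "(x0, t0) \<in> ?K" using r1 by simp
    have bdd: "bdd_above ?S"
    proof (rule bdd_aboveI2)
      fix w assume "w \<in> ?K"
      then show "f n w - \<psi> w \<le> u (x0, t0) - \<phi> (x0, t0) + \<kappa> / 4" using bound[of w] q0[of w] by linarith
    qed
    have n0: "0 < 1 / (real n)\<^sup>2" using n(3) by simp
    obtain w where w: "w \<in> ?K" "Sup ?S - 1 / (real n)\<^sup>2 < f n w - \<psi> w"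
      using less_cSup_iff[of ?S "Sup ?S - 1 / (real n)\<^sup>2"] bdd z0K n0 by auto
    have sup: "f n y - \<psi> y \<le> f n w - \<psi> w + 1 / (real n)\<^sup>2" if "y \<in> ?K" for y
      using cSup_upper[OF imageI[OF that] bdd] w(2) by linarith
    have \<psi>0: "\<psi> (x0, t0) = \<phi> (x0, t0)" by (simp add: \<psi>_def)
    obtain x t where xt: "w = (x, t)" by fastforce
    have "\<not> (r \<le> norm (x - x0) \<or> r \<le> \<bar>t - t0\<bar>)"
    proof
      assume "r \<le> norm (x - x0) \<or> r \<le> \<bar>t - t0\<bar>"
      then have "\<kappa> \<le> q w" unfolding xt by (rule far)
      then show False using bound[OF w(1)] sup[OF z0K] n(1,4) \<psi>0 \<kappa> by linarith
    qed
    moreover have "(y, s) \<in> ?K" if "norm (y - x0) < r1" "\<bar>s - t0\<bar> < r1" for y s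
      using that by (auto simp: dist_norm norm_minus_commute abs_minus_commute)
    ultimately show ?thesis using n(3) sup unfolding xt by (intro exI[of _ n] conjI exI[of _ x] exI[of _ t]) auto
  qed
  show ?thesis
    by (rule exI[of _ \<psi>], (rule exI)+, intro conjI, rule tf) (use r1 main in \<open>auto simp: outer_def vec_eq_iff\<close>)
qed

section \<open>Elementary bounds on the game and its rescaling\<close>

section \<open>The value of the game\<close>

definition val :: "'n::finite itself \<Rightarrow> nat \<Rightarrow> real^'m \<Rightarrow> real" where
  "val _ k x = game_value (admissible_matrices :: (real^'n^'m) set) k x"

lemma zero_admissible: "(0 :: real^'n^'m) \<in> admissible_matrices"
  by (simp add: admissible_matrices_def column_def zero_vec_def[symmetric])

lemma val_0: "val N 0 x = infnorm x"
  by (simp add: val_def)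

lemma val_lipschitz:
  fixes N :: "'n::finite itself" and x y :: "real^'m"
  shows "\<bar>val N k x - val N k y\<bar> \<le> norm (x - y)"
proof -
  have ne: "(admissible_matrices :: (real^'n^'m) set) \<noteq> {}" using zero_admissible by blast
  have *: "val N k x \<le> val N k y + norm (x - y)" for x y :: "real^'m"
    unfolding val_def
    using game_value_le[OF compact_admissible_matrices ne, of k x y] infnorm_le_norm[of "x - y"] by linarith
  show ?thesis using *[of x y] *[of y x] by (simp add: norm_minus_commute abs_le_iff)
qed

lemma val_Suc_le:
  fixes N :: "'n::finite itself" and x :: "real^'m"
  shows "\<exists>A\<in>(admissible_matrices :: (real^'n^'m) set). \<forall>e\<in>sign_vectors. val N (Suc k) x \<le> val N k (x + A *v e)"
proof -
  obtain A :: "real^'n^'m" where "A \<in> admissible_matrices" "val N (Suc k) x = Min ((\<lambda>e. val N k (x + A *v e)) ` sign_vectors)"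
    using game_value_Suc_attained[of k x] unfolding val_def by blast
  then show ?thesis by (intro bexI[of _ A]) (auto intro!: Min_le finite_imageI finite_sign_vectors)
qed

lemma val_Suc_ge:
  fixes N :: "'n::finite itself" and x :: "real^'m"
  assumes "A \<in> (admissible_matrices :: (real^'n^'m) set)"
  shows "\<exists>e\<in>sign_vectors. val N k (x + A *v e) \<le> val N (Suc k) x"
proof -
  have "Min ((\<lambda>e. val N k (x + A *v e)) ` sign_vectors) \<le> val N (Suc k) x"
    using game_value_Suc_attained[of k x] assms unfolding val_def by blast
  moreover have "Min ((\<lambda>e. val N k (x + A *v e)) ` sign_vectors) \<in> (\<lambda>e. val N k (x + A *v e)) ` sign_vectors"
    by (intro Min_in) (auto simp: finite_sign_vectors sign_vectors_nonempty)
  ultimately show ?thesis by force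
qed

lemma val_mono: "k \<le> k' \<Longrightarrow> val N k x \<le> val N k' x"
proof (induction k' rule: dec_induct)
  case (step k')
  then show ?case using val_Suc_ge[OF zero_admissible, of N k' x] by (force simp: matrix_vector_mult_def zero_vec_def[symmetric])
qed simp

lemma val_minus:
  fixes N :: "'n::finite itself" and x :: "real^'m"
  shows "val N k (- x) = val N k x"
proof -
  have "val N k x \<le> val N k (- x)" for x :: "real^'m"
  proof (induction k arbitrary: x)
    case (Suc k)
    obtain A :: "real^'n^'m" where A: "A \<in> admissible_matrices" "\<And>e. e \<in> sign_vectors \<Longrightarrow> val N (Suc k) x \<le> val N k (x + A *v e)"
      using val_Suc_le by blast
    have "- A \<in> admissible_matrices"
    proof -
      have "column j (- A) = - column j A" for j by (simp add: column_def vec_eq_iff)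
      then show ?thesis using A(1) by (simp add: admissible_matrices_def)
    qed
    then obtain e where e: "e \<in> sign_vectors" "val N k (- x + (- A) *v e) \<le> val N (Suc k) (- x)"
      using val_Suc_ge by blast
    have "(- A) *v e = - (A *v e)" by (simp add: matrix_vector_mult_def vec_eq_iff sum_negf)
    then have "- x + (- A) *v e = - (x + A *v e)" by simp
    then show ?case using A(2)[OF e(1)] Suc[of "x + A *v e"] e(2) by simp
  qed (simp add: val_0 infnorm_neg)
  from this[of x] this[of "- x"] show ?thesis by simp
qed

text \<open>Each sign is chosen against the sum accumulated so far, so every vector adds at most its
  own squared length.\<close>

lemma sign_sum_bound:
  fixes a :: "'i \<Rightarrow> 'b::real_inner"
  assumes "finite S" "\<And>j. norm (a j) \<le> 1"
  shows "\<exists>e. (\<forall>j. e j \<in> {-1, 1::real}) \<and> (norm (u + (\<Sum>j\<in>S. e j *\<^sub>R a j)))\<^sup>2 \<le> (norm u)\<^sup>2 + real (card S)"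
  using assms(1)
proof (induction S)
  case empty
  show ?case by (intro exI[of _ "\<lambda>_. 1"]) simp
next
  case (insert j S)
  then obtain e where e: "\<And>j. e j \<in> {-1, 1::real}" "(norm (u + (\<Sum>j\<in>S. e j *\<^sub>R a j)))\<^sup>2 \<le> (norm u)\<^sup>2 + real (card S)" by blast
  define w where "w = u + (\<Sum>j\<in>S. e j *\<^sub>R a j)"
  define s :: real where "s = (if w \<bullet> a j \<le> 0 then 1 else -1)"
  have s: "s \<in> {-1, 1}" "s * (w \<bullet> a j) \<le> 0" "s\<^sup>2 = 1" by (auto simp: s_def)
  have "(\<Sum>i\<in>S. (e(j := s)) i *\<^sub>R a i) = (\<Sum>i\<in>S. e i *\<^sub>R a i)"
    using insert(2) by (intro sum.cong) auto
  then have "u + (\<Sum>i\<in>insert j S. (e(j := s)) i *\<^sub>R a i) = w + s *\<^sub>R a j"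
    using insert(1,2) by (simp add: w_def)
  moreover have "(norm (w + s *\<^sub>R a j))\<^sup>2 = (norm w)\<^sup>2 + 2 * (s * (w \<bullet> a j)) + s\<^sup>2 * (norm (a j))\<^sup>2"
    unfolding power2_norm_eq_inner by (simp add: inner_add_left inner_add_right inner_commute power2_eq_square)
  moreover have "(norm (a j))\<^sup>2 \<le> 1" using assms(2)[of j] by (simp add: abs_square_le_1)
  ultimately have "(norm (u + (\<Sum>i\<in>insert j S. (e(j := s)) i *\<^sub>R a i)))\<^sup>2 \<le> (norm u)\<^sup>2 + real (card (insert j S))"
    using e(2) s(2,3) insert(1,2) by (simp add: w_def[symmetric] del: fun_upd_apply)
  moreover have "\<forall>i. (e(j := s)) i \<in> {-1, 1}" using e(1) s(1) by simp
  ultimately show ?case by blast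
qed

lemma matrix_sign_sum: "A *v (\<chi> j. e j) = (\<Sum>j\<in>UNIV. e j *\<^sub>R column j A)"
  by (simp add: matrix_mult_sum scalar_mult_eq_scaleR)

text \<open>The signs can be played so as to stay near \<open>y\<close>: each round adds at most the
  number of columns to the squared distance.\<close>

lemma val_add_le:
  fixes N :: "'n::finite itself" and x y :: "real^'m"
  shows "val N (k + j) x \<le> val N k y + sqrt ((norm (x - y))\<^sup>2 + real CARD('n) * real j)"
proof (induction j arbitrary: x)
  case 0
  show ?case using val_lipschitz[of N k x y] by simp
next
  case (Suc j)
  obtain A :: "real^'n^'m" where A: "A \<in> admissible_matrices" "\<And>e. e \<in> sign_vectors \<Longrightarrow> val N (Suc (k + j)) x \<le> val N (k + j) (x + A *v e)"
    using val_Suc_le by blast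
  obtain e where e: "\<And>j. e j \<in> {-1, 1::real}" "(norm (x - y + (\<Sum>j\<in>UNIV. e j *\<^sub>R column j A)))\<^sup>2 \<le> (norm (x - y))\<^sup>2 + real CARD('n)"
    using sign_sum_bound[of UNIV "\<lambda>j. column j A" "x - y"] A(1) by (auto simp: admissible_matrices_def)
  have "val N (k + Suc j) x \<le> val N (k + j) (x + A *v (\<chi> j. e j))"
    using A(2)[of "\<chi> j. e j"] e(1) by (simp add: sign_vectors_def)
  also have "\<dots> \<le> val N k y + sqrt ((norm (x + A *v (\<chi> j. e j) - y))\<^sup>2 + real CARD('n) * real j)" by (rule Suc)
  also have "\<dots> \<le> val N k y + sqrt ((norm (x - y))\<^sup>2 + real CARD('n) * real (Suc j))"
  proof -
    have eq: "x + A *v (\<chi> j. e j) - y = x - y + (\<Sum>j\<in>UNIV. e j *\<^sub>R column j A)" by (simp add: matrix_sign_sum)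
    have "real CARD('n) * real (Suc j) = real CARD('n) + real CARD('n) * real j" by (simp add: distrib_left)
    then show ?thesis unfolding eq using e(2) by (intro add_left_mono real_sqrt_le_mono) linarith
  qed
  finally show ?case .
qed

text \<open>The matrix player can use a single nonzero column, a unit vector orthogonal to the
  current position, which raises the squared norm by exactly 1 whatever the sign; such a vector
  exists in dimension at least 2. The bound keeps the limit of the normalised values
  positive.\<close>

lemma val_lower_bound:
  fixes N :: "'n::finite itself" and x :: "real^'m"
  assumes "2 \<le> CARD('m)"
  shows "(norm x)\<^sup>2 + real k \<le> real CARD('m) * (val N k x)\<^sup>2 \<and> 0 \<le> val N k x"
proof (induction k arbitrary: x)
  case 0
  have "norm x \<le> sqrt (real CARD('m)) * infnorm x" using norm_le_infnorm[of x] by simp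
  then have "(norm x)\<^sup>2 \<le> (sqrt (real CARD('m)) * infnorm x)\<^sup>2" by (intro power_mono) auto
  then show ?case by (simp add: val_0 power_mult_distrib infnorm_pos_le)
next
  case (Suc k)
  obtain c :: "real^'m" where c: "c \<noteq> 0" "x \<bullet> c = 0"
  proof -
    have "dim {x} \<le> card {x}" by (rule dim_le_card) (auto simp: span_base)
    then have "dim {x} < DIM(real^'m)" using assms by simp
    then obtain c where "c \<noteq> 0" "\<And>y. y \<in> span {x} \<Longrightarrow> orthogonal c y"
      using orthogonal_to_subspace_exists by metis
    then have "c \<noteq> 0" "orthogonal c x" by (simp_all add: span_base)
    then show thesis using that[of c] by (simp add: orthogonal_def inner_commute)
  qed
  define u where "u = c /\<^sub>R norm c"
  have u: "norm u = 1" "x \<bullet> u = 0" using c by (auto simp: u_def)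
  define j0 :: 'n where "j0 = undefined"
  define A :: "real^'n^'m" where "A = (\<chi> i j. if j = j0 then u $ i else 0)"
  have col: "column j A = (if j = j0 then u else 0)" for j
    by (simp add: column_def A_def vec_eq_iff)
  have "A \<in> admissible_matrices" using u(1) by (simp add: admissible_matrices_def col)
  then obtain e where e: "e \<in> sign_vectors" "val N k (x + A *v e) \<le> val N (Suc k) x"
    using val_Suc_ge by blast
  have "A *v e = (e $ j0) *\<^sub>R u"
    using matrix_sign_sum[of A "\<lambda>j. e $ j"] by (simp add: col if_distrib[of "\<lambda>v. _ *\<^sub>R v"] cong: if_cong)
  moreover have "(e $ j0)\<^sup>2 = 1" using e(1) by (simp add: sign_vectors_def power2_eq_1_iff disj_commute)
  ultimately have "(norm (x + A *v e))\<^sup>2 = (norm x)\<^sup>2 + 1"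
    using u norm_add_Pythagorean[of x "A *v e"] by (simp add: orthogonal_def power_mult_distrib)
  moreover have "real CARD('m) * (val N k (x + A *v e))\<^sup>2 \<le> real CARD('m) * (val N (Suc k) x)\<^sup>2"
    using e(2) Suc[of "x + A *v e"] by (intro mult_left_mono power_mono) auto
  ultimately show ?case using Suc[of "x + A *v e"] e(2) unfolding of_nat_Suc by linarith
qed

text \<open>Parabolic scaling, with a round lasting \<open>1 / (2 * real T)\<close>. At time -1/2
  exactly \<open>T\<close> rounds remain.\<close>

definition scaled :: "'n::finite itself \<Rightarrow> nat \<Rightarrow> (real^'m) \<times> real \<Rightarrow> real" where
  "scaled N T = (\<lambda>(x, t). val N (nat \<lfloor>- 2 * t * real T\<rfloor>) (sqrt (real T) *\<^sub>R x) / sqrt (real T))"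

lemma scaled_minus: "scaled N T (- x, t) = scaled N T (x, t)"
  by (simp add: scaled_def val_minus)

lemma scaled_step:
  assumes "0 < T" "t \<le> - 1 / (2 * real T)"
  obtains k where "\<And>x. scaled N T (x, t) = val N (Suc k) (sqrt (real T) *\<^sub>R x) / sqrt (real T)"
    "\<And>x v. scaled N T (x + (1 / sqrt (real T)) *\<^sub>R v, t + 1 / (2 * real T)) = val N k (sqrt (real T) *\<^sub>R x + v) / sqrt (real T)"
proof -
  define z where "z = - 2 * (t + 1 / (2 * real T)) * real T"
  have z: "- 2 * t * real T = z + 1" using assms(1) by (simp add: z_def field_simps)
  have "t * (2 * real T) \<le> - 1" using mult_right_mono[OF assms(2), of "2 * real T"] assms(1) by simp
  then have "0 \<le> z" using z by simp
  then have "nat \<lfloor>z + 1\<rfloor> = Suc (nat \<lfloor>z\<rfloor>)" by (simp add: nat_add_distrib)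
  then show thesis using assms(1)
    by (intro that[of "nat \<lfloor>z\<rfloor>"]) (simp_all only: scaled_def prod.case z, simp_all add: z_def scaleR_add_right)
qed

lemma scaled_upper_step:
  fixes N :: "'n::finite itself" and x :: "real^'m"
  assumes "0 < T" "t \<le> - 1 / (2 * real T)"
  shows "\<exists>A\<in>(admissible_matrices :: (real^'n^'m) set). \<forall>e\<in>sign_vectors.
    scaled N T (x, t) \<le> scaled N T (x + (1 / sqrt (real T)) *\<^sub>R (A *v e), t + 1 / (2 * real T))"
proof -
  obtain k where k: "\<And>x :: real^'m. scaled N T (x, t) = val N (Suc k) (sqrt (real T) *\<^sub>R x) / sqrt (real T)"
    "\<And>x v :: real^'m. scaled N T (x + (1 / sqrt (real T)) *\<^sub>R v, t + 1 / (2 * real T)) = val N k (sqrt (real T) *\<^sub>R x + v) / sqrt (real T)"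
    using scaled_step[OF assms] by blast
  show ?thesis using val_Suc_le[of N k "sqrt (real T) *\<^sub>R x"] unfolding k by (auto intro!: divide_right_mono)
qed

lemma scaled_lower_step:
  fixes N :: "'n::finite itself" and x :: "real^'m"
  assumes "0 < T" "t \<le> - 1 / (2 * real T)" "A \<in> (admissible_matrices :: (real^'n^'m) set)"
  shows "\<exists>e\<in>sign_vectors. scaled N T (x + (1 / sqrt (real T)) *\<^sub>R (A *v e), t + 1 / (2 * real T)) \<le> scaled N T (x, t)"
proof -
  obtain k where k: "\<And>x :: real^'m. scaled N T (x, t) = val N (Suc k) (sqrt (real T) *\<^sub>R x) / sqrt (real T)"
    "\<And>x v :: real^'m. scaled N T (x + (1 / sqrt (real T)) *\<^sub>R v, t + 1 / (2 * real T)) = val N k (sqrt (real T) *\<^sub>R x + v) / sqrt (real T)"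
    using scaled_step[OF assms(1,2)] by blast
  show ?thesis using val_Suc_ge[OF assms(3), of N k "sqrt (real T) *\<^sub>R x"] unfolding k by (auto intro!: divide_right_mono)
qed

lemma scaled_equicont:
  fixes N :: "'n::finite itself"
  shows "equicont (real CARD('n)) (scaled N :: nat \<Rightarrow> (real^'m) \<times> real \<Rightarrow> real)"
  unfolding equicont_def
proof (intro allI impI)
  fix T :: nat and x x' :: "real^'m" and t t' :: real assume T: "0 < T" and t: "t \<le> 0" "t' \<le> 0"
  have main: "\<bar>scaled N T (x, t) - scaled N T (x', t')\<bar> \<le> norm (x - x') + sqrt (real CARD('n) * (2 * \<bar>t - t'\<bar> + 1 / real T))"
    if t: "t \<le> t'" "t' \<le> 0" for x x' :: "real^'m" and t t'
  proof -
    define k k' where "k = nat \<lfloor>- 2 * t * real T\<rfloor>" and "k' = nat \<lfloor>- 2 * t' * real T\<rfloor>"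
    define r where "r = sqrt (real T)"
    have r: "0 < r" "r\<^sup>2 = real T" using T by (auto simp: r_def)
    have le: "k' \<le> k" unfolding k_def k'_def using t by (intro nat_mono floor_mono mult_right_mono) auto
    have pos: "0 \<le> - 2 * t * real T" "0 \<le> - 2 * t' * real T" using t by (auto simp: mult_nonpos_nonneg)
    have kk: "real (k - k') \<le> real T * (2 * \<bar>t - t'\<bar> + 1 / real T)"
    proof -
      have "real k \<le> - 2 * t * real T" "- 2 * t' * real T \<le> real k' + 1"
        unfolding k_def k'_def using pos by linarith+
      then have "real (k - k') \<le> - 2 * t * real T + 2 * t' * real T + 1" using le by (simp add: of_nat_diff)
      also have "\<dots> = real T * (2 * \<bar>t - t'\<bar> + 1 / real T)" using T t by (simp add: field_simps)
      finally show ?thesis .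
    qed
    have nr: "norm (r *\<^sub>R x - r *\<^sub>R x') = r * norm (x - x')" using r by (simp flip: scaleR_diff_right)
    have "val N k (r *\<^sub>R x) \<le> val N k' (r *\<^sub>R x') + sqrt ((r * norm (x - x'))\<^sup>2 + real CARD('n) * real (k - k'))"
      using val_add_le[of N k' "k - k'" "r *\<^sub>R x" "r *\<^sub>R x'"] le nr by simp
    also have "\<dots> \<le> val N k' (r *\<^sub>R x') + (r * norm (x - x') + sqrt (real CARD('n) * real (k - k')))"
      using sqrt_add_le_add_sqrt[of "(r * norm (x - x'))\<^sup>2" "real CARD('n) * real (k - k')"] r by simp
    also have "\<dots> \<le> val N k' (r *\<^sub>R x') + (r * norm (x - x') + sqrt (real CARD('n) * (real T * (2 * \<bar>t - t'\<bar> + 1 / real T))))"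
      using kk by (intro add_left_mono real_sqrt_le_mono mult_left_mono) auto
    also have "sqrt (real CARD('n) * (real T * (2 * \<bar>t - t'\<bar> + 1 / real T))) = r * sqrt (real CARD('n) * (2 * \<bar>t - t'\<bar> + 1 / real T))"
      by (simp only: r_def real_sqrt_mult mult_ac)
    finally have "val N k (r *\<^sub>R x) - val N k' (r *\<^sub>R x') \<le> r * (norm (x - x') + sqrt (real CARD('n) * (2 * \<bar>t - t'\<bar> + 1 / real T)))"
      by (simp add: distrib_left)
    moreover have "val N k' (r *\<^sub>R x') - val N k (r *\<^sub>R x) \<le> r * (norm (x - x') + sqrt (real CARD('n) * (2 * \<bar>t - t'\<bar> + 1 / real T)))"
    proof -
      have "val N k' (r *\<^sub>R x') - val N k (r *\<^sub>R x) \<le> r * norm (x - x')"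
        using val_mono[OF le, of N "r *\<^sub>R x'"] val_lipschitz[of N k "r *\<^sub>R x" "r *\<^sub>R x'"] nr by (simp add: abs_le_iff)
      also have "\<dots> \<le> r * (norm (x - x') + sqrt (real CARD('n) * (2 * \<bar>t - t'\<bar> + 1 / real T)))"
        using r by (intro mult_left_mono) auto
      finally show ?thesis .
    qed
    ultimately have "\<bar>val N k (r *\<^sub>R x) - val N k' (r *\<^sub>R x')\<bar> / r \<le> norm (x - x') + sqrt (real CARD('n) * (2 * \<bar>t - t'\<bar> + 1 / real T))"
      using r by (simp add: divide_le_eq mult.commute abs_le_iff)
    moreover have "scaled N T (x, t) - scaled N T (x', t') = (val N k (r *\<^sub>R x) - val N k' (r *\<^sub>R x')) / r"
      by (simp only: scaled_def prod.case k_def k'_def r_def diff_divide_distrib)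
    ultimately show ?thesis using r by (simp add: abs_divide)
  qed
  show "\<bar>scaled N T (x, t) - scaled N T (x', t')\<bar> \<le> norm (x - x') + sqrt (real CARD('n) * (2 * \<bar>t - t'\<bar> + 1 / real T))"
  proof (cases "t \<le> t'")
    case True then show ?thesis using main t by blast
  next
    case False
    then show ?thesis using main[of t' t x' x] t by (simp add: abs_minus_commute norm_minus_commute)
  qed
qed

lemma scaled_initial: "0 < T \<Longrightarrow> scaled N T (x, 0) = infnorm x"
  by (simp add: scaled_def val_0 infnorm_mul)

section \<open>Consistency of the game with the level set operator\<close>

section \<open>Consistency\<close>

lemma quadratic_form_diagonal:
  fixes N :: "real^'m^'m"
  assumes "finite C" "\<forall>b\<in>C. \<forall>c\<in>C. b \<noteq> c \<longrightarrow> b \<bullet> (N *v c) = 0"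
  shows "(\<Sum>c\<in>C. y c *\<^sub>R c) \<bullet> (N *v (\<Sum>c\<in>C. y c *\<^sub>R c)) = (\<Sum>c\<in>C. (y c)\<^sup>2 * (c \<bullet> (N *v c)))"
proof -
  have "(\<Sum>c\<in>C. y c *\<^sub>R c) \<bullet> (N *v (\<Sum>c\<in>C. y c *\<^sub>R c)) = (\<Sum>b\<in>C. \<Sum>c\<in>C. y b * (y c * (c \<bullet> (N *v b))))"
    by (simp add: linear_sum[OF matrix_vector_mul_linear] inner_sum_left inner_sum_right matrix_vector_mult_scaleR sum_distrib_left)
  also have "\<dots> = (\<Sum>b\<in>C. \<Sum>c\<in>C. if c = b then (y b)\<^sup>2 * (b \<bullet> (N *v b)) else 0)"
    using assms(2) by (intro sum.cong refl) (auto simp: power2_eq_square)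
  also have "\<dots> = (\<Sum>c\<in>C. (y c)\<^sup>2 * (c \<bullet> (N *v c)))" using assms(1) by simp
  finally show ?thesis .
qed

lemma norm_matrix_sign:
  fixes A :: "real^'n^'m"
  assumes "A \<in> admissible_matrices" "e \<in> sign_vectors"
  shows "norm (A *v e) \<le> real CARD('n)"
proof -
  have "norm (A *v e) = norm (\<Sum>j\<in>UNIV. (e $ j) *\<^sub>R column j A)" using matrix_sign_sum[of A "($) e"] by simp
  also have "\<dots> \<le> (\<Sum>j\<in>(UNIV :: 'n set). 1)"
  proof (rule order_trans[OF norm_sum sum_mono])
    fix j
    have "\<bar>e $ j\<bar> = 1" using assms(2) by (auto simp: sign_vectors_def dest: spec[of _ j])
    then show "norm ((e $ j) *\<^sub>R column j A) \<le> 1" using assms(1) by (simp add: admissible_matrices_def)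
  qed
  finally show ?thesis by simp
qed

text \<open>\<open>B\<close> consists of the eigenvectors with positive eigenvalue, and
  \<open>f\<close> is the positive part of \<open>N\<close>. The balancing bound applies to
  \<open>f\<close>, and \<open>N\<close> lies below it as a quadratic form.\<close>

lemma signs_against_matrix:
  fixes N :: "real^'m^'m"
  assumes sym: "\<And>u v. u \<bullet> (N *v v) = v \<bullet> (N *v u)"
  shows "\<exists>B\<in>all_planes. \<forall>A\<in>(admissible_matrices :: (real^'n^'m) set). \<exists>e\<in>sign_vectors.
    p \<bullet> (A *v e) \<le> 0 \<and> (A *v e) \<bullet> (N *v (A *v e)) \<le> trc B N"
proof -
  obtain C where C: "oset C" "span C = UNIV" "\<forall>b\<in>C. \<forall>c\<in>C. b \<noteq> c \<longrightarrow> b \<bullet> (N *v c) = 0"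
    using orthonormal_eigenbasis[of UNIV "(*v) N"] sym by (auto simp: inner_commute)
  define B where "B = {c \<in> C. 0 < c \<bullet> (N *v c)}"
  have B: "oset B" using C(1) by (rule oset_subset) (auto simp: B_def)
  define f where "f x = (\<Sum>c\<in>B. ((c \<bullet> (N *v c)) * (c \<bullet> x)) *\<^sub>R c)" for x
  have f: "x \<bullet> f y = (\<Sum>c\<in>B. (c \<bullet> (N *v c)) * (c \<bullet> x) * (c \<bullet> y))" for x y
    unfolding f_def by (simp add: inner_sum_right inner_commute mult_ac)
  interpret psd_form f "trc B N"
  proof (rule psd_form.intro)
    show "linear f" unfolding f_def
      by (rule linearI) (simp_all add: inner_add_right algebra_simps sum.distrib scaleR_sum_right)
    show "x \<bullet> f y = f x \<bullet> y" for x y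
      using f[of x y] f[of y x] by (simp add: inner_commute[of "f x"] mult_ac)
    show "0 \<le> x \<bullet> f x" for x
      unfolding f by (intro sum_nonneg) (simp add: B_def mult.assoc)
    fix D :: "(real^'m) set" assume D: "oset D"
    have "(\<Sum>d\<in>D. d \<bullet> f d) = (\<Sum>c\<in>B. (c \<bullet> (N *v c)) * (\<Sum>d\<in>D. (d \<bullet> c)\<^sup>2))"
      unfolding f sum_distrib_left by (subst sum.swap) (simp add: power2_eq_square inner_commute mult.assoc)
    also have "\<dots> \<le> (\<Sum>c\<in>B. (c \<bullet> (N *v c)) * 1)"
    proof (intro sum_mono mult_left_mono)
      fix c assume c: "c \<in> B"
      then have "norm c = 1" using B by (simp add: oset_def)
      then have "(norm (prj D c))\<^sup>2 \<le> 1" using norm_prj_le[OF D, of c] by (simp add: abs_square_le_1)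
      then show "(\<Sum>d\<in>D. (d \<bullet> c)\<^sup>2) \<le> 1" by (simp add: prj_norm_sq[OF D])
      show "0 \<le> c \<bullet> (N *v c)" using c by (simp add: B_def)
    qed
    finally show "(\<Sum>d\<in>D. d \<bullet> f d) \<le> trc B N" by (simp add: trc_def)
  qed
  have le: "x \<bullet> (N *v x) \<le> qf x" for x
  proof -
    have "x \<bullet> (N *v x) = (\<Sum>c\<in>C. (c \<bullet> x)\<^sup>2 * (c \<bullet> (N *v c)))"
      using quadratic_form_diagonal[OF oset_finite[OF C(1)] C(3), of "\<lambda>c. c \<bullet> x"] prj_basis[OF C(1,2), of x] by (simp add: prj_def)
    also have "\<dots> \<le> (\<Sum>c\<in>B. (c \<bullet> x)\<^sup>2 * (c \<bullet> (N *v c)))"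
    proof -
      have "(\<Sum>c\<in>C - B. (c \<bullet> x)\<^sup>2 * (c \<bullet> (N *v c))) \<le> 0"
        by (intro sum_nonpos) (auto simp: B_def mult_nonneg_nonpos)
      then show ?thesis using sum.subset_diff[of B C "\<lambda>c. (c \<bullet> x)\<^sup>2 * (c \<bullet> (N *v c))"] oset_finite[OF C(1)]
        by (simp add: B_def)
    qed
    also have "\<dots> = qf x" unfolding qf_def f by (simp add: power2_eq_square mult_ac)
    finally show ?thesis .
  qed
  have "\<exists>e\<in>sign_vectors. p \<bullet> (A *v e) \<le> 0 \<and> (A *v e) \<bullet> (N *v (A *v e)) \<le> trc B N"
    if A: "A \<in> admissible_matrices" for A :: "real^'n^'m"
  proof -
    obtain s where s: "\<And>j. s j \<in> {-1, 1}" "qf (\<Sum>j\<in>UNIV. s j *\<^sub>R column j A) \<le> trc B N"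
      using balancing[of UNIV "\<lambda>j. column j A"] A by (auto simp: admissible_matrices_def)
    define e where "e = (\<chi> j. s j)"
    have e: "e \<in> sign_vectors" "- e \<in> sign_vectors" using s(1) by (force simp: e_def sign_vectors_def)+
    have q: "(A *v e) \<bullet> (N *v (A *v e)) \<le> trc B N"
      using le[of "A *v e"] s(2) by (simp add: matrix_sign_sum e_def)
    have m: "A *v (- e) = - (A *v e)" "N *v (- (A *v e)) = - (N *v (A *v e))"
      by (simp_all add: matrix_vector_mult_def vec_eq_iff sum_negf)
    \<comment> \<open>Changing all signs preserves the quadratic form, so the linear term can be
      given the required sign.\<close>
    show ?thesis
    proof (cases "p \<bullet> (A *v e) \<le> 0")
      case True then show ?thesis using e(1) q by blast
    next
      case False then show ?thesis using e(2) q by (intro bexI[of _ "- e"]) (simp_all add: m)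
    qed
  qed
  then show ?thesis using B by (auto simp: all_planes_def)
qed

text \<open>The basis vectors of the hyperplane are put into distinct columns, which needs one
  column less than the dimension, and the other columns are 0. As the basis diagonalises the form on
  the hyperplane, the signs enter only through their squares.\<close>

lemma matrix_against_signs:
  fixes N :: "real^'m^'m"
  assumes sym: "\<And>u v. u \<bullet> (N *v v) = v \<bullet> (N *v u)" and n: "CARD('m) - 1 \<le> CARD('n::finite)"
  shows "\<exists>B\<in>hyperplanes. \<exists>A\<in>(admissible_matrices :: (real^'n^'m) set). \<forall>e\<in>sign_vectors.
    p \<bullet> (A *v e) = 0 \<and> (A *v e) \<bullet> (N *v (A *v e)) = trc B N"
proof -
  \<comment> \<open>For \<open>p = 0\<close> any nonzero normal vector will do.\<close>
  obtain \<nu> :: "real^'m" where \<nu>: "\<nu> \<noteq> 0" "\<And>x. \<nu> \<bullet> x = 0 \<Longrightarrow> p \<bullet> x = 0"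
  proof (cases "p = 0")
    case True
    then show thesis using that[of "axis undefined 1"] by simp
  qed (use that[of p] in simp)
  define S where "S = {x. \<nu> \<bullet> x = 0}"
  have "subspace S" unfolding S_def by (rule subspace_hyperplane)
  then obtain C where C: "oset C" "span C = S" "\<forall>b\<in>C. \<forall>c\<in>C. b \<noteq> c \<longrightarrow> b \<bullet> (N *v c) = 0"
    using orthonormal_eigenbasis[of S "(*v) N"] sym by (auto simp: inner_commute)
  have fin: "finite C" by (rule oset_finite[OF C(1)])
  have "card C = dim (span C)" using oset_independent[OF C(1)] by (simp add: dim_eq_card_independent)
  also have "\<dots> = CARD('m) - 1" unfolding C(2) S_def using dim_hyperplane[OF \<nu>(1)] by simp
  finally have card: "card C = CARD('m) - 1" .
  then have hyp: "C \<in> hyperplanes" using C(1) by (simp add: hyperplanes_def)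
  obtain g :: "real^'m \<Rightarrow> 'n" where g: "inj_on g C" using card_le_inj[OF fin, of "UNIV :: 'n set"] card n by auto
  define col where "col j = (if j \<in> g ` C then inv_into C g j else 0)" for j
  define A :: "real^'n^'m" where "A = (\<chi> i j. col j $ i)"
  have colA: "column j A = col j" for j by (simp add: column_def A_def vec_eq_iff)
  have "norm (col j) \<le> 1" for j
    using inv_into_into[of j g C] C(1) by (auto simp: col_def oset_def)
  then have adm: "A \<in> admissible_matrices" by (simp add: admissible_matrices_def colA)
  have "p \<bullet> (A *v e) = 0 \<and> (A *v e) \<bullet> (N *v (A *v e)) = trc C N" if e: "e \<in> sign_vectors" for e
  proof -
    have "A *v e = (\<Sum>j\<in>UNIV. (e $ j) *\<^sub>R col j)" using matrix_sign_sum[of A "($) e"] by (simp add: colA)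
    also have "\<dots> = (\<Sum>j\<in>g ` C. (e $ j) *\<^sub>R col j)"
      by (rule sum.mono_neutral_right) (auto simp: col_def)
    also have "\<dots> = (\<Sum>c\<in>C. (e $ g c) *\<^sub>R c)"
      unfolding sum.reindex[OF g] o_def by (intro sum.cong) (auto simp: col_def g)
    finally have Ae: "A *v e = (\<Sum>c\<in>C. (e $ g c) *\<^sub>R c)" .
    then have "A *v e \<in> S" unfolding C(2)[symmetric] by (simp add: span_sum span_scale span_base)
    then have "p \<bullet> (A *v e) = 0" using \<nu>(2) by (simp add: S_def)
    moreover have "(A *v e) \<bullet> (N *v (A *v e)) = (\<Sum>c\<in>C. (e $ g c)\<^sup>2 * (c \<bullet> (N *v c)))"
      unfolding Ae by (rule quadratic_form_diagonal[OF fin C(3)])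
    moreover have "(e $ j)\<^sup>2 = 1" for j using e by (simp add: sign_vectors_def power2_eq_1_iff disj_commute)
    ultimately show ?thesis by (simp add: trc_def)
  qed
  then show ?thesis using hyp adm by blast
qed

text \<open>Both sides of the game are treated at once: \<open>f\<close> is the scaled value or its
  negative, and \<open>k\<close> is the change of position in one round. If the conclusion failed,
  it would fail for the plane that \<open>step\<close> provides for the penalised Hessian, and the
  value would drop over that round by more than near-maximality allows.\<close>

lemma limsup_plane_subsolution:
  fixes f :: "nat \<Rightarrow> (real^'m) \<times> real \<Rightarrow> real"
  assumes f: "equicont C f" and u: "is_limsup f u" and \<B>: "\<B> \<subseteq> all_planes"
    and step: "\<And>T x t N p. 0 < T \<Longrightarrow> t \<le> - 1 / (2 * real T) \<Longrightarrow> (\<And>u v. u \<bullet> (N *v v) = v \<bullet> (N *v u)) \<Longrightarrow>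
      \<exists>B\<in>\<B>. \<exists>k. f T (x, t) \<le> f T (x + (1 / sqrt (real T)) *\<^sub>R k, t + 1 / (2 * real T)) \<and>
        norm k \<le> n \<and> p \<bullet> k \<le> 0 \<and> k \<bullet> (N *v k) \<le> trc B N"
  shows "plane_subsolution \<B> u"
  unfolding plane_subsolution_def
proof (intro allI impI)
  fix \<phi> \<phi>t :: "(real^'m) \<times> real \<Rightarrow> real" and G H z and \<Lambda> \<epsilon> :: real
  assume \<phi>: "test_function \<phi> \<phi>t G H" and z: "snd z < 0" and max: "local_max_at (\<lambda>w. u w - \<phi> w) z" and \<Lambda>: "0 < \<Lambda>" and \<epsilon>: "0 < \<epsilon>"
  obtain x0 t0 where zz: "z = (x0, t0)" by fastforce
  have t0: "t0 < 0" using z by (simp add: zz)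
  show "\<exists>B\<in>\<B>. - \<epsilon> \<le> \<phi>t z + trc B (H z) - \<Lambda> * (norm (prj B (G z)))\<^sup>2"
  proof (rule ccontr)
    assume "\<not> ?thesis"
    then have neg: "\<phi>t z + trc B (H z) - \<Lambda> * (norm (prj B (G z)))\<^sup>2 < - \<epsilon>" if "B \<in> \<B>" for B using that by force
    define M where "M = H z"
    define p0 where "p0 = G z"
    obtain \<psi> \<psi>t G' H' r0 where \<psi>: "test_function \<psi> \<psi>t G' H'" "\<psi>t z = \<phi>t z" "G' z = p0" "H' z = M" "0 < r0"
      and near: "\<And>r N. 0 < r \<Longrightarrow> \<exists>n>N. \<exists>x t. norm (x - x0) < r \<and> \<bar>t - t0\<bar> < r \<and>
      (\<forall>y s. norm (y - x0) < r0 \<longrightarrow> \<bar>s - t0\<bar> < r0 \<longrightarrow> f n (y, s) - \<psi> (y, s) \<le> f n (x, t) - \<psi> (x, t) + 1 / (real n)\<^sup>2)"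
      using relaxed_maximum[OF f u \<phi> t0 max[unfolded zz]] unfolding M_def p0_def zz by metis
    have symM: "u \<bullet> (M *v v) = v \<bullet> (M *v u)" for u v
      unfolding M_def zz by (rule hessian_symmetric[OF \<phi> t0])
    define n' where "n' = \<bar>n\<bar>"
    define c where "c = 1/2 + n'\<^sup>2"
    have c: "0 < c" by (simp add: c_def add_pos_nonneg)
    \<comment> \<open>Chosen such that the Taylor error over one round is at most
      \<open>(\<epsilon> / 8) / real T\<close>.\<close>
    define e where "e = \<epsilon> / (8 * c)"
    have e: "0 < e" "e * (1/2 + n'\<^sup>2) = \<epsilon> / 8" using \<epsilon> c unfolding c_def[symmetric] by (auto simp: e_def)
    obtain r1 where r1: "0 < r1" "\<And>x t k \<tau>. norm (x - x0) < r1 \<Longrightarrow> norm (x + k - x0) < r1 \<Longrightarrow> \<bar>t - t0\<bar> < r1 \<Longrightarrow> \<bar>t + \<tau> - t0\<bar> < r1 \<Longrightarrow> 0 < \<tau> \<Longrightarrow>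
      \<bar>\<psi> (x + k, t + \<tau>) - \<psi> (x, t) - \<tau> * \<psi>t (x0, t0) - G' (x, t) \<bullet> k - (1/2) * (k \<bullet> (H' (x0, t0) *v k))\<bar> \<le> e * (\<tau> + (norm k)\<^sup>2)"
      using test_function_taylor[OF \<psi>(1) t0 e(1)] by blast
    \<comment> \<open>So small that replacing the gradient at \<open>z\<close> by the one at the
      almost maximal point changes the penalty by at most \<epsilon> / 2.\<close>
    define s where "s = min 1 (\<epsilon> / (2 * \<Lambda> * (2 * norm p0 + 1)))"
    have pp: "0 < 2 * norm p0 + 1" by (simp add: add_nonneg_pos)
    have s: "0 < s" using \<epsilon> \<Lambda> pp by (simp add: s_def)
    obtain r2 where r2: "0 < r2" "\<And>x t. norm (x - x0) < r2 \<Longrightarrow> \<bar>t - t0\<bar> < r2 \<Longrightarrow> dist (G' (x, t)) (G' (x0, t0)) < s"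
      using isCont_near[OF test_function_isCont(2)[OF \<psi>(1), of "(x0, t0)"] s] t0 by auto
    define r where "r = min (min r0 r1) (min r2 (- t0 / 2)) / 2"
    have r: "0 < r" using \<psi>(5) r1(1) r2(1) t0 by (simp add: r_def)
    have "\<forall>\<^sub>F T in sequentially. 1 / real T < \<epsilon> / 8 \<and> 1 / (2 * real T) < r \<and> n' / sqrt (real T) < r \<and> \<Lambda> * (norm p0 + 1) * n' / sqrt (real T) < 2"
      using \<epsilon> r by (intro eventually_conj) real_asymp+
    then obtain N0 where N0: "\<And>T. N0 \<le> T \<Longrightarrow> 1 / real T < \<epsilon> / 8 \<and> 1 / (2 * real T) < r \<and> n' / sqrt (real T) < r \<and> \<Lambda> * (norm p0 + 1) * n' / sqrt (real T) < 2"
      unfolding eventually_sequentially by blast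
    obtain T x t where T: "N0 < T" "norm (x - x0) < r" "\<bar>t - t0\<bar> < r"
      "\<And>y s. norm (y - x0) < r0 \<Longrightarrow> \<bar>s - t0\<bar> < r0 \<Longrightarrow> f T (y, s) - \<psi> (y, s) \<le> f T (x, t) - \<psi> (x, t) + 1 / (real T)\<^sup>2"
      using near[OF r, of N0] by blast
    have T0: "0 < real T" using T(1) by simp
    have big: "1 / real T < \<epsilon> / 8" "1 / (2 * real T) < r" "n' / sqrt (real T) < r" "\<Lambda> * (norm p0 + 1) * n' / sqrt (real T) < 2"
      using N0[of T] T(1) by auto
    have rr: "2 * r \<le> r0" "2 * r \<le> r1" "2 * r \<le> r2" "2 * r \<le> - t0 / 2" by (auto simp: r_def)
    define p where "p = G' (x, t)"
    define N where "N = M - \<Lambda> *\<^sub>R outer p"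
    have symN: "u \<bullet> (N *v v) = v \<bullet> (N *v u)" for u v
      by (simp add: N_def matrix_vector_mult_diff_rdistrib scaleR_matrix_vector_assoc[symmetric] outer_mult inner_diff_right symM[of u v] inner_commute)
    have tT: "t \<le> - 1 / (2 * real T)" using T(3) big(2) rr(4) r by simp
    obtain B k where k: "B \<in> \<B>" "f T (x, t) \<le> f T (x + (1 / sqrt (real T)) *\<^sub>R k, t + 1 / (2 * real T))"
      "norm k \<le> n" "p \<bullet> k \<le> 0" "k \<bullet> (N *v k) \<le> trc B N"
      using step[of T t N x p] T0 tT symN by auto
    have B: "oset B" using k(1) \<B> by (auto simp: all_planes_def)
    have ps: "norm (p - p0) < s"
      using r2(2)[of x t] T(2,3) rr(3) r \<psi>(3) by (simp add: p_def zz dist_norm)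
    have trN: "\<phi>t z + trc B N < - \<epsilon> / 2"
    proof -
      have "trc B N = trc B M - \<Lambda> * (norm (prj B p))\<^sup>2"
        by (simp add: N_def trc_diff trc_scaleR trc_outer[OF B])
      moreover have "(norm (prj B p0))\<^sup>2 - (norm (prj B p))\<^sup>2 \<le> s * (2 * norm p0 + 1)"
      proof -
        have "(norm (prj B p0))\<^sup>2 - (norm (prj B p))\<^sup>2 = (norm (prj B p0) - norm (prj B p)) * (norm (prj B p0) + norm (prj B p))"
          by (simp add: power2_eq_square algebra_simps)
        also have "\<dots> \<le> s * (2 * norm p0 + 1)"
        proof (rule mult_mono)
          have "norm (prj B p0) - norm (prj B p) \<le> norm (prj B (p0 - p))" by (simp add: prj_diff norm_triangle_ineq2)
          also have "\<dots> \<le> norm (p0 - p)" by (rule norm_prj_le[OF B])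
          finally show "norm (prj B p0) - norm (prj B p) \<le> s" using ps by (simp add: norm_minus_commute)
          have "norm p \<le> norm p0 + 1" using ps norm_triangle_sub[of p p0] by (simp add: s_def)
          then show "norm (prj B p0) + norm (prj B p) \<le> 2 * norm p0 + 1"
            using norm_prj_le[OF B, of p0] norm_prj_le[OF B, of p] by linarith
        qed (use s in auto)
        finally show ?thesis .
      qed
      then have "\<Lambda> * ((norm (prj B p0))\<^sup>2 - (norm (prj B p))\<^sup>2) \<le> \<Lambda> * (s * (2 * norm p0 + 1))"
        using \<Lambda> by (intro mult_left_mono) auto
      moreover have "\<Lambda> * (s * (2 * norm p0 + 1)) \<le> \<epsilon> / 2"
      proof -
        have "s * (2 * \<Lambda> * (2 * norm p0 + 1)) \<le> \<epsilon>"
          using pp \<Lambda> by (subst pos_le_divide_eq[symmetric]) (auto simp: s_def)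
        then show ?thesis by (simp add: mult_ac)
      qed
      ultimately show ?thesis using neg[OF k(1)] by (simp add: M_def p0_def right_diff_distrib)
    qed
    define \<tau> where "\<tau> = 1 / (2 * real T)"
    define h where "h = (1 / sqrt (real T)) *\<^sub>R k"
    have kn: "norm k \<le> n'" using k(3) by (simp add: n'_def)
    have hn: "norm h \<le> n' / sqrt (real T)" using kn by (simp add: h_def divide_right_mono)
    have h2: "(norm h)\<^sup>2 \<le> n'\<^sup>2 / real T"
      using power_mono[OF hn, of 2] by (simp add: power_divide)
    have xh: "norm (x + h - x0) < 2 * r"
      using norm_triangle_ineq[of "x - x0" h] T(2) hn big(3) by (simp add: algebra_simps)
    have "0 < \<tau>" "\<tau> < r" using big(2) T0 by (auto simp: \<tau>_def)
    then have tt: "\<bar>t + \<tau> - t0\<bar> < 2 * r" "0 < \<tau>" using T(3) by linarith+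
    have "f T (x + h, t + \<tau>) - \<psi> (x + h, t + \<tau>) \<le> f T (x, t) - \<psi> (x, t) + 1 / (real T)\<^sup>2"
      using xh tt rr(1) by (intro T(4)) auto
    then have a: "- 1 / (real T)\<^sup>2 \<le> \<psi> (x + h, t + \<tau>) - \<psi> (x, t)"
      using k(2) by (simp add: h_def \<tau>_def)
    have "\<bar>\<psi> (x + h, t + \<tau>) - \<psi> (x, t) - \<tau> * \<psi>t (x0, t0) - G' (x, t) \<bullet> h - (1/2) * (h \<bullet> (H' (x0, t0) *v h))\<bar> \<le> e * (\<tau> + (norm h)\<^sup>2)"
      using xh tt rr(2) T(2,3) r by (intro r1(2)) auto
    then have b: "\<psi> (x + h, t + \<tau>) - \<psi> (x, t) \<le> \<tau> * \<phi>t z + p \<bullet> h + (1/2) * (h \<bullet> (M *v h)) + e * (\<tau> + (norm h)\<^sup>2)"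
      using \<psi>(2,4) by (simp add: p_def zz abs_le_iff)
    have hM: "h \<bullet> (M *v h) \<le> trc B N / real T + \<Lambda> * (p \<bullet> h)\<^sup>2"
    proof -
      have "h \<bullet> (M *v h) = h \<bullet> (N *v h) + \<Lambda> * (p \<bullet> h)\<^sup>2"
        by (simp add: N_def matrix_vector_mult_diff_rdistrib scaleR_matrix_vector_assoc[symmetric] outer_mult inner_diff_right power2_eq_square inner_commute)
      moreover have "h \<bullet> (N *v h) = (k \<bullet> (N *v k)) / real T"
        using T0 by (simp add: h_def matrix_vector_mult_scaleR)
      ultimately show ?thesis using k(5) T0 by (simp add: divide_right_mono)
    qed
    \<comment> \<open>The penalty subtracted from the Hessian reappears in the Taylor expansion. It
      is quadratic in \<open>p \<bullet> h\<close>, and since \<open>p \<bullet> h\<close> is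
      nonpositive and small, the linear term absorbs it.\<close>
    have ph: "p \<bullet> h + (1/2) * (\<Lambda> * (p \<bullet> h)\<^sup>2) \<le> 0"
    proof -
      have ph0: "p \<bullet> h \<le> 0" using k(4) T0 by (simp add: h_def divide_nonpos_nonneg)
      have "\<Lambda> * \<bar>p \<bullet> h\<bar> \<le> \<Lambda> * ((norm p0 + 1) * (n' / sqrt (real T)))"
      proof (rule mult_left_mono)
        have "norm p \<le> norm p0 + 1" using ps norm_triangle_sub[of p p0] by (simp add: s_def)
        then have "norm p * norm h \<le> (norm p0 + 1) * (n' / sqrt (real T))" using hn by (intro mult_mono) auto
        then show "\<bar>p \<bullet> h\<bar> \<le> (norm p0 + 1) * (n' / sqrt (real T))"
          using Cauchy_Schwarz_ineq2[of p h] by linarith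
      qed (use \<Lambda> in simp)
      then have "\<Lambda> * \<bar>p \<bullet> h\<bar> \<le> 2" using big(4) by (simp add: mult.assoc)
      then have "0 \<le> 1 + (1/2) * (\<Lambda> * (p \<bullet> h))" using ph0 by simp
      then have "(p \<bullet> h) * (1 + (1/2) * (\<Lambda> * (p \<bullet> h))) \<le> 0" using ph0 by (simp add: mult_nonpos_nonneg)
      then show ?thesis by (simp add: distrib_left power2_eq_square mult_ac)
    qed
    have "- 1 / (real T)\<^sup>2 \<le> \<tau> * (\<phi>t z + trc B N) + e * (\<tau> + n'\<^sup>2 / real T)"
    proof -
      have "e * (\<tau> + (norm h)\<^sup>2) \<le> e * (\<tau> + n'\<^sup>2 / real T)" using h2 e(1) by (intro mult_left_mono) auto
      moreover have "\<tau> * (\<phi>t z + trc B N) = \<tau> * \<phi>t z + (1/2) * (trc B N / real T)" by (simp add: \<tau>_def distrib_left)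
      ultimately show ?thesis using a b hM ph by linarith
    qed
    also have "e * (\<tau> + n'\<^sup>2 / real T) = (e * (1/2 + n'\<^sup>2)) / real T" by (simp add: \<tau>_def distrib_left add_divide_distrib)
    also have "\<dots> = (\<epsilon> / 8) / real T" by (simp add: e(2))
    also have "\<tau> * (\<phi>t z + trc B N) \<le> \<tau> * (- \<epsilon> / 2)" using trN tt(2) by (intro mult_left_mono) auto
    \<comment> \<open>A loss of order 1/T confronts a defect of maximality of order 1/T^2, which is
      impossible for large \<open>T\<close>.\<close>
    finally have "- 1 / (real T)\<^sup>2 \<le> - (\<epsilon> / 8) / real T" by (simp add: \<tau>_def)
    then have "(\<epsilon> / 8) / real T \<le> (1 / real T) / real T" by (simp add: power2_eq_square)
    then have "\<epsilon> / 8 \<le> 1 / real T" using T0 by (simp only: divide_le_cancel)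
    then show False using big(1) by simp
  qed
qed

lemma is_limsup_exists:
  assumes "\<And>n x t. t \<le> 0 \<Longrightarrow> \<bar>f n (x, t)\<bar> \<le> C x t"
  shows "\<exists>u. is_limsup f u"
proof -
  have "\<forall>z. \<exists>L. snd z \<le> 0 \<longrightarrow> (\<forall>e>0. \<forall>\<^sub>F n in sequentially. f n z \<le> L + e) \<and> (\<forall>e>0. \<exists>\<^sub>F n in sequentially. L - e \<le> f n z)"
  proof
    fix z
    show "\<exists>L. snd z \<le> 0 \<longrightarrow> (\<forall>e>0. \<forall>\<^sub>F n in sequentially. f n z \<le> L + e) \<and> (\<forall>e>0. \<exists>\<^sub>F n in sequentially. L - e \<le> f n z)"
      using limsup_exists[of "\<lambda>n. f n z" "C (fst z) (snd z)"] assms[of "snd z" _ "fst z"] by (cases "snd z \<le> 0") auto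
  qed
  then show ?thesis unfolding is_limsup_def by (metis snd_conv)
qed

lemma is_limsup_tendsto:
  assumes "\<And>x t. t \<le> 0 \<Longrightarrow> (\<lambda>n. f n (x, t)) \<longlonglongrightarrow> u (x, t)"
  shows "is_limsup f u"
  unfolding is_limsup_def
proof (intro allI impI conjI)
  fix x and t e :: real assume t: "t \<le> 0" and e: "0 < e"
  show "\<forall>\<^sub>F n in sequentially. f n (x, t) \<le> u (x, t) + e"
    using order_tendstoD(2)[OF assms[OF t], of x "u (x, t) + e"] e by (auto elim: eventually_mono)
  have "\<forall>\<^sub>F n in sequentially. u (x, t) - e \<le> f n (x, t)"
    using order_tendstoD(1)[OF assms[OF t], of "u (x, t) - e" x] e by (auto elim: eventually_mono)
  then show "\<exists>\<^sub>F n in sequentially. u (x, t) - e \<le> f n (x, t)" by (rule eventually_frequently[rotated]) simp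
qed

lemma scaled_limsup_subsolution:
  fixes N :: "'n::finite itself"
  assumes "is_limsup (scaled N :: nat \<Rightarrow> (real^'m) \<times> real \<Rightarrow> real) u"
  shows "plane_subsolution all_planes u"
proof (rule limsup_plane_subsolution[OF scaled_equicont assms order_refl])
  fix T t and x p :: "real^'m" and M :: "real^'m^'m"
  assume T: "0 < T" "t \<le> - 1 / (2 * real T)" and sym: "\<And>u v. u \<bullet> (M *v v) = v \<bullet> (M *v u)"
  obtain A :: "real^'n^'m" where A: "A \<in> admissible_matrices"
    "\<And>e. e \<in> sign_vectors \<Longrightarrow> scaled N T (x, t) \<le> scaled N T (x + (1 / sqrt (real T)) *\<^sub>R (A *v e), t + 1 / (2 * real T))"
    using scaled_upper_step[OF T] by blast
  obtain B where B: "B \<in> all_planes" "\<And>A. A \<in> (admissible_matrices :: (real^'n^'m) set) \<Longrightarrow>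
    \<exists>e\<in>sign_vectors. p \<bullet> (A *v e) \<le> 0 \<and> (A *v e) \<bullet> (M *v (A *v e)) \<le> trc B M"
    using signs_against_matrix[OF sym] by blast
  show "\<exists>B\<in>all_planes. \<exists>k. scaled N T (x, t) \<le> scaled N T (x + (1 / sqrt (real T)) *\<^sub>R k, t + 1 / (2 * real T)) \<and>
        norm k \<le> real CARD('n) \<and> p \<bullet> k \<le> 0 \<and> k \<bullet> (M *v k) \<le> trc B M"
    using A B(1) B(2)[OF A(1)] norm_matrix_sign by blast
qed

lemma scaled_liminf_supersolution:
  fixes N :: "'n::finite itself"
  assumes n: "CARD('m) - 1 \<le> CARD('n)"
    and "is_limsup (\<lambda>T z. - scaled N T z) (u :: (real^'m) \<times> real \<Rightarrow> real)"
  shows "plane_subsolution hyperplanes u"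
proof (rule limsup_plane_subsolution[OF _ assms(2) hyperplanes_subset])
  show "equicont (real CARD('n)) (\<lambda>T (z :: (real^'m) \<times> real). - scaled N T z)"
    using scaled_equicont[where 'm='m, of N] by (simp add: equicont_def abs_minus_commute)
  fix T t and x p :: "real^'m" and M :: "real^'m^'m"
  assume T: "0 < T" "t \<le> - 1 / (2 * real T)" and sym: "\<And>u v. u \<bullet> (M *v v) = v \<bullet> (M *v u)"
  obtain B and A :: "real^'n^'m" where B: "B \<in> hyperplanes" "A \<in> admissible_matrices"
    "\<And>e. e \<in> sign_vectors \<Longrightarrow> p \<bullet> (A *v e) = 0 \<and> (A *v e) \<bullet> (M *v (A *v e)) = trc B M"
    using matrix_against_signs[OF sym n] by blast
  obtain e where e: "e \<in> sign_vectors" "scaled N T (x + (1 / sqrt (real T)) *\<^sub>R (A *v e), t + 1 / (2 * real T)) \<le> scaled N T (x, t)"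
    using scaled_lower_step[OF T B(2)] by blast
  show "\<exists>B\<in>hyperplanes. \<exists>k. - scaled N T (x, t) \<le> - scaled N T (x + (1 / sqrt (real T)) *\<^sub>R k, t + 1 / (2 * real T)) \<and>
        norm k \<le> real CARD('n) \<and> p \<bullet> k \<le> 0 \<and> k \<bullet> (M *v k) \<le> trc B M"
    using B(1) B(3)[OF e(1)] e(2) norm_matrix_sign[OF B(2) e(1)] by (intro bexI[OF _ B(1)] exI[of _ "A *v e"]) simp
qed

lemma equicontD:
  assumes "equicont C f" "0 < n" "t \<le> 0" "t' \<le> 0"
  shows "\<bar>f n (x, t) - f n (x', t')\<bar> \<le> norm (x - x') + sqrt (C * (2 * \<bar>t - t'\<bar> + 1 / real n))"
  using assms by (simp add: equicont_def)

lemma scaled_bound: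
  fixes N :: "'n::finite itself" and x :: "real^'m"
  assumes "t \<le> 0"
  shows "\<bar>scaled N T (x, t)\<bar> \<le> norm x + sqrt (real CARD('n) * (2 * \<bar>t\<bar> + 1))"
proof (cases "0 < T")
  case True
  have "\<bar>scaled N T (x, t) - scaled N T (0 :: real^'m, 0)\<bar> \<le> norm (x - 0) + sqrt (real CARD('n) * (2 * \<bar>t - 0\<bar> + 1 / real T))"
    by (rule equicontD[OF scaled_equicont True assms order_refl])
  moreover have "sqrt (real CARD('n) * (2 * \<bar>t - 0\<bar> + 1 / real T)) \<le> sqrt (real CARD('n) * (2 * \<bar>t\<bar> + 1))"
    using True by (intro real_sqrt_le_mono mult_left_mono) auto
  moreover have "scaled N T (0 :: real^'m, 0) = 0" by (simp add: scaled_initial[OF True] infnorm_0)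
  ultimately show ?thesis by (simp only: diff_zero)
\<comment> \<open>For \<open>T = 0\<close> the quotient is 0, since division by 0 yields 0.\<close>
qed (simp add: scaled_def)

text \<open>\<open>v\<close> is the upper limit and \<open>- w\<close> the lower one. Comparison at
  two equal points gives \<open>v \<le> - w\<close>, so they agree, and a single function inherits
  the property for all planes from above and that for hyperplanes from below.\<close>

theorem scaled_converges:
  fixes N :: "'n::finite itself"
  assumes n: "CARD('m) - 1 \<le> CARD('n)"
  obtains u :: "(real^'m) \<times> real \<Rightarrow> real" where
    "\<And>x t. t \<le> 0 \<Longrightarrow> (\<lambda>T. scaled N T (x, t)) \<longlonglongrightarrow> u (x, t)"
    "plane_subsolution all_planes u" "plane_subsolution hyperplanes (\<lambda>z. - u z)" "continuous_on (UNIV \<times> {..0}) u"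
    "\<And>x. u (x, 0) = infnorm x" "\<And>x t. 0 < t \<Longrightarrow> u (x, t) = 0"
proof -
  note eq = scaled_equicont[where 'm='m, of N]
  have eq': "equicont (real CARD('n)) (\<lambda>T (z :: (real^'m) \<times> real). - scaled N T z)"
    using eq by (simp add: equicont_def abs_minus_commute)
  obtain v where v: "is_limsup (scaled N) (v :: (real^'m) \<times> real \<Rightarrow> real)"
    using is_limsup_exists[of "scaled N", OF scaled_bound] by blast
  obtain w where w: "is_limsup (\<lambda>T z. - scaled N T z) (w :: (real^'m) \<times> real \<Rightarrow> real)"
    using is_limsup_exists[of "\<lambda>T z. - scaled N T z"] scaled_bound[where 'm='m, of _ N] by fastforce
  have initial: "(\<lambda>T. scaled N T (x, 0)) \<longlonglongrightarrow> infnorm x" for x :: "real^'m"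
    by (rule tendsto_eventually, rule eventually_mono[OF eventually_gt_at_top[of 0]]) (rule scaled_initial)
  have v0: "v (x, 0) \<le> infnorm x" for x
  proof (rule field_le_epsilon)
    fix e :: real assume e: "0 < e"
    have "\<exists>\<^sub>F T in sequentially. v (x, 0) - e / 2 \<le> scaled N T (x, 0)" using v e by (simp add: is_limsup_def)
    moreover have "\<forall>\<^sub>F T in sequentially. scaled N T (x, 0) < infnorm x + e / 2"
      using order_tendstoD(2)[OF initial] e by simp
    ultimately show "v (x, 0) \<le> infnorm x + e" using frequently_ex[OF frequently_eventually_frequently] by fastforce
  qed
  have w0: "infnorm x \<le> - w (x, 0)" for x
  proof (rule field_le_epsilon)
    fix e :: real assume e: "0 < e"
    have "\<exists>\<^sub>F T in sequentially. w (x, 0) - e / 2 \<le> - scaled N T (x, 0)" using w e by (simp add: is_limsup_def)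
    moreover have "\<forall>\<^sub>F T in sequentially. infnorm x - e / 2 < scaled N T (x, 0)"
      using order_tendstoD(1)[OF initial] e by simp
    ultimately show "infnorm x \<le> - w (x, 0) + e" using frequently_ex[OF frequently_eventually_frequently] by fastforce
  qed
  have "v (x, t) \<le> - w (x, t)" if t: "t \<le> 0" for x t
  proof -
    have "(\<lambda>z. - (- w z)) = w" by simp
    then have "v ((1/2) *\<^sub>R (x + x), t) \<le> (- w (x, t) + - w (x, t)) / 2"
      using limsup_continuous[OF eq' w]
      by (intro comparison[OF scaled_limsup_subsolution[OF v] limsup_continuous[OF eq v] v0 _ _ w0 t])
        (simp_all add: scaled_liminf_supersolution[OF n w] continuous_on_minus)
    then show ?thesis by (simp flip: scaleR_2)
  qed
  then have lim: "(\<lambda>T. scaled N T (x, t)) \<longlonglongrightarrow> v (x, t)" if t: "t \<le> 0" for x t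
  proof (intro order_tendstoI)
    fix a assume a: "a < v (x, t)"
    have "\<forall>\<^sub>F T in sequentially. - scaled N T (x, t) \<le> w (x, t) + (v (x, t) - a) / 2"
      using w t a by (simp add: is_limsup_def)
    then show "\<forall>\<^sub>F T in sequentially. a < scaled N T (x, t)"
    proof eventually_elim
      case (elim T)
      then show ?case using that a \<open>\<And>x t. t \<le> 0 \<Longrightarrow> v (x, t) \<le> - w (x, t)\<close>[OF t, of x] by (simp add: field_simps)
    qed
  next
    fix a assume a: "v (x, t) < a"
    have "\<forall>\<^sub>F T in sequentially. scaled N T (x, t) \<le> v (x, t) + (a - v (x, t)) / 2"
      using v t a by (simp add: is_limsup_def)
    then show "\<forall>\<^sub>F T in sequentially. scaled N T (x, t) < a"
      by eventually_elim (use a in \<open>simp add: field_simps\<close>)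
  qed
  \<comment> \<open>The value 0 at positive times matches the normalisation in
    \<open>mcf_level_function\<close>.\<close>
  define u where "u = (\<lambda>(x, t). if t \<le> 0 then v (x, t) else 0)"
  have lu: "(\<lambda>T. scaled N T (x, t)) \<longlonglongrightarrow> u (x, t)" if "t \<le> 0" for x t
    using lim[OF that] that by (simp add: u_def)
  have su: "is_limsup (scaled N) u" "is_limsup (\<lambda>T z. - scaled N T z) (\<lambda>z. - u z)"
    using lu by (auto intro!: is_limsup_tendsto tendsto_minus)
  show thesis
  proof (rule that[OF lu])
    show "plane_subsolution all_planes u" by (rule scaled_limsup_subsolution[OF su(1)])
    show "plane_subsolution hyperplanes (\<lambda>z. - u z)" by (rule scaled_liminf_supersolution[OF n su(2)])
    show "continuous_on (UNIV \<times> {..0}) u" by (rule limsup_continuous[OF eq su(1)])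
    show "u (x, 0) = infnorm x" for x using LIMSEQ_unique[OF lu[of 0 x] initial] by simp
    show "u (x, t) = 0" if "0 < t" for x t using that by (simp add: u_def)
  qed
qed

section \<open>The level set operator and its envelopes in terms of traces\<close>

section \<open>The level set operator\<close>

lemma trc_basis:
  fixes M :: "real^'m^'m"
  assumes C: "oset C" "span C = UNIV"
  shows "trc C M = trace M"
proof -
  have e: "(\<Sum>c\<in>C. c $ i * c $ j) = (if i = j then 1 else 0)" for i j
  proof -
    have "(\<Sum>c\<in>C. c $ i * c $ j) = prj C (axis j 1) $ i" by (simp add: prj_def inner_axis mult.commute)
    then show ?thesis by (simp add: prj_basis[OF C] axis_def)
  qed
  have "trc C M = (\<Sum>c\<in>C. \<Sum>i\<in>UNIV. \<Sum>j\<in>UNIV. M $ i $ j * (c $ i * c $ j))"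
    by (simp add: trc_def inner_vec_def matrix_vector_mult_def sum_distrib_left mult_ac)
  also have "\<dots> = (\<Sum>i\<in>UNIV. \<Sum>j\<in>UNIV. M $ i $ j * (\<Sum>c\<in>C. c $ i * c $ j))"
    unfolding sum_distrib_left by (subst sum.swap, rule sum.cong[OF refl], rule sum.swap)
  also have "\<dots> = trace M" by (simp add: e trace_def if_distrib[of "(*) _"] cong: if_cong)
  finally show ?thesis .
qed

lemma trc_le_trace:
  fixes M :: "real^'m^'m"
  assumes D: "oset D" and sym: "\<And>u v. u \<bullet> (M *v v) = v \<bullet> (M *v u)" and psd: "\<And>v. 0 \<le> v \<bullet> (M *v v)"
  shows "trc D M \<le> trace M"
proof -
  obtain C where C: "oset C" "span C = UNIV" "\<forall>b\<in>C. \<forall>c\<in>C. b \<noteq> c \<longrightarrow> b \<bullet> (M *v c) = 0"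
    using orthonormal_eigenbasis[of UNIV "(*v) M"] sym by (auto simp: inner_commute)
  have "d \<bullet> (M *v d) = (\<Sum>c\<in>C. (c \<bullet> d)\<^sup>2 * (c \<bullet> (M *v c)))" for d
    using quadratic_form_diagonal[OF oset_finite[OF C(1)] C(3), of "\<lambda>c. c \<bullet> d"] prj_basis[OF C(1,2), of d] by (simp add: prj_def)
  then have "trc D M = (\<Sum>d\<in>D. \<Sum>c\<in>C. (c \<bullet> d)\<^sup>2 * (c \<bullet> (M *v c)))" unfolding trc_def by (rule sum.cong[OF refl])
  also have "\<dots> = (\<Sum>c\<in>C. (\<Sum>d\<in>D. (d \<bullet> c)\<^sup>2) * (c \<bullet> (M *v c)))"
    by (subst sum.swap) (simp add: sum_distrib_right inner_commute)
  also have "\<dots> \<le> (\<Sum>c\<in>C. 1 * (c \<bullet> (M *v c)))"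
  proof (intro sum_mono mult_right_mono psd)
    fix c assume c: "c \<in> C"
    then have "norm c = 1" using C(1) by (simp add: oset_def)
    then have "(norm (prj D c))\<^sup>2 \<le> 1" using norm_prj_le[OF D, of c] by (simp add: abs_square_le_1)
    then show "(\<Sum>d\<in>D. (d \<bullet> c)\<^sup>2) \<le> 1" by (simp add: prj_norm_sq[OF D])
  qed
  also have "\<dots> = trace M" using trc_basis[OF C(1,2), of M] by (simp add: trc_def)
  finally show ?thesis .
qed

lemma oset_insert_normal:
  assumes "oset D" "u \<noteq> 0" "\<And>b. b \<in> D \<Longrightarrow> b \<bullet> u = 0"
  shows "oset (insert (u /\<^sub>R norm u) D)" "u /\<^sub>R norm u \<notin> D"
    "trc (insert (u /\<^sub>R norm u) D) M = trc D M + trace M - mcf_F M u"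
proof -
  show "oset (insert (u /\<^sub>R norm u) D)" using assms by (intro oset_insert) auto
  show n: "u /\<^sub>R norm u \<notin> D"
  proof
    assume "u /\<^sub>R norm u \<in> D"
    from assms(3)[OF this] show False using assms(2) by simp
  qed
  have "(u /\<^sub>R norm u) \<bullet> (M *v (u /\<^sub>R norm u)) = ((M *v u) \<bullet> u) / (norm u)\<^sup>2"
    by (simp add: matrix_vector_mult_scaleR inner_commute power2_eq_square divide_inverse)
  then show "trc (insert (u /\<^sub>R norm u) D) M = trc D M + trace M - mcf_F M u"
    using n oset_finite[OF assms(1)] by (simp add: trc_def mcf_F_def)
qed

text \<open>The unit vector along \<open>u\<close> extends \<open>D\<close> to an orthonormal set,
  whose trace is at most the full one as \<open>M\<close> is positive semidefinite;
  \<open>mcf_F\<close> is the full trace less the part along \<open>u\<close>.\<close>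

lemma mcf_F_ge_trc:
  assumes "oset D" "u \<noteq> 0" "\<And>b. b \<in> D \<Longrightarrow> b \<bullet> u = 0"
    and "\<And>u v. u \<bullet> (M *v v) = v \<bullet> (M *v u)" "\<And>v. 0 \<le> v \<bullet> (M *v v)"
  shows "trc D M \<le> mcf_F M u"
  using trc_le_trace[OF oset_insert_normal(1)[OF assms(1-3)] assms(4,5)] oset_insert_normal(3)[OF assms(1-3), of M] by simp

lemma mcf_F_hyperplane:
  fixes M :: "real^'m^'m"
  assumes B: "B \<in> hyperplanes" "u \<noteq> 0" "\<And>b. b \<in> B \<Longrightarrow> b \<bullet> u = 0"
  shows "mcf_F M u = trc B M"
proof -
  note i = oset_insert_normal[OF hyperplane_oset[OF B(1)] B(2,3)]
  have "card (insert (u /\<^sub>R norm u) B) = DIM(real^'m)"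
    using B(1) i(2) oset_finite[OF hyperplane_oset[OF B(1)]] by (simp add: hyperplanes_def)
  then show ?thesis using trc_basis[OF i(1) oset_span_UNIV[OF i(1)], of M] i(3)[of M] by simp
qed

lemma normal_hyperplane:
  fixes p :: "real^'m"
  assumes "p \<noteq> 0"
  obtains B where "B \<in> hyperplanes" "\<And>b. b \<in> B \<Longrightarrow> b \<bullet> p = 0" "prj B p = 0" "\<And>M. mcf_F M p = trc B M"
proof -
  have "norm (p /\<^sub>R norm p) = 1" using assms by simp
  then obtain B where B: "oset (insert (p /\<^sub>R norm p) B)" "p /\<^sub>R norm p \<notin> B" "card B + 1 = DIM(real^'m)"
    using oset_basis_extend by blast
  have h: "B \<in> hyperplanes" using oset_subset[OF B(1)] B(3) by (auto simp: hyperplanes_def)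
  have z: "b \<bullet> p = 0" if "b \<in> B" for b
  proof -
    have "b \<noteq> p /\<^sub>R norm p" using that B(2) by blast
    then have "b \<bullet> (p /\<^sub>R norm p) = 0" using oset_inner[OF B(1), of b "p /\<^sub>R norm p"] that by simp
    then show ?thesis using assms by simp
  qed
  show thesis using mcf_F_hyperplane[OF h assms z] by (intro that[OF h z]) (auto simp: prj_def z)
qed

lemma eventually_mcf_filter:
  "eventually P (mcf_filter M p) \<longleftrightarrow>
    (\<exists>r>0. \<forall>M' p'. norm (M' - M) < r \<longrightarrow> norm (p' - p) < r \<longrightarrow> transpose M' = M' \<longrightarrow> p' \<noteq> 0 \<longrightarrow> P (M', p'))"
  unfolding mcf_filter_def eventually_inf_principal eventually_nhds_metric
proof safe
  fix d :: real assume d: "0 < d" "\<forall>x. dist x (M, p) < d \<longrightarrow> x \<in> {(M', p'). transpose M' = M' \<and> p' \<noteq> 0} \<longrightarrow> P x"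
  show "\<exists>r>0. \<forall>M' p'. norm (M' - M) < r \<longrightarrow> norm (p' - p) < r \<longrightarrow> transpose M' = M' \<longrightarrow> p' \<noteq> 0 \<longrightarrow> P (M', p')"
  proof (intro exI[of _ "d / 2"] conjI allI impI)
    fix M' p' assume a: "norm (M' - M) < d / 2" "norm (p' - p) < d / 2" "transpose M' = M'" "p' \<noteq> 0"
    have "dist (M', p') (M, p) \<le> norm (M' - M) + norm (p' - p)"
      unfolding dist_norm using norm_Pair_le[of "M' - M" "p' - p"] by simp
    then show "P (M', p')" using d(2) a by auto
  qed (use d in simp)
next
  fix r :: real assume r: "0 < r" "\<forall>M' p'. norm (M' - M) < r \<longrightarrow> norm (p' - p) < r \<longrightarrow> transpose M' = M' \<longrightarrow> p' \<noteq> 0 \<longrightarrow> P (M', p')"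
  show "\<exists>d>0. \<forall>x. dist x (M, p) < d \<longrightarrow> x \<in> {(M', p'). transpose M' = M' \<and> p' \<noteq> 0} \<longrightarrow> P x"
  proof (intro exI[of _ r] conjI allI impI r(1))
    fix x assume a: "dist x (M, p) < r" "x \<in> {(M', p'). transpose M' = M' \<and> p' \<noteq> 0}"
    obtain M' p' where x: "x = (M', p')" by fastforce
    have "norm (M' - M) < r" "norm (p' - p) < r"
      using a(1) dist_fst_le[of x "(M, p)"] dist_snd_le[of x "(M, p)"] by (auto simp: x dist_norm)
    then show "P x" using r(2) a(2) by (simp add: x)
  qed
qed

lemma mcf_F_upper_ge:
  assumes "\<And>r. 0 < r \<Longrightarrow> \<exists>M' p'. norm (M' - M) < r \<and> norm (p' - p) < r \<and> transpose M' = M' \<and> p' \<noteq> 0 \<and> c \<le> mcf_F M' p'"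
  shows "ereal c \<le> mcf_F_upper M p"
proof (rule ccontr)
  assume "\<not> ?thesis"
  then have "\<forall>\<^sub>F x in mcf_filter M p. (\<lambda>(M', p'). ereal (mcf_F M' p')) x < ereal c"
    unfolding mcf_F_upper_def by (intro Limsup_lessD) simp
  then show False unfolding eventually_mcf_filter using assms by (force simp: not_less[symmetric])
qed

lemma mcf_F_lower_le:
  assumes "\<And>r. 0 < r \<Longrightarrow> \<exists>M' p'. norm (M' - M) < r \<and> norm (p' - p) < r \<and> transpose M' = M' \<and> p' \<noteq> 0 \<and> mcf_F M' p' \<le> c"
  shows "mcf_F_lower M p \<le> ereal c"
proof (rule ccontr)
  assume "\<not> ?thesis"
  then have "\<forall>\<^sub>F x in mcf_filter M p. ereal c < (\<lambda>(M', p'). ereal (mcf_F M' p')) x"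
    unfolding mcf_F_lower_def by (intro less_LiminfD) simp
  then show False unfolding eventually_mcf_filter using assms by (force simp: not_less[symmetric])
qed

lemma mcf_F_upper_witness:
  assumes "ereal c < mcf_F_upper M p" "0 < r"
  shows "\<exists>M' p'. norm (M' - M) < r \<and> norm (p' - p) < r \<and> p' \<noteq> 0 \<and> c < mcf_F M' p'"
proof (rule ccontr)
  assume "\<not> ?thesis"
  then have "\<forall>\<^sub>F x in mcf_filter M p. (\<lambda>(M', p'). ereal (mcf_F M' p')) x \<le> ereal c"
    unfolding eventually_mcf_filter prod.case ereal_less_eq using assms(2) by (meson not_le)
  then have "mcf_F_upper M p \<le> ereal c" unfolding mcf_F_upper_def by (rule Limsup_bounded)
  then show False using assms(1) by simp
qed

lemma mcf_F_lower_witness: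
  assumes "mcf_F_lower M p < ereal c" "0 < r"
  shows "\<exists>M' p'. norm (M' - M) < r \<and> norm (p' - p) < r \<and> p' \<noteq> 0 \<and> mcf_F M' p' < c"
proof (rule ccontr)
  assume "\<not> ?thesis"
  then have "\<forall>\<^sub>F x in mcf_filter M p. ereal c \<le> (\<lambda>(M', p'). ereal (mcf_F M' p')) x"
    unfolding eventually_mcf_filter prod.case ereal_less_eq using assms(2) by (meson not_le)
  then have "ereal c \<le> mcf_F_lower M p" unfolding mcf_F_lower_def by (rule Liminf_bounded)
  then show False using assms(1) by simp
qed

text \<open>\<open>mcf_F M' p'\<close> is the trace over the hyperplane orthogonal to
  \<open>p'\<close>, so the values of the operator near a point are almost traces over hyperplanes
  nearly orthogonal to \<open>p\<close>. For \<open>p = 0\<close> this leaves the hyperplane free,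
  as in the envelopes. The radius comes from the constant in \<open>trc_bound\<close>.\<close>

lemma nearby_hyperplane:
  fixes M :: "real^'m^'m"
  assumes "0 < e"
  obtains r where "0 < r" "\<And>M' p'. norm (M' - M) < r \<Longrightarrow> norm (p' - p) < r \<Longrightarrow> p' \<noteq> 0 \<Longrightarrow>
    \<exists>B\<in>hyperplanes. \<bar>mcf_F M' p' - trc B M\<bar> \<le> e \<and> norm (prj B p) \<le> e"
proof (rule that[of "e / real CARD('m) ^ 3"])
  define r where "r = e / real CARD('m) ^ 3"
  have m: "1 \<le> real CARD('m) ^ 3" by (simp add: one_le_power Suc_leI)
  have re: "r \<le> e" "real CARD('m) ^ 3 * r = e" using m assms by (auto simp: r_def divide_le_eq mult_le_cancel_left1)
  fix M' p' assume a: "norm (M' - M) < e / real CARD('m) ^ 3" "norm (p' - p) < e / real CARD('m) ^ 3" "p' \<noteq> 0"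
  obtain B :: "(real^'m) set" where B: "B \<in> hyperplanes" "prj B p' = 0" "\<And>M. mcf_F M p' = trc B M"
    using normal_hyperplane[OF a(3)] by metis
  have os: "oset B" by (rule hyperplane_oset[OF B(1)])
  have "\<bar>(M' - M) $ i $ j\<bar> \<le> r" for i j
    using component_le_norm_cart[of "(M' - M) $ i" j] Finite_Cartesian_Product.norm_nth_le[of "M' - M" i] a(1) by (simp add: r_def)
  then have "\<bar>trc B (M' - M)\<bar> \<le> e" using trc_bound[OF _ os, of "M' - M" r] re(2) by simp
  moreover have "norm (prj B p) \<le> e"
  proof -
    have "prj B p = prj B (p - p')" by (simp add: prj_diff B(2))
    then have "norm (prj B p) \<le> norm (p - p')" using norm_prj_le[OF os] by metis
    then show ?thesis using a(2) re(1) by (simp add: r_def norm_minus_commute)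
  qed
  ultimately show "\<exists>B\<in>hyperplanes. \<bar>mcf_F M' p' - trc B M\<bar> \<le> e \<and> norm (prj B p) \<le> e"
    using B(1,3) by (intro bexI[of _ B]) (auto simp: trc_diff)
qed (use assms in simp)

lemma test_function_scale:
  assumes "test_function \<phi> \<phi>t G H"
  shows "test_function (\<lambda>w. c * \<phi> w) (\<lambda>w. c * \<phi>t w) (\<lambda>w. c *\<^sub>R G w) (\<lambda>w. c *\<^sub>R H w)"
  using assms unfolding test_function_def
  by (auto intro!: derivative_eq_intros continuous_intros simp: scaleR_matrix_vector_assoc[symmetric])

section \<open>Passing between viscosity solutions and plane subsolutions\<close>

section \<open>Viscosity solutions and plane subsolutions\<close>

lemma mcf_subsolution_imp_plane:
  assumes "mcf_subsolution v"
  shows "plane_subsolution hyperplanes v"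
  unfolding plane_subsolution_def
proof (intro allI impI)
  fix \<phi> \<phi>t G H z and \<Lambda> \<epsilon> :: real
  assume \<phi>: "test_function \<phi> \<phi>t G H" "snd z < 0" "local_max_at (\<lambda>w. v w - \<phi> w) z" and p: "0 < \<Lambda>" "0 < \<epsilon>"
  have "0 \<le> ereal (\<phi>t z) + mcf_F_upper (H z) (G z)" using assms \<phi> unfolding mcf_subsolution_def by blast
  then have up: "ereal (- \<phi>t z - \<epsilon> / 3) < mcf_F_upper (H z) (G z)" using p(2) by (cases "mcf_F_upper (H z) (G z)") auto
  \<comment> \<open>The tolerance is split in three: one third is the slack in \<open>up\<close>,
    one covers the error of the trace, and by \<open>e\<^sup>2 \<le> e\<close> and the last bound
    one covers the penalty.\<close>
  define e where "e = min (\<epsilon> / 3) (min 1 (\<epsilon> / (3 * \<Lambda>)))"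
  have e: "0 < e" "e \<le> \<epsilon> / 3" "e \<le> 1" "e \<le> \<epsilon> / (3 * \<Lambda>)" using p by (auto simp: e_def)
  obtain r where r: "0 < r" "\<And>M' p'. norm (M' - H z) < r \<Longrightarrow> norm (p' - G z) < r \<Longrightarrow> p' \<noteq> 0 \<Longrightarrow>
    \<exists>B\<in>hyperplanes. \<bar>mcf_F M' p' - trc B (H z)\<bar> \<le> e \<and> norm (prj B (G z)) \<le> e"
    using nearby_hyperplane[OF e(1)] by blast
  obtain M' p' where M: "norm (M' - H z) < r" "norm (p' - G z) < r" "p' \<noteq> 0" "- \<phi>t z - \<epsilon> / 3 < mcf_F M' p'"
    using mcf_F_upper_witness[OF up r(1)] by blast
  obtain B where B: "B \<in> hyperplanes" "\<bar>mcf_F M' p' - trc B (H z)\<bar> \<le> e" "norm (prj B (G z)) \<le> e" using r(2)[OF M(1-3)] by blast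
  have "(norm (prj B (G z)))\<^sup>2 \<le> e * 1" unfolding power2_eq_square using B(3) e by (intro mult_mono) auto
  then have "\<Lambda> * (norm (prj B (G z)))\<^sup>2 \<le> \<Lambda> * (\<epsilon> / (3 * \<Lambda>))" using e(4) p(1) by (intro mult_left_mono) auto
  then have "\<Lambda> * (norm (prj B (G z)))\<^sup>2 \<le> \<epsilon> / 3" using p by simp
  then show "\<exists>B\<in>hyperplanes. - \<epsilon> \<le> \<phi>t z + trc B (H z) - \<Lambda> * (norm (prj B (G z)))\<^sup>2"
    using B(2) M(4) e(2) by (intro bexI[OF _ B(1)]) linarith
qed

lemma mcf_supersolution_imp_plane:
  assumes "mcf_supersolution v"
  shows "plane_subsolution hyperplanes (\<lambda>w. - v w)"
  unfolding plane_subsolution_def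
proof (intro allI impI)
  fix \<phi> \<phi>t G H z and \<Lambda> \<epsilon> :: real
  assume \<phi>: "test_function \<phi> \<phi>t G H" "snd z < 0" "local_max_at (\<lambda>w. - v w - \<phi> w) z" and p: "0 < \<Lambda>" "0 < \<epsilon>"
  have "local_min_at (\<lambda>w. v w - - \<phi> w) z" using \<phi>(3) unfolding local_max_at_def local_min_at_def by (rule eventually_mono) simp
  then have "ereal (- \<phi>t z) + mcf_F_lower (- H z) (- G z) \<le> 0"
    using assms \<phi>(2) test_function_scale[OF \<phi>(1), of "-1"] unfolding mcf_supersolution_def by fastforce
  then have low: "mcf_F_lower (- H z) (- G z) < ereal (\<phi>t z + \<epsilon> / 3)" using p(2) by (cases "mcf_F_lower (- H z) (- G z)") auto
  define e where "e = min (\<epsilon> / 3) (min 1 (\<epsilon> / (3 * \<Lambda>)))"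
  have e: "0 < e" "e \<le> \<epsilon> / 3" "e \<le> 1" "e \<le> \<epsilon> / (3 * \<Lambda>)" using p by (auto simp: e_def)
  obtain r where r: "0 < r" "\<And>M' p'. norm (M' - - H z) < r \<Longrightarrow> norm (p' - - G z) < r \<Longrightarrow> p' \<noteq> 0 \<Longrightarrow>
    \<exists>B\<in>hyperplanes. \<bar>mcf_F M' p' - trc B (- H z)\<bar> \<le> e \<and> norm (prj B (- G z)) \<le> e"
    using nearby_hyperplane[OF e(1)] by blast
  obtain M' p' where M: "norm (M' - - H z) < r" "norm (p' - - G z) < r" "p' \<noteq> 0" "mcf_F M' p' < \<phi>t z + \<epsilon> / 3"
    using mcf_F_lower_witness[OF low r(1)] by blast
  obtain B where B: "B \<in> hyperplanes" "\<bar>mcf_F M' p' - trc B (- H z)\<bar> \<le> e" "norm (prj B (- G z)) \<le> e" using r(2)[OF M(1-3)] by blast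
  have m: "trc B (- H z) = - trc B (H z)" using trc_scaleR[of B "-1" "H z"] by simp
  have "(norm (prj B (G z)))\<^sup>2 \<le> e * 1" unfolding power2_eq_square using B(3) e by (intro mult_mono) (auto simp: prj_minus)
  then have "\<Lambda> * (norm (prj B (G z)))\<^sup>2 \<le> \<Lambda> * (\<epsilon> / (3 * \<Lambda>))" using e(4) p(1) by (intro mult_left_mono) auto
  then have "\<Lambda> * (norm (prj B (G z)))\<^sup>2 \<le> \<epsilon> / 3" using p by simp
  then show "\<exists>B\<in>hyperplanes. - \<epsilon> \<le> \<phi>t z + trc B (H z) - \<Lambda> * (norm (prj B (G z)))\<^sup>2"
    using B(2) M(4) e(2) m by (intro bexI[OF _ B(1)]) linarith
qed

text \<open>\<Lambda> is arbitrary in the definition, while the other terms are bounded for fixed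
  \<open>z\<close>; a value of order \<open>1 / r\<^sup>2\<close> forces the projected gradient
  below \<open>r\<close>.\<close>

lemma plane_gradient_small:
  fixes H :: "(real^'m) \<times> real \<Rightarrow> real^'m^'m"
  assumes v: "plane_subsolution \<B> v" "\<B> \<subseteq> all_planes" and \<phi>: "test_function \<phi> \<phi>t G H" "snd z < 0" "local_max_at (\<lambda>w. v w - \<phi> w) z"
    and "0 < \<epsilon>" "0 < r"
  shows "\<exists>B\<in>\<B>. - \<epsilon> \<le> \<phi>t z + trc B (H z) \<and> norm (prj B (G z)) < r"
proof -
  define C where "C = norm (H z)"
  define K where "K = \<epsilon> + \<bar>\<phi>t z\<bar> + real CARD('m) ^ 3 * C + 1"
  have K: "0 < K" using assms(6) by (simp add: K_def C_def add_pos_nonneg)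
  define \<Lambda> where "\<Lambda> = K / r\<^sup>2"
  have \<Lambda>: "0 < \<Lambda>" using K assms(7) by (simp add: \<Lambda>_def)
  obtain B where B: "B \<in> \<B>" "- \<epsilon> \<le> \<phi>t z + trc B (H z) - \<Lambda> * (norm (prj B (G z)))\<^sup>2"
    using v(1) \<phi> \<Lambda> assms(6) unfolding plane_subsolution_def by blast
  have os: "oset B" using B(1) v(2) by (auto simp: all_planes_def)
  have "\<bar>H z $ i $ j\<bar> \<le> C" for i j
    using component_le_norm_cart[of "H z $ i" j] Finite_Cartesian_Product.norm_nth_le[of "H z" i] by (simp add: C_def)
  then have "\<bar>trc B (H z)\<bar> \<le> real CARD('m) ^ 3 * C" by (rule trc_bound[OF _ os])
  then have "\<Lambda> * (norm (prj B (G z)))\<^sup>2 < K" using B(2) unfolding K_def by linarith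
  then have "(norm (prj B (G z)))\<^sup>2 < r\<^sup>2" using K assms(7) by (simp add: \<Lambda>_def field_simps)
  then have "norm (prj B (G z)) < r" using assms(7) by (simp add: power2_less_imp_less)
  moreover have "0 \<le> \<Lambda> * (norm (prj B (G z)))\<^sup>2" using \<Lambda> by simp
  then have "- \<epsilon> \<le> \<phi>t z + trc B (H z)" using B(2) by linarith
  ultimately show ?thesis using B(1) by blast
qed

lemma transpose_symmetric:
  fixes M :: "real^'m^'m"
  assumes "\<And>u v. u \<bullet> (M *v v) = v \<bullet> (M *v u)"
  shows "transpose M = M"
proof -
  have "M $ i $ j = M $ j $ i" for i j
    using assms[of "axis i 1" "axis j 1"] by (simp add: inner_axis' matrix_vector_mult_basis column_def)
  then show ?thesis by (simp add: transpose_def vec_eq_iff)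
qed

text \<open>A hyperplane over which the gradient has a small projection is exactly orthogonal to a
  nonzero vector near the gradient, namely a multiple of its normal, and there the operator equals
  the trace over the hyperplane. This covers a vanishing gradient as well.\<close>

lemma plane_imp_mcf_supersolution:
  fixes v :: "(real^'m) \<times> real \<Rightarrow> real"
  assumes v: "plane_subsolution hyperplanes (\<lambda>w. - v w)" and c: "continuous_on (UNIV \<times> {..0}) v"
  shows "mcf_supersolution v"
  unfolding mcf_supersolution_def
proof (intro conjI allI impI)
  show "lsc_on (UNIV \<times> {..0}) v"
    unfolding lsc_on_def using c by (auto simp: continuous_on_def intro!: order_tendstoD(1))
  fix \<phi> \<phi>t :: "(real^'m) \<times> real \<Rightarrow> real" and G H z assume \<phi>: "test_function \<phi> \<phi>t G H" "snd z < 0" "local_min_at (\<lambda>w. v w - \<phi> w) z"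
  have max: "local_max_at (\<lambda>w. - v w - - 1 * \<phi> w) z" using \<phi>(3) unfolding local_max_at_def local_min_at_def by (rule eventually_mono) simp
  have sym: "transpose (H z) = H z"
    using hessian_symmetric[OF \<phi>(1), of "snd z" _ "fst z"] \<phi>(2) by (intro transpose_symmetric) simp
  have "mcf_F_lower (H z) (G z) \<le> ereal (- \<phi>t z + \<epsilon>)" if \<epsilon>: "0 < \<epsilon>" for \<epsilon>
  proof (rule mcf_F_lower_le)
    fix r :: real assume r: "0 < r"
    obtain B where B: "B \<in> hyperplanes" "- \<epsilon> \<le> - 1 * \<phi>t z + trc B (- 1 *\<^sub>R H z)" "norm (prj B (- 1 *\<^sub>R G z)) < r / 2"
      using plane_gradient_small[OF v hyperplanes_subset test_function_scale[OF \<phi>(1)] \<phi>(2) max \<epsilon>, of "r / 2"] r by auto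
    have os: "oset B" by (rule hyperplane_oset[OF B(1)])
    obtain \<nu> where \<nu>: "norm \<nu> = 1" "oset (insert \<nu> B)" "\<nu> \<notin> B" "\<And>x. prj B x = x - (\<nu> \<bullet> x) *\<^sub>R \<nu>"
      using oset_complement_vector[OF os] B(1) by (auto simp: hyperplanes_def)
    \<comment> \<open>The multiple of the normal must not be 0; if the gradient has no component
      along the normal, the length \<open>r / 4\<close> is still within the permitted
      distance.\<close>
    define a where "a = (if \<nu> \<bullet> G z = 0 then r / 4 else \<nu> \<bullet> G z)"
    have a: "a \<noteq> 0" "\<bar>a - \<nu> \<bullet> G z\<bar> \<le> r / 4" using r by (auto simp: a_def)
    have p: "a *\<^sub>R \<nu> \<noteq> 0" using a(1) \<nu>(1) by auto
    have "b \<bullet> (a *\<^sub>R \<nu>) = 0" if "b \<in> B" for b using oset_inner[OF \<nu>(2), of b \<nu>] that \<nu>(3) by auto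
    then have F: "mcf_F (H z) (a *\<^sub>R \<nu>) = trc B (H z)" by (rule mcf_F_hyperplane[OF B(1) p])
    have "a *\<^sub>R \<nu> - G z = (a - \<nu> \<bullet> G z) *\<^sub>R \<nu> - prj B (G z)" by (simp add: \<nu>(4) scaleR_diff_left)
    then have "norm (a *\<^sub>R \<nu> - G z) \<le> \<bar>a - \<nu> \<bullet> G z\<bar> + norm (prj B (G z))"
      using norm_triangle_ineq4[of "(a - \<nu> \<bullet> G z) *\<^sub>R \<nu>" "prj B (G z)"] \<nu>(1) by simp
    also have "\<dots> < r" using a(2) B(3) r by (simp add: prj_minus)
    finally have "norm (a *\<^sub>R \<nu> - G z) < r" .
    moreover have "mcf_F (H z) (a *\<^sub>R \<nu>) \<le> - \<phi>t z + \<epsilon>" using B(2) by (simp only: F trc_scaleR)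
    ultimately show "\<exists>M' p'. norm (M' - H z) < r \<and> norm (p' - G z) < r \<and> transpose M' = M' \<and> p' \<noteq> 0 \<and> mcf_F M' p' \<le> - \<phi>t z + \<epsilon>"
      using sym p r by (intro exI[of _ "H z"] exI[of _ "a *\<^sub>R \<nu>"]) simp
  qed
  note le = this
  show "ereal (\<phi>t z) + mcf_F_lower (H z) (G z) \<le> 0"
  proof (cases "mcf_F_lower (H z) (G z)")
    case (real a)
    have "a \<le> - \<phi>t z" by (rule field_le_epsilon) (use le real in auto)
    then show ?thesis by (simp add: real)
  qed (use le[of 1] in auto)
qed

text \<open>The definition asks for continuity of the derivatives; joint continuity of \<phi> itself
  follows from a locally bounded gradient and continuity in time.\<close>

lemma test_function_isCont_self:
  fixes \<phi> :: "(real^'m) \<times> real \<Rightarrow> real"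
  assumes \<phi>: "test_function \<phi> \<phi>t G H" and t: "t < 0"
  shows "isCont \<phi> (x, t)"
  unfolding continuous_at_eps_delta
proof (intro allI impI)
  fix e :: real assume e: "0 < e"
  define C where "C = norm (G (x, t)) + 1"
  have C: "0 < C" by (simp add: C_def add_nonneg_pos)
  obtain r where r: "0 < r" "\<And>y s. norm (y - x) < r \<Longrightarrow> \<bar>s - t\<bar> < r \<Longrightarrow> dist (G (y, s)) (G (x, t)) < 1"
    using isCont_near[OF test_function_isCont(2)[OF \<phi>, of "(x, t)"], of 1] t by auto
  have "isCont (\<lambda>s. \<phi> (x, s)) t" using test_functionD(1)[OF \<phi> t] by (rule DERIV_isCont)
  then obtain d where d: "0 < d" "\<And>s. dist s t < d \<Longrightarrow> dist (\<phi> (x, s)) (\<phi> (x, t)) < e / 2"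
    using e unfolding continuous_at_eps_delta by (metis half_gt_zero)
  define \<delta> where "\<delta> = min (min r d) (min (- t) (e / (2 * C)))"
  have \<delta>: "0 < \<delta>" "\<delta> \<le> r" "\<delta> \<le> d" "\<delta> \<le> - t" "\<delta> \<le> e / (2 * C)" using r d t e C by (auto simp: \<delta>_def)
  have "dist (\<phi> w) (\<phi> (x, t)) < e" if "dist w (x, t) < \<delta>" for w
  proof -
    obtain y s where w: "w = (y, s)" by fastforce
    have n: "norm (y - x) < \<delta>" "\<bar>s - t\<bar> < \<delta>"
      using that dist_fst_le[of w "(x, t)"] dist_snd_le[of w "(x, t)"] by (auto simp: w dist_norm)
    have s: "s < 0" using n(2) \<delta>(4) by linarith
    obtain \<theta> where \<theta>: "\<theta> \<in> {0<..<1}" "\<phi> (x + (y - x), s) - \<phi> (x, s) = G (x + \<theta> *\<^sub>R (y - x), s) \<bullet> (y - x)"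
      using mean_value_line[of "\<lambda>y. \<phi> (y, s)" "\<lambda>y. G (y, s)" x "y - x"] test_functionD(2)[OF \<phi> s] by blast
    have "norm (\<theta> *\<^sub>R (y - x)) \<le> norm (y - x)" using \<theta>(1) by (simp add: mult_left_le_one_le)
    then have "dist (G (x + \<theta> *\<^sub>R (y - x), s)) (G (x, t)) < 1" using n \<delta>(2) by (intro r(2)) auto
    then have "norm (G (x + \<theta> *\<^sub>R (y - x), s)) \<le> C"
      using norm_triangle_sub[of "G (x + \<theta> *\<^sub>R (y - x), s)" "G (x, t)"] by (simp add: C_def dist_norm)
    then have "\<bar>\<phi> (y, s) - \<phi> (x, s)\<bar> \<le> C * norm (y - x)"
      using \<theta>(2) Cauchy_Schwarz_ineq2[of "G (x + \<theta> *\<^sub>R (y - x), s)" "y - x"]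
        mult_right_mono[of "norm (G (x + \<theta> *\<^sub>R (y - x), s))" C "norm (y - x)"] by simp
    also have "\<dots> \<le> C * (e / (2 * C))" using n(1) \<delta>(5) C by (intro mult_left_mono) auto
    also have "\<dots> = e / 2" using C by simp
    finally have "\<bar>\<phi> (y, s) - \<phi> (x, s)\<bar> \<le> e / 2" .
    moreover have "\<bar>\<phi> (x, s) - \<phi> (x, t)\<bar> < e / 2" using d(2)[of s] n(2) \<delta>(3) by (simp add: dist_real_def)
    ultimately show ?thesis unfolding w dist_real_def by linarith
  qed
  then show "\<exists>d>0. \<forall>x'. dist x' (x, t) < d \<longrightarrow> dist (\<phi> x') (\<phi> (x, t)) < e" using \<delta>(1) by blast
qed

text \<open>Midpoint convexity up to a quartic defect, which is invisible to second derivatives. The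
  defect is 0 when a convex function is touched directly and stems from the penalty when the
  variable is doubled.\<close>

lemma hessian_psd:
  fixes \<phi> :: "(real^'m) \<times> real \<Rightarrow> real"
  assumes \<phi>: "test_function \<phi> \<phi>t G H" and t: "t < 0" and r: "0 < r"
    and le: "\<And>k. norm k < r \<Longrightarrow> 2 * \<phi> (x, t) \<le> \<phi> (x + k, t) + \<phi> (x - k, t) + C * norm k ^ 4"
  shows "0 \<le> v \<bullet> (H (x, t) *v v)"
proof (rule ccontr)
  assume neg: "\<not> 0 \<le> v \<bullet> (H (x, t) *v v)"
  define \<delta> where "\<delta> = - (v \<bullet> (H (x, t) *v v))"
  have \<delta>: "0 < \<delta> / 2" using neg by (simp add: \<delta>_def)
  have cH: "isCont H (x, t)" using test_function_isCont(3)[OF \<phi>, of "(x, t)"] t by simp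
  have "isCont (\<lambda>w. v \<bullet> (H w *v v)) (x, t)"
    unfolding inner_vec_def matrix_vector_mult_def vec_lambda_beta by (intro continuous_intros cH)
  then obtain r1 where r1: "0 < r1" "\<And>y s. norm (y - x) < r1 \<Longrightarrow> \<bar>s - t\<bar> < r1 \<Longrightarrow> dist (v \<bullet> (H (y, s) *v v)) (v \<bullet> (H (x, t) *v v)) < \<delta> / 2"
    using isCont_near[OF _ \<delta>] by blast
  have t1: "((\<lambda>s. s * norm v) \<longlongrightarrow> 0 * norm v) (at_right 0)"
    and t2: "((\<lambda>s. C * s\<^sup>2 * norm v ^ 4) \<longlongrightarrow> C * 0\<^sup>2 * norm v ^ 4) (at_right 0)"
    by (intro tendsto_intros)+
  have "\<forall>\<^sub>F s in at_right 0. s * norm v < min r r1" using order_tendstoD(2)[OF t1, of "min r r1"] r r1(1) by simp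
  moreover have "\<forall>\<^sub>F s in at_right 0. C * s\<^sup>2 * norm v ^ 4 < \<delta> / 2" using order_tendstoD(2)[OF t2, of "\<delta> / 2"] \<delta> by simp
  moreover have "\<forall>\<^sub>F s in at_right 0. (0::real) < s" by (rule eventually_at_right_less)
  ultimately have "\<forall>\<^sub>F s in at_right 0. s * norm v < min r r1 \<and> C * s\<^sup>2 * norm v ^ 4 < \<delta> / 2 \<and> 0 < s"
    by (intro eventually_conj)
  then obtain s where s: "s * norm v < min r r1" "C * s\<^sup>2 * norm v ^ 4 < \<delta> / 2" "0 < s"
    using eventually_happens' by (metis (no_types, lifting) trivial_limit_at_right_real)
  have T: "\<phi> (x + k, t) < \<phi> (x, t) + G (x, t) \<bullet> k - s\<^sup>2 * \<delta> / 4" if k: "k = s *\<^sub>R v \<or> k = - (s *\<^sub>R v)" for k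
  proof -
    obtain \<theta> where \<theta>: "\<theta> \<in> {0<..<1}" "\<phi> (x + k, t) = \<phi> (x, t) + G (x, t) \<bullet> k + (1/2) * (k \<bullet> (H (x + \<theta> *\<^sub>R k, t) *v k))"
      using taylor_second_order[of "\<lambda>y. \<phi> (y, t)" "\<lambda>y. G (y, t)" x k "\<lambda>y. H (y, t)"] test_functionD(2,3)[OF \<phi> t] by blast
    have nk: "norm k = s * norm v" using k s(3) by auto
    have "norm (\<theta> *\<^sub>R k) \<le> norm k" using \<theta>(1) by (simp add: mult_left_le_one_le)
    then have "dist (v \<bullet> (H (x + \<theta> *\<^sub>R k, t) *v v)) (v \<bullet> (H (x, t) *v v)) < \<delta> / 2"
      using nk s(1) r1(1) by (intro r1(2)) auto
    then have n: "v \<bullet> (H (x + \<theta> *\<^sub>R k, t) *v v) < - (\<delta> / 2)" unfolding \<delta>_def dist_real_def by linarith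
    have m: "M *v (- (s *\<^sub>R v)) = - (s *\<^sub>R (M *v v))" for M :: "real^'m^'m"
      using matrix_vector_mult_scaleR[of M "- s" v] by simp
    have "k \<bullet> (H (x + \<theta> *\<^sub>R k, t) *v k) = s\<^sup>2 * (v \<bullet> (H (x + \<theta> *\<^sub>R k, t) *v v))"
      using k m by (auto simp: matrix_vector_mult_scaleR power2_eq_square simp del: scaleR_minus_right)
    also have "\<dots> < s\<^sup>2 * (- (\<delta> / 2))" using n s(3) by (intro mult_strict_left_mono) auto
    finally show ?thesis using \<theta>(2) by (simp add: mult.commute)
  qed
  have "2 * \<phi> (x, t) \<le> \<phi> (x + s *\<^sub>R v, t) + \<phi> (x - s *\<^sub>R v, t) + C * norm (s *\<^sub>R v) ^ 4" using s by (intro le) auto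
  moreover have "C * norm (s *\<^sub>R v) ^ 4 = s\<^sup>2 * (C * s\<^sup>2 * norm v ^ 4)" using s(3) by (simp add: power_mult_distrib power2_eq_square power4_eq_xxxx)
  moreover have "s\<^sup>2 * (C * s\<^sup>2 * norm v ^ 4) < s\<^sup>2 * (\<delta> / 2)" using s by (intro mult_strict_left_mono) auto
  moreover have "\<phi> (x + s *\<^sub>R v, t) + \<phi> (x - s *\<^sub>R v, t) < 2 * \<phi> (x, t) - s\<^sup>2 * (\<delta> / 2)"
    using T[of "s *\<^sub>R v"] T[of "- (s *\<^sub>R v)"] by simp
  ultimately show False by linarith
qed

lemma test_function_shift:
  assumes \<phi>: "test_function \<phi> \<phi>t G H"
  shows "test_function (\<lambda>(x, t). \<phi> (x - a, t)) (\<lambda>(x, t). \<phi>t (x - a, t)) (\<lambda>(x, t). G (x - a, t)) (\<lambda>(x, t). H (x - a, t))"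
proof -
  have s: "((\<lambda>y. y - a) has_derivative (\<lambda>h. h)) (at x)" for x by (auto intro!: derivative_eq_intros)
  have c: "continuous_on (UNIV \<times> {..<0}) (\<lambda>(x, t). f (x - a, t))" if "continuous_on (UNIV \<times> {..<0}) f"
    for f :: "(real^'a) \<times> real \<Rightarrow> 'b::topological_space"
    unfolding case_prod_unfold by (rule continuous_on_compose2[OF that]) (auto intro!: continuous_intros)
  show ?thesis unfolding test_function_def prod.case
  proof (intro conjI allI impI)
    fix x and t :: real assume t: "t < 0"
    note d = test_functionD[OF \<phi> t, of "x - a"]
    show "((\<lambda>s. \<phi> (x - a, s)) has_real_derivative \<phi>t (x - a, t)) (at t)" by (rule d(1))
    show "((\<lambda>y. \<phi> (y - a, t)) has_derivative (\<lambda>h. G (x - a, t) \<bullet> h)) (at x)"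
      using diff_chain_at[OF s d(2)] by (simp add: o_def)
    show "((\<lambda>y. G (y - a, t)) has_derivative (\<lambda>h. H (x - a, t) *v h)) (at x)"
      using diff_chain_at[OF s d(3)] by (simp add: o_def)
  qed (use \<phi> c in \<open>auto simp: test_function_def\<close>)
qed

lemma test_function_time:
  assumes "\<And>t. t < 0 \<Longrightarrow> (g has_real_derivative g' t) (at t)" "continuous_on {..<0} g'"
  shows "test_function (\<lambda>(x, t). g t) (\<lambda>(x, t). g' t) (\<lambda>_. 0) (\<lambda>_. 0)"
  unfolding test_function_def prod.case
proof (intro conjI allI impI)
  show "continuous_on (UNIV \<times> {..<0}) (\<lambda>(x, t). g' t)"
    unfolding case_prod_unfold by (rule continuous_on_compose2[OF assms(2)]) (auto intro!: continuous_intros)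
qed (auto intro!: derivative_eq_intros assms(1) simp: matrix_vector_mult_def zero_vec_def[symmetric] fun_eq_iff)

text \<open>The plane \<open>B\<close> may have any dimension. The part \<open>u\<close> of the
  gradient orthogonal to it is nonzero, because the projection is shorter than the gradient, and by
  positive semidefiniteness the trace over the complement of \<open>u\<close> dominates that over
  \<open>B\<close>.\<close>

lemma plane_nonzero_gradient:
  fixes v :: "(real^'m) \<times> real \<Rightarrow> real"
  assumes v: "plane_subsolution all_planes v"
    and conv: "\<And>y1 y2 t. t \<le> 0 \<Longrightarrow> v ((1/2) *\<^sub>R (y1 + y2), t) \<le> (v (y1, t) + v (y2, t)) / 2"
    and \<phi>: "test_function \<phi> \<phi>t G H" "snd z < 0" "local_max_at (\<lambda>w. v w - \<phi> w) z"
    and G: "G z \<noteq> 0" and r: "0 < r" "0 < \<epsilon>"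
  shows "\<exists>p'. p' \<noteq> 0 \<and> norm (p' - G z) < r \<and> - \<phi>t z - \<epsilon> \<le> mcf_F (H z) p'"
proof -
  obtain x t where z: "z = (x, t)" by fastforce
  have t: "t < 0" using \<phi>(2) by (simp add: z)
  obtain d where d: "0 < d" "\<And>w. dist w z < d \<Longrightarrow> v w - \<phi> w \<le> v z - \<phi> z"
    using \<phi>(3) unfolding local_max_at_def eventually_nhds_metric by blast
  have psd: "0 \<le> u \<bullet> (H z *v u)" for u
    unfolding z
  proof (rule hessian_psd[OF \<phi>(1) t d(1), where C=0])
    fix k :: "real^'m" assume k: "norm k < d"
    have "v (x + k, t) - \<phi> (x + k, t) \<le> v z - \<phi> z" "v (x - k, t) - \<phi> (x - k, t) \<le> v z - \<phi> z"
      using k d(2)[of "(x + k, t)"] d(2)[of "(x - k, t)"] by (auto simp: z dist_Pair_Pair dist_norm)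
    moreover have "x + k + (x - k) = 2 *\<^sub>R x" by (simp add: scaleR_2)
    then have "v (x, t) \<le> (v (x + k, t) + v (x - k, t)) / 2" using conv[of t "x + k" "x - k"] t by simp
    ultimately show "2 * \<phi> (x, t) \<le> \<phi> (x + k, t) + \<phi> (x - k, t) + 0 * norm k ^ 4" by (simp add: z)
  qed
  have sym: "u \<bullet> (H z *v w) = w \<bullet> (H z *v u)" for u w unfolding z by (rule hessian_symmetric[OF \<phi>(1) t])
  have "0 < min r (norm (G z))" using r G by simp
  then obtain B where B: "B \<in> all_planes" "- \<epsilon> \<le> \<phi>t z + trc B (H z)" "norm (prj B (G z)) < min r (norm (G z))"
    using plane_gradient_small[OF v order_refl \<phi> r(2)] by blast
  have os: "oset B" using B(1) by (simp add: all_planes_def)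
  define u where "u = G z - prj B (G z)"
  have u: "u \<noteq> 0" "norm (u - G z) < r" using B(3) by (auto simp: u_def)
  have "b \<bullet> u = 0" if "b \<in> B" for b using inner_prj[OF os that, of "G z"] by (simp add: u_def inner_diff_right)
  then have "trc B (H z) \<le> mcf_F (H z) u" by (rule mcf_F_ge_trc[OF os u(1) _ sym psd])
  then show ?thesis using u B(2) by (intro exI[of _ u]) auto
qed

text \<open>At a vanishing gradient the variable is doubled with the penalisation \<open>\<alpha> |x - y|^4\<close>, whose
  Hessian vanishes at \<open>x = y\<close>; if the maximum has \<open>x \<noteq> y\<close>, the translated test function has a
  nonzero gradient.\<close>

lemma plane_zero_gradient:
  fixes v :: "(real^'m) \<times> real \<Rightarrow> real"
  assumes v: "plane_subsolution all_planes v" and c: "continuous_on (UNIV \<times> {..0}) v"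
    and lip: "\<And>x y t. t \<le> 0 \<Longrightarrow> \<bar>v (x, t) - v (y, t)\<bar> \<le> norm (x - y)"
    and conv: "\<And>y1 y2 t. t \<le> 0 \<Longrightarrow> v ((1/2) *\<^sub>R (y1 + y2), t) \<le> (v (y1, t) + v (y2, t)) / 2"
    and \<phi>: "test_function \<phi> \<phi>t G H" "snd z < 0" "local_max_at (\<lambda>w. v w - \<phi> w) z"
    and G: "G z = 0" and r: "0 < r" "0 < \<epsilon>"
  shows "\<exists>M' p'. norm (M' - H z) < r \<and> norm (p' - G z) < r \<and> transpose M' = M' \<and> p' \<noteq> 0 \<and> - \<phi>t z - \<epsilon> \<le> mcf_F M' p'"
proof -
  obtain x0 t0 where z: "z = (x0, t0)" by fastforce
  have t0: "t0 < 0" using \<phi>(2) by (simp add: z)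
  define q where "q = (\<lambda>(x, t). ((x - x0) \<bullet> (x - x0))\<^sup>2 + (t - t0)\<^sup>2)"
  define \<psi> where "\<psi> = (\<lambda>(x, t). \<phi> (x, t) + ((x - x0) \<bullet> (x - x0))\<^sup>2 + (t - t0)\<^sup>2)"
  define \<psi>t where "\<psi>t = (\<lambda>(x, t). \<phi>t (x, t) + 2 * (t - t0))"
  define G' where "G' = (\<lambda>(x, t). G (x, t) + (4 * ((x - x0) \<bullet> (x - x0))) *\<^sub>R (x - x0))"
  define H' where "H' = (\<lambda>(x, t). H (x, t) + (4 * ((x - x0) \<bullet> (x - x0))) *\<^sub>R mat 1 + 8 *\<^sub>R outer (x - x0))"
  have \<psi>: "test_function \<psi> \<psi>t G' H'"
    using test_function_strict[OF \<phi>(1), of x0 t0] unfolding \<psi>_def \<psi>t_def G'_def H'_def .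
  have \<psi>z: "\<psi>t z = \<phi>t z" "G' z = 0" "H' z = H z"
    using G by (simp_all add: \<psi>t_def G'_def H'_def z outer_def vec_eq_iff)
  have \<psi>q: "\<psi> w = \<phi> w + q w" for w by (simp add: \<psi>_def q_def case_prod_unfold)
  note cont = test_function_isCont[OF \<psi>, of "(x0, t0)"]
  have half: "0 < \<epsilon> / 2" "0 < r / 2" using r by auto
  obtain d1 where d1: "0 < d1" "\<And>x t. norm (x - x0) < d1 \<Longrightarrow> \<bar>t - t0\<bar> < d1 \<Longrightarrow> dist (\<psi>t (x, t)) (\<psi>t (x0, t0)) < \<epsilon> / 2"
    using isCont_near[OF cont(1) half(1)] t0 by auto
  obtain d2 where d2: "0 < d2" "\<And>x t. norm (x - x0) < d2 \<Longrightarrow> \<bar>t - t0\<bar> < d2 \<Longrightarrow> dist (G' (x, t)) (G' (x0, t0)) < r / 2"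
    using isCont_near[OF cont(2) half(2)] t0 by auto
  obtain d3 where d3: "0 < d3" "\<And>x t. norm (x - x0) < d3 \<Longrightarrow> \<bar>t - t0\<bar> < d3 \<Longrightarrow> dist (H' (x, t)) (H' (x0, t0)) < r"
    using isCont_near[OF cont(3) r(1)] t0 by auto
  obtain d0 where d0: "0 < d0" "\<And>w. dist w z < d0 \<Longrightarrow> v w - \<phi> w \<le> v z - \<phi> z"
    using \<phi>(3) unfolding local_max_at_def eventually_nhds_metric by blast
  define \<rho> where "\<rho> = min (min d0 d1) (min (min d2 d3) (- t0)) / 4"
  have \<rho>: "0 < \<rho>" "2 * \<rho> < d0" "\<rho> < d1" "\<rho> < d2" "\<rho> < d3" "\<rho> < - t0"
    using d0 d1 d2 d3 t0 by (auto simp: \<rho>_def)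
  \<comment> \<open>\<eta> will bound both the distance of the two variables and the perturbation
    \<open>q\<close>; the last two bounds then confine \<open>b\<close> and \<tau> to half of the
    box.\<close>
  define \<eta> where "\<eta> = min (\<rho> / 2) (min ((\<rho> / 2) ^ 4) ((\<rho> / 2)\<^sup>2) / 2)"
  have \<eta>: "0 < \<eta>" "\<eta> \<le> \<rho> / 2" "\<eta> < (\<rho> / 2) ^ 4" "\<eta> < (\<rho> / 2)\<^sup>2" using \<rho>(1) by (auto simp: \<eta>_def min_less_iff_disj)
  \<comment> \<open>With this \<alpha>, \<open>\<alpha> * L ^ 4 \<le> L\<close> forces
    \<open>L \<le> \<eta>\<close>.\<close>
  define \<alpha> where "\<alpha> = 1 / \<eta> ^ 3"
  have \<alpha>: "0 < \<alpha>" using \<eta> by (simp add: \<alpha>_def)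
  define K where "K = cball x0 \<rho> \<times> cball x0 \<rho> \<times> cball t0 \<rho>"
  have Kneg: "t < 0" if "t \<in> cball t0 \<rho>" for t using that \<rho>(6) by (auto simp: dist_real_def)
  define \<Psi> where "\<Psi> = (\<lambda>(x, y, t). v (x, t) - \<psi> (y, t) - \<alpha> * ((y - x) \<bullet> (y - x))\<^sup>2)"
  have "continuous_on K \<Psi>"
  proof -
    have "continuous_on K (\<lambda>w. v (fst w, snd (snd w)))"
      by (rule continuous_on_compose2[OF c]) (use Kneg in \<open>auto intro!: continuous_intros simp: K_def less_imp_le\<close>)
    moreover have "continuous_on (UNIV \<times> {..<0}) \<psi>"
      by (rule continuous_at_imp_continuous_on) (auto intro: test_function_isCont_self[OF \<psi>])
    then have "continuous_on K (\<lambda>w. \<psi> (fst (snd w), snd (snd w)))"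
      by (rule continuous_on_compose2) (use Kneg in \<open>auto intro!: continuous_intros simp: K_def\<close>)
    ultimately show ?thesis unfolding \<Psi>_def case_prod_unfold by (intro continuous_intros)
  qed
  moreover have "compact K" unfolding K_def by (intro compact_Times compact_cball)
  moreover have z0K: "(x0, x0, t0) \<in> K" using \<rho>(1) by (simp add: K_def)
  ultimately obtain w where w: "w \<in> K" "\<And>w'. w' \<in> K \<Longrightarrow> \<Psi> w' \<le> \<Psi> w"
    using continuous_attains_sup[of K \<Psi>] by blast
  obtain a b \<tau> where ab: "w = (a, b, \<tau>)" by (metis prod_cases3)
  have inK: "norm (a - x0) \<le> \<rho>" "norm (b - x0) \<le> \<rho>" "\<bar>\<tau> - t0\<bar> \<le> \<rho>"
    using w(1) by (auto simp: ab K_def dist_norm norm_minus_commute dist_real_def)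
  have \<tau>: "\<tau> < 0" using inK(3) \<rho>(6) by linarith
  have max: "v (x, t) - \<psi> (y, t) - \<alpha> * ((y - x) \<bullet> (y - x))\<^sup>2 \<le> v (a, \<tau>) - \<psi> (b, \<tau>) - \<alpha> * ((b - a) \<bullet> (b - a))\<^sup>2"
    if "norm (x - x0) \<le> \<rho>" "norm (y - x0) \<le> \<rho>" "\<bar>t - t0\<bar> \<le> \<rho>" for x y t
    using w(2)[of "(x, y, t)"] that by (simp add: ab K_def \<Psi>_def dist_norm norm_minus_commute dist_real_def)
  define L where "L = norm (b - a)"
  have L: "0 \<le> L" by (simp add: L_def)
  have L4: "((b - a) \<bullet> (b - a))\<^sup>2 = L ^ 4" by (simp add: L_def power2_norm_eq_inner[symmetric] flip: power_mult)
  \<comment> \<open>The maximum is compared with the value at the centre; moving \<open>a\<close> to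
    \<open>b\<close> changes \<open>v\<close> by at most \<open>L\<close>.\<close>
  have key: "\<alpha> * L ^ 4 + q (b, \<tau>) \<le> L"
  proof -
    have "v z - \<phi> z \<le> v (a, \<tau>) - \<psi> (b, \<tau>) - \<alpha> * L ^ 4"
      using max[of x0 x0 t0] \<rho>(1) by (simp add: L4 z \<psi>q q_def)
    moreover have "v (a, \<tau>) \<le> v (b, \<tau>) + L" using lip[of \<tau> a b] \<tau> by (simp add: L_def norm_minus_commute abs_le_iff)
    moreover have "v (b, \<tau>) - \<phi> (b, \<tau>) \<le> v z - \<phi> z"
    proof (rule d0(2))
      have "dist (b, \<tau>) z \<le> norm (b - x0) + \<bar>\<tau> - t0\<bar>" unfolding z dist_norm using norm_Pair_le[of "b - x0" "\<tau> - t0"] by simp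
      then show "dist (b, \<tau>) z < d0" using inK \<rho>(2) by linarith
    qed
    ultimately show ?thesis unfolding \<psi>q by linarith
  qed
  have q: "0 \<le> ((b - x0) \<bullet> (b - x0))\<^sup>2" "0 \<le> (\<tau> - t0)\<^sup>2" by auto
  have L\<eta>: "L \<le> \<eta>"
  proof (rule ccontr)
    assume "\<not> L \<le> \<eta>"
    then have l: "\<eta> < L" by simp
    have "\<alpha> * L ^ 4 \<le> L" using key q unfolding q_def prod.case by linarith
    then have "L ^ 4 \<le> L * \<eta> ^ 3" using \<eta>(1) by (simp add: \<alpha>_def divide_le_eq)
    then have "L * L ^ 3 \<le> L * \<eta> ^ 3" by (simp add: power_Suc[symmetric] del: power_Suc)
    then have "L ^ 3 \<le> \<eta> ^ 3" using l \<eta>(1) by simp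
    moreover have "\<eta> ^ 3 < L ^ 3" using l \<eta>(1) by (intro power_strict_mono) auto
    ultimately show False by simp
  qed
  have q\<eta>: "q (b, \<tau>) \<le> \<eta>" using key L\<eta> \<alpha> by (smt (verit) L zero_le_power mult_nonneg_nonneg)
  have b: "norm (b - x0) < \<rho> / 2"
  proof (rule power_less_imp_less_base)
    have "norm (b - x0) ^ 4 = ((b - x0) \<bullet> (b - x0))\<^sup>2" by (simp add: power2_norm_eq_inner[symmetric] flip: power_mult)
    then show "norm (b - x0) ^ 4 < (\<rho> / 2) ^ 4" using q\<eta> q \<eta>(3) unfolding q_def prod.case by linarith
  qed (use \<rho>(1) in simp)
  have \<tau>t: "\<bar>\<tau> - t0\<bar> < \<rho> / 2"
  proof (rule power_less_imp_less_base)
    show "\<bar>\<tau> - t0\<bar>\<^sup>2 < (\<rho> / 2)\<^sup>2" using q\<eta> q \<eta>(4) unfolding q_def prod.case power2_abs by linarith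
  qed (use \<rho>(1) in simp)
  have a: "norm (a - x0) < \<rho>" using norm_triangle_ineq4[of "b - x0" "b - a"] b L\<eta> \<eta>(2) by (simp add: L_def)
  have near: "norm (H' (b, \<tau>) - H z) < r" "norm (G' (b, \<tau>)) < r / 2" "\<bar>\<psi>t (b, \<tau>) - \<phi>t z\<bar> < \<epsilon> / 2"
    using d1(2)[of b \<tau>] d2(2)[of b \<tau>] d3(2)[of b \<tau>] inK \<rho> \<psi>z by (auto simp: z dist_norm dist_real_def)
  have sym: "u \<bullet> (H' (b, \<tau>) *v u') = u' \<bullet> (H' (b, \<tau>) *v u)" for u u' by (rule hessian_symmetric[OF \<psi> \<tau>])
  have symH: "transpose (H' (b, \<tau>)) = H' (b, \<tau>)" by (rule transpose_symmetric[OF sym])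
  define \<sigma> where "\<sigma> = min (\<rho> - norm (a - x0)) (min (\<rho> - norm (b - x0)) (\<rho> - \<bar>\<tau> - t0\<bar>))"
  have \<sigma>: "0 < \<sigma>" using a b \<tau>t \<rho>(1) by (simp add: \<sigma>_def)
  have \<sigma>K: "norm (a + k - x0) \<le> \<rho>" "norm (b + k - x0) \<le> \<rho>" if "norm k < \<sigma>" for k
    using that norm_triangle_ineq[of "a - x0" k] norm_triangle_ineq[of "b - x0" k] by (auto simp: \<sigma>_def algebra_simps)
  have \<sigma>t: "\<bar>t - t0\<bar> \<le> \<rho>" if "\<bar>t - \<tau>\<bar> < \<sigma>" for t using that by (auto simp: \<sigma>_def)
  have loc: "local_max_at f (a, \<tau>)" if "\<And>k t. norm k < \<sigma> \<Longrightarrow> \<bar>t - \<tau>\<bar> < \<sigma> \<Longrightarrow> f (a + k, t) \<le> f (a, \<tau>)" for f :: "(real^'m) \<times> real \<Rightarrow> real"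
    unfolding local_max_at_def eventually_nhds_metric
  proof (intro exI[of _ \<sigma>] conjI allI impI \<sigma>)
    fix w assume "dist w (a, \<tau>) < \<sigma>"
    then have "norm (fst w - a) < \<sigma>" "\<bar>snd w - \<tau>\<bar> < \<sigma>"
      using dist_fst_le[of w "(a, \<tau>)"] dist_snd_le[of w "(a, \<tau>)"] by (auto simp: dist_norm dist_real_def)
    then show "f w \<le> f (a, \<tau>)" using that[of "fst w - a" "snd w"] by simp
  qed
  show ?thesis
  proof (cases "a = b")
    case True
    \<comment> \<open>As a function of the first variable the penalty is a test function whose
      gradient and Hessian vanish at \<open>b\<close>, so the subsolution property bounds the time
      derivative alone. The term \<open>- (t - \<tau>)\<^sup>2\<close> cancels the one added by
      \<open>test_function_strict\<close>.\<close>
    define g where "g t = \<psi> (b, t) / \<alpha> - (t - \<tau>)\<^sup>2" for t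
    have tg: "test_function (\<lambda>(x, t). g t) (\<lambda>(x, t). \<psi>t (b, t) / \<alpha> - 2 * (t - \<tau>)) (\<lambda>_. 0) (\<lambda>_. 0 :: real^'m^'m)"
    proof (rule test_function_time)
      show "(g has_real_derivative \<psi>t (b, t) / \<alpha> - 2 * (t - \<tau>)) (at t)" if "t < 0" for t
        unfolding g_def using test_functionD(1)[OF \<psi> that, of b] \<alpha>
        by (auto intro!: derivative_eq_intros DERIV_cdivide)
      have "continuous_on (UNIV \<times> {..<0}) \<psi>t" using \<psi> by (simp add: test_function_def)
      then have "continuous_on {..<0} (\<lambda>t. \<psi>t (b, t))"
        by (rule continuous_on_compose2) (auto intro!: continuous_intros)
      then show "continuous_on {..<0} (\<lambda>t. \<psi>t (b, t) / \<alpha> - 2 * (t - \<tau>))" using \<alpha> by (intro continuous_intros) auto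
    qed
    note T = test_function_scale[OF test_function_strict[OF tg, of b \<tau>], of \<alpha>]
    have "local_max_at (\<lambda>w. v w - \<alpha> * (case w of (x, t) \<Rightarrow> (case (x, t) of (x, t) \<Rightarrow> g t) + ((x - b) \<bullet> (x - b))\<^sup>2 + (t - \<tau>)\<^sup>2)) (a, \<tau>)"
    proof (rule loc)
      fix k :: "real^'m" and t assume k: "norm k < \<sigma>" "\<bar>t - \<tau>\<bar> < \<sigma>"
      have "v (a + k, t) - \<psi> (b, t) - \<alpha> * ((b - (a + k)) \<bullet> (b - (a + k)))\<^sup>2 \<le> v (a, \<tau>) - \<psi> (b, \<tau>)"
        using max[OF \<sigma>K(1)[OF k(1)] inK(2) \<sigma>t[OF k(2)]] True by simp
      then show "v (a + k, t) - \<alpha> * (case (a + k, t) of (x, t) \<Rightarrow> (case (x, t) of (x, t) \<Rightarrow> g t) + ((x - b) \<bullet> (x - b))\<^sup>2 + (t - \<tau>)\<^sup>2)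
        \<le> v (a, \<tau>) - \<alpha> * (case (a, \<tau>) of (x, t) \<Rightarrow> (case (x, t) of (x, t) \<Rightarrow> g t) + ((x - b) \<bullet> (x - b))\<^sup>2 + (t - \<tau>)\<^sup>2)"
        using \<alpha> True by (simp add: g_def distrib_left)
    qed
    from plane_gradient_small[OF v order_refl T _ this half(1) r(1)]
    obtain B :: "(real^'m) set" where B: "oset B" "- (\<epsilon> / 2) \<le> \<psi>t (b, \<tau>)"
      using \<tau> \<alpha> True by (auto simp: all_planes_def trc_def outer_def matrix_vector_mult_def zero_vec_def[symmetric])
    have psd: "0 \<le> u \<bullet> (H' (b, \<tau>) *v u)" for u
    proof (rule hessian_psd[OF \<psi> \<tau> \<sigma>, where C="2 * \<alpha>"])
      fix k :: "real^'m" assume k: "norm k < \<sigma>"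
      have e: "(k \<bullet> k)\<^sup>2 = norm k ^ 4" by (simp add: power2_norm_eq_inner[symmetric] flip: power_mult)
      have "\<psi> (b, \<tau>) \<le> \<psi> (b + k, \<tau>) + \<alpha> * norm k ^ 4" if "norm k < \<sigma>" for k
        using max[OF inK(1) \<sigma>K(2)[OF that] inK(3)] True by (simp add: power2_norm_eq_inner[symmetric] flip: power_mult)
      from this[OF k] this[of "- k"] k show "2 * \<psi> (b, \<tau>) \<le> \<psi> (b + k, \<tau>) + \<psi> (b - k, \<tau>) + 2 * \<alpha> * norm k ^ 4" by simp
    qed
    define p' where "p' = (r / 2) *\<^sub>R (axis undefined 1 :: real^'m)"
    have p': "p' \<noteq> 0" "norm p' < r" using r(1) by (auto simp: p'_def)
    \<comment> \<open>The zero plane suffices: on a positive semidefinite Hessian the operator is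
      nonnegative in every direction.\<close>
    have "trc {} (H' (b, \<tau>)) \<le> mcf_F (H' (b, \<tau>)) p'" by (rule mcf_F_ge_trc[OF _ p'(1) _ sym psd]) auto
    then have "- \<phi>t z - \<epsilon> \<le> mcf_F (H' (b, \<tau>)) p'" using near(3) B(2) unfolding trc_def sum.empty by linarith
    then show ?thesis using p' near symH G by (intro exI[of _ "H' (b, \<tau>)"] exI[of _ p']) auto
  next
    case False
    note T = test_function_shift[OF \<psi>, of "a - b"]
    have lm: "local_max_at (\<lambda>w. v w - (case w of (x, t) \<Rightarrow> \<psi> (x - (a - b), t))) (a, \<tau>)"
    proof (rule loc)
      fix k :: "real^'m" and t assume k: "norm k < \<sigma>" "\<bar>t - \<tau>\<bar> < \<sigma>"
      show "v (a + k, t) - (case (a + k, t) of (x, t) \<Rightarrow> \<psi> (x - (a - b), t)) \<le> v (a, \<tau>) - (case (a, \<tau>) of (x, t) \<Rightarrow> \<psi> (x - (a - b), t))"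
        using max[OF \<sigma>K[OF k(1)] \<sigma>t[OF k(2)]] by (simp add: algebra_simps)
    qed
    \<comment> \<open>As a function of the second variable, \<psi> plus the penalty has a local
      minimum at \<open>b\<close>, so the gradient of \<psi> cancels that of the penalty, which is
      nonzero for distinct \<open>a\<close> and \<open>b\<close>.\<close>
    have "G' (b, \<tau>) \<noteq> 0"
    proof
      assume G0: "G' (b, \<tau>) = 0"
      have i: "((\<lambda>y. (y - a) \<bullet> (y - a)) has_derivative (\<lambda>h. 2 * ((b - a) \<bullet> h))) (at b)"
        by (auto intro!: derivative_eq_intros simp: inner_commute)
      have "((\<lambda>y. \<psi> (y, \<tau>) + \<alpha> * ((y - a) \<bullet> (y - a))\<^sup>2) has_derivative
        (\<lambda>h. G' (b, \<tau>) \<bullet> h + \<alpha> * (2 * (2 * ((b - a) \<bullet> h)) * ((b - a) \<bullet> (b - a))))) (at b)"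
        using has_derivative_power[OF i, of 2]
        by (intro has_derivative_add test_functionD(2)[OF \<psi> \<tau>] has_derivative_mult_right) (simp add: mult_ac)
      moreover have "\<forall>\<^sub>F y in at b. \<psi> (b, \<tau>) + \<alpha> * ((b - a) \<bullet> (b - a))\<^sup>2 \<le> \<psi> (y, \<tau>) + \<alpha> * ((y - a) \<bullet> (y - a))\<^sup>2"
        unfolding eventually_at
      proof (intro exI[of _ \<sigma>] conjI ballI impI \<sigma>)
        fix y assume "y \<noteq> b \<and> dist y b < \<sigma>"
        then have "norm (y - b) < \<sigma>" by (simp add: dist_norm)
        from max[OF inK(1) \<sigma>K(2)[OF this] inK(3)]
        show "\<psi> (b, \<tau>) + \<alpha> * ((b - a) \<bullet> (b - a))\<^sup>2 \<le> \<psi> (y, \<tau>) + \<alpha> * ((y - a) \<bullet> (y - a))\<^sup>2" by simp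
      qed
      ultimately have "(\<lambda>h. G' (b, \<tau>) \<bullet> h + \<alpha> * (2 * (2 * ((b - a) \<bullet> h)) * ((b - a) \<bullet> (b - a)))) = (\<lambda>h. 0)"
        by (rule has_derivative_local_min)
      from fun_cong[OF this, of "b - a"] show False using G0 \<alpha> False by simp
    qed
    then obtain p' where p': "p' \<noteq> 0" "norm (p' - G' (b, \<tau>)) < r / 2" "- \<psi>t (b, \<tau>) - \<epsilon> / 2 \<le> mcf_F (H' (b, \<tau>)) p'"
      using plane_nonzero_gradient[OF v conv T _ lm _ half(2,1)] \<tau> by auto
    have "norm p' < r" using p'(2) near(2) norm_triangle_sub[of p' "G' (b, \<tau>)"] by simp
    then show ?thesis using p'(1,3) near symH G
      by (intro exI[of _ "H' (b, \<tau>)"] exI[of _ p']) (auto simp: abs_if split: if_splits)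
  qed
qed

lemma plane_imp_mcf_subsolution:
  fixes v :: "(real^'m) \<times> real \<Rightarrow> real"
  assumes v: "plane_subsolution all_planes v" and c: "continuous_on (UNIV \<times> {..0}) v"
    and lip: "\<And>x y t. t \<le> 0 \<Longrightarrow> \<bar>v (x, t) - v (y, t)\<bar> \<le> norm (x - y)"
    and conv: "\<And>y1 y2 t. t \<le> 0 \<Longrightarrow> v ((1/2) *\<^sub>R (y1 + y2), t) \<le> (v (y1, t) + v (y2, t)) / 2"
  shows "mcf_subsolution v"
  unfolding mcf_subsolution_def
proof (intro conjI allI impI)
  show "usc_on (UNIV \<times> {..0}) v"
    unfolding usc_on_def using c by (auto simp: continuous_on_def intro!: order_tendstoD(2))
  fix \<phi> \<phi>t :: "(real^'m) \<times> real \<Rightarrow> real" and G H z assume \<phi>: "test_function \<phi> \<phi>t G H" "snd z < 0" "local_max_at (\<lambda>w. v w - \<phi> w) z"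
  have sym: "transpose (H z) = H z"
    using hessian_symmetric[OF \<phi>(1), of "snd z" _ "fst z"] \<phi>(2) by (intro transpose_symmetric) simp
  have le: "ereal (- \<phi>t z - \<epsilon>) \<le> mcf_F_upper (H z) (G z)" if \<epsilon>: "0 < \<epsilon>" for \<epsilon>
  proof (rule mcf_F_upper_ge)
    fix r :: real assume r: "0 < r"
    show "\<exists>M' p'. norm (M' - H z) < r \<and> norm (p' - G z) < r \<and> transpose M' = M' \<and> p' \<noteq> 0 \<and> - \<phi>t z - \<epsilon> \<le> mcf_F M' p'"
    proof (cases "G z = 0")
      case True
      show ?thesis by (rule plane_zero_gradient[OF v c lip conv \<phi> True r \<epsilon>])
    next
      case False
      then show ?thesis using plane_nonzero_gradient[OF v conv \<phi> False r \<epsilon>] sym r by (intro exI[of _ "H z"]) auto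
    qed
  qed
  show "0 \<le> ereal (\<phi>t z) + mcf_F_upper (H z) (G z)"
  proof (cases "mcf_F_upper (H z) (G z)")
    case (real a)
    have "- \<phi>t z \<le> a" by (rule field_le_epsilon) (use le real in fastforce)
    then show ?thesis by (simp add: real)
  qed (use le[of 1] in auto)
qed

section \<open>Identification of the flow of the cube and of its extinction time\<close>

section \<open>The extinction time of the cube\<close>

lemma plane_subsolution_mono: "plane_subsolution \<A> v \<Longrightarrow> \<A> \<subseteq> \<B> \<Longrightarrow> plane_subsolution \<B> v"
  unfolding plane_subsolution_def by blast

lemma semicontinuous_imp_continuous_on:
  assumes "usc_on S u" "lsc_on S u"
  shows "continuous_on S u"
  unfolding continuous_on_def using assms unfolding usc_on_def lsc_on_def by (intro ballI order_tendstoI) auto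

text \<open>Any other solution is continuous, being semicontinuous from both sides, and gives plane
  subsolutions for hyperplanes on both sides; comparison in both directions at equal points
  identifies it with \<open>u\<close>.\<close>

lemma mcf_level_function_cube:
  fixes u :: "(real^'m) \<times> real \<Rightarrow> real"
  assumes u: "plane_subsolution all_planes u" "plane_subsolution hyperplanes (\<lambda>z. - u z)" "continuous_on (UNIV \<times> {..0}) u"
    and u0: "\<And>x. u (x, 0) = infnorm x" and pos: "\<And>x t. 0 < t \<Longrightarrow> u (x, t) = 0"
    and lip: "\<And>x y t. t \<le> 0 \<Longrightarrow> \<bar>u (x, t) - u (y, t)\<bar> \<le> norm (x - y)"
    and conv: "\<And>y1 y2 t. t \<le> 0 \<Longrightarrow> u ((1/2) *\<^sub>R (y1 + y2), t) \<le> (u (y1, t) + u (y2, t)) / 2"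
    and growth: "linear_growth u"
  shows "mcf_level_function cube = u"
  unfolding mcf_level_function_def
proof (rule the_equality)
  have "mcf_level_solution cube u"
    unfolding mcf_level_solution_def
    using plane_imp_mcf_subsolution[OF u(1,3) lip conv] plane_imp_mcf_supersolution[OF u(2,3)] growth u0
    by (simp add: body_norm_cube)
  then show "mcf_level_solution cube u \<and> (\<forall>x. \<forall>t>0. u (x, t) = 0)" using pos by blast
  fix w :: "(real^'m) \<times> real \<Rightarrow> real" assume w: "mcf_level_solution cube w \<and> (\<forall>x. \<forall>t>0. w (x, t) = 0)"
  then have sol: "mcf_subsolution w" "mcf_supersolution w" "\<And>x. w (x, 0) = infnorm x"
    by (auto simp: mcf_level_solution_def body_norm_cube)
  have wc: "continuous_on (UNIV \<times> {..0}) w"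
    using sol(1,2) by (intro semicontinuous_imp_continuous_on) (auto simp: mcf_subsolution_def mcf_supersolution_def)
  note w1 = plane_subsolution_mono[OF mcf_subsolution_imp_plane[OF sol(1)] hyperplanes_subset]
  note w2 = mcf_supersolution_imp_plane[OF sol(2)]
  have half: "(1/2) *\<^sub>R (x + x) = x" for x :: "real^'m" by (simp flip: scaleR_2)
  have "w (x, t) = u (x, t)" for x :: "real^'m" and t
  proof (cases "t \<le> 0")
    case True
    have "w ((1/2) *\<^sub>R (x + x), t) \<le> (u (x, t) + u (x, t)) / 2"
      by (rule comparison[OF w1 wc _ u(2,3) _ True]) (simp_all add: sol(3) u0)
    moreover have "u ((1/2) *\<^sub>R (x + x), t) \<le> (w (x, t) + w (x, t)) / 2"
      by (rule comparison[OF u(1,3) _ w2 wc _ True]) (simp_all add: sol(3) u0)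
    ultimately show ?thesis unfolding half by simp
  next
    case False
    then show ?thesis using w pos by simp
  qed
  then show "w = u" by auto
qed

lemma extinction_time_cube:
  fixes u :: "(real^'m) \<times> real \<Rightarrow> real"
  assumes u: "mcf_level_function cube = u"
    and lip: "\<And>x y t. t \<le> 0 \<Longrightarrow> \<bar>u (x, t) - u (y, t)\<bar> \<le> norm (x - y)"
    and conv: "\<And>y1 y2 t. t \<le> 0 \<Longrightarrow> u ((1/2) *\<^sub>R (y1 + y2), t) \<le> (u (y1, t) + u (y2, t)) / 2"
    and even: "\<And>x t. t \<le> 0 \<Longrightarrow> u (- x, t) = u (x, t)"
    and scaling: "\<And>s. 0 < s \<Longrightarrow> u (0, - s) = c * sqrt (2 * s)" and c: "0 < c"
  shows "extinction_time (cube :: (real^'m) set) = 1 / (2 * c\<^sup>2)"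
proof -
  define E where "E = {t. t > 0 \<and> interior (mcf (cube :: (real^'m) set) t) \<noteq> {}}"
  define \<tau> where "\<tau> = 1 / (2 * c\<^sup>2)"
  have \<tau>: "0 < \<tau>" using c by (simp add: \<tau>_def)
  have c\<tau>: "c * sqrt (2 * \<tau>) = 1" using c by (simp add: \<tau>_def real_sqrt_divide)
  have less: "c * sqrt (2 * t) < 1 \<longleftrightarrow> t < \<tau>" for t
  proof -
    have "c * sqrt (2 * t) < 1 \<longleftrightarrow> c * sqrt (2 * t) < c * sqrt (2 * \<tau>)" by (simp only: c\<tau>)
    then show ?thesis using c by simp
  qed
  have in_E: "t \<in> E" if t: "0 < t" "t < \<tau>" for t
  proof -
    have pos: "0 < 1 - u (0, - t)" using t less[of t] scaling[of t] by simp
    \<comment> \<open>The Lipschitz bound turns a value below 1 at the origin into a whole ball,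
      hence into nonempty interior.\<close>
    have "ball 0 (1 - u (0, - t)) \<subseteq> mcf (cube :: (real^'m) set) t"
    proof
      fix x :: "real^'m" assume "x \<in> ball 0 (1 - u (0, - t))"
      then have "norm x < 1 - u (0, - t)" by simp
      then show "x \<in> mcf cube t" using lip[of "- t" x 0] t(1) by (simp add: mcf_def u abs_le_iff)
    qed
    then have "ball 0 (1 - u (0, - t)) \<subseteq> interior (mcf (cube :: (real^'m) set) t)" by (rule interior_maximal) simp
    then show ?thesis using t(1) pos by (auto simp: E_def)
  qed
  have le: "t \<le> \<tau>" if tE: "t \<in> E" for t
  proof -
    have t: "0 < t" using tE by (simp add: E_def)
    obtain x :: "real^'m" where "x \<in> interior (mcf cube t)" using tE by (auto simp: E_def)
    then have "x \<in> mcf cube t" using interior_subset by blast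
    then have x: "u (x, - t) \<le> 1" by (simp add: mcf_def u)
    have "u ((1/2) *\<^sub>R (x + - x), - t) \<le> (u (x, - t) + u (- x, - t)) / 2" by (rule conv) (use t in simp)
    then have "u (0, - t) \<le> 1" using x even[of "- t" x] t by simp
    then have "c * sqrt (2 * t) \<le> c * sqrt (2 * \<tau>)" using scaling[OF t] c\<tau> by simp
    then show ?thesis using c by simp
  qed
  have "Sup E = \<tau>"
  proof (rule cSup_eq_non_empty)
    show "E \<noteq> {}" using in_E[of "\<tau> / 2"] \<tau> by auto
    fix y assume y: "\<And>x. x \<in> E \<Longrightarrow> x \<le> y"
    show "\<tau> \<le> y" by (rule dense_le_bounded[OF \<tau>]) (rule y, rule in_E)
  qed (rule le)
  then show ?thesis by (simp add: extinction_time_def E_def \<tau>_def)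
qed

text \<open>At the origin the scaled value with \<open>k T\<close> rounds is the normalised value
  for \<open>k T\<close> rounds times the square root of \<open>k T / T\<close>, and this ratio
  tends to \<open>2 * s\<close>.\<close>

lemma val_scaling:
  assumes "(\<lambda>T. val N T (0 :: real^'m) / sqrt (real T)) \<longlonglongrightarrow> c" "0 < s"
  shows "(\<lambda>T. scaled N T (0 :: real^'m, - s)) \<longlonglongrightarrow> c * sqrt (2 * s)"
proof -
  define k where "k T = nat \<lfloor>2 * s * real T\<rfloor>" for T
  have kT: "(\<lambda>T. real (k T) / real T) \<longlonglongrightarrow> 2 * s"
  proof (rule tendsto_sandwich)
    show "\<forall>\<^sub>F T in sequentially. 2 * s - 1 / real T \<le> real (k T) / real T"
      using eventually_gt_at_top[of 0]
    proof eventually_elim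
      case (elim T)
      have "2 * s * real T - 1 \<le> real (k T)" unfolding k_def by linarith
      then have "(2 * s * real T - 1) / real T \<le> real (k T) / real T" using elim by (intro divide_right_mono) auto
      then show ?case using elim by (simp add: diff_divide_distrib)
    qed
    show "\<forall>\<^sub>F T in sequentially. real (k T) / real T \<le> 2 * s"
      using eventually_gt_at_top[of 0]
    proof eventually_elim
      case (elim T)
      have "0 \<le> 2 * s * real T" using assms(2) by simp
      then have "real (k T) \<le> 2 * s * real T" unfolding k_def by linarith
      then show ?case using elim by (simp add: field_simps)
    qed
    show "(\<lambda>T. 2 * s - 1 / real T) \<longlonglongrightarrow> 2 * s" using tendsto_diff[OF tendsto_const lim_1_over_n, of "2 * s"] by simp
  qed simp
  have "filterlim (\<lambda>T. real (k T)) at_top sequentially"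
  proof (rule filterlim_at_top_mono)
    show "filterlim (\<lambda>T. 2 * s * real T - 1) at_top sequentially" using assms(2) by real_asymp
    show "\<forall>\<^sub>F T in sequentially. 2 * s * real T - 1 \<le> real (k T)" unfolding k_def by (rule always_eventually) linarith
  qed
  then have "filterlim k at_top sequentially" by (simp add: filterlim_sequentially_iff_filterlim_real)
  then have "(\<lambda>T. val N (k T) (0 :: real^'m) / sqrt (real (k T))) \<longlonglongrightarrow> c" by (rule filterlim_compose[OF assms(1)])
  then have "(\<lambda>T. val N (k T) (0 :: real^'m) / sqrt (real (k T)) * sqrt (real (k T) / real T)) \<longlonglongrightarrow> c * sqrt (2 * s)"
    by (intro tendsto_mult tendsto_real_sqrt kT)
  then show ?thesis
  proof (rule Lim_transform_eventually)
    show "\<forall>\<^sub>F T in sequentially. val N (k T) (0 :: real^'m) / sqrt (real (k T)) * sqrt (real (k T) / real T) = scaled N T (0 :: real^'m, - s)"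
      using filterlim_at_top_dense[THEN iffD1, OF \<open>filterlim (\<lambda>T. real (k T)) at_top sequentially\<close>, rule_format, of 0]
      by eventually_elim (simp add: scaled_def k_def[symmetric] real_sqrt_divide)
  qed
qed

theorem theorem1p1:
  assumes "CARD('m::finite) \<ge> 2" and "CARD('n::finite) \<ge> CARD('m) - 1"
  shows "(\<lambda>T. K_game TYPE('m) TYPE('n) T / sqrt (real T))
           \<longlonglongrightarrow> 1 / sqrt (2 * extinction_time (cube :: (real^'m) set))"
proof -
  define N where "N = TYPE('n)"
  obtain u :: "(real^'m) \<times> real \<Rightarrow> real" where
    lim: "\<And>x t. t \<le> 0 \<Longrightarrow> (\<lambda>T. scaled N T (x, t)) \<longlonglongrightarrow> u (x, t)"
    and u: "plane_subsolution all_planes u" "plane_subsolution hyperplanes (\<lambda>z. - u z)" "continuous_on (UNIV \<times> {..0}) u"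
    and u0: "\<And>x. u (x, 0) = infnorm x" and pos: "\<And>x t. 0 < t \<Longrightarrow> u (x, t) = 0"
    using scaled_converges[where N=N and 'm='m] assms(2) by blast
  have lu: "is_limsup (scaled N) u" by (rule is_limsup_tendsto) (rule lim)
  have lip: "\<bar>u (x, t) - u (y, t)\<bar> \<le> norm (x - y)" if "t \<le> 0" for x y t
    using limsup_modulus[OF scaled_equicont lu that that, of x y] limsup_modulus[OF scaled_equicont lu that that, of y x]
    by (simp add: norm_minus_commute abs_le_iff)
  have conv: "u ((1/2) *\<^sub>R (y1 + y2), t) \<le> (u (y1, t) + u (y2, t)) / 2" if "t \<le> 0" for y1 y2 t
    using u that by (intro comparison) (simp_all add: u0)
  have even: "u (- x, t) = u (x, t)" if "t \<le> 0" for x t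
    using LIMSEQ_unique[OF lim[OF that, of "- x"]] lim[OF that, of x] by (simp add: scaled_minus)
  have growth: "linear_growth u"
    unfolding linear_growth_def
  proof (intro allI impI)
    fix S :: real assume S: "0 < S"
    define D where "D = sqrt (real CARD('n) * (2 * S + 1))"
    have "\<bar>u (x, t)\<bar> \<le> (1 + D) * (1 + norm x)" if t: "t \<in> {-S..0}" for x t
    proof -
      have "\<bar>scaled N T (x, t)\<bar> \<le> norm x + D" for T
      proof (rule order_trans[OF scaled_bound])
        show "norm x + sqrt (real CARD('n) * (2 * \<bar>t\<bar> + 1)) \<le> norm x + D"
          unfolding D_def using t by (intro add_left_mono real_sqrt_le_mono mult_left_mono) auto
      qed (use t in simp)
      then have "\<bar>u (x, t)\<bar> \<le> norm x + D"
        using t by (intro LIMSEQ_le_const2[OF tendsto_rabs[OF lim]]) auto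
      also have "\<dots> \<le> (1 + D) * (1 + norm x)" using S by (simp add: D_def algebra_simps)
      finally show ?thesis .
    qed
    then show "\<exists>C. \<forall>x. \<forall>t\<in>{-S..0}. \<bar>u (x, t)\<bar> \<le> C * (1 + norm x)" by blast
  qed
  \<comment> \<open>Time -1/2 is that of exactly \<open>T\<close> rounds, so \<open>c\<close> is the
    limit of the normalised game values.\<close>
  define c where "c = u (0, - (1/2))"
  have limc: "(\<lambda>T. val N T (0 :: real^'m) / sqrt (real T)) \<longlonglongrightarrow> c"
    using lim[of "- (1/2)" 0] by (simp add: c_def scaled_def)
  have scaling: "u (0, - s) = c * sqrt (2 * s)" if "0 < s" for s
    using LIMSEQ_unique[OF lim val_scaling[OF limc that]] that by simp
  \<comment> \<open>Positivity of \<open>c\<close> is what makes \<open>u\<close> reach the level 1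
    at the origin in finite time.\<close>
  have "0 < c"
  proof -
    have "1 / sqrt (real CARD('m)) \<le> val N T (0 :: real^'m) / sqrt (real T)" if "1 \<le> T" for T
    proof -
      have "real T \<le> real CARD('m) * (val N T (0 :: real^'m))\<^sup>2" "0 \<le> val N T (0 :: real^'m)"
        using val_lower_bound[OF assms(1), of "0 :: real^'m" T N] by auto
      then have "sqrt (real T) \<le> sqrt (real CARD('m)) * val N T (0 :: real^'m)"
        by (metis real_sqrt_le_mono real_sqrt_mult real_sqrt_unique)
      then show ?thesis using that by (simp add: field_simps)
    qed
    then have "1 / sqrt (real CARD('m)) \<le> c" by (intro LIMSEQ_le_const[OF limc]) blast
    then show ?thesis using less_le_trans[of 0 "1 / sqrt (real CARD('m))" c] by simp
  qed
  then have "1 / sqrt (2 * extinction_time (cube :: (real^'m) set)) = c"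
    using extinction_time_cube[OF mcf_level_function_cube[OF u u0 pos lip conv growth] lip conv even scaling]
    by (simp add: real_sqrt_divide)
  then show ?thesis using limc by (simp add: K_game_def val_def)
qed

end
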